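(* Let $\mathfrak g$ be the simple complex Lie algebra of type $D_4$, with the numbering $\alpha_1,\dots,\alpha_{12}$ of its positive roots fixed in the context. Let $\Sigma$ be the set of all essential signatures (of all dominant highest weights), which is a subsemigroup of $\mathfrak t_{\mathbb Z}^*\oplus\mathbb Z^{12}$, and let $\Sigma^f$ be the subsemigroup generated by the essential signatures of the fundamental highest weights $\omega_1,\omega_2,\omega_3,\omega_4$. Then: (1) $\Sigma=\Sigma^f$, i.e. the semigroup of essential signatures is generated by the essential signatures of fundamental highest weights. (2) $\Sigma$ is saturated: $\Sigma=\Sigma_{\mathbb Q}\cap(\mathfrak t_{\mathbb Z}^*\oplus\mathbb Z^{12})$, where $\Sigma_{\mathbb Q}$ is the rational cone spanned by $\Sigma$. (3) There exist a family of subsets $M_i\subset\{1,\dots,12\}$, a family of elements $l_i\in\mathfrak t_{\mathbb Z}$ and coefficients $a_{ij}\in\{1,2,3\}$ ($j\in M_i$) such that, for every dominant weight $\lambda$, a signature $\sigma=(\lambda,p_1,\dots,p_{12})$ of highest weight $\lambda$ is essential if and only if $$\sum_{j\in M_i}a_{ij}p_j\le\lambda(l_i)\quad\text{for all } i.$$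
   Context: Let $\mathfrak g=\mathfrak u^-\oplus\mathfrak t\oplus\mathfrak u$ be the triangular decomposition, with $\mathfrak t$ a Cartan subalgebra, $\mathfrak u=\langle e_\alpha\mid\alpha\in\Delta_+\rangle$, $\mathfrak u^-=\langle e_{-\alpha}\mid\alpha\in\Delta_+\rangle$, where $\Delta_+$ is the set of positive roots and $e_{\pm\alpha}$ are root vectors. $\mathfrak t_{\mathbb Z}\subset\mathfrak t$ is the coroot lattice and $\mathfrak t_{\mathbb Z}^*$ the weight lattice (weights taking integer values on $\mathfrak t_{\mathbb Z}$). $V(\lambda)$ is the irreducible finite-dimensional $\mathfrak g$-module with dominant (integral) highest weight $\lambda$ and $v_\lambda$ is a highest weight vector. Roots of $D_4$: the weights of $V(\omega_1)$ are $\pm\varepsilon_1,\dots,\pm\varepsilon_4$; the simple roots are $\beta_1=\varepsilon_1-\varepsilon_2$, $\beta_2=\varepsilon_2-\varepsilon_3$, $\beta_3=\varepsilon_3-\varepsilon_4$, $\beta_4=\varepsilon_3+\varepsilon_4$, and $\omega_1,\dots,\omega_4$ are the corresponding fundamental weights. The positive roots are numbered $\alpha_1=\varepsilon_1+\varepsilon_2$, $\alpha_2=\varepsilon_2+\varepsilon_3$, $\alpha_3=\varepsilon_1+\varepsilon_3$, $\alpha_4=\varepsilon_3+\varepsilon_4$, $\alpha_5=\varepsilon_2+\varepsilon_4$, $\alpha_6=\varepsilon_1+\varepsilon_4$, $\alpha_7=\varepsilon_1-\varepsilon_3$, $\alpha_8=\varepsilon_1-\varepsilon_4$, $\alpha_9=\varepsilon_3-\varepsilon_4$,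 $\alpha_{10}=\varepsilon_2-\varepsilon_4$, $\alpha_{11}=\varepsilon_2-\varepsilon_3$, $\alpha_{12}=\varepsilon_1-\varepsilon_2$. A signature (with $N=12$) is a tuple $\sigma=(\lambda,p_1,\dots,p_N)$ with $\lambda$ a dominant weight and $p_i\in\mathbb Z_{\ge0}$; $\lambda$ is called the highest weight of $\sigma$. Put $v(\sigma)=e_{-\alpha_1}^{p_1}\cdots e_{-\alpha_N}^{p_N}\cdot v_\lambda\in V(\lambda)$. Signatures with the same highest weight $\lambda$ are ordered as follows: for $\sigma=(\lambda,p_1,\dots,p_N)$ and $\sigma'=(\lambda,p_1',\dots,p_N')$ set $q_i=\sum_{j=1}^{N-i+1}p_j$, $q_i'=\sum_{j=1}^{N-i+1}p_j'$; then $\sigma<\sigma'$ iff $(q_1,\dots,q_N)<(q_1',\dots,q_N')$ lexicographically. A signature $\sigma$ is essential if $v(\sigma)\notin\langle v(\tau)\mid\tau<\sigma\rangle$, where $\langle\cdots\rangle$ denotes linear span and $\tau$ runs over signatures with the same highest weight as $\sigma$. The rational cone spanned by a set is the set of all finite linear combinations of its elements with nonnegative rational coefficients. Semigroups are understood to contain $0$. *)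

theory Defs
  imports "HOL-Analysis.Analysis" "HOL-Library.Function_Algebras"
begin

section \<open>The simple complex Lie algebra of type $D_4$\<close>

text \<open>
  It is realised as the orthogonal Lie algebra of the split symmetric form on an
  8-dimensional space.  The basis vectors \<open>Inl i\<close> and \<open>Inr i\<close> have weights
  $\varepsilon_i$ and $-\varepsilon_i$ and are dual to each other under the form.
  As usual for the numeral type \<open>4\<close>, the indices are 1, 2, 3 and 4 = 0; likewise
  for the type \<open>12\<close>, whose elements are \<open>of_nat j\<close> with \<open>j \<in> {1..12}\<close>.
\<close>

type_synonym mat8 = "((complex, 4 + 4) vec, 4 + 4) vec"

definition bracket :: "mat8 \<Rightarrow> mat8 \<Rightarrow> mat8" where
  "bracket X Y = X ** Y - Y ** X"

definition cscale :: "complex \<Rightarrow> mat8 \<Rightarrow> mat8" where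
  "cscale c X = (\<chi> a b. c * X $ a $ b)"

definition split_form :: mat8 where
  "split_form = (\<chi> a b. if (\<exists>i. a = Inl i \<and> b = Inr i \<or> a = Inr i \<and> b = Inl i) then 1 else 0)"

definition so8 :: "mat8 set" where
  "so8 = {X. transpose X ** split_form + split_form ** X = 0}"

text \<open>The Cartan subalgebra consists of the matrices \<open>cartan x\<close>, $\varepsilon_i$ being
  the functional \<open>cartan x \<mapsto> x $ i\<close>.\<close>

definition cartan :: "complex ^ 4 \<Rightarrow> mat8" where
  "cartan x = (\<chi> a b. if a = b then (case a of Inl i \<Rightarrow> x $ i | Inr i \<Rightarrow> - (x $ i)) else 0)"

text \<open>
  Rational points of the dual of the Cartan subalgebra are given by their coordinates
  with respect to the $\varepsilon_i$, rational points \<open>cartan x\<close> of the Cartan subalgebra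
  by the coordinates \<open>x\<close>.  A functional that is integral on the coroot lattice
  (which spans the Cartan subalgebra) has rational coordinates, so all weights are covered.
\<close>

definition pairing :: "rat ^ 4 \<Rightarrow> rat ^ 4 \<Rightarrow> rat" where
  "pairing \<mu> x = (\<Sum>i\<in>UNIV. \<mu> $ i * x $ i)"

definition eval_weight :: "rat ^ 4 \<Rightarrow> complex ^ 4 \<Rightarrow> complex" where
  "eval_weight \<mu> x = (\<Sum>i\<in>UNIV. of_rat (\<mu> $ i) * x $ i)"

definition eps :: "4 \<Rightarrow> rat ^ 4" where
  "eps i = axis i 1"

definition pos_root :: "nat \<Rightarrow> rat ^ 4" where
  "pos_root k =
     [eps 1 + eps 2, eps 2 + eps 3, eps 1 + eps 3, eps 3 + eps 4,
      eps 2 + eps 4, eps 1 + eps 4, eps 1 - eps 3, eps 1 - eps 4,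
      eps 3 - eps 4, eps 2 - eps 4, eps 2 - eps 3, eps 1 - eps 2] ! (k - 1)"

definition simple_root :: "nat \<Rightarrow> rat ^ 4" where
  "simple_root k = [eps 1 - eps 2, eps 2 - eps 3, eps 3 - eps 4, eps 3 + eps 4] ! (k - 1)"

definition root_space :: "rat ^ 4 \<Rightarrow> mat8 set" where
  "root_space \<alpha> =
     {X \<in> so8. \<forall>x. bracket (cartan x) X = cscale (eval_weight \<alpha> x) X}"

definition negative_root_vectors :: "(nat \<Rightarrow> mat8) \<Rightarrow> bool" where
  "negative_root_vectors e \<longleftrightarrow>
     (\<forall>k\<in>{1..12}. e k \<in> root_space (- pos_root k) \<and> e k \<noteq> 0)"

section \<open>Lattices and dominant weights\<close>

definition coroot :: "rat ^ 4 \<Rightarrow> rat ^ 4" where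
  "coroot \<alpha> = (2 / pairing \<alpha> \<alpha>) *s \<alpha>"

definition coroot_lattice :: "(rat ^ 4) set" where
  "coroot_lattice = {(\<Sum>k=1..12. of_int (c k) *s coroot (pos_root k)) | c :: nat \<Rightarrow> int. True}"

definition weight_lattice :: "(rat ^ 4) set" where
  "weight_lattice = {\<mu>. \<forall>l\<in>coroot_lattice. pairing \<mu> l \<in> \<int>}"

definition dominant :: "rat ^ 4 \<Rightarrow> bool" where
  "dominant \<mu> \<longleftrightarrow> \<mu> \<in> weight_lattice \<and> (\<forall>k\<in>{1..4}. pairing \<mu> (coroot (simple_root k)) \<ge> 0)"

definition fundamental_weights :: "(rat ^ 4) set" where
  "fundamental_weights =
     {\<omega>. \<exists>k\<in>{1..4}. \<forall>j\<in>{1..4}. pairing \<omega> (coroot (simple_root j)) = (if j = k then 1 else 0)}"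

section \<open>Irreducible highest weight modules\<close>

text \<open>
  Modules are carried by finite-dimensional complex subspaces \<open>W\<close> of the space of sequences;
  every finite-dimensional module is isomorphic to one of this form.  Only the values
  \<open>\<rho> X w\<close> with \<open>X \<in> so8\<close> and \<open>w \<in> W\<close> matter.
\<close>

type_synonym cseq = "nat \<Rightarrow> complex"

definition seq_scale :: "complex \<Rightarrow> cseq \<Rightarrow> cseq" where
  "seq_scale c f = (\<lambda>n. c * f n)"

global_interpretation cseq: vector_space seq_scale
  by unfold_locales (auto simp: seq_scale_def fun_eq_iff algebra_simps)

definition is_module :: "cseq set \<Rightarrow> (mat8 \<Rightarrow> cseq \<Rightarrow> cseq) \<Rightarrow> bool" where
  "is_module W \<rho> \<longleftrightarrow>
     cseq.subspace W \<and> (\<exists>B. finite B \<and> cseq.span B = W) \<and>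
     (\<forall>X\<in>so8. \<forall>w\<in>W. \<rho> X w \<in> W) \<and>
     (\<forall>X\<in>so8. \<forall>w\<in>W. \<forall>w'\<in>W. \<rho> X (w + w') = \<rho> X w + \<rho> X w') \<and>
     (\<forall>X\<in>so8. \<forall>c. \<forall>w\<in>W. \<rho> X (seq_scale c w) = seq_scale c (\<rho> X w)) \<and>
     (\<forall>X\<in>so8. \<forall>Y\<in>so8. \<forall>w\<in>W. \<rho> (X + Y) w = \<rho> X w + \<rho> Y w) \<and>
     (\<forall>X\<in>so8. \<forall>c. \<forall>w\<in>W. \<rho> (cscale c X) w = seq_scale c (\<rho> X w)) \<and>
     (\<forall>X\<in>so8. \<forall>Y\<in>so8. \<forall>w\<in>W. \<rho> (bracket X Y) w = \<rho> X (\<rho> Y w) - \<rho> Y (\<rho> X w))"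

definition is_irreducible :: "cseq set \<Rightarrow> (mat8 \<Rightarrow> cseq \<Rightarrow> cseq) \<Rightarrow> bool" where
  "is_irreducible W \<rho> \<longleftrightarrow>
     is_module W \<rho> \<and> W \<noteq> {0} \<and>
     (\<forall>U. cseq.subspace U \<and> U \<subseteq> W \<and> (\<forall>X\<in>so8. \<forall>u\<in>U. \<rho> X u \<in> U) \<longrightarrow> U = {0} \<or> U = W)"

definition highest_weight_vector ::
    "rat ^ 4 \<Rightarrow> cseq set \<Rightarrow> (mat8 \<Rightarrow> cseq \<Rightarrow> cseq) \<Rightarrow> cseq \<Rightarrow> bool" where
  "highest_weight_vector \<mu> W \<rho> v \<longleftrightarrow>
     v \<in> W \<and> v \<noteq> 0 \<and>
     (\<forall>x. \<rho> (cartan x) v = seq_scale (eval_weight \<mu> x) v) \<and>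
     (\<forall>k\<in>{1..12}. \<forall>X\<in>root_space (pos_root k). \<rho> X v = 0)"

section \<open>Essential signatures\<close>

text \<open>\<open>sig_vector e \<rho> v p\<close> is $e_{-\alpha_1}^{p_1} \cdots e_{-\alpha_{12}}^{p_{12}} v$, where
  \<open>e k\<close> stands for $e_{-\alpha_k}$.\<close>

definition sig_vector ::
    "(nat \<Rightarrow> mat8) \<Rightarrow> (mat8 \<Rightarrow> cseq \<Rightarrow> cseq) \<Rightarrow> cseq \<Rightarrow> nat ^ 12 \<Rightarrow> cseq" where
  "sig_vector e \<rho> v p = foldr (\<lambda>k w. (\<rho> (e k) ^^ (p $ of_nat k)) w) [1..<13] v"

definition partial_sum :: "nat ^ 12 \<Rightarrow> nat \<Rightarrow> nat" where
  "partial_sum p i = (\<Sum>j=1..12 - i + 1. p $ of_nat j)"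

definition sig_less :: "nat ^ 12 \<Rightarrow> nat ^ 12 \<Rightarrow> bool" where
  "sig_less p p' \<longleftrightarrow>
     (\<exists>i\<in>{1..12}. partial_sum p i < partial_sum p' i \<and>
        (\<forall>k\<in>{1..<i}. partial_sum p k = partial_sum p' k))"

text \<open>The module of highest weight \<open>\<mu>\<close> and its highest weight vector are unique up to
  isomorphism, so it does not matter which model is used.\<close>

definition essential :: "(nat \<Rightarrow> mat8) \<Rightarrow> rat ^ 4 \<Rightarrow> nat ^ 12 \<Rightarrow> bool" where
  "essential e \<mu> p \<longleftrightarrow>
     dominant \<mu> \<and>
     (\<exists>W \<rho> v. is_irreducible W \<rho> \<and> highest_weight_vector \<mu> W \<rho> v \<and>
        sig_vector e \<rho> v p \<notin> cseq.span {sig_vector e \<rho> v p' | p'. sig_less p' p})"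

text \<open>The group $\mathfrak t_{\mathbb Z}^* \oplus \mathbb Z^{12}$ is regarded as a lattice in
  its rational span.\<close>

type_synonym sig_space = "(rat ^ 4) \<times> (rat ^ 12)"

definition sig_lattice :: "sig_space set" where
  "sig_lattice = {(\<mu>, p). \<mu> \<in> weight_lattice \<and> (\<forall>j. p $ j \<in> \<int>)}"

definition essential_signatures :: "(nat \<Rightarrow> mat8) \<Rightarrow> sig_space set" where
  "essential_signatures e = {(\<mu>, \<chi> j. of_nat (p $ j)) | \<mu> p. essential e \<mu> p}"

inductive_set semigroup_generated :: "'a::monoid_add set \<Rightarrow> 'a set" for S where
  zero: "0 \<in> semigroup_generated S"
| gen: "s \<in> S \<Longrightarrow> s \<in> semigroup_generated S"
| add: "s \<in> semigroup_generated S \<Longrightarrow> t \<in> semigroup_generated S \<Longrightarrow>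
        s + t \<in> semigroup_generated S"

definition fundamental_semigroup :: "(nat \<Rightarrow> mat8) \<Rightarrow> sig_space set" where
  "fundamental_semigroup e =
     semigroup_generated {s \<in> essential_signatures e. fst s \<in> fundamental_weights}"

definition sig_scale :: "rat \<Rightarrow> sig_space \<Rightarrow> sig_space" where
  "sig_scale c s = (c *s fst s, c *s snd s)"

definition rational_cone :: "sig_space set \<Rightarrow> sig_space set" where
  "rational_cone S = {(\<Sum>s\<in>F. sig_scale (c s) s) | F c. finite F \<and> F \<subseteq> S \<and> (\<forall>s\<in>F. 0 \<le> c s)}"

end

theory Submission
  imports Defs "HOL-Library.Poly_Mapping" "HOL-Library.Multiset"
begin

text \<open>
  For a highest weight vector $v$ of weight $\lambda$ let $A(\lambda)$ be the span of the coordinates of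
  $\exp(x_1 e_{-\alpha_1}) \cdots \exp(x_{12} e_{-\alpha_{12}}) v$, which are polynomials in twelve variables.
  The coefficient of $x^p$ in such a coordinate is that of the vector of signature $p$, up to a factorial.
  By duality a signature is essential iff its exponent is the lowest exponent, in the order of signatures,
  of some polynomial in $A(\lambda)$ (\<open>essential_iff_lowest\<close>). This order is a monomial order, so lowest
  exponents add under multiplication of polynomials.

  Essential signatures may be computed in any module that contains a vector of the right kind,
  irreducible or not: linear relations between words in the Lie algebra applied to a highest weight
  vector carry over to an irreducible module of the same highest weight (\<open>annihilator_subset\<close>). In a
  tensor product the exponentials act diagonally. Hence $A(\lambda + \mu)$ is spanned by the products of
  elements of $A(\lambda)$ and $A(\mu)$ (\<open>gen_tens\<close>, \<open>has_model_mult\<close>), and everything is determined by the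
  four fundamental modules. Irreducible modules are obtained as cyclic submodules of tensor products of
  these, irreducibility following from an invariant hermitian form (\<open>cyc_irreducible\<close>).

  The four spaces $A(\omega_i)$ have together 52 basis elements with distinct signatures, the generators.
  Quadratic straightening relations show that products of generators over standard multisets span
  $A(\lambda)$. Standard multisets of the same types have distinct sums of exponents (\<open>standard_unique\<close>),
  so that these sums are exactly the lowest exponents that occur (\<open>lowest_span\<close>): the semigroup of
  essential signatures is generated by the generators. On the other hand each lattice point of the
  cone given by 70 explicit inequalities is such a sum (\<open>decompose\<close>). All three claims of the theorem
  follow, since a set of lattice points described by homogeneous linear inequalities is saturated.
\<close>

section \<open>Polynomials and the order of signatures\<close>

lemma index12_cases:
  fixes x :: 12
  obtains j where "j \<in> {1..12}" "x = of_nat j"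
proof (cases x rule: bit0_cases)
  case (of_int z)
  show ?thesis
  proof (cases "z = 0")
    case True
    then have "x = of_nat 12" using of_int by simp
    then show ?thesis using that[of 12] by simp
  next
    case False
    then have "nat z \<in> {1..12}" "x = of_nat (nat z)" using of_int by auto
    then show ?thesis using that by blast
  qed
qed

lemma vec12_eqI: "(\<And>j. j \<in> {1..12} \<Longrightarrow> p $ of_nat j = q $ of_nat j) \<Longrightarrow> p = (q :: 'a ^ 12)"
  by (metis index12_cases vec_eq_iff)

lemma of_nat12_inj: "i \<in> {1..12} \<Longrightarrow> j \<in> {1..12} \<Longrightarrow> (of_nat i :: 12) = of_nat j \<longleftrightarrow> i = j"
proof
  assume ij: "i \<in> {1..12}" "j \<in> {1..12}" and eq: "(of_nat i :: 12) = of_nat j"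
  have *: "card ((of_nat :: nat \<Rightarrow> 12) ` {1..12}) = 12"
  proof -
    have "(of_nat :: nat \<Rightarrow> 12) ` {1..12} = UNIV"
      using index12_cases by blast
    then show ?thesis by simp
  qed
  have "inj_on (of_nat :: nat \<Rightarrow> 12) {1..12}"
    by (rule eq_card_imp_inj_on) (simp_all only: * card_atLeastAtMost finite_atLeastAtMost)
  then show "i = j" using ij eq by (simp add: inj_on_def)
qed simp

lemma partial_sum_add: "partial_sum (p + q) i = partial_sum p i + partial_sum q i"
  by (simp add: partial_sum_def sum.distrib)

lemma partial_sum_0: "partial_sum 0 i = 0"
  by (simp add: partial_sum_def)

lemma partial_sums_determine:
  assumes "\<And>i. i \<in> {1..12} \<Longrightarrow> partial_sum p i = partial_sum q i"
  shows "p = q"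
proof (rule vec12_eqI)
  fix j :: nat assume j: "j \<in> {1..12}"
  have S: "(\<Sum>k=1..n. p $ of_nat k) = (\<Sum>k=1..n. q $ of_nat k)" if "n \<le> 12" for n
  proof (cases "n = 0")
    case False
    then have n: "13 - n \<in> {1..12}" "12 - (13 - n) + 1 = n" using that by auto
    show ?thesis using assms[OF n(1)] unfolding partial_sum_def n(2) .
  qed simp
  have "(\<Sum>k=1..Suc (j - 1). p $ of_nat k) = (\<Sum>k=1..Suc (j - 1). q $ of_nat k)"
    by (rule S) (use j in auto)
  moreover have "(\<Sum>k=1..j - 1. p $ of_nat k) = (\<Sum>k=1..j - 1. q $ of_nat k)"
    by (rule S) (use j in auto)
  ultimately have "p $ of_nat (Suc (j - 1)) = q $ of_nat (Suc (j - 1))"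
    by (simp del: of_nat_Suc)
  then show "p $ of_nat j = q $ of_nat j" using j by (simp del: of_nat_Suc)
qed

lemma sig_less_total: "sig_less p q \<or> p = q \<or> sig_less q p"
proof (cases "p = q")
  case False
  define P where "P i \<longleftrightarrow> i \<in> {1..12} \<and> partial_sum p i \<noteq> partial_sum q i" for i
  have ex: "\<exists>i. P i" using partial_sums_determine False unfolding P_def by blast
  define i where "i = (LEAST i. P i)"
  have i: "P i" unfolding i_def using ex by (rule LeastI_ex)
  have "\<forall>k\<in>{1..<i}. partial_sum p k = partial_sum q k"
    using not_less_Least[of _ P, folded i_def] i by (force simp: P_def)
  then show ?thesis using i unfolding P_def sig_less_def
    by (metis linorder_neqE_nat)
qed simp

lemma sig_less_irrefl: "\<not> sig_less p p"
  by (simp add: sig_less_def)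

lemma sig_less_trans: assumes "sig_less p q" "sig_less q r" shows "sig_less p r"
proof -
  obtain i where i: "i \<in> {1..12}" "partial_sum p i < partial_sum q i"
    "\<forall>k\<in>{1..<i}. partial_sum p k = partial_sum q k" using assms(1) by (auto simp: sig_less_def)
  obtain j where j: "j \<in> {1..12}" "partial_sum q j < partial_sum r j"
    "\<forall>k\<in>{1..<j}. partial_sum q k = partial_sum r k" using assms(2) by (auto simp: sig_less_def)
  have "min i j \<in> {1..12}" using i j by auto
  moreover have "partial_sum p (min i j) < partial_sum r (min i j)"
    using i j by (cases i j rule: linorder_cases) (auto simp: min_def)
  moreover have "\<forall>k\<in>{1..<min i j}. partial_sum p k = partial_sum r k" using i j by auto
  ultimately show ?thesis unfolding sig_less_def by blast
qed

lemma sig_less_add: "sig_less (r + p) (r + q) \<longleftrightarrow> sig_less p q"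
  by (simp add: sig_less_def partial_sum_add)

text \<open>The signature order is a total order on exponent vectors that is compatible with addition, that is, a
  monomial order. Wrapping exponent vectors in a type of their own lets the polynomials with these
  monomials be \<open>poly_mapping\<close>s, whose product needs the additive structure of the exponents.\<close>

datatype mono = Mono (exps: "nat ^ 12")

instantiation mono :: "{linorder, ordered_cancel_comm_monoid_add}"
begin
definition "0 = Mono 0"
definition "p + q = Mono (exps p + exps q)"
definition "p - q = Mono (exps p - exps q)"
definition "p < q \<longleftrightarrow> sig_less (exps p) (exps q)"
definition "p \<le> q \<longleftrightarrow> p = q \<or> sig_less (exps p) (exps q)"
instance
proof
  fix p q r :: mono
  show "(p < q) = (p \<le> q \<and> \<not> q \<le> p)"
    unfolding less_mono_def less_eq_mono_def using sig_less_irrefl sig_less_trans by metis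
  show "p \<le> p" by (simp add: less_eq_mono_def)
  show "p \<le> q \<Longrightarrow> q \<le> r \<Longrightarrow> p \<le> r" unfolding less_eq_mono_def using sig_less_trans by metis
  show "p \<le> q \<Longrightarrow> q \<le> p \<Longrightarrow> p = q"
    unfolding less_eq_mono_def using sig_less_irrefl sig_less_trans by metis
  show "p \<le> q \<or> q \<le> p" unfolding less_eq_mono_def using sig_less_total mono.expand by metis
  show "p + q + r = p + (q + r)" by (simp add: plus_mono_def add.assoc)
  show "p + q = q + p" by (simp add: plus_mono_def add.commute)
  show "0 + p = p" by (simp add: plus_mono_def zero_mono_def)
  show "p + q - p = q" by (simp add: plus_mono_def minus_mono_def)
  show "p - q - r = p - (q + r)" by (simp add: plus_mono_def minus_mono_def vec_eq_iff)
  show "p \<le> q \<Longrightarrow> r + p \<le> r + q"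
    by (auto simp: less_eq_mono_def plus_mono_def sig_less_add)
qed
end

lemma exps_zero [simp]: "exps 0 = 0" and exps_add [simp]: "exps (p + q) = exps p + exps q"
  by (simp_all add: zero_mono_def plus_mono_def)

type_synonym pol = "mono \<Rightarrow>\<^sub>0 complex"

definition pscale :: "complex \<Rightarrow> pol \<Rightarrow> pol" where
  "pscale c F = Poly_Mapping.single 0 c * F"

lemma single_0_add: "Poly_Mapping.single 0 (a + b) = (Poly_Mapping.single 0 a + Poly_Mapping.single 0 b :: pol)"
  by (rule single_add)

global_interpretation pol: vector_space pscale
  by unfold_locales
    (simp_all add: pscale_def algebra_simps single_0_add mult_single flip: mult.assoc)

lemma lookup_pscale [simp]: "Poly_Mapping.lookup (pscale c F) p = c * Poly_Mapping.lookup F p"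
proof -
  have "Poly_Mapping.lookup (Poly_Mapping.single 0 c * F) p = 
     (\<Sum>l. (c when 0 = l) * (\<Sum>q. Poly_Mapping.lookup F q when p = l + q))"
    by (simp add: lookup_mult lookup_single)
  also have "\<dots> = (\<Sum>l. (c * (\<Sum>q. Poly_Mapping.lookup F q when p = l + q)) when 0 = l)"
    by (rule Sum_any.cong) (simp add: when_mult)
  also have "\<dots> = c * Poly_Mapping.lookup F p"
    by (simp add: Sum_any_when_equal)
  finally show ?thesis by (simp add: pscale_def)
qed

definition lowest :: "pol \<Rightarrow> mono \<Rightarrow> bool" where
  "lowest F p \<longleftrightarrow> Poly_Mapping.lookup F p \<noteq> 0 \<and> (\<forall>q<p. Poly_Mapping.lookup F q = 0)"

text \<open>Compatibility of the order with addition and the absence of zero divisors in the coefficients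
  make lowest exponents additive. This is why essential signatures form a semigroup.\<close>

lemma lowest_mult:
  assumes "lowest F p" "lowest G q"
  shows "lowest (F * G) (p + q)"
proof -
  have F: "Poly_Mapping.lookup F a = 0" if "a < p" for a using assms that by (simp add: lowest_def)
  have G: "Poly_Mapping.lookup G a = 0" if "a < q" for a using assms that by (simp add: lowest_def)
  have lk: "Poly_Mapping.lookup (F * G) r =
    (\<Sum>l. Poly_Mapping.lookup F l * (\<Sum>a. Poly_Mapping.lookup G a when r = l + a))" for r
    by (simp add: lookup_mult)
  have inner: "(\<Sum>a. Poly_Mapping.lookup G a when r = l + a) = (if l = p then Poly_Mapping.lookup G q else 0)"
    if "Poly_Mapping.lookup F l \<noteq> 0" "r \<le> p + q" "r = p + q \<or> l \<noteq> p" for r l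
  proof (cases "l = p")
    case True
    then have "(\<Sum>a. Poly_Mapping.lookup G a when r = l + a) = (\<Sum>a. Poly_Mapping.lookup G a when q = a)"
      using that by simp
    then show ?thesis using True by (simp add: Sum_any_when_equal')
  next
    case False
    then have l: "p < l" using that(1) F by (meson linorder_neqE)
    have "(Poly_Mapping.lookup G a when r = l + a) = 0" for a
    proof (cases "r = l + a")
      case True
      have "a < q"
      proof (rule ccontr)
        assume "\<not> a < q"
        then have "p + q < l + a" using l by (intro add_less_le_mono) auto
        then show False using True that(2) by simp
      qed
      then show ?thesis by (simp add: G)
    qed simp
    then show ?thesis using False by simp
  qed
  have "Poly_Mapping.lookup (F * G) (p + q) =
     (\<Sum>l. Poly_Mapping.lookup F p * Poly_Mapping.lookup G q when l = p)"
    unfolding lk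
  proof (rule Sum_any.cong)
    fix l show "Poly_Mapping.lookup F l * (\<Sum>a. Poly_Mapping.lookup G a when p + q = l + a)
      = (Poly_Mapping.lookup F p * Poly_Mapping.lookup G q when l = p)"
      using inner[of l "p + q"] by (cases "Poly_Mapping.lookup F l = 0") (auto simp: when_def)
  qed
  moreover have "Poly_Mapping.lookup (F * G) r = 0" if r: "r < p + q" for r
  proof -
    have "Poly_Mapping.lookup F l * (\<Sum>a. Poly_Mapping.lookup G a when r = l + a) = 0" for l
    proof (cases "l = p")
      case True
      have "(Poly_Mapping.lookup G a when r = p + a) = 0" for a
      proof (cases "r = p + a")
        case True
        have "a < q"
        proof (rule ccontr)
          assume "\<not> a < q"
          then have "p + q \<le> p + a" by (intro add_left_mono) simp
          then show False using r True by simp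
        qed
        then show ?thesis by (simp add: G)
      qed simp
      then show ?thesis using True by simp
    next
      case False
      then show ?thesis using inner[of l r] r by (cases "Poly_Mapping.lookup F l = 0") auto
    qed
    then have eq: "(\<lambda>l. Poly_Mapping.lookup F l * (\<Sum>a. Poly_Mapping.lookup G a when r = l + a)) = (\<lambda>l. 0)" by blast
    show ?thesis unfolding lk eq by simp
  qed
  ultimately show ?thesis using assms by (simp add: lowest_def)
qed

lemma lowest_1: "lowest 1 0"
proof -
  have "\<not> sig_less q 0" for q by (simp add: sig_less_def partial_sum_0)
  then show ?thesis by (simp add: lowest_def lookup_one less_mono_def)
qed

lemma lowest_unique: "lowest F p \<Longrightarrow> lowest F q \<Longrightarrow> p = q"
  by (metis linorder_neqE lowest_def)

section \<open>Combinatorial data\<close>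

text \<open>The generators: the coordinates of $\exp(x_1 e_{-\alpha_1}) \cdots \exp(x_{12} e_{-\alpha_{12}}) v$ for
  the four fundamental highest weight vectors, up to sign, in a suitable basis for each. An entry
  consists of the number of the fundamental weight and of the terms of the polynomial, each a
  coefficient and a sorted list of variables; the first term is the lowest one.\<close>

definition gens :: "(nat \<times> (int \<times> nat list) list) list" where
  "gens = [
   (3,[(1,[3,10]),(-1,[1,9]),(-1,[2,8]),(1,[2,7,9])]), (4,[(1,[2,6]),(-1,[3,5]),(1,[1,4])]),
   (1,[(1,[7]),(1,[11,12])]), (2,[(1,[3,10]),(-1,[2,8]),(1,[3,9,11])]),
   (1,[(1,[6]),(1,[5,12]),(1,[4,7]),(1,[4,11,12])]), (3,[(1,[10])]), (4,[(1,[2])]),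
   (2,[(1,[6,11]),(-1,[5,7])]), (2,[(1,[3,11]),(1,[6,10]),(1,[5,8]),(1,[2,7]),(1,[6,9,11])]),
   (2,[(1,[1,2]),(1,[2,3,11]),(1,[3,5,10]),(-1,[1,4,10]),(-1,[2,5,8]),(-1,[2,2,7]),(1,[3,5,9,11]),(-1,[1,4,9,11]),(-1,[2,4,8,11]),(1,[2,4,7,10]),(1,[2,4,7,9,11])]),
   (1,[(1,[3]),(1,[2,12]),(-1,[4,8]),(-1,[4,10,12]),(-1,[4,9,11,12])]), (4,[(1,[6])]),
   (1,[(1,[12])]), (3,[(1,[9])]), (2,[(1,[2]),(-1,[4,10]),(-1,[4,9,11])]),
   (2,[(1,[1,10]),(1,[1,9,11]),(1,[2,8,11]),(-1,[2,7,10]),(-1,[2,7,9,11])]), (4,[(1,[5])]),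
   (3,[(1,[2]),(-1,[4,10]),(1,[5,9])]), (3,[(1,[8]),(-1,[7,9])]),
   (3,[(1,[1]),(1,[6,10]),(-1,[5,8]),(1,[5,7,9])]), (2,[(1,[11])]),
   (2,[(1,[1,8]),(1,[3,8,11]),(-1,[3,7,10]),(-1,[3,7,9,11])]),
   (2,[(1,[1,11]),(-1,[5,8,11]),(1,[5,7,10]),(1,[5,7,9,11])]),
   (2,[(1,[1,7]),(-1,[6,8,11]),(1,[6,7,10]),(1,[6,7,9,11])]), (2,[(1,[10]),(1,[9,11])]),
   (2,[(1,[1,6]),(1,[3,6,11]),(1,[6,6,10]),(-1,[5,6,8]),(-1,[3,5,7]),(1,[1,4,7]),(1,[6,6,9,11]),(-1,[4,6,8,11]),(1,[4,6,7,10]),(1,[4,6,7,9,11])]),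
   (2,[(1,[8,11]),(-1,[7,10]),(-1,[7,9,11])]), (4,[(1,[1])]), (2,[(1,[8])]),
   (2,[(1,[1]),(1,[3,11]),(1,[6,10]),(1,[6,9,11])]), (1,[(1,[])]),
   (2,[(1,[1,1]),(1,[1,3,11]),(1,[1,6,10]),(-1,[1,5,8]),(-1,[1,2,7]),(1,[1,6,9,11]),(1,[2,6,8,11]),(-1,[3,5,8,11]),(-1,[2,6,7,10]),(1,[3,5,7,10]),(-1,[2,6,7,9,11]),(1,[3,5,7,9,11])]),
   (1,[(1,[1,12]),(1,[6,8]),(1,[3,7]),(1,[3,11,12]),(1,[6,10,12]),(1,[6,9,11,12])]),
   (2,[(1,[2,6]),(-1,[3,5]),(-1,[3,4,11]),(-1,[4,6,10]),(1,[4,5,8]),(1,[2,4,7]),(-1,[4,6,9,11]),(1,[4,4,8,11]),(-1,[4,4,7,10]),(-1,[4,4,7,9,11])]),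
   (2,[(1,[3]),(-1,[4,8])]), (2,[(1,[6]),(1,[4,7])]),
   (2,[(1,[6,10]),(1,[5,8]),(2,[2,7]),(1,[6,9,11]),(1,[4,8,11]),(-1,[4,7,10]),(-1,[4,7,9,11])]),
   (1,[(1,[1]),(-1,[5,8]),(-1,[2,7]),(-1,[2,11,12]),(-1,[5,10,12]),(-1,[5,9,11,12])]),
   (2,[(1,[])]), (4,[(1,[4])]),
   (2,[(1,[5,8]),(1,[2,7]),(1,[4,8,11]),(-1,[4,7,10]),(-1,[4,7,9,11])]),
   (2,[(1,[6,8]),(1,[3,7])]),
   (2,[(1,[1,3]),(1,[3,3,11]),(1,[3,6,10]),(-1,[2,6,8]),(-1,[1,4,8]),(-1,[2,3,7]),(1,[3,6,9,11]),(-1,[3,4,8,11]),(1,[3,4,7,10]),(1,[3,4,7,9,11])]),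
   (3,[(1,[])]), (2,[(1,[2,11]),(1,[5,10]),(1,[5,9,11])]),
   (2,[(1,[1,5]),(1,[2,6,11]),(1,[1,4,11]),(1,[5,6,10]),(-1,[5,5,8]),(-1,[2,5,7]),(1,[5,6,9,11]),(-1,[4,5,8,11]),(1,[4,5,7,10]),(1,[4,5,7,9,11])]),
   (2,[(1,[5]),(1,[4,11])]), (2,[(1,[7])]), (4,[(1,[3])]),
   (1,[(1,[8]),(1,[10,12]),(1,[9,11,12])]), (4,[(1,[])]),
   (3,[(1,[3]),(1,[6,9]),(-1,[4,8]),(1,[4,7,9])])]"

text \<open>The entry \<open>(b, T)\<close> at position \<open>a\<close> is the straightening relation which expresses the product of
  generators \<open>a\<close> and \<open>b\<close> as the combination \<open>T\<close> of products of two generators. The first term of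
  \<open>T\<close> has the same lowest monomial as the given product, all others have a higher one.\<close>

definition rels :: "(nat \<times> (int \<times> nat \<times> nat) list) list list" where
  "rels = [
   [], [], [],
   [(5,[(1,0,24),(1,13,15)]), (17,[(1,0,14),(1,9,13)]), (18,[(1,0,28),(1,13,21)]), (19,[(1,0,29),(1,13,31),(-1,0,8),(1,0,36),(-1,0,40)]), (43,[(1,0,38),(1,13,29),(-1,13,36),(1,13,40)]), (51,[(1,0,34),(1,13,42)])],
   [(6,[(1,1,30),(1,10,16),(-1,37,39)]), (23,[(1,2,25),(-1,7,32)]), (47,[(1,2,35),(-1,7,12)])],
   [(8,[(1,0,20),(1,13,22),(1,17,26),(1,5,36)]), (10,[(1,0,30),(1,13,37),(1,17,49)]), (34,[(1,0,38),(1,13,29),(1,14,18),(-1,8,13),(1,13,40)]), (42,[(1,0,29),(1,13,31),(1,9,18),(-1,0,40)]), (48,[(1,0,50),(1,13,27),(1,6,18)]), (51,[(1,0,43),(1,13,19),(1,17,18)])],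
   [(7,[(1,1,20),(1,8,16),(-1,22,39),(-1,16,36)]), (11,[(1,1,50),(1,16,48),(-1,27,39)]), (25,[(1,1,29),(1,16,42),(-1,31,39)]), (33,[(1,1,14),(-1,9,39)]), (35,[(1,1,38),(1,16,34),(-1,29,39),(1,8,39)]), (36,[(1,1,24),(1,3,16),(-1,15,39),(2,6,40)]), (41,[(1,1,28),(1,40,48),(-1,21,39)])],
   [(10,[(1,4,8),(-1,4,36),(1,2,33)]), (30,[(1,4,20),(-1,2,46)]), (37,[(1,4,22),(-1,2,45)]), (49,[(1,4,26),(1,2,36),(-2,2,40)])],
   [(11,[(1,7,48),(1,11,36),(-1,1,47),(1,23,39)]), (15,[(1,3,22),(1,9,26),(1,15,36)]), (24,[(1,3,20),(1,14,26),(1,24,36)]), (25,[(1,7,42),(1,25,36),(-1,23,33)]), (35,[(1,7,34),(1,35,36),(-1,33,47)]), (36,[(1,3,7),(1,26,33),(2,8,40),(1,36,36),(-2,36,40)])],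
   [(11,[(1,1,29),(1,16,42),(-1,31,39),(-1,1,36),(1,1,40)]), (16,[(1,6,45),(-1,1,44)]), (27,[(1,6,31),(-1,1,15)]), (48,[(1,6,42),(-1,1,3)]), (50,[(1,6,29),(-1,1,24),(-1,6,40)])],
   [(11,[(1,4,48),(1,1,12),(-1,32,39)]), (15,[(1,3,37),(1,9,49)]), (20,[(1,8,30),(-1,4,24),(-1,30,40),(1,12,44)]), (22,[(1,8,37),(-1,4,15),(-1,37,40),(1,32,44)]), (23,[(1,2,42),(-1,8,32),(1,32,36)]), (24,[(1,3,30),(1,14,49)]), (25,[(1,4,42),(1,32,33)]), (26,[(1,8,49),(-1,36,49),(-1,2,3)]), (35,[(1,4,34),(1,12,33)]), (36,[(1,3,4),(1,33,49),(2,10,40)]), (47,[(1,2,34),(-1,8,12),(1,12,36)])],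
   [(14,[(1,1,38),(1,16,34),(-1,29,39),(1,8,39),(-1,36,39),(1,39,40)]), (17,[(1,1,43),(1,16,51),(-1,19,39)]), (20,[(1,7,50),(1,16,47)]), (22,[(1,7,27),(1,16,23)]), (30,[(1,4,50),(-1,12,16),(-1,2,39)]), (33,[(1,1,35),(-1,25,39)]), (37,[(1,4,27),(-1,16,32),(-1,1,2)]), (44,[(1,1,20),(1,8,16),(-1,22,39),(-1,16,40)])],
   [], [],
   [(15,[(1,9,24),(-1,3,44)]), (16,[(1,6,46),(-1,39,44)]), (19,[(1,9,43),(-1,8,17),(2,5,33),(1,0,46),(1,13,45),(2,17,40)]), (21,[(1,9,28),(-1,3,40)]), (22,[(1,9,20),(-1,8,44),(1,36,44)]), (23,[(1,9,47),(-1,26,33),(-1,8,40),(1,36,40)]), (25,[(1,9,35),(1,33,36),(-1,33,40)]), (27,[(1,6,29),(-1,6,8),(-1,15,39),(1,6,40)]), (29,[(1,9,38),(1,14,36),(-1,3,46),(-1,14,40)]), (31,[(1,9,29),(-1,8,9),(1,9,36),(-1,3,45),(-1,9,40)]), (32,[(1,9,12),(1,33,49),(1,10,40)]), (37,[(1,9,30),(-1,10,44)]), (42,[(1,9,34),(1,3,33)]), (45,[(1,9,46),(1,33,44)]), (48,[(1,6,34),(-1,3,39)]), (50,[(1,6,38),(-1,24,39)])],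
   [(17,[(1,5,9),(-1,0,44)]), (18,[(1,5,21),(-1,0,26)]), (19,[(1,5,31),(-1,0,22)]), (33,[(1,9,36),(-1,3,45),(-2,9,40)]), (34,[(1,3,29),(1,9,28),(-1,3,8)]), (42,[(1,3,31),(1,9,21)]), (43,[(1,5,29),(-1,0,20),(-1,5,36),(1,5,40)]), (48,[(1,3,27),(1,6,21)]), (51,[(1,0,29),(1,13,31),(1,9,18),(-1,0,8)])],
   [(25,[(1,11,45),(-1,1,7)]), (33,[(1,1,46),(-1,39,45)]), (35,[(1,11,46),(-1,7,39)]), (41,[(1,11,40),(-1,1,47),(1,23,39)])],
   [(21,[(1,9,18),(-1,0,40)]), (24,[(1,5,14),(1,13,44)]), (27,[(1,6,19),(-1,1,5),(-1,0,16)]), (28,[(1,14,18),(1,13,40)]), (29,[(1,9,43),(1,5,33),(1,13,45),(1,17,40)]), (31,[(1,9,19),(-1,0,45)]), (34,[(1,14,51),(-1,13,33)]), (36,[(1,5,33),(1,0,46),(1,13,45),(2,17,40)]), (38,[(1,14,43),(1,13,46)]), (42,[(1,9,51),(1,0,33)]), (48,[(1,6,51),(-1,0,39),(-1,1,13)]), (50,[(1,6,43),(-1,5,39),(1,13,16)])],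
   [(24,[(1,5,28),(1,13,26)]), (33,[(1,17,41),(-1,40,51)]), (36,[(1,5,41),(-1,0,47),(-1,13,23),(1,18,40)]), (44,[(1,17,26),(1,5,40)])],
   [(21,[(1,18,31),(-1,0,23)]), (24,[(1,5,29),(-1,0,20),(-1,17,26),(-1,5,40)]), (26,[(1,18,22),(-1,5,23)]), (28,[(1,18,29),(-1,8,18),(1,5,41),(-1,0,47)]), (33,[(1,17,25),(-1,45,51)]), (36,[(1,5,25),(1,18,45),(2,17,23),(-1,0,7)]), (40,[(1,18,45),(1,17,23)]), (41,[(1,18,25),(1,23,51)]), (44,[(1,17,22),(1,5,45)]), (49,[(1,18,37),(1,5,32),(-1,0,2)])],
   [(25,[(1,7,29),(1,23,46)]), (32,[(1,12,22),(1,4,26),(1,2,8),(-1,2,40)]), (33,[(1,7,14),(-1,8,46),(1,36,46)]), (34,[(1,8,38),(-1,24,35),(-1,28,46),(-1,14,47)]), (35,[(1,7,38),(1,46,47)]), (36,[(1,7,24),(1,20,40),(1,44,47)]), (41,[(1,7,28),(1,8,47),(-1,36,47),(1,40,47)]), (42,[(1,8,29),(-1,15,35),(-1,21,46),(-1,9,47),(-1,3,7),(-1,26,33),(-1,8,40),(-1,36,36),(2,36,40)]), (48,[(1,8,50),(-1,11,24),(-1,16,28),(-1,6,47)]), (51,[(1,8,43),(-1,5,35),(-1,18,46),(-1,17,47)])],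
   [(24,[(1,15,28),(1,3,26)]), (33,[(1,9,41),(-1,40,42)]), (36,[(1,15,41),(-1,3,23),(1,21,40)]), (43,[(1,18,29),(-1,5,41),(1,13,23)]), (44,[(1,9,26),(1,15,40)]), (51,[(1,18,42),(-1,0,41)])],
   [(24,[(1,15,20),(-1,26,44)]), (25,[(1,7,31),(1,23,45)]), (28,[(1,20,21),(-1,8,26),(1,26,36),(-1,26,40)]), (29,[(1,20,31),(1,23,44)]), (30,[(1,20,37),(1,2,44)]), (33,[(1,7,9),(-1,8,45),(1,36,45)]), (34,[(1,8,29),(-1,15,35),(-1,21,46),(-1,9,47),(-1,8,8),(1,26,33),(2,8,40),(-1,36,40)]), (35,[(1,7,29),(1,23,46),(-1,7,8),(1,7,40)]), (36,[(1,7,15),(1,22,40),(1,23,44)]), (38,[(1,20,29),(-1,8,20),(1,44,47)]), (41,[(1,7,21),(1,8,23),(-1,23,36),(1,23,40)]), (42,[(1,8,31),(-1,15,25),(-1,21,45),(-1,9,23)]), (43,[(1,19,20),(-1,5,7)]), (46,[(1,20,45),(-1,7,44)]), (47,[(1,20,23),(1,7,26)]), (48,[(1,8,27),(-1,11,15),(-1,16,21),(-1,6,23)]), (50,[(1,20,27),(-1,16,26)]), (51,[(1,8,19),(-1,5,25),(-1,18,45),(-1,17,23)])],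
   [(24,[(1,15,47),(-1,26,36),(1,26,40)]), (28,[(1,21,47),(-1,26,41)]), (30,[(1,2,29),(-1,12,22),(-1,4,26),(-1,2,8),(1,2,40)]), (37,[(1,2,31),(-1,22,32)]), (43,[(1,19,47),(-1,7,18)]), (49,[(1,2,21),(-1,26,32)])],
   [(25,[(1,15,35),(1,3,7),(1,36,36),(-3,36,40),(2,40,40)]), (27,[(1,15,50),(-1,6,26)]), (29,[(1,15,38),(1,3,20),(1,24,36),(-1,24,40)]), (31,[(1,15,29),(-1,9,26),(-1,15,40)]), (32,[(1,12,15),(1,36,49),(1,2,3),(-1,40,49)]), (33,[(1,14,36),(-1,3,46),(-2,14,40)]), (34,[(1,3,38),(1,14,28)]), (37,[(1,15,30),(-1,44,49)]), (42,[(1,3,29),(1,9,28),(-1,3,40)]), (43,[(1,5,38),(1,13,20)]), (45,[(1,15,46),(1,36,44),(-2,40,44)]), (48,[(1,3,50),(1,6,28)]), (51,[(1,0,38),(1,13,29),(1,14,18)])],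
   [(26,[(1,7,21),(-1,23,36),(2,23,40)]), (27,[(1,11,31),(1,1,23)]), (28,[(1,21,35),(1,36,41),(-2,40,41)]), (30,[(1,4,29),(-1,12,45),(-1,4,40),(1,2,33)]), (37,[(1,4,31),(-1,32,45)]), (43,[(1,19,35),(1,7,51)]), (44,[(1,7,9),(1,36,45),(-1,40,45)]), (47,[(1,23,35),(1,7,41)]), (48,[(1,11,42),(1,1,41)]), (49,[(1,4,21),(1,32,36),(-2,32,40)]), (50,[(1,11,29),(-1,11,40),(1,1,47)])],
   [(29,[(1,20,21),(-1,15,47),(1,26,36),(-1,26,40)]), (30,[(1,20,49),(-1,2,24)]), (31,[(1,21,22),(-1,15,23)]), (34,[(1,8,28),(-1,24,41),(-1,28,40)]), (35,[(1,7,28),(-1,36,47),(2,40,47)]), (37,[(1,22,49),(-1,2,15)]), (38,[(1,20,28),(-1,24,47)]), (42,[(1,8,21),(-1,15,41),(-1,21,40)]), (43,[(1,18,20),(-1,5,47)]), (45,[(1,22,40),(-1,23,44)]), (46,[(1,20,40),(-1,44,47)]), (51,[(1,8,18),(-1,5,41),(-1,18,40)])],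
   [(28,[(1,21,50),(-1,26,48)]), (33,[(1,1,29),(-1,31,39),(-1,1,8),(1,1,40)]), (35,[(1,11,29),(-1,7,48),(-1,11,36),(1,11,40),(1,1,47)]), (36,[(1,11,15),(1,16,21),(2,6,23),(1,1,26)]), (40,[(1,16,21),(1,6,23),(1,1,26)]), (41,[(1,11,21),(1,23,48)]), (43,[(1,19,50),(-1,5,11),(1,16,18)]), (44,[(1,6,22),(1,15,16)]), (45,[(1,16,31),(1,1,22)]), (46,[(1,16,29),(-1,8,16),(1,22,39),(1,16,40)]), (47,[(1,23,50),(1,11,26)]), (51,[(1,19,48),(-1,0,11),(-1,1,18)])],
   [(29,[(1,21,38),(1,24,41)]), (31,[(1,21,29),(-1,8,21),(1,15,41)]), (32,[(1,12,21),(1,41,49)]), (33,[(1,14,41),(-1,34,40)]), (36,[(1,24,41),(-1,3,47),(1,28,40)]), (37,[(1,21,30),(-1,8,49),(1,36,49),(1,2,3),(-1,40,49)]), (42,[(1,21,34),(1,3,41)]), (43,[(1,18,38),(1,13,47)]), (44,[(1,14,26),(1,24,40)]), (45,[(1,21,46),(1,26,33),(1,36,40),(-2,40,40)]), (51,[(1,18,34),(1,13,41)])],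
   [(32,[(1,12,31),(1,4,21),(1,2,42),(1,32,36),(-1,32,40)]), (33,[(1,9,35),(-1,34,45),(1,8,33)]), (35,[(1,25,38),(1,35,40),(-1,33,47)]), (36,[(1,15,35),(1,21,46),(2,9,47),(1,3,7),(1,36,36),(-1,36,40)]), (40,[(1,21,46),(1,9,47),(1,36,40),(-1,40,40)]), (41,[(1,21,35),(1,23,34),(1,8,41),(-1,40,41)]), (43,[(1,19,38),(1,8,43),(-1,5,35),(-1,17,47)]), (44,[(1,9,20),(1,15,46),(1,36,44),(-1,40,44)]), (47,[(1,23,38),(1,7,28),(1,8,47),(-1,36,47),(1,40,47)]), (48,[(1,27,34),(1,8,48),(-1,40,48),(1,21,39)]), (49,[(1,21,30),(1,12,15),(1,36,49),(1,2,3),(-1,40,49)]), (50,[(1,27,38),(1,8,50),(-1,16,28),(-1,6,47)]), (51,[(1,19,34),(1,8,51),(-1,0,35),(-1,17,41)])],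
   [(31,[(1,29,37),(1,32,44)]), (32,[(1,12,37),(1,4,49),(1,2,10)]), (33,[(1,4,14),(-1,10,46)]), (34,[(1,10,38),(-1,12,14)]), (35,[(1,4,38),(-1,12,46)]), (36,[(1,4,24),(1,30,40),(1,2,14),(-1,12,44)]), (41,[(1,4,28),(1,2,34),(-1,8,12),(1,12,36),(-1,12,40)]), (42,[(1,10,29),(-1,9,12),(-1,33,49),(-1,10,40)]), (47,[(1,2,38),(-1,12,20)]), (48,[(1,10,50),(-1,6,12),(1,39,49)]), (51,[(1,10,43),(-1,12,17),(1,4,13)])],
   [(33,[(1,9,25),(-1,42,45)]), (34,[(1,29,42),(-1,8,42),(1,9,41)]), (35,[(1,25,29),(-1,7,42),(-1,25,36),(1,25,40)]), (36,[(1,15,25),(1,21,45),(2,9,23)]), (38,[(1,29,29),(-1,8,29),(1,26,33),(1,8,40),(-1,40,40)]), (40,[(1,21,45),(1,9,23)]), (41,[(1,21,25),(1,23,42)]), (43,[(1,19,29),(-1,5,25),(-1,17,23)]), (44,[(1,9,22),(1,15,45)]), (46,[(1,29,45),(-1,7,9),(-1,36,45),(1,40,45)]), (47,[(1,23,29),(1,7,21),(-1,23,36),(1,23,40)]), (48,[(1,27,42),(1,1,21)]), (49,[(1,21,37),(1,15,32)]), (50,[(1,27,29),(-1,16,21),(-1,6,23)]), (51,[(1,19,42),(-1,0,25)])],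
   [(34,[(1,12,42),(1,10,41)]), (35,[(1,12,25),(1,4,41)]), (38,[(1,12,29),(1,4,28),(1,2,34),(-1,8,12),(1,12,36),(-1,12,40)]), (43,[(1,12,19),(1,4,18),(1,2,51)]), (46,[(1,12,45),(1,4,40),(-1,2,33)]), (47,[(1,12,23),(1,2,41)]), (50,[(1,12,27),(1,11,49),(1,2,48)])],
   [(37,[(1,4,9),(-1,10,45)]), (38,[(1,14,35),(-1,34,46)]), (43,[(1,17,35),(-1,46,51)]), (48,[(1,1,34),(-1,39,42)]), (50,[(1,1,38),(-1,29,39),(1,39,40)])],
   [(36,[(1,3,35),(1,14,41),(1,34,40)]), (37,[(1,10,29),(-1,9,12),(-1,8,10)]), (44,[(1,8,14),(-1,14,36),(1,3,46),(1,14,40)]), (49,[(1,10,28),(1,3,12)])],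
   [(37,[(1,4,29),(-1,12,45),(-1,4,8)]), (42,[(1,25,34),(-1,33,41)]), (44,[(1,7,14),(1,36,46),(-1,40,46)]), (45,[(1,25,46),(1,7,33)]), (48,[(1,11,34),(1,39,41)]), (49,[(1,4,28),(1,12,36),(-2,12,40)]), (50,[(1,11,38),(1,39,47)])],
   [(37,[(1,4,15),(1,37,40),(1,2,9),(-1,32,44)]), (38,[(1,24,35),(1,28,46),(2,14,47)]), (42,[(1,3,25),(1,9,41),(1,40,42)]), (43,[(1,5,35),(1,18,46),(2,17,47),(1,7,13)]), (48,[(1,3,11),(1,1,28),(2,40,48),(-1,21,39)]), (50,[(1,11,24),(1,16,28),(2,6,47),(1,26,39)]), (51,[(1,0,35),(1,13,25),(1,17,41),(1,40,51)])],
   [(38,[(1,29,30),(-1,8,30),(-1,12,44)]), (41,[(1,4,21),(1,2,42),(-1,8,32),(1,32,36),(-1,32,40)]), (42,[(1,10,31),(-1,9,32)]), (43,[(1,19,30),(-1,4,5),(-1,2,17)]), (46,[(1,30,45),(-1,4,44)]), (47,[(1,2,29),(-1,12,22),(-1,2,8)]), (48,[(1,10,27),(-1,6,32),(1,1,49)]), (50,[(1,27,30),(-1,16,49),(-1,2,6)]), (51,[(1,10,19),(-1,17,32),(-1,0,4)])],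
   [(40,[(1,28,46),(1,14,47)]), (41,[(1,28,35),(1,34,47)]), (42,[(1,29,34),(-1,14,41)]), (44,[(1,14,20),(1,24,46)]), (45,[(1,29,46),(1,7,14),(-1,8,46),(1,36,46),(-1,40,46)]), (48,[(1,34,50),(1,28,39)]), (49,[(1,28,30),(1,12,24)]), (51,[(1,34,43),(1,13,35)])],
   [], [(43,[(1,18,46),(1,17,47)]), (50,[(1,16,28),(1,6,47),(1,26,39)])],
   [(43,[(1,18,35),(1,47,51)]), (44,[(1,26,33),(1,8,40),(-1,40,40)]), (45,[(1,25,40),(-1,23,33)]), (46,[(1,35,40),(-1,33,47)]), (50,[(1,11,28),(1,47,48)])],
   [(43,[(1,19,34),(1,8,51),(-1,0,35),(-1,13,25),(-2,17,41)]), (44,[(1,8,9),(-1,9,36),(1,3,45),(1,9,40)]), (46,[(1,34,45),(-1,8,33),(1,33,36),(-1,33,40)]), (47,[(1,23,34),(1,8,41),(-1,36,41)]), (49,[(1,10,21),(1,3,32)]), (50,[(1,27,34),(1,8,48),(-1,1,28),(-2,40,48),(1,21,39)])],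
   [(44,[(1,17,20),(1,5,46)]), (45,[(1,19,46),(1,7,17)]), (49,[(1,18,30),(1,5,12),(1,2,13)])],
   [(48,[(1,6,8),(-1,1,24),(1,15,39),(-1,6,40)]), (50,[(1,6,20),(1,16,24)]), (51,[(1,8,17),(-1,5,33),(-1,17,40)])],
   [(47,[(1,23,46),(1,7,40)]), (48,[(1,16,42),(1,1,8),(-1,1,36),(1,1,40)]), (49,[(1,37,40),(-1,2,9),(1,32,44)]), (50,[(1,16,29),(1,1,20),(-1,16,40)])],
   [(48,[(1,16,34),(1,8,39),(-1,36,39),(1,39,40)]), (49,[(1,30,40),(-1,2,14),(1,12,44)]), (50,[(1,16,38),(1,20,39)])],
   [(49,[(1,2,28),(-1,12,26)])], [], [(51,[(1,10,18),(1,0,12),(1,13,32)])],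
   [(51,[(1,43,48),(1,11,13),(-1,18,39)])], []]"

text \<open>A weight on the generators such that replacing a non-standard pair by the first term of its
  straightening relation lowers the total weight; this makes straightening terminate.\<close>

definition weightA :: "nat list" where
  "weightA = [
   0, 0, 1, 10, 0, 13, 16, 0, 11, 2, 18, 31, 8, 15, 8, 18, 32, 24, 5, 17, 9, 9, 17, 23, 21, 18,
   22, 35, 11, 10, 15, 17, 18, 44, 13, 16, 36, 20, 7, 27, 18, 24, 18, 19, 43, 16, 12, 23, 41, 24,
   34, 27]"

text \<open>The pair \<open>(c, d)\<close> stands for the inequality
  $\sum_j d_j p_j \le \sum_k c_k \langle\lambda, \beta_k^\vee\rangle$.\<close>

definition facets :: "(int list \<times> int list) list" where
  "facets = [
   ([0,0,0,1],[0,0,0,1,0,0,0,0,0,0,0,0]), ([0,0,1,0],[0,0,0,0,0,0,0,0,1,0,0,0]),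
   ([0,1,0,0],[0,0,0,0,0,0,0,0,0,0,1,0]), ([1,0,0,0],[0,0,0,0,0,0,0,0,0,0,0,1]),
   ([0,1,0,1],[0,0,0,1,1,0,0,0,0,0,1,0]), ([0,1,1,0],[0,0,0,0,0,0,0,0,1,1,1,0]),
   ([1,1,0,0],[0,0,0,0,0,0,1,0,0,0,1,1]), ([0,1,1,1],[0,1,0,1,1,0,0,0,1,1,0,0]),
   ([0,1,1,1],[0,0,0,1,1,0,0,0,1,1,1,0]), ([1,1,0,1],[0,0,0,1,1,1,1,0,0,0,0,1]),
   ([1,1,0,1],[0,0,0,1,1,0,1,0,0,0,1,1]), ([1,1,1,0],[0,0,0,0,0,0,1,1,1,1,0,1]),
   ([1,1,1,0],[0,0,0,0,0,0,1,0,1,1,1,1]), ([1,1,1,1],[0,1,1,1,1,0,1,0,1,0,0,1]),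
   ([1,1,1,1],[0,1,1,1,0,0,1,1,1,0,0,1]), ([1,1,1,1],[0,1,0,1,1,0,1,0,1,1,0,1]),
   ([1,1,1,1],[0,1,0,1,0,0,1,1,1,1,0,1]), ([1,1,1,1],[0,0,1,1,1,1,1,0,1,0,0,1]),
   ([1,1,1,1],[0,0,0,1,1,0,1,0,1,1,1,1]), ([1,2,1,1],[1,1,1,1,1,0,1,1,1,0,1,0]),
   ([1,2,1,1],[1,1,0,1,1,0,1,1,1,1,1,0]), ([1,2,1,1],[1,0,1,1,1,1,1,1,1,0,1,0]),
   ([1,2,1,1],[1,0,0,1,1,1,1,1,1,1,1,0]), ([1,2,1,1],[0,1,1,1,1,0,1,1,1,0,1,1]),
   ([1,2,1,1],[0,1,0,1,1,0,1,1,1,1,1,1]), ([1,2,1,1],[0,0,1,1,1,1,1,1,1,0,1,1]),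
   ([1,2,1,1],[0,0,0,1,1,1,1,1,1,1,1,1]), ([1,2,1,2],[1,1,1,2,1,1,1,1,1,0,1,0]),
   ([1,2,1,2],[1,1,0,2,1,1,1,1,1,1,1,0]), ([1,2,1,2],[0,1,1,2,2,1,1,0,1,0,1,1]),
   ([1,2,1,2],[0,1,1,2,1,1,1,1,1,0,1,1]), ([1,2,1,2],[0,1,0,2,2,1,1,0,1,1,1,1]),
   ([1,2,1,2],[0,1,0,2,1,1,1,1,1,1,1,1]), ([1,2,2,1],[1,1,1,1,1,0,1,1,2,1,1,0]),
   ([1,2,2,1],[1,0,1,1,1,1,1,1,2,1,1,0]), ([1,2,2,1],[0,1,1,1,1,0,1,1,2,1,1,1]),
   ([1,2,2,1],[0,1,0,1,1,0,1,1,2,2,1,1]), ([1,2,2,1],[0,0,1,1,1,1,1,1,2,1,1,1]),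
   ([2,2,1,1],[0,1,1,1,1,0,2,1,1,0,1,2]), ([2,2,1,1],[0,1,0,1,1,0,2,1,1,1,1,2]),
   ([2,2,1,1],[0,0,1,1,1,1,2,1,1,0,1,2]), ([2,2,1,1],[0,0,0,1,1,1,2,1,1,1,1,2]),
   ([1,2,2,2],[1,1,1,2,1,1,1,1,2,1,1,0]), ([1,2,2,2],[0,1,1,2,2,1,1,0,2,1,1,1]),
   ([1,2,2,2],[0,1,1,2,1,1,1,1,2,1,1,1]), ([1,3,1,2],[1,1,1,2,2,1,1,1,1,0,2,0]),
   ([1,3,1,2],[1,1,0,2,2,1,1,1,1,1,2,0]), ([1,3,1,2],[0,1,1,2,2,1,1,1,1,0,2,1]),
   ([1,3,1,2],[0,1,0,2,2,1,1,1,1,1,2,1]), ([2,2,1,2],[0,1,1,2,2,1,2,0,1,0,1,2]),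
   ([2,2,1,2],[0,1,1,2,1,1,2,1,1,0,1,2]), ([2,2,1,2],[0,1,0,2,2,1,2,0,1,1,1,2]),
   ([2,2,1,2],[0,1,0,2,1,1,2,1,1,1,1,2]), ([2,2,2,1],[0,1,1,1,1,0,2,1,2,1,1,2]),
   ([2,2,2,1],[0,1,0,1,1,0,2,1,2,2,1,2]), ([2,2,2,1],[0,0,1,1,1,1,2,1,2,1,1,2]),
   ([1,3,2,2],[1,1,0,2,2,1,1,1,2,2,2,0]), ([1,3,2,2],[0,1,0,2,2,1,1,1,2,2,2,1]),
   ([2,2,2,2],[0,1,1,2,2,1,2,0,2,1,1,2]), ([2,2,2,2],[0,1,1,2,1,1,2,1,2,1,1,2]),
   ([2,3,1,2],[1,1,1,2,2,1,2,1,1,0,2,1]), ([2,3,1,2],[1,1,0,2,2,1,2,1,1,1,2,1]),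
   ([1,3,3,2],[1,1,1,2,2,1,1,1,3,2,2,0]), ([1,3,3,2],[0,1,1,2,2,1,1,1,3,2,2,1]),
   ([2,3,2,2],[1,1,0,2,2,1,2,1,2,2,2,1]), ([3,3,1,2],[0,1,1,2,2,1,3,1,1,0,2,3]),
   ([3,3,1,2],[0,1,0,2,2,1,3,1,1,1,2,3]), ([2,3,3,2],[1,1,1,2,2,1,2,1,3,2,2,1]),
   ([3,3,2,2],[0,1,0,2,2,1,3,1,2,2,2,3]), ([3,3,3,2],[0,1,1,2,2,1,3,1,3,2,2,3])]"

text \<open>A certificate that every standard multiset of generators lies on one of the faces named at the
  leaves. A branch splits the multisets according to whether they contain a given generator.\<close>

datatype cover = Leaf nat | Branch nat cover cover

text \<open>Entry \<open>a\<close> lists the generators that cannot occur together with \<open>a\<close> in a standard multiset.\<close>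

definition nonstdA :: "nat list list" where
  "nonstdA = [
   [], [], [], [5,17,18,19,43,51], [6,23,47], [3,8,10,34,42,48,51], [4,7,11,25,33,35,36,41],
   [6,10,30,37,49], [5,11,15,24,25,35,36], [11,16,27,48,50],
   [5,7,11,15,20,22,23,24,25,26,35,36,47], [6,8,9,10,14,17,20,22,30,33,37,44], [], [],
   [11,15,16,19,21,22,23,25,27,29,31,32,37,42,45,48,50], [8,10,14,17,18,19,33,34,42,43,48,51],
   [9,14,25,33,35,41], [3,11,15,21,24,27,28,29,31,34,36,38,42,48,50], [3,15,24,33,36,44],
   [3,14,15,21,24,26,28,33,36,40,41,44,49], [10,11,25,32,33,34,35,36,41,42,48,51],
   [14,17,19,24,33,36,43,44,51], [10,11,14,24,25,28,29,30,33,34,35,36,38,41,42,43,46,47,48,50,51],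
   [4,10,14,24,28,30,37,43,49], [8,10,17,18,19,21,22,23,25,27,29,31,32,33,34,37,42,43,45,48,51],
   [6,8,10,14,16,20,22,24,26,27,28,30,37,43,44,47,48,49,50],
   [10,19,25,29,30,31,34,35,37,38,42,43,45,46,51],
   [9,14,17,24,25,28,33,35,36,40,41,43,44,45,46,47,51],
   [17,19,22,23,25,27,29,31,32,33,36,37,42,43,44,45,51],
   [14,17,22,24,26,28,32,33,35,36,40,41,43,44,47,48,49,50,51],
   [7,11,22,23,25,26,31,32,33,34,35,36,41,42,47,48,51],
   [14,17,24,26,28,30,33,34,35,36,38,40,41,43,44,46,47,48,49,50,51],
   [14,20,24,28,29,30,34,35,38,43,46,47,50],
   [6,11,15,16,18,19,20,21,22,24,27,28,29,30,31,37,38,43,48,50],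
   [5,15,17,20,22,24,26,30,31,32,36,37,44,49],
   [6,8,10,16,20,22,26,27,29,30,31,32,37,42,44,45,48,49,50],
   [6,8,10,17,18,19,20,21,22,27,28,29,30,31,34,37,38,42,43,48,50,51],
   [7,11,14,23,24,25,26,28,33,34,35,36,38,41,42,43,46,47,48,50,51],
   [17,22,26,31,32,33,36,37,40,41,42,44,45,48,49,51], [], [19,27,29,31,38,43,50],
   [6,16,19,20,22,27,29,30,31,37,38,43,44,45,46,50],
   [5,14,15,17,20,22,24,26,28,30,35,36,37,38,43,44,46,47,49,50],
   [3,15,21,22,23,24,25,26,27,28,29,31,32,33,36,37,40,41,42,44,45,49],
   [11,18,19,21,25,27,28,29,31,34,35,38,41,42,43,48,50,51],
   [14,24,26,27,28,35,38,41,43,47,48,49,50], [22,26,27,31,32,37,41,42,48,49,50],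
   [4,10,22,25,27,29,30,31,32,37,42,45,49],
   [5,9,14,15,17,20,22,24,25,29,30,31,33,35,36,37,38,44,45,46],
   [7,19,23,25,29,31,34,35,38,42,43,45,46,47,51],
   [9,14,17,22,25,29,31,32,33,35,36,37,40,41,42,44,45,46,51],
   [3,5,15,20,21,22,24,26,27,28,29,30,31,36,37,38,44,49,50]]"

text \<open>For each generator \<open>g\<close>, a certificate that every standard multiset of generators after \<open>g\<close> lies on
  a face that does not contain \<open>g\<close>.\<close>

definition coversA :: "cover list" where
  "coversA = [
   Branch 36 (Branch 3 (Leaf 1) (Leaf 72)) (Branch 24 (Branch 3 (Leaf 1) (Leaf 72)) (Branch 15 (Branch 3 (Leaf 1) (Leaf 72)) (Branch 5 (Leaf 72) (Branch 3 (Leaf 1) (Leaf 79))))),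
   Branch 33 (Leaf 0) (Branch 44 (Branch 6 (Leaf 75) (Branch 16 (Branch 17 (Branch 7 (Branch 4 (Leaf 4) (Leaf 10)) (Branch 4 (Leaf 4) (Leaf 75))) (Branch 47 (Leaf 18) (Branch 23 (Leaf 18) (Leaf 8)))) (Leaf 0))) (Branch 14 (Branch 6 (Leaf 75) (Leaf 0)) (Branch 17 (Branch 6 (Leaf 75) (Branch 16 (Branch 7 (Branch 4 (Leaf 4) (Leaf 10)) (Branch 4 (Leaf 4) (Leaf 75))) (Leaf 0))) (Branch 6 (Leaf 75) (Branch 9 (Leaf 0) (Leaf 71)))))),
   Branch 47 (Leaf 3) (Branch 23 (Leaf 3) (Leaf 76)),
   Branch 36 (Leaf 72) (Branch 24 (Leaf 72) (Branch 15 (Leaf 72) (Branch 5 (Leaf 72) (Leaf 79)))),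
   Branch 37 (Leaf 75) (Branch 30 (Leaf 75) (Branch 49 (Branch 10 (Branch 33 (Leaf 14) (Branch 41 (Leaf 14) (Leaf 75))) (Branch 33 (Branch 8 (Leaf 14) (Leaf 16)) (Branch 36 (Branch 11 (Leaf 11) (Branch 16 (Leaf 36) (Leaf 16))) (Branch 11 (Leaf 11) (Branch 41 (Branch 48 (Leaf 14) (Branch 8 (Leaf 14) (Leaf 16))) (Leaf 75)))))) (Branch 10 (Branch 33 (Branch 41 (Leaf 14) (Leaf 13)) (Branch 41 (Leaf 14) (Leaf 75))) (Leaf 3)))),
   Branch 36 (Leaf 1) (Branch 24 (Leaf 1) (Branch 15 (Leaf 1) (Leaf 79))),
   Branch 33 (Leaf 0) (Branch 44 (Branch 16 (Branch 17 (Branch 47 (Leaf 10) (Branch 23 (Leaf 10) (Leaf 4))) (Branch 47 (Leaf 18) (Branch 23 (Leaf 18) (Leaf 8)))) (Leaf 0)) (Branch 14 (Leaf 0) (Branch 17 (Branch 16 (Branch 47 (Leaf 10) (Branch 23 (Leaf 10) (Leaf 4))) (Leaf 0)) (Branch 9 (Leaf 0) (Leaf 71))))),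
   Branch 22 (Leaf 75) (Branch 44 (Branch 36 (Branch 26 (Branch 16 (Branch 49 (Leaf 36) (Leaf 54)) (Leaf 16)) (Branch 49 (Leaf 7) (Leaf 15))) (Branch 33 (Branch 49 (Leaf 14) (Branch 26 (Leaf 14) (Leaf 13))) (Leaf 75))) (Branch 26 (Branch 20 (Leaf 75) (Branch 8 (Branch 33 (Leaf 14) (Branch 41 (Leaf 14) (Leaf 75))) (Branch 33 (Leaf 16) (Branch 36 (Branch 14 (Leaf 16) (Branch 9 (Leaf 16) (Leaf 11))) (Branch 41 (Branch 11 (Leaf 11) (Branch 48 (Leaf 11) (Leaf 16))) (Branch 11 (Leaf 11) (Leaf 75))))))) (Branch 20 (Leaf 75) (Branch 8 (Branch 33 (Branch 41 (Leaf 14) (Branch 49 (Leaf 14) (Leaf 13))) (Branch 41 (Leaf 14) (Leaf 75))) (Leaf 80))))),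
   Branch 22 (Leaf 72) (Branch 44 (Branch 10 (Leaf 7) (Leaf 72)) (Branch 26 (Branch 48 (Leaf 11) (Leaf 72)) (Branch 20 (Leaf 72) (Leaf 80)))),
   Branch 33 (Branch 44 (Branch 45 (Branch 10 (Leaf 29) (Leaf 51)) (Branch 32 (Branch 23 (Leaf 52) (Branch 36 (Leaf 32) (Leaf 30))) (Branch 23 (Branch 26 (Leaf 52) (Leaf 51)) (Leaf 70)))) (Branch 14 (Leaf 70) (Branch 17 (Branch 49 (Leaf 30) (Branch 26 (Leaf 50) (Branch 10 (Branch 41 (Leaf 30) (Leaf 29)) (Leaf 9)))) (Branch 49 (Leaf 44) (Branch 26 (Leaf 52) (Leaf 17)))))) (Branch 44 (Branch 14 (Leaf 70) (Branch 17 (Branch 47 (Leaf 10) (Branch 23 (Leaf 10) (Leaf 4))) (Branch 47 (Leaf 18) (Branch 23 (Leaf 18) (Leaf 8))))) (Branch 14 (Leaf 70) (Branch 17 (Branch 35 (Leaf 9) (Branch 25 (Leaf 9) (Branch 41 (Branch 23 (Leaf 50) (Branch 32 (Leaf 30) (Leaf 70))) (Branch 47 (Leaf 10) (Branch 23 (Leaf 10) (Leaf 4)))))) (Leaf 71)))),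
   Branch 37 (Leaf 72) (Branch 30 (Leaf 72) (Branch 49 (Branch 48 (Leaf 11) (Leaf 72)) (Leaf 3))),
   Branch 50 (Leaf 75) (Branch 48 (Branch 41 (Leaf 14) (Leaf 75)) (Branch 27 (Leaf 75) (Branch 16 (Branch 36 (Branch 49 (Leaf 8) (Leaf 18)) (Leaf 75)) (Leaf 0)))),
   Branch 32 (Branch 36 (Branch 16 (Branch 23 (Leaf 64) (Leaf 56)) (Leaf 28)) (Branch 33 (Leaf 27) (Branch 41 (Branch 15 (Leaf 22) (Branch 17 (Leaf 27) (Leaf 21))) (Branch 25 (Branch 15 (Leaf 22) (Leaf 27)) (Branch 15 (Leaf 20) (Leaf 19)))))) (Leaf 81),
   Leaf 78,
   Branch 33 (Branch 44 (Branch 46 (Leaf 51) (Branch 47 (Leaf 52) (Leaf 28))) (Branch 17 (Branch 49 (Leaf 27) (Branch 26 (Leaf 50) (Leaf 9))) (Branch 49 (Leaf 28) (Branch 26 (Leaf 52) (Leaf 17))))) (Branch 44 (Branch 17 (Branch 47 (Leaf 10) (Branch 23 (Leaf 10) (Leaf 4))) (Branch 47 (Leaf 18) (Branch 23 (Leaf 18) (Leaf 8)))) (Branch 17 (Branch 35 (Leaf 9) (Branch 41 (Branch 47 (Leaf 50) (Leaf 27)) (Branch 25 (Leaf 9) (Branch 47 (Leaf 10) (Branch 23 (Leaf 10) (Leaf 4)))))) (Leaf 71))),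
   Branch 24 (Leaf 70) (Branch 36 (Branch 49 (Branch 16 (Leaf 57) (Leaf 32)) (Branch 26 (Branch 16 (Leaf 68) (Leaf 52)) (Branch 44 (Leaf 51) (Leaf 9)))) (Leaf 79)),
   Branch 45 (Leaf 0) (Branch 46 (Leaf 0) (Branch 40 (Branch 48 (Leaf 14) (Leaf 0)) (Leaf 74))),
   Branch 44 (Leaf 1) (Branch 33 (Branch 51 (Leaf 17) (Leaf 1)) (Leaf 71)),
   Branch 43 (Leaf 77) (Branch 51 (Branch 19 (Leaf 77) (Leaf 17)) (Branch 19 (Leaf 77) (Leaf 1))),
   Branch 43 (Leaf 70) (Branch 51 (Leaf 17) (Leaf 1)),
   Branch 22 (Leaf 19) (Branch 44 (Branch 26 (Leaf 16) (Branch 47 (Leaf 15) (Branch 23 (Leaf 15) (Leaf 7)))) (Branch 26 (Branch 33 (Leaf 16) (Leaf 11)) (Leaf 80))),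
   Branch 28 (Leaf 70) (Branch 49 (Branch 33 (Leaf 32) (Branch 41 (Branch 32 (Leaf 37) (Leaf 70)) (Branch 40 (Branch 48 (Leaf 23) (Leaf 8)) (Leaf 5)))) (Branch 26 (Branch 41 (Branch 32 (Branch 48 (Leaf 40) (Leaf 52)) (Branch 23 (Branch 48 (Leaf 40) (Leaf 52)) (Leaf 70))) (Branch 40 (Branch 33 (Leaf 52) (Branch 48 (Leaf 38) (Leaf 18))) (Branch 33 (Leaf 52) (Leaf 12)))) (Branch 41 (Branch 24 (Leaf 70) (Leaf 17)) (Branch 40 (Branch 30 (Leaf 7) (Branch 37 (Leaf 4) (Branch 22 (Leaf 10) (Branch 24 (Leaf 70) (Branch 44 (Leaf 15) (Leaf 17)))))) (Leaf 77))))),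
   Branch 44 (Branch 26 (Leaf 16) (Branch 47 (Leaf 15) (Branch 23 (Leaf 15) (Leaf 7)))) (Branch 26 (Branch 33 (Leaf 16) (Leaf 11)) (Leaf 80)),
   Branch 47 (Leaf 70) (Leaf 76),
   Branch 36 (Branch 49 (Leaf 28) (Branch 26 (Leaf 52) (Branch 44 (Leaf 51) (Leaf 9)))) (Leaf 79),
   Branch 35 (Leaf 70) (Branch 36 (Branch 45 (Leaf 7) (Branch 32 (Leaf 16) (Leaf 70))) (Branch 41 (Leaf 14) (Branch 33 (Branch 49 (Leaf 14) (Branch 26 (Leaf 14) (Leaf 13))) (Leaf 75)))),
   Branch 44 (Branch 47 (Leaf 15) (Leaf 7)) (Leaf 80),
   Branch 50 (Leaf 70) (Branch 48 (Branch 43 (Leaf 70) (Leaf 14)) (Leaf 0)),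
   Branch 50 (Branch 49 (Leaf 2) (Leaf 77)) (Branch 49 (Branch 48 (Leaf 21) (Branch 41 (Leaf 28) (Leaf 7))) (Branch 41 (Leaf 17) (Branch 40 (Branch 30 (Leaf 4) (Branch 37 (Leaf 4) (Branch 44 (Leaf 15) (Leaf 17)))) (Leaf 77)))),
   Branch 31 (Leaf 19) (Branch 37 (Leaf 4) (Branch 42 (Leaf 17) (Branch 32 (Branch 45 (Branch 51 (Leaf 9) (Leaf 7)) (Branch 36 (Leaf 16) (Leaf 14))) (Branch 45 (Branch 51 (Leaf 13) (Branch 34 (Leaf 13) (Leaf 7))) (Leaf 70))))),
   Branch 37 (Leaf 19) (Branch 49 (Branch 44 (Leaf 16) (Branch 33 (Leaf 16) (Leaf 11))) (Leaf 3)),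
   Branch 37 (Leaf 4) (Branch 42 (Leaf 17) (Branch 45 (Branch 36 (Leaf 7) (Leaf 13)) (Branch 32 (Branch 36 (Leaf 16) (Leaf 14)) (Leaf 70)))),
   Leaf 81,
   Branch 44 (Branch 36 (Branch 47 (Leaf 18) (Leaf 8)) (Leaf 75)) (Leaf 71),
   Branch 42 (Leaf 21) (Branch 48 (Branch 51 (Branch 43 (Leaf 6) (Leaf 40)) (Branch 43 (Leaf 6) (Leaf 11))) (Branch 51 (Leaf 9) (Leaf 72))),
   Branch 41 (Branch 36 (Leaf 11) (Leaf 14)) (Branch 36 (Branch 47 (Leaf 15) (Leaf 7)) (Leaf 75)),
   Leaf 79,
   Branch 49 (Leaf 70) (Leaf 3),
   Branch 50 (Branch 47 (Leaf 6) (Leaf 2)) (Branch 49 (Leaf 14) (Branch 43 (Branch 46 (Leaf 9) (Leaf 6)) (Branch 41 (Leaf 14) (Leaf 13)))),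
   Leaf 73,
   Branch 49 (Leaf 74) (Branch 41 (Leaf 74) (Leaf 77)),
   Leaf 75,
   Branch 45 (Leaf 4) (Leaf 70),
   Branch 51 (Leaf 13) (Leaf 1),
   Leaf 80,
   Leaf 70,
   Leaf 74,
   Leaf 76,
   Branch 51 (Leaf 0) (Leaf 72),
   Leaf 77,
   Leaf 0,
   Leaf 72]"

text \<open>A second notion of standardness, for the points of the cone with $p_1 = 0$: the entry
  \<open>(b, c, d)\<close> at position \<open>a\<close> replaces \<open>a\<close> and \<open>b\<close> by \<open>c\<close> and \<open>d\<close>, which have the same types and
  the same sum of exponents.\<close>

definition moves :: "(nat \<times> nat \<times> nat) list list" where
  "moves = [
   [], [], [], [(5,0,24),(17,0,14),(18,0,28),(43,0,38),(51,0,34)],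
   [(6,1,30),(14,30,33),(20,7,30),(28,30,41),(34,10,35),(38,30,35),(47,2,35),(48,10,11),(50,11,30)],
   [(8,0,20),(10,0,30),(34,0,38),(48,0,50),(51,0,43)],
   [(7,1,20),(11,1,50),(33,1,14),(35,1,38),(36,1,24),(41,1,28)],
   [(10,4,8),(14,20,33),(28,20,41),(34,8,35),(38,20,35),(48,8,11),(49,4,26),(50,11,20)],
   [(14,34,44),(24,3,20),(36,3,7)], [], [(20,8,30),(24,3,30),(26,8,49),(36,3,4),(47,2,34)],
   [(14,1,38),(17,1,43),(28,41,50),(33,1,35),(34,35,48),(38,35,50),(44,1,20),(46,16,35)], [], [],
   [(16,6,46),(18,17,28),(20,38,44),(26,28,44),(35,33,38),(36,24,33),(41,28,33),(43,17,38),(48,6,34),(50,6,38),(51,17,34)],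
   [], [(28,40,50),(33,1,46),(34,46,48),(38,46,50),(41,11,40)],
   [(24,5,14),(35,33,43),(36,5,33),(41,18,33),(48,6,51),(50,6,43)],
   [(24,5,28),(34,28,51),(35,41,43),(36,5,41),(38,28,43),(44,17,26),(46,40,43)], [],
   [(34,8,38),(36,7,24),(48,8,50),(49,26,30),(51,8,43)], [], [], [],
   [(34,3,38),(43,5,38),(48,3,50),(51,0,38)], [],
   [(34,8,28),(35,20,41),(38,20,28),(43,18,20),(46,20,40),(51,8,18)], [],
   [(35,38,41),(36,24,41),(46,38,40)], [], [(34,10,38),(36,4,24),(47,2,38),(48,10,50),(51,10,43)],
   [], [], [(48,1,34),(50,1,38)], [(36,3,35),(49,10,28)], [(44,20,33),(49,30,41)],
   [(38,24,35),(43,5,35),(48,3,11),(50,11,24),(51,0,35)], [], [(48,34,50),(49,28,30),(51,34,43)],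
   [], [], [(44,26,33),(46,35,40)], [], [(44,17,20),(49,18,30)], [(48,6,8),(50,6,20),(51,8,17)],
   [], [(49,30,40)], [(49,2,28)], [], [(51,10,18)], [(51,43,48)], []]"

definition weightB :: "nat list" where
  "weightB = [
   0, 0, 5, 7, 12, 3, 20, 11, 2, 0, 6, 25, 7, 10, 19, 0, 26, 16, 15, 0, 0, 0, 0, 0, 8, 0, 10, 0,
   2, 0, 0, 0, 0, 2, 7, 3, 23, 0, 0, 19, 2, 4, 0, 7, 12, 0, 5, 9, 26, 12, 17, 19]"

definition nonstdB :: "nat list list" where
  "nonstdB = [
   [], [], [], [5,17,18,43,51], [6,14,20,28,34,38,47,48,50], [3,8,10,34,48,51],
   [4,7,11,33,35,36,41], [6,10,14,28,34,38,48,49,50], [5,14,24,36], [], [5,7,20,24,26,36,47],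
   [6,14,17,28,33,34,38,44,46], [], [], [4,7,8,11,16,18,20,26,35,36,41,43,48,50,51], [],
   [14,28,33,34,38,41], [3,11,24,35,36,41,48,50], [3,14,24,34,35,36,38,44,46], [],
   [4,10,14,34,36,48,49,51], [], [], [], [8,10,17,18,34,43,48,51], [], [10,14,34,35,38,43,46,51],
   [], [4,7,11,16,35,36,46], [], [34,36,47,48,51], [], [], [6,11,16,48,50],
   [4,5,7,11,16,18,20,24,26,30,36,49], [6,14,17,18,26,28,44,49],
   [6,8,10,14,17,18,20,28,30,34,38,43,48,50,51], [], [4,7,11,16,18,26,36,48,49,51], [], [],
   [6,14,16,17,44,46], [], [3,14,24,26,36,44,49], [11,18,35,41,43,48,50,51], [],
   [11,18,26,28,41,49], [4,10,30,49], [4,5,7,14,17,20,24,30,33,36,38,44],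
   [7,20,34,35,38,43,46,47,51], [4,7,14,17,33,36,44,51], [3,5,14,20,24,26,30,36,38,44,49,50]]"

text \<open>The entry \<open>(j, h)\<close> at position \<open>g\<close> says that adding the variable \<open>j\<close> to the exponent of \<open>g\<close>
  gives the exponent of the generator \<open>h\<close> of the same type.\<close>

definition raises :: "(nat \<times> nat) list list" where
  "raises = [
   [], [], [], [], [], [(3,0)], [(6,1)], [], [], [], [], [(2,1)], [(1,32)], [],
   [(1,9),(6,33),(11,44)], [], [], [], [], [], [(1,22),(2,44),(3,8),(6,7),(8,26)], [], [], [],
   [(1,15),(3,3),(6,36)], [], [], [], [(1,21),(5,40),(6,41),(11,26)],
   [(1,31),(2,9),(3,42),(5,45),(6,25),(7,23),(8,21),(10,15),(11,22)],
   [(1,37),(3,10),(6,4),(7,2),(8,49),(12,12)], [], [], [], [(1,42),(10,3),(11,8)],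
   [(1,25),(2,33),(8,41),(10,36),(11,7)], [], [(12,32)],
   [(1,29),(2,14),(3,34),(5,46),(6,35),(7,47),(8,28),(10,24),(11,20)], [], [], [], [],
   [(1,19),(2,17),(3,51),(8,18),(9,13),(10,5)], [], [], [(1,45),(8,40)], [(1,23)], [], [],
   [(1,27),(2,6),(3,48),(4,39),(5,16),(6,11)], [(10,0)]]"

text \<open>An order of elimination of the variables. The certificate at \<open>j\<close> concerns the standard multisets of
  generators that avoid the earlier variables and that cannot be raised by \<open>j\<close>: they lie on a facet
  in which the coefficient of $p_j$ is positive.\<close>

definition coversB :: "(nat \<times> cover) list" where
  "coversB = [
   (1, Branch 51 (Branch 33 (Leaf 27) (Branch 6 (Leaf 19) (Branch 9 (Leaf 27) (Branch 17 (Branch 16 (Branch 23 (Leaf 60) (Leaf 45)) (Leaf 27)) (Leaf 21))))) (Branch 33 (Branch 5 (Leaf 28) (Branch 17 (Leaf 27) (Leaf 42))) (Branch 44 (Branch 5 (Branch 6 (Leaf 20) (Branch 16 (Branch 17 (Branch 23 (Leaf 61) (Leaf 46)) (Branch 23 (Leaf 64) (Leaf 56))) (Leaf 28))) (Branch 17 (Branch 7 (Branch 16 (Branch 23 (Leaf 60) (Leaf 45)) (Leaf 27)) (Branch 4 (Branch 16 (Leaf 45) (Leaf 27)) (Leaf 19))) (Branch 6 (Leaf 33) (Branch 16 (Branch 23 (Leaf 67) (Leaf 62)) (Leaf 42))))) (Branch 17 (Branch 6 (Branch 5 (Leaf 20) (Leaf 19)) (Branch 16 (Branch 5 (Branch 23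 (Leaf 61) (Leaf 46)) (Branch 23 (Leaf 60) (Leaf 45))) (Branch 5 (Leaf 28) (Leaf 27)))) (Branch 19 (Branch 9 (Branch 5 (Branch 6 (Leaf 20) (Leaf 28)) (Branch 6 (Leaf 19) (Leaf 27))) (Branch 5 (Branch 6 (Leaf 20) (Leaf 22)) (Branch 6 (Leaf 19) (Leaf 21)))) (Branch 6 (Branch 5 (Leaf 20) (Branch 18 (Leaf 19) (Leaf 33))) (Branch 5 (Branch 9 (Leaf 28) (Leaf 22)) (Branch 9 (Branch 18 (Leaf 27) (Leaf 42)) (Branch 18 (Leaf 21) (Leaf 34)))))))))),
   (3, Branch 36 (Branch 49 (Branch 44 (Branch 16 (Leaf 63) (Leaf 44)) (Branch 33 (Leaf 44) (Leaf 37))) (Branch 44 (Branch 26 (Branch 47 (Branch 16 (Leaf 69) (Leaf 59)) (Branch 16 (Leaf 63) (Leaf 44))) (Branch 47 (Leaf 58) (Leaf 43))) (Branch 26 (Branch 33 (Branch 47 (Leaf 59) (Leaf 44)) (Branch 47 (Leaf 55) (Leaf 37))) (Leaf 17)))) (Branch 35 (Leaf 17) (Branch 11 (Branch 47 (Branch 3 (Leaf 55) (Leaf 40)) (Branch 3 (Leaf 37) (Leaf 25))) (Branch 7 (Branch 46 (Branch 4 (Branch 3 (Leaf 43) (Leaf 29)) (Branch 3 (Leaf 58) (Leaf 49))) (Branch 16 (Branch 3 (Branch 47 (Leaf 69) (Leaf 63)) (Branch 47 (Leaf 65) (Leaf 47))) (Branch 4 (Branch 3 (Leaf 44) (Leaf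 30)) (Branch 3 (Leaf 59) (Leaf 50))))) (Branch 4 (Branch 46 (Branch 3 (Leaf 43) (Leaf 29)) (Branch 16 (Branch 3 (Leaf 63) (Leaf 47)) (Branch 3 (Leaf 44) (Leaf 30)))) (Branch 46 (Leaf 13) (Branch 16 (Branch 3 (Branch 47 (Leaf 53) (Leaf 35)) (Branch 47 (Leaf 38) (Leaf 23))) (Leaf 14)))))))),
   (6, Branch 49 (Branch 11 (Leaf 26) (Branch 16 (Branch 36 (Leaf 57) (Leaf 48)) (Leaf 32))) (Branch 44 (Branch 26 (Branch 47 (Branch 16 (Branch 36 (Leaf 68) (Leaf 66)) (Leaf 52)) (Branch 16 (Branch 36 (Leaf 57) (Leaf 48)) (Leaf 32))) (Branch 47 (Leaf 51) (Leaf 31))) (Branch 26 (Branch 17 (Branch 16 (Branch 47 (Leaf 66) (Leaf 48)) (Branch 47 (Leaf 52) (Leaf 32))) (Branch 33 (Branch 47 (Leaf 52) (Leaf 32)) (Branch 47 (Leaf 41) (Leaf 26)))) (Leaf 9)))),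
   (8, Branch 50 (Leaf 11) (Branch 16 (Branch 17 (Branch 47 (Leaf 39) (Leaf 24)) (Branch 44 (Branch 47 (Leaf 54) (Leaf 36)) (Leaf 11))) (Leaf 16))),
   (2, Branch 47 (Leaf 15) (Leaf 7)),
   (5, Branch 24 (Branch 47 (Leaf 18) (Leaf 8)) (Branch 47 (Leaf 10) (Leaf 4))),
   (10, Branch 47 (Leaf 12) (Leaf 5)),
   (4, Leaf 0),
   (7, Leaf 6),
   (9, Leaf 1),
   (11, Leaf 2),
   (12, Leaf 3)]"
definition ids :: "nat list" where
  "ids = [0,1,2,3,4,5,6,7,8,9,10,11,12,13,14,15,16,17,18,19,20,21,22,23,24,25,26,27,28,29,30,31,
    32,33,34,35,36,37,38,39,40,41,42,43,44,45,46,47,48,49,50,51]"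
definition ids2 :: "nat list" where
  "ids2 = ids @ [52,53,54,55,56,57,58,59,60,61,62,63,64,65,66,67,68,69,70,71,72,73,74,75,76,77,78,79,80,81]"
lemma ids2: "ids2 = [0..<82]" by (simp add: ids2_def ids_def upt_rec)
lemma ids: "ids = [0..<52]" by (simp add: ids_def upt_rec)
lemma nth_table: "xs = ys \<Longrightarrow> list_all (\<lambda>(i, y). xs ! i = y) (zip ids2 ys)"
  by (auto simp: list_all_length ids2)

definition gtv :: "(nat \<times> nat list) list" where
  "gtv = map (\<lambda>(t, p). (t, snd (hd p))) gens"
definition gtype :: "nat \<Rightarrow> nat" where "gtype g = fst (gtv ! g)"
definition gvars :: "nat \<Rightarrow> nat list" where "gvars g = snd (gtv ! g)"

definition fval :: "int list \<times> int list \<Rightarrow> nat \<times> nat list \<Rightarrow> int" where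
  "fval F g = fst F ! (fst g - 1) - sum_list (map (\<lambda>v. snd F ! (v - 1)) (snd g))"

text \<open>The last twelve inequalities are $p_j \ge 0$.\<close>

definition all_facets :: "(int list \<times> int list) list" where
  "all_facets = facets @ map (\<lambda>j. ([0,0,0,0], map (\<lambda>i. if i = j then -1 else 0) [1,2,3,4,5,6,7,8,9,10,11,12])) [1,2,3,4,5,6,7,8,9,10,11,12::nat]"

fun covers :: "nat list list \<Rightarrow> (nat \<Rightarrow> bool) \<Rightarrow> nat list \<Rightarrow> cover \<Rightarrow> bool" where
  "covers N P A (Leaf l) = (l < 82 \<and> P l \<and> list_all (\<lambda>a. fval (all_facets ! l) (gtv ! a) = 0) A)"
| "covers N P A (Branch a t u) = (covers N P (filter (\<lambda>b. b \<notin> set (N ! a)) A) t \<and> covers N P (filter (\<lambda>b. b \<noteq> a) A) u)"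

lemmas gtv_eq = gtv_def[unfolded gens_def, simplified]
lemmas gtv_nth = nth_table[OF gtv_eq, unfolded ids2_def ids_def, simplified]
lemmas allf_eq = all_facets_def[unfolded facets_def, simplified]
lemmas allf_nth = nth_table[OF allf_eq, unfolded ids2_def ids_def, simplified]
lemmas nonstdA_nth = nth_table[OF nonstdA_def, unfolded ids2_def ids_def, simplified]
lemmas nonstdB_nth = nth_table[OF nonstdB_def, unfolded ids2_def ids_def, simplified]
lemmas coversA_nth = nth_table[OF coversA_def, unfolded ids2_def ids_def, simplified]
lemmas weightA_nth = nth_table[OF weightA_def, unfolded ids2_def ids_def, simplified]
lemmas weightB_nth = nth_table[OF weightB_def, unfolded ids2_def ids_def, simplified]
lemmas rels_nth = nth_table[OF rels_def, unfolded ids2_def ids_def, simplified]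
lemmas moves_nth = nth_table[OF moves_def, unfolded ids2_def ids_def, simplified]

definition lighter :: "nat list \<Rightarrow> nat \<Rightarrow> nat \<Rightarrow> nat \<Rightarrow> nat \<Rightarrow> bool" where
  "lighter W a b c d \<longleftrightarrow> c < 52 \<and> d < 52 \<and>
     (gtype c = gtype a \<and> gtype d = gtype b \<or> gtype c = gtype b \<and> gtype d = gtype a) \<and>
     sort (gvars c @ gvars d) = sort (gvars a @ gvars b) \<and> W ! c + W ! d < W ! a + W ! b"

lemma rels_lighter: "list_all (\<lambda>a. list_all (\<lambda>(b, T). b < 52 \<and> T \<noteq> [] \<and> (case hd T of (x, c, d) \<Rightarrow> x = 1 \<and> lighter weightA a b c d)) (rels ! a)) ids"
  by (simp add: ids_def rels_nth lighter_def gtype_def gvars_def gtv_nth weightA_nth)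

lemma moves_lighter: "list_all (\<lambda>a. list_all (\<lambda>(b, c, d). lighter weightB a b c d) (moves ! a)) ids"
  by (simp add: ids_def moves_nth lighter_def gtype_def gvars_def gtv_nth weightB_nth)

lemma nonstdA_check: "list_all (\<lambda>a. list_all (\<lambda>b. b \<noteq> a \<and> b < 52 \<and> (b \<in> fst ` set (rels ! a) \<or> a \<in> fst ` set (rels ! b))) (nonstdA ! a)) ids"
  by (simp add: ids_def rels_nth nonstdA_nth)

lemma nonstdB_check: "list_all (\<lambda>a. list_all (\<lambda>b. b \<noteq> a \<and> b < 52 \<and> (b \<in> fst ` set (moves ! a) \<or> a \<in> fst ` set (moves ! b))) (nonstdB ! a)) ids"
  by (simp add: ids_def moves_nth nonstdB_nth)

lemma facets_nonneg: "list_all (\<lambda>F. list_all (\<lambda>g. fval F g \<ge> 0) gtv) all_facets"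
  by (simp add: allf_eq gtv_eq fval_def)


lemmas raises_nth = nth_table[OF raises_def, unfolded ids2_def ids_def, simplified]

lemma raises_ok: "list_all (\<lambda>g. list_all (\<lambda>(j, g'). g' < 52 \<and> gtv ! g' = (gtype g, insort j (gvars g))) (raises ! g)) ids"
  by (simp add: ids_def raises_nth gtype_def gvars_def gtv_nth)

definition raisable :: "nat \<Rightarrow> nat \<Rightarrow> bool" where
  "raisable j g \<longleftrightarrow> j \<in> set (map fst (raises ! g))"

fun stages :: "nat list \<Rightarrow> (nat \<times> cover) list \<Rightarrow> bool" where
  "stages es [] = True"
| "stages es ((j, c) # cs) = 
    (covers (if es = [] then nonstdA else nonstdB) (\<lambda>l. l < 70 \<and> snd (all_facets ! l) ! (j - 1) > 0)
      (filter (\<lambda>g. list_all (\<lambda>v. v \<notin> set es) (gvars g) \<and> \<not> raisable j g) ids) c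
     \<and> stages (j # es) cs)"


lemma stages_ok: "stages [] coversB"
  by (simp add: coversB_def ids_def raisable_def raises_nth gtype_def gvars_def gtv_nth allf_nth nonstdA_nth nonstdB_nth fval_def)

lemma gtv_range: "list_all (\<lambda>(t, vs). t \<in> {1,2,3,4} \<and> list_all (\<lambda>v. v \<in> {1,2,3,4,5,6,7,8,9,10,11,12}) vs \<and> sorted vs) gtv"
  by (simp add: gtv_eq)
lemma facet_coeffs: "list_all (\<lambda>F. length (fst F) = 4 \<and> length (snd F) = 12 \<and> list_all (\<lambda>c. c \<in> {0,1,2,3}) (snd F)) facets"
  by (simp add: facets_def)
lemma length_facets: "length facets = 70" by (simp add: facets_def)
lemma length_gens: "length gens = 52" by (simp add: gens_def)
lemma trivial_gens: "gtv ! 30 = (1, [])" "gtv ! 38 = (2, [])" "gtv ! 43 = (3, [])" "gtv ! 50 = (4, [])"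
  by (simp_all add: gtv_nth)
lemma elim_vars: "list_all (\<lambda>j. j \<in> set (map fst coversB)) [1,2,3,4,5,6,7,8,9,10,11,12]" by (simp add: coversB_def)

lemma coversA_ok: "list_all (\<lambda>g. covers nonstdA (\<lambda>l. fval (all_facets ! l) (gtv ! g) > 0) (filter (\<lambda>x. x > g) ids) (coversA ! g)) ids"
  by (simp add: allf_nth gtv_nth fval_def nonstdA_nth coversA_nth ids_def)

section \<open>Standard multisets and the lattice points of the cone\<close>

definition valid :: "nat multiset \<Rightarrow> bool" where "valid S \<longleftrightarrow> set_mset S \<subseteq> {..<52}"
definition gtypes :: "nat multiset \<Rightarrow> nat multiset" where "gtypes S = image_mset gtype S"
definition gsum :: "nat multiset \<Rightarrow> nat multiset" where "gsum S = (\<Sum>g\<in>#S. mset (gvars g))"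
definition standard :: "nat list list \<Rightarrow> nat multiset \<Rightarrow> bool" where
  "standard N S \<longleftrightarrow> (\<forall>a b. {#a, b#} \<subseteq># S \<longrightarrow> b \<notin> set (N ! a))"
definition FV :: "int list \<times> int list \<Rightarrow> nat multiset \<Rightarrow> nat multiset \<Rightarrow> int" where
  "FV F T M = (\<Sum>t\<in>#T. fst F ! (t - 1)) - (\<Sum>v\<in>#M. snd F ! (v - 1))"

lemma valid_simps [simp]: "valid {#}" "valid (add_mset g S) \<longleftrightarrow> g < 52 \<and> valid S"
  "valid (S + T) \<longleftrightarrow> valid S \<and> valid T"
  by (auto simp: valid_def)
lemma gtypes_simps [simp]: "gtypes {#} = {#}" "gtypes (add_mset g S) = add_mset (gtype g) (gtypes S)"
  "gtypes (S + T) = gtypes S + gtypes T"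
  by (auto simp: gtypes_def)
lemma gsum_simps [simp]: "gsum {#} = {#}" "gsum (add_mset g S) = mset (gvars g) + gsum S"
  "gsum (S + T) = gsum S + gsum T"
  by (auto simp: gsum_def)
lemma FV_simps [simp]: "FV F {#} {#} = 0" "FV F (T + T') (M + M') = FV F T M + FV F T' M'"
  by (auto simp: FV_def)

lemma length_gtv: "length gtv = 52"
  by (simp add: gtv_def length_gens)

lemma fval_FV: "fval F (gtv ! g) = FV F {#gtype g#} (mset (gvars g))"
proof -
  have "sum_list (map f vs) = (\<Sum>v\<in>#mset vs. f v)" for f :: "nat \<Rightarrow> int" and vs
    by (induction vs) auto
  then show ?thesis by (simp add: fval_def FV_def gtype_def gvars_def)
qed

lemma FV_sum: "FV F (gtypes S) (gsum S) = (\<Sum>g\<in>#S. fval F (gtv ! g))"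
proof (induction S)
  case (add g S)
  have "FV F (gtypes (add_mset g S)) (gsum (add_mset g S)) = FV F ({#gtype g#} + gtypes S) (mset (gvars g) + gsum S)"
    by simp
  also have "\<dots> = fval F (gtv ! g) + FV F (gtypes S) (gsum S)"
    unfolding FV_simps fval_FV ..
  finally show ?case using add by simp
qed simp

lemma fval_nonneg: "l < 82 \<Longrightarrow> g < 52 \<Longrightarrow> 0 \<le> fval (all_facets ! l) (gtv ! g)"
proof -
  have "length all_facets = 82" by (simp add: all_facets_def length_facets)
  then show "l < 82 \<Longrightarrow> g < 52 \<Longrightarrow> 0 \<le> fval (all_facets ! l) (gtv ! g)"
    using facets_nonneg by (simp add: list_all_length length_gtv)
qed

lemma FV_nonneg: assumes "valid S" "l < 82" shows "0 \<le> FV (all_facets ! l) (gtypes S) (gsum S)"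
proof -
  have "\<forall>g\<in>#S. 0 \<le> fval (all_facets ! l) (gtv ! g)"
    using assms by (auto simp: valid_def intro: fval_nonneg)
  then have "0 \<le> (\<Sum>g\<in>#S. fval (all_facets ! l) (gtv ! g))" by (induction S) auto
  then show ?thesis by (simp add: FV_sum)
qed

lemma covers_sound:
  assumes "covers N P A t" "standard N S" "set_mset S \<subseteq> set A" "\<And>a. a \<in> set A \<Longrightarrow> a \<notin> set (N ! a)"
  shows "\<exists>l<82. P l \<and> (\<forall>a\<in>#S. fval (all_facets ! l) (gtv ! a) = 0)"
  using assms
proof (induction t arbitrary: A)
  case (Leaf l)
  then show ?case by (auto simp: list_all_iff)
next
  case (Branch a t u)
  show ?case
  proof (cases "a \<in># S")
    case True
    have "b \<notin> set (N ! a)" if b: "b \<in># S" for b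
    proof (cases "b = a")
      case True
      then show ?thesis using Branch.prems b by auto
    next
      case False
      then have "{#a, b#} \<subseteq># S" using \<open>a \<in># S\<close> b by (auto simp: insert_subset_eq_iff in_diff_count)
      then show ?thesis using Branch.prems(2) by (simp add: standard_def)
    qed
    then show ?thesis using Branch.prems by (intro Branch.IH(1)[of "filter (\<lambda>b. b \<notin> set (N ! a)) A"]) auto
  next
    case False
    then show ?thesis using Branch.prems by (intro Branch.IH(2)[of "filter (\<lambda>b. b \<noteq> a) A"]) auto
  qed
qed

lemma nonstdA_irrefl: "a < 52 \<Longrightarrow> a \<notin> set (nonstdA ! a)"
  using nonstdA_check by (force simp: list_all_iff ids)
lemma nonstdB_irrefl: "a < 52 \<Longrightarrow> a \<notin> set (nonstdB ! a)"
  using nonstdB_check by (force simp: list_all_iff ids)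

lemma standard_mono: "standard N S \<Longrightarrow> S' \<subseteq># S \<Longrightarrow> standard N S'"
  unfolding standard_def by (meson subset_mset.order_trans)

lemma standard_unique_aux:
  assumes "valid D" "valid D'" "standard nonstdA D'" "g \<in># D" "\<forall>a\<in>#D'. g < a"
    and eq: "gtypes D = gtypes D'" "gsum D = gsum D'"
  shows False
proof -
  have g: "g < 52" using assms by (auto simp: valid_def)
  then have cov: "covers nonstdA (\<lambda>l. fval (all_facets ! l) (gtv ! g) > 0) (filter (\<lambda>x. x > g) ids) (coversA ! g)"
    using coversA_ok by (simp add: list_all_iff ids)
  have "set_mset D' \<subseteq> set (filter (\<lambda>x. x > g) ids)" using assms(2,5) by (auto simp: ids valid_def)
  from covers_sound[OF cov assms(3) this]
  obtain l where l: "l < 82" "fval (all_facets ! l) (gtv ! g) > 0" "\<forall>a\<in>#D'. fval (all_facets ! l) (gtv ! a) = 0"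
    using nonstdA_irrefl by (auto simp: ids)
  obtain D1 where D: "D = add_mset g D1" using assms(4) by (metis mset_add)
  have "0 \<le> FV (all_facets ! l) (gtypes D1) (gsum D1)" using assms(1) D l by (intro FV_nonneg) auto
  then have "0 < FV (all_facets ! l) (gtypes D) (gsum D)"
    using l(2) unfolding FV_sum D by simp
  moreover have "(\<Sum>g\<in>#D'. fval (all_facets ! l) (gtv ! g)) = 0"
    using l(3) by (induction D') auto
  then have "FV (all_facets ! l) (gtypes D') (gsum D') = 0" by (simp only: FV_sum)
  ultimately show False using eq by simp
qed

text \<open>Two standard multisets with the same types and sum: let \<open>g\<close> be the first generator at which they
  differ, after removing what they share. One of them has \<open>g\<close>, the other consists of later generators
  only and hence lies on a face that does not contain \<open>g\<close>. Evaluating this facet on the common sum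
  gives zero and a positive number.\<close>

lemma standard_unique:
  assumes "valid S" "valid S'" "standard nonstdA S" "standard nonstdA S'"
    and "gtypes S = gtypes S'" "gsum S = gsum S'"
  shows "S = S'"
proof (rule ccontr)
  assume "S \<noteq> S'"
  define D D' where "D = S - S'" and "D' = S' - S"
  have S: "S = (S \<inter># S') + D" "S' = (S \<inter># S') + D'"
    by (auto simp: D_def D'_def multiset_eq_iff min_def)
  have v: "valid D" "valid D'" using assms(1,2) by (auto simp: valid_def D_def D'_def dest: in_diffD)
  have st: "standard nonstdA D" "standard nonstdA D'" using assms(3,4) standard_mono by (auto simp: D_def D'_def)
  have eq: "gtypes D = gtypes D'" "gsum D = gsum D'"
    using assms(5,6) S gtypes_simps(3) gsum_simps(3) by (metis add_left_cancel)+
  have ne: "set_mset (D + D') \<noteq> {}"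
  proof
    assume "set_mset (D + D') = {}"
    then have "D = {#}" "D' = {#}" by auto
    then show False using S \<open>S \<noteq> S'\<close> by simp
  qed
  define g where "g = Min (set_mset (D + D'))"
  have g: "g \<in># D + D'" "\<forall>a\<in>#D + D'. g \<le> a" 
    using Min_in[OF _ ne] ne by (simp_all add: g_def del: set_mset_union)
  have disj: "a \<in># D \<Longrightarrow> a \<in># D' \<Longrightarrow> False" for a
    by (auto simp: D_def D'_def in_diff_count)
  consider "g \<in># D" | "g \<in># D'" using g by auto
  then show False
  proof cases
    case 1
    then have "\<forall>a\<in>#D'. g < a" using g disj by (metis union_iff le_neq_implies_less)
    then show False using standard_unique_aux[of D D' g] 1 v st eq by simp
  next
    case 2
    then have "\<forall>a\<in>#D. g < a" using g disj by (metis union_iff le_neq_implies_less)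
    then show False using standard_unique_aux[of D' D g] 2 v st eq by simp
  qed
qed

lemma lighter_swap:
  assumes "lighter W b a c d" shows "lighter W a b c d"
proof -
  have *: "sort xs = sort ys" if "mset xs = mset ys" for xs ys :: "nat list"
    by (rule properties_for_sort) (simp_all add: that)
  have "sort (gvars b @ gvars a) = sort (gvars a @ gvars b)"
    by (rule *) simp
  then show ?thesis using assms unfolding lighter_def by (metis add.commute)
qed

lemma nonstdA_lighter: assumes "a < 52" "b \<in> set (nonstdA ! a)" shows "\<exists>c d. lighter weightA a b c d"
proof -
  have R: "\<exists>c d. lighter weightA a b c d" if a: "a < 52" "b \<in> fst ` set (rels ! a)" for a b
  proof -
    obtain T where "(b, T) \<in> set (rels ! a)" using a by force
    then have "case hd T of (x, c, d) \<Rightarrow> x = 1 \<and> lighter weightA a b c d"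
      using rels_lighter a(1) by (fastforce simp: list_all_iff ids)
    then show ?thesis by (cases "hd T") auto
  qed
  have "b < 52 \<and> (b \<in> fst ` set (rels ! a) \<or> a \<in> fst ` set (rels ! b))"
    using nonstdA_check assms by (auto simp: list_all_iff ids)
  then show ?thesis using R[OF assms(1), of b] R[of b a] by (auto dest: lighter_swap)
qed

lemma nonstdB_lighter: assumes "a < 52" "b \<in> set (nonstdB ! a)" shows "\<exists>c d. lighter weightB a b c d"
proof -
  have R: "\<exists>c d. lighter weightB a b c d" if a: "a < 52" "b \<in> fst ` set (moves ! a)" for a b
  proof -
    obtain c d where "(b, c, d) \<in> set (moves ! a)" using a by force
    then show ?thesis
      using moves_lighter a(1) by (fastforce simp: list_all_iff ids)
  qed
  have "b < 52 \<and> (b \<in> fst ` set (moves ! a) \<or> a \<in> fst ` set (moves ! b))"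
    using nonstdB_check assms by (auto simp: list_all_iff ids)
  then show ?thesis using R[OF assms(1), of b] R[of b a] by (auto dest: lighter_swap)
qed

lemma lighter_replace:
  assumes "lighter W a b c d"
  shows "gtypes {#c, d#} = gtypes {#a, b#}" "gsum {#c, d#} = gsum {#a, b#}" "valid {#c, d#}"
proof -
  have "mset (sort (gvars c @ gvars d)) = mset (sort (gvars a @ gvars b))"
    using assms by (simp add: lighter_def)
  then show "gsum {#c, d#} = gsum {#a, b#}" by simp
qed (use assms in \<open>auto simp: lighter_def\<close>)

text \<open>Replacing a non-standard pair keeps types and sum and lowers the weight.\<close>

lemma exists_standard:
  assumes N: "\<And>a b. a < 52 \<Longrightarrow> b \<in> set (N ! a) \<Longrightarrow> \<exists>c d. lighter W a b c d"
    and "valid S"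
  shows "\<exists>S'. valid S' \<and> gtypes S' = gtypes S \<and> gsum S' = gsum S \<and> standard N S'"
  using assms(2)
proof (induction "\<Sum>g\<in>#S. W ! g" arbitrary: S rule: less_induct)
  case less
  show ?case
  proof (cases "standard N S")
    case False
    then obtain a b where ab: "{#a, b#} \<subseteq># S" "b \<in> set (N ! a)" by (auto simp: standard_def)
    then obtain R where R: "S = {#a, b#} + R" by (metis subset_mset.add_diff_inverse)
    obtain c d where l: "lighter W a b c d" using N[of a b] ab less.prems R by auto
    have "\<exists>S'. valid S' \<and> gtypes S' = gtypes ({#c, d#} + R) \<and> gsum S' = gsum ({#c, d#} + R) \<and> standard N S'"
    proof (rule less.hyps)
      show "(\<Sum>g\<in>#{#c, d#} + R. W ! g) < (\<Sum>g\<in>#S. W ! g)"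
        using l by (simp add: R lighter_def)
      show "valid ({#c, d#} + R)" using lighter_replace(3)[OF l] less.prems R by simp
    qed
    moreover have "gtypes ({#c, d#} + R) = gtypes S"
      by (simp only: R gtypes_simps(3) lighter_replace(1)[OF l])
    moreover have "gsum ({#c, d#} + R) = gsum S"
      by (simp only: R gsum_simps(3) lighter_replace(2)[OF l])
    ultimately show ?thesis by simp
  qed (use less.prems in blast)
qed

lemma stages_append:
  "stages es (pre @ (j, c) # post) \<Longrightarrow> 
    covers (if rev (map fst pre) @ es = [] then nonstdA else nonstdB) (\<lambda>l. l < 70 \<and> snd (all_facets ! l) ! (j - 1) > 0)
      (filter (\<lambda>g. list_all (\<lambda>v. v \<notin> set (rev (map fst pre) @ es)) (gvars g) \<and> \<not> raisable j g) ids) c"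
proof (induction pre arbitrary: es)
  case (Cons x pre)
  obtain a b where x: "x = (a, b)" by (cases x)
  have "stages (a # es) (pre @ (j, c) # post)" using Cons.prems by (simp add: x)
  from Cons.IH[OF this] show ?case
    by (simp only: x list.map rev.simps fst_conv append_assoc append_Cons append_Nil)
qed auto

lemma gtv_mem:
  assumes "g < 52" shows "gtype g \<in> {1..4}" "set (gvars g) \<subseteq> {1..12}"
proof -
  obtain t vs where tv: "gtv ! g = (t, vs)" by (cases "gtv ! g")
  then have "(t, vs) \<in> set gtv" using nth_mem[of g gtv] assms by (simp add: length_gtv)
  then have *: "t \<in> {1,2,3,4}" "list_all (\<lambda>v. v \<in> {1,2,3,4,5,6,7,8,9,10,11,12}) vs"
    using gtv_range by (auto simp only: list_all_iff prod.case)
  show "gtype g \<in> {1..4}" using *(1) tv by (auto simp: gtype_def)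
  have "v \<in> {1..12}" if "v \<in> {1,2,3,4,5,6,7,8,9,10,11,12}" for v :: nat using that by auto
  then show "set (gvars g) \<subseteq> {1..12}" using *(2) tv by (simp only: gvars_def list_all_iff snd_conv) blast
qed

lemma facet_coeff:
  assumes "l < 70" "j \<in> {1..12}" shows "snd (facets ! l) ! (j - 1) \<in> {0,1,2,3}"
proof -
  have "facets ! l \<in> set facets" using assms by (simp add: length_facets)
  then have *: "length (snd (facets ! l)) = 12" "\<forall>c\<in>set (snd (facets ! l)). c \<in> {0,1,2,3}"
    using facet_coeffs unfolding list_all_iff by blast+
  have "j - 1 < 12" using assms(2) by auto
  then show ?thesis using * nth_mem[of "j - 1" "snd (facets ! l)"] by metis
qed

text \<open>The lattice points of the polyhedral cone are the exponents of products of generators. Induction on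
  the size of the exponent: remove one copy of the first variable \<open>j\<close>, in the order of elimination,
  that occurs, and decompose the rest into a standard multiset. If one of its generators can be
  raised by \<open>j\<close>, this gives a decomposition of the original point. Otherwise the rest lies on a facet
  with positive coefficient at \<open>j\<close>, and adding \<open>j\<close> violates the inequality.\<close>

lemma decompose:
  assumes "set_mset T \<subseteq> {1..4}" "set_mset M \<subseteq> {1..12}" "\<And>l. l < 70 \<Longrightarrow> 0 \<le> FV (facets ! l) T M"
  shows "\<exists>S. valid S \<and> gtypes S = T \<and> gsum S = M"
  using assms
proof (induction "size M" arbitrary: M)
  case 0
  define o1 where "o1 t = (if t = 1 then 30 else if t = 2 then 38 else if t = 3 then 43 else 50 :: nat)" for t :: nat
  have "gtype (o1 t) = t \<and> gvars (o1 t) = []" if "t \<in> {1..4}" for t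
  proof -
    have "t = 1 \<or> t = 2 \<or> t = 3 \<or> t = 4" using that by auto
    then show ?thesis by (auto simp: o1_def gtype_def gvars_def trivial_gens)
  qed
  then have "gtypes (image_mset o1 T) = T \<and> gsum (image_mset o1 T) = {#} \<and> valid (image_mset o1 T)"
    using \<open>set_mset T \<subseteq> {1..4}\<close> by (induction T) (auto simp: o1_def)
  then show ?case using 0 by auto
next
  case (Suc n)
  have "\<exists>x\<in>set coversB. fst x \<in># M"
  proof -
    obtain j where j: "j \<in># M" using Suc.hyps(2) by (metis size_eq_Suc_imp_elem)
    then have "j \<in> {1..12}" using Suc.prems by auto
    then have "j \<in> set [1,2,3,4,5,6,7,8,9,10,11,12]" by simp presburger
    then have "j \<in> set (map fst coversB)" using elim_vars by (simp only: list_all_iff)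
    then show ?thesis using j by auto
  qed
  from split_list_first_prop[OF this] obtain pre x post where split: "coversB = pre @ x # post" "fst x \<in># M" "\<forall>y\<in>set pre. fst y \<notin># M"
    by blast
  obtain j c where x: "x = (j, c)" by (cases x)
  define es where "es = rev (map fst pre)"
  define N where "N = (if es = [] then nonstdA else nonstdB)"
  define W where "W = (if es = [] then weightA else weightB)"
  have cov: "covers N (\<lambda>l. l < 70 \<and> snd (all_facets ! l) ! (j - 1) > 0)
      (filter (\<lambda>g. list_all (\<lambda>v. v \<notin> set es) (gvars g) \<and> \<not> raisable j g) ids) c"
    using stages_append[of "[]" pre j c post] stages_ok split(1) x by (simp add: N_def es_def)
  have j: "j \<in># M" using split x by simp
  then obtain M' where M: "M = add_mset j M'" by (metis mset_add)
  have j12: "j \<in> {1..12}" using j Suc.prems by auto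
  have FVM: "FV F T M' = FV F T M + snd F ! (j - 1)" for F by (simp add: FV_def M)
  have "\<exists>S. valid S \<and> gtypes S = T \<and> gsum S = M'"
  proof (rule Suc.hyps(1))
    fix l :: nat assume l: "l < 70"
    have "snd (facets ! l) ! (j - 1) \<ge> 0"
      using facet_coeff[OF l j12] by auto
    then show "0 \<le> FV (facets ! l) T M'" using Suc.prems(3)[OF l] by (simp add: FVM)
  qed (use Suc M in auto)
  then obtain S0 where S0: "valid S0" "gtypes S0 = T" "gsum S0 = M'" by blast
  have "\<exists>S. valid S \<and> gtypes S = gtypes S0 \<and> gsum S = gsum S0 \<and> standard N S"
    by (rule exists_standard[of N W S0]) (use S0 in \<open>auto simp: N_def W_def nonstdA_lighter nonstdB_lighter\<close>)
  then obtain S where S: "valid S" "gtypes S = T" "gsum S = M'" "standard N S" using S0 by auto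
  show ?case
  proof (cases "\<exists>g\<in>#S. raisable j g")
    case True
    then obtain g where g: "g \<in># S" "raisable j g" by blast
    have "g < 52" using g S(1) by (auto simp: valid_def)
    then obtain g' where g': "g' < 52" "gtv ! g' = (gtype g, insort j (gvars g))"
      using raises_ok g(2) by (fastforce simp: raisable_def list_all_iff ids)
    obtain R where R: "S = add_mset g R" using g by (metis mset_add)
    have "gtype g' = gtype g" "mset (gvars g') = add_mset j (mset (gvars g))"
      using g' by (simp_all add: gtype_def gvars_def)
    then have "valid (add_mset g' R) \<and> gtypes (add_mset g' R) = T \<and> gsum (add_mset g' R) = M"
      using S R g' M by auto
    then show ?thesis by blast
  next
    case False
    have "set (gvars g) \<inter> set es = {}" if "g \<in># S" for g
    proof -
      have "mset (gvars g) \<subseteq># gsum S" using that by (metis gsum_simps(2) mset_add mset_subset_eq_add_left)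
      then have "set (gvars g) \<subseteq> set_mset M" using S(3) M by (metis mset_subset_eqD set_mset_mset subsetI union_iff add_mset_add_single)
      then show ?thesis using split(3) by (auto simp: es_def)
    qed
    then have "set_mset S \<subseteq> set (filter (\<lambda>g. list_all (\<lambda>v. v \<notin> set es) (gvars g) \<and> \<not> raisable j g) ids)"
      using False S(1) by (auto simp: list_all_iff ids valid_def)
    moreover have "a \<notin> set (N ! a)" if "a \<in> set (filter (\<lambda>g. list_all (\<lambda>v. v \<notin> set es) (gvars g) \<and> \<not> raisable j g) ids)" for a
      using that nonstdA_irrefl nonstdB_irrefl by (auto simp: N_def ids)
    ultimately obtain l where
      l: "l < 70" "snd (all_facets ! l) ! (j - 1) > 0" "\<forall>a\<in>#S. fval (all_facets ! l) (gtv ! a) = 0"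
      using covers_sound[OF cov S(4)] by blast
    have al: "all_facets ! l = facets ! l" using l(1) by (simp add: all_facets_def nth_append length_facets)
    have "(\<Sum>g\<in>#S. fval (all_facets ! l) (gtv ! g)) = 0"
      using l(3) by (induction S) auto
    then have "FV (facets ! l) T M' = 0" using S FV_sum[of "facets ! l" S] al by simp
    then show ?thesis using FVM[of "facets ! l"] l(2) Suc.prems(3)[OF l(1)] al by simp
  qed
qed

section \<open>Straightening\<close>

definition peval :: "(nat \<Rightarrow> 'a::comm_ring_1) \<Rightarrow> (int \<times> nat list) list \<Rightarrow> 'a" where
  "peval X L = (\<Sum>(c, vs)\<leftarrow>L. of_int c * prod_list (map X vs))"

definition gpoly :: "(nat \<Rightarrow> 'a::comm_ring_1) \<Rightarrow> nat \<Rightarrow> 'a" where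
  "gpoly X g = peval X (snd (gens ! g))"

lemma gpoly_zip: "list_all (\<lambda>(i, y). gpoly X i = peval X (snd y)) (zip ids2 gens)"
  by (auto simp: list_all_length ids2 length_gens gpoly_def)

lemmas gpoly_table = gpoly_zip[unfolded gens_def ids2_def ids_def, simplified, unfolded peval_def, simplified]

lemma rels_hold:
  fixes X :: "nat \<Rightarrow> 'a::idom"
  shows "list_all (\<lambda>a. list_all (\<lambda>(b, T). gpoly X a * gpoly X b =
      (\<Sum>(c, i, j)\<leftarrow>T. of_int c * (gpoly X i * gpoly X j))) (rels ! a)) ids"
  by (simp only: ids_def rels_nth list.pred_inject prod.case list.map sum_list.Cons sum_list.Nil One_nat_def simp_thms
      gpoly_table of_int_1 of_int_minus of_int_numeral of_int_neg_numeral; intro conjI; algebra)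

fun desc_less :: "nat list \<Rightarrow> nat list \<Rightarrow> bool" where
  "desc_less (x # xs) (y # ys) = (y < x \<or> x = y \<and> desc_less xs ys)"
| "desc_less _ _ = False"

definition lower :: "nat list \<Rightarrow> nat list \<Rightarrow> bool" where
  "lower vs ws \<longleftrightarrow> length vs < length ws \<or> length vs = length ws \<and> desc_less (rev (sort vs)) (rev (sort ws))"

lemma gens_lowest:
  "list_all (\<lambda>(t, p). p \<noteq> [] \<and> fst (hd p) = 1 \<and>
     list_all (\<lambda>(c, vs). list_all (\<lambda>v. 1 \<le> v \<and> v \<le> 12) vs \<and> lower (snd (hd p)) vs) (tl p)) gens"
  by (simp add: gens_def lower_def)

lemma rels_higher:
  "list_all (\<lambda>a. list_all (\<lambda>(b, T). list_all (\<lambda>(c, i, j). i < 52 \<and> j < 52 \<and>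
       (gtype i = gtype a \<and> gtype j = gtype b \<or> gtype i = gtype b \<and> gtype j = gtype a) \<and>
       lower (gvars a @ gvars b) (gvars i @ gvars j)) (tl T)) (rels ! a)) ids"
  by (simp add: ids_def rels_nth gtype_def gvars_def gtv_nth lower_def)

definition var :: "nat \<Rightarrow> pol" where "var v = Poly_Mapping.single (Mono (axis (of_nat v) 1)) 1"
definition monm :: "nat multiset \<Rightarrow> mono" where "monm M = (\<Sum>v\<in>#M. Mono (axis (of_nat v) 1))"

lemma monm_simps [simp]: "monm {#} = 0" "monm (add_mset v M) = Mono (axis (of_nat v) 1) + monm M"
  "monm (M + M') = monm M + monm M'"
  by (auto simp: monm_def)

lemma prod_list_var: "prod_list (map var vs) = Poly_Mapping.single (monm (mset vs)) 1"
  by (induction vs) (simp_all add: var_def mult_single)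

lemma exps_monm:
  assumes "set_mset M \<subseteq> {1..12}" "j \<in> {1..12}"
  shows "exps (monm M) $ of_nat j = count M j"
  using assms(1)
proof (induction M)
  case (add v M)
  then have "v \<in> {1..12}" by auto
  then show ?case using add assms(2) of_nat12_inj[of v j]
    by (auto simp: plus_mono_def axis_def)
qed (simp add: zero_mono_def)

lemma monm_inj:
  assumes "set_mset M \<subseteq> {1..12}" "set_mset M' \<subseteq> {1..12}" "monm M = monm M'"
  shows "M = M'"
proof (rule multiset_eqI)
  fix j show "count M j = count M' j"
  proof (cases "j \<in> {1..12}")
    case True
    then show ?thesis using exps_monm assms by metis
  next
    case False
    then show ?thesis using assms by (metis count_eq_zero_iff subsetD)
  qed
qed

lemma monm_surj: "\<exists>M. set_mset M \<subseteq> {1..12} \<and> monm M = p"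
proof -
  define M where "M = (\<Sum>j=1..12. replicate_mset (exps p $ of_nat j) j)"
  have c: "count M k = (if k \<in> {1..12} then exps p $ of_nat k else 0)" for k
    by (simp add: M_def count_sum if_distrib[of "\<lambda>f. f k"] if_distrib)
  then have M: "set_mset M \<subseteq> {1..12}" by (auto simp: set_mset_def split: if_splits)
  have "exps (monm M) = exps p"
    by (rule vec12_eqI) (use exps_monm[OF M] c in auto)
  then show ?thesis using M mono.expand by blast
qed

lemma partial_sum_monm:
  assumes "set vs \<subseteq> {1..12}" "i \<in> {1..12}"
  shows "partial_sum (exps (monm (mset vs))) i = length (filter (\<lambda>v. v \<le> 13 - i) vs)"
  using assms(1)
proof (induction vs)
  case Nil show ?case by (simp add: partial_sum_def)
next
  case (Cons v vs)
  then have v: "v \<in> {1..12}" by auto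
  have "partial_sum (axis (of_nat v) 1) i = (\<Sum>j=1..13 - i. if j = v then 1 else 0)"
    unfolding partial_sum_def
  proof (rule sum.cong)
    show "{1..12 - i + 1} = {1..13 - i}" using assms(2) by auto
    fix j assume "j \<in> {1..13 - i}"
    then have "j \<in> {1..12}" using assms(2) by auto
    then show "(axis (of_nat v) 1 :: nat ^ 12) $ of_nat j = (if j = v then 1 else 0)"
      using of_nat12_inj[OF _ v, of j] by (simp add: axis_def)
  qed
  also have "\<dots> = (if v \<le> 13 - i then 1 else 0)" using v by simp
  finally show ?case using Cons by (simp add: plus_mono_def partial_sum_add)
qed

lemma desc_less_monm:
  assumes "desc_less vs ws" "length vs = length ws" "sorted (rev vs)" "sorted (rev ws)"
    "set vs \<subseteq> {1..12}" "set ws \<subseteq> {1..12}"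
  shows "monm (mset vs) < monm (mset ws)"
  using assms
proof (induction vs ws rule: desc_less.induct)
  case (1 x xs y ys)
  show ?case
  proof (cases "x = y")
    case True
    then have "monm (mset xs) < monm (mset ys)" using 1 by (auto simp: sorted_append)
    then show ?thesis using True by (simp add: add_strict_left_mono)
  next
    case False
    then have xy: "y < x" using 1 by simp
    have bounds: "x \<le> 12" "1 \<le> y" "\<forall>v\<in>set (x # xs). v \<le> x" "\<forall>v\<in>set (y # ys). v \<le> y"
      using 1 by (auto simp: sorted_append)
    let ?i = "14 - x"
    have i: "?i \<in> {1..12}" using bounds xy by auto
    have "partial_sum (exps (monm (mset (x # xs)))) ?i \<le> length xs"
      unfolding partial_sum_monm[OF 1(6) i] using bounds xy i by simp
    moreover have "filter (\<lambda>v. v \<le> 13 - ?i) (y # ys) = y # ys"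
      using bounds xy by (intro filter_True) auto
    then have "partial_sum (exps (monm (mset (y # ys)))) ?i = Suc (length ys)"
      unfolding partial_sum_monm[OF 1(7) i] by simp
    moreover have "partial_sum (exps (monm (mset (x # xs)))) k = partial_sum (exps (monm (mset (y # ys)))) k"
      if k: "k \<in> {1..<?i}" for k
    proof -
      have k12: "k \<in> {1..12}" using k i by auto
      have "filter (\<lambda>v. v \<le> 13 - k) (x # xs) = x # xs" "filter (\<lambda>v. v \<le> 13 - k) (y # ys) = y # ys"
        using bounds xy k by (auto intro!: filter_True)
      then show ?thesis using 1(3) unfolding partial_sum_monm[OF 1(6) k12] partial_sum_monm[OF 1(7) k12] by simp
    qed
    ultimately show ?thesis unfolding less_mono_def sig_less_def using i 1(3) by (intro bexI[of _ ?i]) auto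
  qed
qed auto

lemma lower_monm:
  assumes "lower vs ws" "set vs \<subseteq> {1..12}" "set ws \<subseteq> {1..12}"
  shows "monm (mset vs) < monm (mset ws)"
proof (cases "length vs < length ws")
  case True
  have "filter (\<lambda>v. v \<le> 12) xs = xs" if "set xs \<subseteq> {1..12}" for xs :: "nat list"
    using that by (intro filter_True) auto
  then show ?thesis unfolding less_mono_def sig_less_def
    using True assms by (intro bexI[of _ 1]) (simp_all add: partial_sum_monm)
next
  case False
  then have "monm (mset (rev (sort vs))) < monm (mset (rev (sort ws)))"
    using assms by (intro desc_less_monm) (auto simp: lower_def)
  then show ?thesis by simp
qed

lemma lookup_sum_list: "Poly_Mapping.lookup (sum_list Fs) q = (\<Sum>F\<leftarrow>Fs. Poly_Mapping.lookup F q)"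
  by (induction Fs) (simp_all add: lookup_add)

lemma peval_term: "of_int c * prod_list (map var vs) = Poly_Mapping.single (monm (mset vs)) (of_int c)"
  by (simp add: prod_list_var mult_single flip: single_of_int)

lemma lowest_peval:
  assumes "L = (1, vs) # R" "\<And>c ws. (c, ws) \<in> set R \<Longrightarrow> monm (mset vs) < monm (mset ws)"
  shows "lowest (peval var L) (monm (mset vs))"
proof -
  have R: "Poly_Mapping.lookup (peval var R) q = 0" if "q \<le> monm (mset vs)" for q
  proof -
    have "\<forall>(c, ws)\<in>set R. q \<noteq> monm (mset ws)"
      using assms(2) that by fastforce
    then have "\<forall>x\<in>set R. Poly_Mapping.lookup (case x of (c, ws) \<Rightarrow> of_int c * prod_list (map var ws)) q = 0"
      by (auto simp: peval_term lookup_single when_def)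
    then have "map (\<lambda>x. Poly_Mapping.lookup (case x of (c, ws) \<Rightarrow> of_int c * prod_list (map var ws)) q) R = map (\<lambda>x. 0) R"
      by simp
    then show ?thesis unfolding peval_def lookup_sum_list map_map comp_def
      by (simp only: sum_list_0)
  qed
  have "peval var L = Poly_Mapping.single (monm (mset vs)) 1 + peval var R"
    by (simp add: peval_def assms(1) prod_list_var)
  then show ?thesis using R by (auto simp: lowest_def lookup_add lookup_single when_def)
qed

lemma lowest_gpoly:
  assumes "g < 52" shows "lowest (gpoly var g) (monm (mset (gvars g)))"
proof -
  obtain t p where g: "gens ! g = (t, p)" by (cases "gens ! g")
  then have mem: "(t, p) \<in> set gens" using nth_mem[of g gens] assms by (simp add: length_gens)
  have p: "p \<noteq> []" "fst (hd p) = 1"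
    "\<And>c vs. (c, vs) \<in> set (tl p) \<Longrightarrow> (\<forall>v\<in>set vs. 1 \<le> v \<and> v \<le> 12) \<and> lower (snd (hd p)) vs"
    using bspec[OF gens_lowest[unfolded list_all_iff] mem] by auto
  have gv: "gvars g = snd (hd p)" using assms g by (simp add: gvars_def gtv_def length_gens)
  have gv12: "set (gvars g) \<subseteq> {1..12}" using gtv_mem assms by blast
  have "lowest (peval var p) (monm (mset (gvars g)))"
  proof (rule lowest_peval)
    show "p = (1, gvars g) # tl p" using p gv by (cases p; cases "hd p") auto
    fix c ws assume "(c, ws) \<in> set (tl p)"
    then show "monm (mset (gvars g)) < monm (mset ws)" using p(3) gv gv12 by (intro lower_monm) auto
  qed
  then show ?thesis by (simp add: gpoly_def g)
qed

definition gprod :: "nat multiset \<Rightarrow> pol" where "gprod S = (\<Prod>g\<in>#S. gpoly var g)"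

lemma gprod_simps [simp]: "gprod {#} = 1" "gprod (add_mset g S) = gpoly var g * gprod S"
  "gprod (S + T) = gprod S * gprod T"
  by (auto simp: gprod_def)

lemma lowest_gprod: "valid S \<Longrightarrow> lowest (gprod S) (monm (gsum S))"
  by (induction S) (auto simp: lowest_1 lowest_mult lowest_gpoly)

lemma gsum_vars: "valid S \<Longrightarrow> set_mset (gsum S) \<subseteq> {1..12}"
  by (induction S) (use gtv_mem in auto)

definition above :: "nat multiset \<Rightarrow> nat multiset \<Rightarrow> bool" where
  "above S' S \<longleftrightarrow> monm (gsum S) < monm (gsum S') \<or>
     gsum S' = gsum S \<and> (\<Sum>g\<in>#S'. weightA ! g) < (\<Sum>g\<in>#S. weightA ! g)"

lemma above_trans: "above A B \<Longrightarrow> above B C \<Longrightarrow> above A C"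
  unfolding above_def by (metis order.strict_trans)

lemma above_irrefl: "\<not> above A A"
  by (simp add: above_def)

lemma above_add: "above A B \<Longrightarrow> above (A + R) (B + R)"
  by (auto simp: above_def add_strict_right_mono)

lemma finite_valid: "finite {S. valid S \<and> gtypes S = T}"
proof (rule finite_subset)
  show "{S. valid S \<and> gtypes S = T} \<subseteq> mset ` {xs. set xs \<subseteq> {..<52} \<and> length xs = size T}"
  proof
    fix S assume S: "S \<in> {S. valid S \<and> gtypes S = T}"
    obtain xs where "S = mset xs" by (metis ex_mset)
    then show "S \<in> mset ` {xs. set xs \<subseteq> {..<52} \<and> length xs = size T}"
      using S by (auto simp: valid_def gtypes_def)
  qed
  show "finite (mset ` {xs. set xs \<subseteq> {..<52::nat} \<and> length xs = size T})"
    by (intro finite_imageI finite_lists_length_eq) simp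
qed

lemma straighten_pair:
  assumes "a < 52" "b \<in> set (nonstdA ! a)"
  obtains T where "gpoly var a * gpoly var b = (\<Sum>(c, i, j)\<leftarrow>T. of_int c * (gpoly var i * gpoly var j) :: pol)"
    "\<And>c i j. (c, i, j) \<in> set T \<Longrightarrow> i < 52 \<and> j < 52 \<and> gtypes {#i, j#} = gtypes {#a, b#} \<and> above {#i, j#} {#a, b#}"
proof -
  have main: thesis if ab: "a < 52" "b < 52" "(b, T) \<in> set (rels ! a)" 
    and that: "\<And>T. gpoly var a * gpoly var b = (\<Sum>(c, i, j)\<leftarrow>T. of_int c * (gpoly var i * gpoly var j) :: pol) \<Longrightarrow>
    (\<And>c i j. (c, i, j) \<in> set T \<Longrightarrow> i < 52 \<and> j < 52 \<and> gtypes {#i, j#} = gtypes {#a, b#} \<and> above {#i, j#} {#a, b#}) \<Longrightarrow> thesis"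
    for a b T thesis
  proof (rule that)
    show "gpoly var a * gpoly var b = (\<Sum>(c, i, j)\<leftarrow>T. of_int c * (gpoly var i * gpoly var j) :: pol)"
      using rels_hold[of var] ab unfolding list_all_iff ids by fastforce
    fix c i j assume cij: "(c, i, j) \<in> set T"
    have lt: "T \<noteq> [] \<and> (case hd T of (x, c, d) \<Rightarrow> x = 1 \<and> lighter weightA a b c d)"
      using rels_lighter ab unfolding list_all_iff ids by fastforce
    show "i < 52 \<and> j < 52 \<and> gtypes {#i, j#} = gtypes {#a, b#} \<and> above {#i, j#} {#a, b#}"
    proof (cases "(c, i, j) = hd T")
      case True
      then have l: "lighter weightA a b i j" using lt by (metis prod.case)
      have "gsum {#i, j#} = gsum {#a, b#}" by (rule lighter_replace(2)[OF l])
      moreover have "(\<Sum>g\<in>#{#i, j#}. weightA ! g) < (\<Sum>g\<in>#{#a, b#}. weightA ! g)"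
        using l by (simp add: lighter_def)
      ultimately have "above {#i, j#} {#a, b#}" unfolding above_def by blast
      then show ?thesis using lighter_replace(1,3)[OF l] by simp
    next
      case False
      then have "(c, i, j) \<in> set (tl T)" using cij lt by (cases T) auto
      then have *: "i < 52" "j < 52" "gtype i = gtype a \<and> gtype j = gtype b \<or> gtype i = gtype b \<and> gtype j = gtype a"
        "lower (gvars a @ gvars b) (gvars i @ gvars j)"
        using rels_higher ab unfolding list_all_iff ids by fastforce+
      have "monm (mset (gvars a @ gvars b)) < monm (mset (gvars i @ gvars j))"
        using lower_monm[of "gvars a @ gvars b" "gvars i @ gvars j"] * ab gtv_mem by simp
      then have "above {#i, j#} {#a, b#}" by (simp add: above_def)
      then show ?thesis using * by auto
    qed
  qed
  have "b < 52 \<and> (b \<in> fst ` set (rels ! a) \<or> a \<in> fst ` set (rels ! b))"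
    using nonstdA_check assms by (auto simp: list_all_iff ids)
  then consider T where "(b, T) \<in> set (rels ! a)" "b < 52" | T where "(a, T) \<in> set (rels ! b)" "b < 52" by force
  then show thesis
  proof cases
    case 1
    then show ?thesis using main[OF assms(1) 1(2,1)] that by blast
  next
    case 2
    show ?thesis
      by (rule main[OF 2(2) assms(1) 2(1)]) (rule that, simp_all add: mult.commute add_mset_commute)
  qed
qed

lemma of_int_pscale: "of_int c * F = pscale (of_int c) F"
  by (simp add: pscale_def single_of_int)

text \<open>Every product of generators is a combination of products over standard multisets of the same types.
  Each step replaces a non-standard pair; the products that arise either have the same sum and smaller
  weight or a higher lowest monomial, and there are finitely many multisets of given types.\<close>

lemma straighten:
  "valid S \<Longrightarrow> gprod S \<in> pol.span {gprod C | C. valid C \<and> gtypes C = gtypes S \<and> standard nonstdA C}"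
proof (induction "card {S'. valid S' \<and> gtypes S' = gtypes S \<and> above S' S}" arbitrary: S rule: less_induct)
  case less
  let ?B = "\<lambda>S. {gprod C | C. valid C \<and> gtypes C = gtypes S \<and> standard nonstdA C}"
  show ?case
  proof (cases "standard nonstdA S")
    case True
    then show ?thesis using less.prems by (intro pol.span_base) blast
  next
    case False
    then obtain a b where ab: "{#a, b#} \<subseteq># S" "b \<in> set (nonstdA ! a)" by (auto simp: standard_def)
    then obtain R where R: "S = {#a, b#} + R" by (metis subset_mset.add_diff_inverse)
    then have "a < 52" using less.prems by auto
    from straighten_pair[OF this ab(2)] obtain T where
      T: "gpoly var a * gpoly var b = (\<Sum>(c, i, j)\<leftarrow>T. of_int c * (gpoly var i * gpoly var j) :: pol)"
      "\<And>c i j. (c, i, j) \<in> set T \<Longrightarrow> i < 52 \<and> j < 52 \<and> gtypes {#i, j#} = gtypes {#a, b#} \<and> above {#i, j#} {#a, b#}" by blast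
    have "gprod S = (\<Sum>(c, i, j)\<leftarrow>T. of_int c * (gpoly var i * gpoly var j)) * gprod R"
      by (simp add: R T(1)[symmetric] mult.assoc)
    also have "\<dots> = (\<Sum>(c, i, j)\<leftarrow>T. pscale (of_int c) (gprod ({#i, j#} + R)))"
      by (induction T) (auto simp: algebra_simps of_int_pscale[symmetric])
    also have "\<dots> \<in> pol.span (?B S)"
    proof -
      have *: "pscale (of_int c) (gprod ({#i, j#} + R)) \<in> pol.span (?B S)" if "(c, i, j) \<in> set T" for c i j
      proof (rule pol.span_scale)
        let ?S' = "{#i, j#} + R"
        have t: "gtypes ?S' = gtypes S" using T(2)[OF that] unfolding R gtypes_simps(3) by simp
        have v: "valid ?S'" using T(2)[OF that] less.prems R by simp
        have ab': "above ?S' S" unfolding R using T(2)[OF that] by (intro above_add) blast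
        have "{S''. valid S'' \<and> gtypes S'' = gtypes ?S' \<and> above S'' ?S'} \<subset> {S''. valid S'' \<and> gtypes S'' = gtypes S \<and> above S'' S}"
        proof
          show "{S''. valid S'' \<and> gtypes S'' = gtypes ?S' \<and> above S'' ?S'} \<subseteq> {S''. valid S'' \<and> gtypes S'' = gtypes S \<and> above S'' S}"
            unfolding t using ab' above_trans by blast
          have "?S' \<in> {S''. valid S'' \<and> gtypes S'' = gtypes S \<and> above S'' S}"
            unfolding mem_Collect_eq using v t ab' by blast
          moreover have "?S' \<notin> {S''. valid S'' \<and> gtypes S'' = gtypes ?S' \<and> above S'' ?S'}"
            using above_irrefl by blast
          ultimately show "{S''. valid S'' \<and> gtypes S'' = gtypes ?S' \<and> above S'' ?S'} \<noteq> {S''. valid S'' \<and> gtypes S'' = gtypes S \<and> above S'' S}"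
            by blast
        qed
        then have "card {S''. valid S'' \<and> gtypes S'' = gtypes ?S' \<and> above S'' ?S'} < card {S''. valid S'' \<and> gtypes S'' = gtypes S \<and> above S'' S}"
          by (intro psubset_card_mono finite_subset[OF _ finite_valid[of "gtypes S"]]) auto
        from less.hyps[OF this v] show "gprod ?S' \<in> pol.span (?B S)" by (simp only: t)
      qed
      then have "\<forall>x\<in>set T. (case x of (c, i, j) \<Rightarrow> pscale (of_int c) (gprod ({#i, j#} + R))) \<in> pol.span (?B S)" by auto
      then show ?thesis by (induction T) (auto intro: pol.span_add pol.span_zero)
    qed
    finally show ?thesis .
  qed
qed

lemma lookup_sum: "Poly_Mapping.lookup (\<Sum>x\<in>A. f x) q = (\<Sum>x\<in>A. Poly_Mapping.lookup (f x) q)"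
  by (induction A rule: infinite_finite_induct) (auto simp: lookup_add)

text \<open>Distinct standard multisets of the same types have distinct sums, so the lowest monomials of the
  spanning products do not cancel: the lowest monomial of a combination is one of them.\<close>

lemma lowest_span:
  assumes F: "F \<in> pol.span {gprod S | S. valid S \<and> gtypes S = T}" and p: "lowest F p"
  shows "\<exists>S. valid S \<and> gtypes S = T \<and> p = monm (gsum S)"
proof -
  let ?B = "{gprod C | C. valid C \<and> gtypes C = T \<and> standard nonstdA C}"
  have "{gprod S | S. valid S \<and> gtypes S = T} \<subseteq> pol.span ?B" using straighten by auto
  then have "F \<in> pol.span ?B" using F pol.span_mono[of _ "pol.span ?B"] pol.span_span by blast
  then obtain t u where t: "finite t" "t \<subseteq> ?B" "F = (\<Sum>x\<in>t. pscale (u x) x)"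
    unfolding pol.span_explicit by blast
  define t' where "t' = {x \<in> t. u x \<noteq> 0}"
  have F': "Poly_Mapping.lookup F q = (\<Sum>x\<in>t'. u x * Poly_Mapping.lookup x q)" for q
    unfolding t(3) lookup_sum lookup_pscale t'_def by (rule sum.mono_neutral_cong_right) (use t(1) in auto)
  have "\<exists>C. \<forall>x\<in>?B. x = gprod (C x) \<and> valid (C x) \<and> gtypes (C x) = T \<and> standard nonstdA (C x)"
    by (rule bchoice) blast
  then obtain C where C: "\<And>x. x \<in> t \<Longrightarrow> x = gprod (C x) \<and> valid (C x) \<and> gtypes (C x) = T \<and> standard nonstdA (C x)"
    using t(2) by blast
  then have C1: "\<And>x. x \<in> t \<Longrightarrow> x = gprod (C x)" and C2: "\<And>x. x \<in> t \<Longrightarrow> valid (C x)"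
    and C3: "\<And>x. x \<in> t \<Longrightarrow> gtypes (C x) = T" and C4: "\<And>x. x \<in> t \<Longrightarrow> standard nonstdA (C x)" by blast+
  define \<mu> where "\<mu> x = monm (gsum (C x))" for x
  have low: "lowest x (\<mu> x)" if "x \<in> t" for x using lowest_gprod[OF C2[OF that]] unfolding \<mu>_def C1[OF that, symmetric] .
  have inj: "x = y" if "x \<in> t" "y \<in> t" "\<mu> x = \<mu> y" for x y
  proof -
    have g: "gsum (C x) = gsum (C y)"
      by (rule monm_inj[OF gsum_vars[OF C2[OF that(1)]] gsum_vars[OF C2[OF that(2)]] that(3)[unfolded \<mu>_def]])
    have "C x = C y"
      by (rule standard_unique) (simp_all add: C2 C3 C4 that g)
    then have "gprod (C x) = gprod (C y)" by simp
    then show ?thesis by (simp only: C1[OF that(1), symmetric] C1[OF that(2), symmetric])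
  qed
  have fin: "finite t'" using t(1) by (simp add: t'_def)
  have "t' \<noteq> {}"
  proof
    assume "t' = {}" then have "Poly_Mapping.lookup F p = 0" by (simp add: F')
    then show False using p by (simp add: lowest_def)
  qed
  then have "Min (\<mu> ` t') \<in> \<mu> ` t'" using fin by (intro Min_in) auto
  then obtain x0 where x0: "x0 \<in> t'" "\<mu> x0 = Min (\<mu> ` t')" by force
  have x0t: "x0 \<in> t" using x0 by (simp add: t'_def)
  have less: "\<mu> x0 < \<mu> x" if "x \<in> t'" "x \<noteq> x0" for x
  proof -
    have "\<mu> x0 \<le> \<mu> x" using x0(2) fin that by simp
    moreover have "\<mu> x0 \<noteq> \<mu> x" using inj[of x0 x] that x0t by (auto simp: t'_def)
    ultimately show ?thesis by simp
  qed
  have zero: "Poly_Mapping.lookup x q = 0" if "x \<in> t'" "q < \<mu> x" for x q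
    using low[of x] that by (auto simp: lowest_def t'_def)
  have "lowest F (\<mu> x0)"
    unfolding lowest_def
  proof (intro conjI allI impI)
    have "(\<Sum>x\<in>t'. u x * Poly_Mapping.lookup x (\<mu> x0)) = u x0 * Poly_Mapping.lookup x0 (\<mu> x0)"
      using fin x0(1) zero less by (subst sum.remove[of _ x0]) (auto intro!: sum.neutral)
    then show "Poly_Mapping.lookup F (\<mu> x0) \<noteq> 0"
      using low[OF x0t] x0(1) by (simp add: F' lowest_def t'_def)
    fix q assume q: "q < \<mu> x0"
    have "Poly_Mapping.lookup x q = 0" if "x \<in> t'" for x
      using zero[OF that] less[OF that] q by (cases "x = x0") auto
    then show "Poly_Mapping.lookup F q = 0" by (simp add: F')
  qed
  then have "p = \<mu> x0" using p lowest_unique by blast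
  then show ?thesis using C2[OF x0t] C3[OF x0t] \<mu>_def by blast
qed

section \<open>The Lie algebra\<close>

fun opp :: "4 + 4 \<Rightarrow> 4 + 4" where "opp (Inl i) = Inr i" | "opp (Inr i) = Inl i"

definition rootmat :: "4 + 4 \<Rightarrow> 4 + 4 \<Rightarrow> mat8" where
  "rootmat a b = (\<chi> i j. (if i = a \<and> j = b then 1 else 0) - (if i = opp b \<and> j = opp a then 1 else 0))"

definition root_entry :: "nat \<Rightarrow> (4 + 4) \<times> (4 + 4)" where
  "root_entry k = [(Inr 2, Inl 1), (Inr 3, Inl 2), (Inr 3, Inl 1), (Inr 4, Inl 3), (Inr 4, Inl 2), (Inr 4, Inl 1), (Inl 3, Inl 1), (Inl 4, Inl 1), (Inl 4, Inl 3), (Inl 4, Inl 2), (Inl 3, Inl 2), (Inl 2, Inl 1)] ! (k - 1)"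

definition neg :: "nat \<Rightarrow> mat8" where "neg k = rootmat (fst (root_entry k)) (snd (root_entry k))"
definition pos :: "nat \<Rightarrow> mat8" where "pos k = rootmat (snd (root_entry k)) (fst (root_entry k))"

lemma root_entries: 
  "root_entry (Suc 0) = (Inr 2, Inl 1)" "root_entry 2 = (Inr 3, Inl 2)" "root_entry 3 = (Inr 3, Inl 1)" "root_entry 4 = (Inr 4, Inl 3)" "root_entry 5 = (Inr 4, Inl 2)" "root_entry 6 = (Inr 4, Inl 1)" "root_entry 7 = (Inl 3, Inl 1)" "root_entry 8 = (Inl 4, Inl 1)" "root_entry 9 = (Inl 4, Inl 3)" "root_entry 10 = (Inl 4, Inl 2)" "root_entry 11 = (Inl 3, Inl 2)" "root_entry 12 = (Inl 2, Inl 1)"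
  by (simp_all add: root_entry_def)

lemma sum_44: "sum f (UNIV :: (4 + 4) set) =
   f (Inl 1) + f (Inl 2) + f (Inl 3) + f (Inl 4) + (f (Inr 1) + f (Inr 2) + f (Inr 3) + f (Inr 4))"
  by (simp add: UNIV_Plus_UNIV[symmetric] sum.Plus sum_4 comp_def del: UNIV_Plus_UNIV)

lemma forall_44: "(\<forall>x :: 4 + 4. P x) \<longleftrightarrow> P (Inl 1) \<and> P (Inl 2) \<and> P (Inl 3) \<and> P (Inl 4) \<and>
   P (Inr 1) \<and> P (Inr 2) \<and> P (Inr 3) \<and> P (Inr 4)"
  by (simp add: split_sum_all forall_4)

lemma split_form_nth: "split_form $ a $ b = (if b = opp a then 1 else 0)"
  by (cases a; cases b) (auto simp: split_form_def)

lemma opp_opp [simp]: "opp (opp a) = a" by (cases a) auto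
lemma so8_iff: "X \<in> so8 \<longleftrightarrow> (\<forall>a b. X $ opp a $ b = - X $ opp b $ a)"
proof -
  have "(transpose X ** split_form) $ a $ b = (\<Sum>k\<in>UNIV. if k = opp b then X $ k $ a else 0)" for a b
    unfolding matrix_matrix_mult_def vec_lambda_beta by (rule sum.cong) (auto simp: transpose_def split_form_nth)
  moreover have "(split_form ** X) $ a $ b = (\<Sum>k\<in>UNIV. if k = opp a then X $ k $ b else 0)" for a b
    unfolding matrix_matrix_mult_def vec_lambda_beta by (rule sum.cong) (auto simp: split_form_nth)
  ultimately have "(transpose X ** split_form + split_form ** X) $ a $ b = X $ opp b $ a + X $ opp a $ b" for a b
    by simp
  then show ?thesis unfolding so8_def mem_Collect_eq vec_eq_iff by (simp add: add_eq_0_iff)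
qed

lemma so8_nth: "X \<in> so8 \<Longrightarrow> X $ a $ b = - X $ opp b $ opp a"
  using so8_iff[of X] by (metis opp_opp)

lemma bracket_nth: "bracket X Y $ a $ b = (\<Sum>c\<in>UNIV. X $ a $ c * Y $ c $ b - Y $ a $ c * X $ c $ b)"
  by (simp add: bracket_def matrix_matrix_mult_def sum_subtractf)

lemma cscale_nth [simp]: "cscale c X $ a $ b = c * X $ a $ b" by (simp add: cscale_def)

lemma so8_opp: "X \<in> so8 \<Longrightarrow> X $ opp a $ b = - X $ opp b $ a"
  using so8_iff by blast

lemma so8_add: "X \<in> so8 \<Longrightarrow> Y \<in> so8 \<Longrightarrow> X + Y \<in> so8"
  unfolding so8_iff[of "X + Y"] vector_add_component
  using so8_opp[of X] so8_opp[of Y] by (metis minus_add_distrib)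

lemma so8_cscale: "X \<in> so8 \<Longrightarrow> cscale c X \<in> so8"
  unfolding so8_iff[of "cscale c X"] cscale_nth using so8_opp[of X] by (metis mult_minus_right)

lemma so8_zero: "0 \<in> so8"
  by (simp add: so8_iff)

lemma so8_sum: "(\<And>i. i \<in> A \<Longrightarrow> f i \<in> so8) \<Longrightarrow> sum f A \<in> so8"
  by (induction A rule: infinite_finite_induct) (auto intro: so8_add so8_zero)

lemma so8_bracket:
  assumes X: "X \<in> so8" and Y: "Y \<in> so8" shows "bracket X Y \<in> so8"
proof -
  have inj: "inj_on opp UNIV" by (rule inj_on_inverseI[of _ opp]) simp
  have r: "range opp = UNIV" by (rule surjI[of _ opp]) simp
  have "bracket X Y $ opp a $ b = - bracket X Y $ opp b $ a" for a b
  proof -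
    have "bracket X Y $ opp b $ a = (\<Sum>c\<in>range opp. X $ opp b $ c * Y $ c $ a - Y $ opp b $ c * X $ c $ a)"
      by (simp add: bracket_nth r)
    also have "\<dots> = (\<Sum>c\<in>UNIV. X $ opp b $ opp c * Y $ opp c $ a - Y $ opp b $ opp c * X $ opp c $ a)"
      by (simp add: sum.reindex[OF inj])
    also have "\<dots> = (\<Sum>c\<in>UNIV. X $ c $ b * Y $ opp a $ c - Y $ c $ b * X $ opp a $ c)"
    proof (rule sum.cong)
      fix c
      show "X $ opp b $ opp c * Y $ opp c $ a - Y $ opp b $ opp c * X $ opp c $ a = X $ c $ b * Y $ opp a $ c - Y $ c $ b * X $ opp a $ c"
        using so8_nth[OF X, of "opp b" "opp c"] so8_nth[OF Y, of "opp b" "opp c"] so8_nth[OF X, of "opp c" a] so8_nth[OF Y, of "opp c" a]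
        by simp
    qed simp
    finally show ?thesis by (simp add: bracket_nth sum_subtractf mult.commute)
  qed
  then show ?thesis unfolding so8_iff by blast
qed

text \<open>The anti-involution of the compact real form. It exchanges the root vectors \<open>neg k\<close> and \<open>pos k\<close>.\<close>

definition herm :: "mat8 \<Rightarrow> mat8" where "herm X = (\<chi> a b. cnj (X $ b $ a))"

lemma herm_so8:
  assumes "X \<in> so8" shows "herm X \<in> so8"
proof -
  have "herm X $ opp a $ b = - herm X $ opp b $ a" for a b
    using so8_nth[OF assms, of b "opp a"] by (simp add: herm_def)
  then show ?thesis unfolding so8_iff by blast
qed

lemma numeral_4_neq [simp]: "(1::4) \<noteq> 2" "(1::4) \<noteq> 3" "(1::4) \<noteq> 4" "(2::4) \<noteq> 3" "(2::4) \<noteq> 4" "(3::4) \<noteq> 4"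
  "(2::4) \<noteq> 1" "(3::4) \<noteq> 1" "(4::4) \<noteq> 1" "(3::4) \<noteq> 2" "(4::4) \<noteq> 2" "(4::4) \<noteq> 3"
  by simp_all

lemma index12: "k \<in> {1..12} \<longleftrightarrow> k \<in> set [1,2,3,4,5,6,7,8,9,10,11,12::nat]"
  by simp presburger

lemma opp_neq [simp]: "opp a \<noteq> a" "a \<noteq> opp a" by (cases a; simp)+

lemma rootmat_nth: "rootmat a b $ i $ j = (if i = a \<and> j = b then 1 else 0) - (if i = opp b \<and> j = opp a then 1 else 0)"
  by (simp add: rootmat_def)

lemma rootmat_so8: "rootmat a b \<in> so8"
proof -
  have "rootmat a b $ opp i $ j = - rootmat a b $ opp j $ i" for i j
  proof -
    have 1: "opp i = a \<and> j = b \<longleftrightarrow> opp j = opp b \<and> i = opp a" by (metis opp_opp)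
    have 2: "opp i = opp b \<and> j = opp a \<longleftrightarrow> opp j = a \<and> i = b" by (metis opp_opp)
    show ?thesis unfolding rootmat_nth 1 2 by simp
  qed
  then show ?thesis unfolding so8_iff by blast
qed

lemma neg_so8: "neg k \<in> so8" and pos_so8: "pos k \<in> so8"
  by (simp_all add: neg_def pos_def rootmat_so8)

lemma cartan_so8: "cartan x \<in> so8"
  by (simp add: so8_iff forall_44 cartan_def)

lemma herm_neg: "herm (neg k) = pos k"
  by (simp add: herm_def neg_def pos_def rootmat_nth vec_eq_iff conj_commute)

lemma cartan_nth: "cartan x $ a $ b = (if a = b then case_sum (\<lambda>i. x $ i) (\<lambda>i. - (x $ i)) a else 0)"
  by (simp add: cartan_def split: sum.splits)

lemma bracket_cartan: "bracket (cartan x) X $ a $ b = (cartan x $ a $ a - cartan x $ b $ b) * X $ a $ b"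
proof -
  have "bracket (cartan x) X $ a $ b = (\<Sum>c\<in>UNIV. (if a = c then cartan x $ a $ a * X $ a $ b else 0)) - (\<Sum>c\<in>UNIV. (if c = b then X $ a $ b * cartan x $ b $ b else 0))"
    unfolding bracket_nth sum_subtractf
    by (intro arg_cong2[where f = "(-)"] sum.cong) (auto simp: cartan_nth)
  then show ?thesis by (simp add: algebra_simps)
qed

text \<open>A regular element of the Cartan subalgebra. Its eigenvalues separate the roots, so that a root space
  can be computed from the action of this single element.\<close>

definition hgt :: "complex ^ 4" where "hgt = (\<chi> i. if i = 1 then 1000 else if i = 2 then 100 else if i = 3 then 10 else 1)"

lemma hgt_nth [simp]: "hgt $ 1 = 1000" "hgt $ 2 = 100" "hgt $ 3 = 10" "hgt $ 4 = 1"
  by (simp_all add: hgt_def)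

lemma eps_nth [simp]: "eps i $ j = (if i = j then 1 else 0)"
  by (auto simp: eps_def axis_def)

lemma cartan_opp: "cartan x $ opp a $ opp a = - cartan x $ a $ a"
  by (cases a) (simp_all add: cartan_nth)

lemma bracket_cartan_rootmat:
  "bracket (cartan x) (rootmat a b) = cscale (cartan x $ a $ a - cartan x $ b $ b) (rootmat a b)"
  by (simp add: vec_eq_iff bracket_cartan rootmat_nth cartan_opp)

lemma root_weight:
  assumes "k \<in> {1..12}"
  shows "eval_weight (pos_root k) x = cartan x $ snd (root_entry k) $ snd (root_entry k) - cartan x $ fst (root_entry k) $ fst (root_entry k)"
  using assms unfolding index12
  by (auto simp: eval_weight_def sum_4 pos_root_def root_entries cartan_nth)

lemma eval_weight_minus: "eval_weight (- \<mu>) x = - eval_weight \<mu> x"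
  by (simp add: eval_weight_def sum_negf of_rat_minus)

lemma pos_root_vec: "k \<in> {1..12} \<Longrightarrow> pos k \<in> root_space (pos_root k)"
  by (simp add: root_space_def pos_def rootmat_so8 bracket_cartan_rootmat root_weight)

lemma hgt_separates:
  assumes "k \<in> {1..12}"
  shows "\<forall>i j. cartan hgt $ i $ i - cartan hgt $ j $ j = cartan hgt $ fst (root_entry k) $ fst (root_entry k) - cartan hgt $ snd (root_entry k) $ snd (root_entry k) \<longrightarrow>
     (i, j) = root_entry k \<or> (i, j) = (opp (snd (root_entry k)), opp (fst (root_entry k)))"
  using assms unfolding index12 list.set insert_iff empty_iff
  by (elim disjE; simp add: forall_44 root_entries cartan_nth)

lemma root_space_rootmat:
  assumes so: "X \<in> so8" and r: "bracket (cartan hgt) X = cscale (cartan hgt $ a $ a - cartan hgt $ b $ b) X"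
    and sep: "\<And>i j. cartan hgt $ i $ i - cartan hgt $ j $ j = cartan hgt $ a $ a - cartan hgt $ b $ b \<Longrightarrow>
      (i, j) = (a, b) \<or> (i, j) = (opp b, opp a)"
    and ab: "a \<noteq> opp b"
  shows "X = cscale (X $ a $ b) (rootmat a b)"
proof -
  have "X $ i $ j = X $ a $ b * rootmat a b $ i $ j" for i j
  proof (cases "(i, j) = (a, b) \<or> (i, j) = (opp b, opp a)")
    case True
    then show ?thesis
    proof
      assume "(i, j) = (a, b)"
      then have ij: "i = a" "j = b" by simp_all
      have "\<not> (a = opp b \<and> b = opp a)" using ab by blast
      then have "rootmat a b $ a $ b = 1" unfolding rootmat_nth by (simp only: if_False if_True simp_thms diff_zero)
      then show ?thesis unfolding ij by (simp only: mult_1_right)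
    next
      assume "(i, j) = (opp b, opp a)"
      then have ij: "i = opp b" "j = opp a" by simp_all
      have "\<not> (opp b = a \<and> opp a = b)" using ab by blast
      then have "rootmat a b $ opp b $ opp a = - 1" unfolding rootmat_nth by (simp only: if_False if_True simp_thms diff_0)
      then show ?thesis unfolding ij using so8_nth[OF so, of a b] by (simp only: mult_minus1_right minus_minus)
    qed
  next
    case False
    then have "cartan hgt $ i $ i - cartan hgt $ j $ j \<noteq> cartan hgt $ a $ a - cartan hgt $ b $ b" using sep by blast
    moreover have "(cartan hgt $ i $ i - cartan hgt $ j $ j) * X $ i $ j = (cartan hgt $ a $ a - cartan hgt $ b $ b) * X $ i $ j"
      using arg_cong[OF r, of "\<lambda>M. M $ i $ j"] unfolding bracket_cartan cscale_nth .
    ultimately have "X $ i $ j = 0" by (metis mult_cancel_right)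
    moreover have "\<not> (i = a \<and> j = b)" "\<not> (i = opp b \<and> j = opp a)" using False by blast+
    then have "rootmat a b $ i $ j = 0" unfolding rootmat_nth by (simp only: if_False diff_self)
    ultimately show ?thesis by (simp only: mult_zero_right)
  qed
  then show ?thesis unfolding vec_eq_iff cscale_nth by blast
qed

lemma root_entry_neq: "k \<in> {1..12} \<Longrightarrow> fst (root_entry k) \<noteq> opp (snd (root_entry k))"
  unfolding index12 by (auto simp: root_entries)

lemma root_space_neg:
  assumes "k \<in> {1..12}" "X \<in> root_space (- pos_root k)"
  shows "\<exists>c. X = cscale c (neg k)"
  unfolding neg_def
  by (rule exI, rule root_space_rootmat)
    (use assms hgt_separates[OF assms(1)] root_entry_neq[OF assms(1)] in \<open>auto simp: root_space_def eval_weight_minus root_weight prod_eq_iff\<close>)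

lemma root_space_pos:
  assumes "k \<in> {1..12}" "X \<in> root_space (pos_root k)"
  shows "\<exists>c. X = cscale c (pos k)"
  unfolding pos_def
proof (rule exI, rule root_space_rootmat)
  let ?a = "fst (root_entry k)" and ?b = "snd (root_entry k)"
  show "(i, j) = (?b, ?a) \<or> (i, j) = (opp ?a, opp ?b)"
    if "cartan hgt $ i $ i - cartan hgt $ j $ j = cartan hgt $ ?b $ ?b - cartan hgt $ ?a $ ?a" for i j
  proof -
    have "cartan hgt $ j $ j - cartan hgt $ i $ i = cartan hgt $ ?a $ ?a - cartan hgt $ ?b $ ?b"
      using that by (simp add: algebra_simps)
    then show ?thesis using hgt_separates[OF assms(1)] by (auto simp: prod_eq_iff)
  qed
  show "?b \<noteq> opp ?a" using root_entry_neq[OF assms(1)] by (metis opp_opp)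
qed (use assms in \<open>auto simp: root_space_def root_weight\<close>)

lemma neg_self_zero: "(z :: complex) = - z \<Longrightarrow> z = 0"
  by (drule arg_cong[where f = "\<lambda>w. z + w"]) simp

lemma so8_rules:
  assumes "X \<in> so8"
  shows "X $ Inr i $ Inr j = - X $ Inl j $ Inl i"
    "X $ Inl 1 $ Inr 1 = 0" "X $ Inr 1 $ Inl 1 = 0"
    "X $ Inl 2 $ Inr 2 = 0" "X $ Inr 2 $ Inl 2 = 0"
    "X $ Inl 2 $ Inr 1 = - X $ Inl 1 $ Inr 2" "X $ Inr 2 $ Inl 1 = - X $ Inr 1 $ Inl 2"
    "X $ Inl 3 $ Inr 3 = 0" "X $ Inr 3 $ Inl 3 = 0"
    "X $ Inl 3 $ Inr 1 = - X $ Inl 1 $ Inr 3" "X $ Inr 3 $ Inl 1 = - X $ Inr 1 $ Inl 3"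
    "X $ Inl 3 $ Inr 2 = - X $ Inl 2 $ Inr 3" "X $ Inr 3 $ Inl 2 = - X $ Inr 2 $ Inl 3"
    "X $ Inl 4 $ Inr 4 = 0" "X $ Inr 4 $ Inl 4 = 0"
    "X $ Inl 4 $ Inr 1 = - X $ Inl 1 $ Inr 4" "X $ Inr 4 $ Inl 1 = - X $ Inr 1 $ Inl 4"
    "X $ Inl 4 $ Inr 2 = - X $ Inl 2 $ Inr 4" "X $ Inr 4 $ Inl 2 = - X $ Inr 2 $ Inl 4"
    "X $ Inl 4 $ Inr 3 = - X $ Inl 3 $ Inr 4" "X $ Inr 4 $ Inl 3 = - X $ Inr 3 $ Inl 4"
proof -
  have RR: "X $ Inr i $ Inr j = - X $ Inl j $ Inl i" for i j
    using so8_nth[OF assms, of "Inr i" "Inr j"] by (simp only: opp.simps)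
  have LR: "X $ Inl i $ Inr j = - X $ Inl j $ Inr i" for i j
    using so8_nth[OF assms, of "Inl i" "Inr j"] by (simp only: opp.simps)
  have RL: "X $ Inr i $ Inl j = - X $ Inr j $ Inl i" for i j
    using so8_nth[OF assms, of "Inr i" "Inl j"] by (simp only: opp.simps)
  have LR0: "X $ Inl i $ Inr i = 0" for i by (rule neg_self_zero) (rule LR)
  have RL0: "X $ Inr i $ Inl i = 0" for i by (rule neg_self_zero) (rule RL)
  show RR: "X $ Inr i $ Inr j = - X $ Inl j $ Inl i" by (rule RR)
  show "X $ Inl 1 $ Inr 1 = 0" by (rule LR0) show "X $ Inr 1 $ Inl 1 = 0" by (rule RL0)
  show "X $ Inl 2 $ Inr 2 = 0" by (rule LR0) show "X $ Inr 2 $ Inl 2 = 0" by (rule RL0)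
  show "X $ Inl 3 $ Inr 3 = 0" by (rule LR0) show "X $ Inr 3 $ Inl 3 = 0" by (rule RL0)
  show "X $ Inl 4 $ Inr 4 = 0" by (rule LR0) show "X $ Inr 4 $ Inl 4 = 0" by (rule RL0)
  show "X $ Inl 2 $ Inr 1 = - X $ Inl 1 $ Inr 2" by (rule LR) show "X $ Inr 2 $ Inl 1 = - X $ Inr 1 $ Inl 2" by (rule RL)
  show "X $ Inl 3 $ Inr 1 = - X $ Inl 1 $ Inr 3" by (rule LR) show "X $ Inr 3 $ Inl 1 = - X $ Inr 1 $ Inl 3" by (rule RL)
  show "X $ Inl 3 $ Inr 2 = - X $ Inl 2 $ Inr 3" by (rule LR) show "X $ Inr 3 $ Inl 2 = - X $ Inr 2 $ Inl 3" by (rule RL)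
  show "X $ Inl 4 $ Inr 1 = - X $ Inl 1 $ Inr 4" by (rule LR) show "X $ Inr 4 $ Inl 1 = - X $ Inr 1 $ Inl 4" by (rule RL)
  show "X $ Inl 4 $ Inr 2 = - X $ Inl 2 $ Inr 4" by (rule LR) show "X $ Inr 4 $ Inl 2 = - X $ Inr 2 $ Inl 4" by (rule RL)
  show "X $ Inl 4 $ Inr 3 = - X $ Inl 3 $ Inr 4" by (rule LR) show "X $ Inr 4 $ Inl 3 = - X $ Inr 3 $ Inl 4" by (rule RL)
qed

lemma so8_decomp:
  assumes so: "X \<in> so8"
  shows "\<exists>x f g. X = cartan x + (\<Sum>k=1..12. cscale (f k) (neg k)) + (\<Sum>k=1..12. cscale (g k) (pos k))"
proof -
  let ?f = "\<lambda>k. X $ fst (root_entry k) $ snd (root_entry k)"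
  let ?g = "\<lambda>k. X $ snd (root_entry k) $ fst (root_entry k)"
  have s: "(\<Sum>k=1..12. h k) = h 1 + h 2 + h 3 + h 4 + h 5 + h 6 + h 7 + h 8 + h 9 + h 10 + h 11 + h (12::nat)" for h :: "nat \<Rightarrow> mat8"
    by (simp add: numeral_eq_Suc add.assoc)
  have "X = cartan (\<chi> i. X $ Inl i $ Inl i) + (\<Sum>k=1..12. cscale (?f k) (neg k)) + (\<Sum>k=1..12. cscale (?g k) (pos k))"
    unfolding s vec_eq_iff forall_44
    by (simp add: cartan_nth neg_def pos_def root_entries rootmat_nth so8_rules[OF so])
  then show ?thesis by (intro exI)
qed

section \<open>Highest weight modules\<close>

locale cvs = vector_space scale for scale :: "complex \<Rightarrow> 'v \<Rightarrow> 'v :: ab_group_add"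

abbreviation act :: "(mat8 \<Rightarrow> 'v \<Rightarrow> 'v) \<Rightarrow> mat8 list \<Rightarrow> 'v \<Rightarrow> 'v" where
  "act \<rho> w v \<equiv> foldr \<rho> w v"

text \<open>Irreducibility is not part of this locale: it also covers the full tensor products, in which the
  highest weight vector generates a smaller module.\<close>

locale hw_module = cvs scale for scale :: "complex \<Rightarrow> 'v \<Rightarrow> 'v :: ab_group_add" +
  fixes \<mu> :: "rat ^ 4" and W :: "'v set" and \<rho> :: "mat8 \<Rightarrow> 'v \<Rightarrow> 'v" and v :: 'v
  assumes sub: "subspace W" and rho_mem: "X \<in> so8 \<Longrightarrow> w \<in> W \<Longrightarrow> \<rho> X w \<in> W"
  and rho_add: "X \<in> so8 \<Longrightarrow> w \<in> W \<Longrightarrow> w' \<in> W \<Longrightarrow> \<rho> X (w + w') = \<rho> X w + \<rho> X w'"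
  and rho_scale: "X \<in> so8 \<Longrightarrow> w \<in> W \<Longrightarrow> \<rho> X (scale c w) = scale c (\<rho> X w)"
  and add_rho: "X \<in> so8 \<Longrightarrow> Y \<in> so8 \<Longrightarrow> w \<in> W \<Longrightarrow> \<rho> (X + Y) w = \<rho> X w + \<rho> Y w"
  and cscale_rho: "X \<in> so8 \<Longrightarrow> w \<in> W \<Longrightarrow> \<rho> (cscale c X) w = scale c (\<rho> X w)"
  and bracket_rho: "X \<in> so8 \<Longrightarrow> Y \<in> so8 \<Longrightarrow> w \<in> W \<Longrightarrow> \<rho> (bracket X Y) w = \<rho> X (\<rho> Y w) - \<rho> Y (\<rho> X w)"
  and v_mem: "v \<in> W" and v_nz: "v \<noteq> 0"
  and v_cartan: "\<rho> (cartan x) v = scale (eval_weight \<mu> x) v"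
  and v_pos: "k \<in> {1..12} \<Longrightarrow> \<rho> (pos k) v = 0"
begin

lemma add_mem: "x \<in> W \<Longrightarrow> y \<in> W \<Longrightarrow> x + y \<in> W"
  by (rule subspace_add[OF sub])

lemma scale_mem: "x \<in> W \<Longrightarrow> scale c x \<in> W"
  by (rule subspace_scale[OF sub])

lemma zero_mem: "0 \<in> W"
  by (rule subspace_0[OF sub])

lemma rho_zero: "X \<in> so8 \<Longrightarrow> \<rho> X 0 = 0"
  using rho_scale[of X 0 0] zero_mem by simp

lemma zero_rho: "w \<in> W \<Longrightarrow> \<rho> 0 w = 0"
  using add_rho[OF so8_zero so8_zero, of w] by simp

lemma sum_rho:
  assumes "\<And>i. i \<in> A \<Longrightarrow> f i \<in> so8" "w \<in> W"
  shows "\<rho> (sum f A) w = (\<Sum>i\<in>A. \<rho> (f i) w)"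
  using assms(1) by (induction A rule: infinite_finite_induct) (auto simp: zero_rho assms(2) add_rho so8_sum)

lemma act_mem: "set w \<subseteq> so8 \<Longrightarrow> x \<in> W \<Longrightarrow> act \<rho> w x \<in> W"
  by (induction w) (auto intro: rho_mem)

lemma act_add: "set w \<subseteq> so8 \<Longrightarrow> x \<in> W \<Longrightarrow> y \<in> W \<Longrightarrow> act \<rho> w (x + y) = act \<rho> w x + act \<rho> w y"
  by (induction w) (auto simp: rho_add act_mem)

lemma act_scale: "set w \<subseteq> so8 \<Longrightarrow> x \<in> W \<Longrightarrow> act \<rho> w (scale c x) = scale c (act \<rho> w x)"
  by (induction w) (auto simp: rho_scale act_mem)

end

context cvs
begin

definition lincomb :: "(mat8 \<Rightarrow> 'v \<Rightarrow> 'v) \<Rightarrow> (complex \<times> mat8 list) list \<Rightarrow> 'v \<Rightarrow> 'v" where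
  "lincomb \<rho> L v = (\<Sum>(c, w)\<leftarrow>L. scale c (act \<rho> w v))"

lemma lincomb_simps [simp]: "lincomb \<rho> [] v = 0" "lincomb \<rho> ((c, w) # L) v = scale c (act \<rho> w v) + lincomb \<rho> L v"
  "lincomb \<rho> (L @ L') v = lincomb \<rho> L v + lincomb \<rho> L' v"
  by (simp_all add: lincomb_def)

lemma lincomb_scaled: "lincomb \<rho> (map (\<lambda>(c, w). (d * c, w)) L) v = scale d (lincomb \<rho> L v)"
proof (induction L)
  case Nil
  show ?case by (simp only: list.map lincomb_simps scale_zero_right)
next
  case (Cons a L)
  then show ?case
    by (cases a) (simp only: list.map prod.case lincomb_simps scale_right_distrib scale_scale)
qed

lemma lincomb_singles: "lincomb \<rho> (map (\<lambda>k. (f k, [g k])) ks) v = (\<Sum>k\<leftarrow>ks. scale (f k) (\<rho> (g k) v))"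
  by (induction ks) (simp_all only: list.map lincomb_simps sum_list.Nil sum_list.Cons foldr.simps comp_apply id_apply)

end

definition words :: "mat8 set \<Rightarrow> (complex \<times> mat8 list) list \<Rightarrow> bool" where
  "words A L \<longleftrightarrow> (\<forall>(c, w)\<in>set L. set w \<subseteq> A)"

lemma words_simps [simp]: "words A []" "words A ((c, w) # L) \<longleftrightarrow> set w \<subseteq> A \<and> words A L"
  "words A (L @ L') \<longleftrightarrow> words A L \<and> words A L'"
  "words A (map (\<lambda>(c, w). (d * c, w)) L) \<longleftrightarrow> words A L"
  by (auto simp: words_def)

lemma words_mono: "words A L \<Longrightarrow> A \<subseteq> B \<Longrightarrow> words B L"
  unfolding words_def by fast

abbreviation negs :: "mat8 set" where "negs \<equiv> neg ` {1..12}"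

lemma negs_so8: "negs \<subseteq> so8" using neg_so8 by blast

context hw_module
begin

lemma lincomb_mem: "words so8 L \<Longrightarrow> x \<in> W \<Longrightarrow> lincomb \<rho> L x \<in> W"
  by (induction L) (auto intro!: add_mem scale_mem act_mem zero_mem)

lemma lincomb_prefix:
  "words so8 L \<Longrightarrow> set w \<subseteq> so8 \<Longrightarrow> x \<in> W \<Longrightarrow> lincomb \<rho> (map (\<lambda>(c, u). (c, w @ u)) L) x = act \<rho> w (lincomb \<rho> L x)"
proof (induction L)
  case Nil
  then show ?case using act_scale[of w x 0] by simp
next
  case (Cons a L)
  then show ?case by (cases a) (simp add: act_add act_scale scale_mem act_mem lincomb_mem)
qed

end

lemma words_prefix: "words A L \<Longrightarrow> set w \<subseteq> A \<Longrightarrow> words A (map (\<lambda>(c, u). (c, w @ u)) L)"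
  by (induction L) auto

context cvs
begin

text \<open>In the action on a highest weight vector, Cartan elements and positive root vectors can be moved to
  the right and be evaluated there. The resulting combination of words in the negative root vectors
  depends on the weight only, and this uniformity is what the comparison of modules rests on.\<close>

lemma reduce_one:
  fixes \<mu> :: "rat ^ 4"
  shows "X \<in> so8 \<Longrightarrow> set u \<subseteq> negs \<Longrightarrow>
    \<exists>L. words negs L \<and> (\<forall>W \<rho> v. hw_module scale \<mu> W \<rho> v \<longrightarrow> act \<rho> (X # u) v = lincomb \<rho> L v)"
proof (induction u arbitrary: X)
  case Nil
  obtain x f g where X: "X = cartan x + (\<Sum>k=1..12. cscale (f k) (neg k)) + (\<Sum>k=1..12. cscale (g k) (pos k))"
    using so8_decomp[OF Nil(1)] by blast
  define L where "L = (eval_weight \<mu> x, []) # map (\<lambda>k. (f k, [neg k])) [1..<13]"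
  have "words negs L" by (auto simp: L_def words_def)
  moreover have "act \<rho> [X] v = lincomb \<rho> L v" if h: "hw_module scale \<mu> W \<rho> v" for W \<rho> v
  proof -
    interpret hw_module scale \<mu> W \<rho> v by (rule h)
    have s: "(\<Sum>k=1..12. h k) = sum_list (map h [1..<13])" for h :: "nat \<Rightarrow> 'v"
      by (subst sum_list_distinct_conv_sum_set) (auto intro!: sum.cong)
    have "\<rho> X v = \<rho> (cartan x) v + \<rho> (\<Sum>k=1..12. cscale (f k) (neg k)) v + \<rho> (\<Sum>k=1..12. cscale (g k) (pos k)) v"
      unfolding X by (simp add: add_rho so8_add so8_sum so8_cscale cartan_so8 neg_so8 pos_so8 v_mem)
    also have "\<dots> = scale (eval_weight \<mu> x) v + (\<Sum>k=1..12. scale (f k) (\<rho> (neg k) v)) + (\<Sum>k=1..12. scale (g k) (\<rho> (pos k) v))"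
      by (simp add: v_cartan sum_rho cscale_rho so8_cscale neg_so8 pos_so8 v_mem)
    also have "(\<Sum>k=1..12. scale (g k) (\<rho> (pos k) v)) = 0"
      by (rule sum.neutral) (simp add: v_pos)
    finally show ?thesis
      unfolding s L_def lincomb_simps(2) lincomb_singles by (simp only: foldr.simps comp_apply id_apply add_0_right)
  qed
  ultimately show ?case by blast
next
  case (Cons E u)
  then have E: "E \<in> so8" "E \<in> negs" "set u \<subseteq> negs" using negs_so8 by auto
  obtain L1 where L1: "words negs L1" "\<And>W \<rho> v. hw_module scale \<mu> W \<rho> v \<Longrightarrow> act \<rho> (X # u) v = lincomb \<rho> L1 v"
    using Cons.IH[OF Cons.prems(1) E(3)] by blast
  obtain L2 where L2: "words negs L2" "\<And>W \<rho> v. hw_module scale \<mu> W \<rho> v \<Longrightarrow> act \<rho> (bracket X E # u) v = lincomb \<rho> L2 v"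
    using Cons.IH[OF so8_bracket[OF Cons.prems(1) E(1)] E(3)] by blast
  let ?L = "map (\<lambda>(c, u). (c, [E] @ u)) L1 @ L2"
  have "words negs ?L" using L1(1) L2(1) E(2) words_prefix[of negs L1 "[E]"] by simp
  moreover have "act \<rho> (X # E # u) v = lincomb \<rho> ?L v" if h: "hw_module scale \<mu> W \<rho> v" for W \<rho> v
  proof -
    interpret hw_module scale \<mu> W \<rho> v by (rule h)
    have u: "act \<rho> u v \<in> W" using act_mem E(3) negs_so8 v_mem by blast
    have "act \<rho> (X # E # u) v = \<rho> E (\<rho> X (act \<rho> u v)) + \<rho> (bracket X E) (act \<rho> u v)"
      using bracket_rho[OF Cons.prems(1) E(1) u] by simp
    also have "\<rho> E (\<rho> X (act \<rho> u v)) = lincomb \<rho> (map (\<lambda>(c, u). (c, [E] @ u)) L1) v"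
      using lincomb_prefix[of L1 "[E]" v] L1(2)[OF h] words_mono[OF L1(1) negs_so8] E(1) v_mem by simp
    also have "\<rho> (bracket X E) (act \<rho> u v) = lincomb \<rho> L2 v" using L2(2)[OF h] by simp
    finally show ?thesis by simp
  qed
  ultimately show ?case by blast
qed

lemma reduce_comb:
  fixes \<mu> :: "rat ^ 4"
  assumes "X \<in> so8" "words negs L"
  shows "\<exists>L'. words negs L' \<and> (\<forall>W \<rho> v. hw_module scale \<mu> W \<rho> v \<longrightarrow> \<rho> X (lincomb \<rho> L v) = lincomb \<rho> L' v)"
  using assms(2)
proof (induction L)
  case Nil
  have "\<rho> X (lincomb \<rho> [] v) = lincomb \<rho> [] v" if "hw_module scale \<mu> W \<rho> v" for W \<rho> v
    using hw_module.rho_zero[OF that assms(1)] unfolding lincomb_simps(1) .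
  then show ?case by (intro exI[of _ "[]"]) auto
next
  case (Cons a L)
  obtain c u where a: "a = (c, u)" by (cases a)
  obtain L' where L': "words negs L'" "\<And>W \<rho> v. hw_module scale \<mu> W \<rho> v \<Longrightarrow> \<rho> X (lincomb \<rho> L v) = lincomb \<rho> L' v"
    using Cons a by auto
  obtain L1 where L1: "words negs L1" "\<And>W \<rho> v. hw_module scale \<mu> W \<rho> v \<Longrightarrow> act \<rho> (X # u) v = lincomb \<rho> L1 v"
    using reduce_one[OF assms(1), of u \<mu>] Cons.prems a by auto
  have "\<rho> X (lincomb \<rho> (a # L) v) = lincomb \<rho> (map (\<lambda>(d, w). (c * d, w)) L1 @ L') v" if h: "hw_module scale \<mu> W \<rho> v" for W \<rho> v
  proof -
    interpret hw_module scale \<mu> W \<rho> v by (rule h)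
    have "set u \<subseteq> so8" "words so8 L" using Cons.prems a negs_so8 words_mono by auto
    then have m: "act \<rho> u v \<in> W" "lincomb \<rho> L v \<in> W" using v_mem by (auto intro: act_mem lincomb_mem)
    then have "\<rho> X (lincomb \<rho> (a # L) v) = scale c (act \<rho> (X # u) v) + \<rho> X (lincomb \<rho> L v)"
      by (simp add: a rho_add[OF assms(1)] rho_scale[OF assms(1)] scale_mem)
    then show ?thesis using L1(2)[OF h] L'(2)[OF h] by (simp add: lincomb_scaled)
  qed
  then show ?case using L1(1) L'(1) by (intro exI[of _ "map (\<lambda>(d, w). (c * d, w)) L1 @ L'"]) auto
qed

lemma reduce_word:
  fixes \<mu> :: "rat ^ 4"
  shows "set w \<subseteq> so8 \<Longrightarrow> \<exists>L. words negs L \<and> (\<forall>W \<rho> v. hw_module scale \<mu> W \<rho> v \<longrightarrow> act \<rho> w v = lincomb \<rho> L v)"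
proof (induction w)
  case Nil
  show ?case by (intro exI[of _ "[(1, [])]"]) simp
next
  case (Cons X w)
  then obtain L where L: "words negs L" "\<And>W \<rho> v. hw_module scale \<mu> W \<rho> v \<Longrightarrow> act \<rho> w v = lincomb \<rho> L v" by auto
  obtain L' where "words negs L'" "\<And>W \<rho> v. hw_module scale \<mu> W \<rho> v \<Longrightarrow> \<rho> X (lincomb \<rho> L v) = lincomb \<rho> L' v"
    using reduce_comb[OF _ L(1), of X \<mu>] Cons.prems by auto
  then show ?case using L(2) by (intro exI[of _ L']) auto
qed

lemma reduce:
  fixes \<mu> :: "rat ^ 4"
  shows "words so8 L \<Longrightarrow> \<exists>L'. words negs L' \<and> (\<forall>W \<rho> v. hw_module scale \<mu> W \<rho> v \<longrightarrow> lincomb \<rho> L v = lincomb \<rho> L' v)"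
proof (induction L)
  case Nil show ?case by (intro exI[of _ "[]"]) simp
next
  case (Cons a L)
  obtain c w where a: "a = (c, w)" by (cases a)
  obtain L' where L': "words negs L'" "\<And>W \<rho> v. hw_module scale \<mu> W \<rho> v \<Longrightarrow> lincomb \<rho> L v = lincomb \<rho> L' v" using Cons a by auto
  obtain L1 where L1: "words negs L1" "\<And>W \<rho> v. hw_module scale \<mu> W \<rho> v \<Longrightarrow> act \<rho> w v = lincomb \<rho> L1 v"
    using reduce_word[of w \<mu>] Cons.prems a by auto
  show ?case
    using L1 L' by (intro exI[of _ "map (\<lambda>(d, w). (c * d, w)) L1 @ L'"]) (simp add: a lincomb_scaled)
qed

end

text \<open>The sum of the fundamental coweights. Its eigenvalue on a negative root vector is minus the height of
  the root, so it grades the module by height.\<close>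

definition rho_vee :: "complex ^ 4" where "rho_vee = (\<chi> i. if i = 1 then 3 else if i = 2 then 2 else if i = 3 then 1 else 0)"

text \<open>The coefficient of the empty word. In a highest weight module this is the component of the
  corresponding vector in the highest weight space.\<close>

definition lead :: "(complex \<times> mat8 list) list \<Rightarrow> complex" where
  "lead L = (\<Sum>(c, w)\<leftarrow>L. if w = [] then c else 0)"

lemma lead_simps [simp]: "lead [] = 0" "lead ((c, w) # L) = (if w = [] then c else 0) + lead L" "lead (L @ L') = lead L + lead L'"
  by (simp_all add: lead_def)

lemma bracket_neg_height:
  assumes "k \<in> {1..12}"
  shows "\<exists>n>0. bracket (cartan rho_vee) (neg k) = cscale (- of_nat n) (neg k)"
proof (intro exI conjI)
  let ?n = "[5, 3, 4, 1, 2, 3, 2, 3, 1, 2, 1, 1] ! (k - 1) :: nat"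
  show "0 < ?n" using assms unfolding index12 list.set insert_iff empty_iff by (elim disjE; simp)
  have "cartan rho_vee $ fst (root_entry k) $ fst (root_entry k) - cartan rho_vee $ snd (root_entry k) $ snd (root_entry k) = - of_nat ?n"
    using assms unfolding index12 list.set insert_iff empty_iff
    by (elim disjE; simp add: root_entries cartan_nth rho_vee_def)
  then show "bracket (cartan rho_vee) (neg k) = cscale (- of_nat ?n) (neg k)"
    unfolding neg_def bracket_cartan_rootmat by (simp only:)
qed

context hw_module
begin

abbreviation "H \<equiv> \<rho> (cartan rho_vee)"
abbreviation "m0 \<equiv> eval_weight \<mu> rho_vee"

lemma word_weight: "set u \<subseteq> negs \<Longrightarrow> u \<noteq> [] \<Longrightarrow> \<exists>n>0. H (act \<rho> u v) = scale (m0 - of_nat n) (act \<rho> u v)"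
proof (induction u)
  case (Cons E u)
  then obtain k where k: "k \<in> {1..12}" "E = neg k" by auto
  obtain n where n: "n > 0" "bracket (cartan rho_vee) E = cscale (- of_nat n) E"
    using bracket_neg_height[OF k(1)] k(2) by blast
  obtain n' :: nat where n': "H (act \<rho> u v) = scale (m0 - of_nat n') (act \<rho> u v)"
  proof (cases "u = []")
    case True
    then show ?thesis using v_cartan that[of 0] by simp
  next
    case False
    then show ?thesis using Cons that by auto
  qed
  have E: "E \<in> so8" using k neg_so8 by simp
  have m: "act \<rho> u v \<in> W" using act_mem[of u v] Cons.prems negs_so8 v_mem by auto
  have "H (\<rho> E (act \<rho> u v)) = \<rho> E (H (act \<rho> u v)) + \<rho> (bracket (cartan rho_vee) E) (act \<rho> u v)"
    using bracket_rho[OF cartan_so8 E m] by simp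
  also have "\<dots> = scale (m0 - of_nat (n' + n)) (\<rho> E (act \<rho> u v))"
    unfolding n(2) n' rho_scale[OF E m] cscale_rho[OF E m] scale_left_distrib[symmetric]
    by (simp add: algebra_simps)
  finally show ?case using n(1) by (intro exI[of _ "n' + n"]) simp
qed simp

fun proj :: "nat \<Rightarrow> 'v \<Rightarrow> 'v" where
  "proj 0 x = x"
| "proj (Suc K) x = H (proj K x) - scale (m0 - of_nat (Suc K)) (proj K x)"

lemma proj_mem: "x \<in> W \<Longrightarrow> proj K x \<in> W"
  by (induction K) (auto intro!: subspace_diff[OF sub] rho_mem scale_mem cartan_so8)

lemma proj_add: "x \<in> W \<Longrightarrow> y \<in> W \<Longrightarrow> proj K (x + y) = proj K x + proj K y"
  by (induction K) (simp_all add: rho_add cartan_so8 proj_mem scale_right_distrib)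

lemma proj_scale: "x \<in> W \<Longrightarrow> proj K (scale c x) = scale c (proj K x)"
  by (induction K) (simp_all add: rho_scale cartan_so8 proj_mem scale_right_diff_distrib mult.commute)

lemma proj_weight:
  "x \<in> W \<Longrightarrow> H x = scale (m0 - of_nat n) x \<Longrightarrow> proj K x = scale (\<Prod>i=1..K. of_nat i - of_nat n) x"
proof (induction K)
  case (Suc K)
  let ?p = "\<Prod>i=1..K. of_nat i - of_nat n :: complex"
  have IH: "proj K x = scale ?p x" using Suc by blast
  have "proj (Suc K) x = scale ?p (H x) - scale (m0 - of_nat (Suc K)) (scale ?p x)"
    by (simp only: proj.simps IH rho_scale[OF cartan_so8 Suc.prems(1)])
  also have "\<dots> = scale (?p * (m0 - of_nat n) - (m0 - of_nat (Suc K)) * ?p) x"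
    unfolding Suc.prems(2) scale_scale by (rule scale_left_diff_distrib[symmetric])
  also have "?p * (m0 - of_nat n) - (m0 - of_nat (Suc K)) * ?p = (\<Prod>i=1..Suc K. of_nat i - of_nat n)"
    by (simp add: algebra_simps)
  finally show ?case .
qed simp

text \<open>\<open>proj K\<close> annihilates all vectors of height between 1 and \<open>K\<close> below the highest weight and multiplies
  the highest weight vector by \<open>fact K\<close>.\<close>

lemma proj_lincomb:
  "words negs L \<Longrightarrow> \<exists>K0. \<forall>K\<ge>K0. proj K (lincomb \<rho> L v) = scale (lead L * fact K) v"
proof (induction L)
  case Nil
  have "proj K 0 = 0" for K using proj_scale[OF zero_mem, of K 0] by simp
  then show ?case unfolding lincomb_simps(1) lead_simps(1) by (intro exI[of _ 0]) (simp only: mult_zero_left scale_zero_left simp_thms)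
next
  case (Cons a L)
  obtain c u where a: "a = (c, u)" by (cases a)
  have u: "set u \<subseteq> negs" "words negs L" using Cons.prems a by auto
  obtain K0 where K0: "\<And>K. K \<ge> K0 \<Longrightarrow> proj K (lincomb \<rho> L v) = scale (lead L * fact K) v"
    using Cons.IH u by blast
  have m: "act \<rho> u v \<in> W" "lincomb \<rho> L v \<in> W"
    using u negs_so8 v_mem by (auto intro!: act_mem lincomb_mem words_mono[OF u(2)])
  have split: "proj K (lincomb \<rho> (a # L) v) = scale c (proj K (act \<rho> u v)) + proj K (lincomb \<rho> L v)" for K
    by (simp add: a proj_add proj_scale m scale_mem)
  show ?case
  proof (cases "u = []")
    case True
    have "H v = scale (m0 - of_nat 0) v" by (simp add: v_cartan)
    from proj_weight[OF v_mem this] have pv: "proj K v = scale (fact K) v" for K by (simp add: fact_prod)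
    have "proj K (lincomb \<rho> (a # L) v) = scale (lead (a # L) * fact K) v" if "K \<ge> K0" for K
    proof -
      have "proj K (lincomb \<rho> (a # L) v) = scale c (scale (fact K) v) + scale (lead L * fact K) v"
        unfolding split True K0[OF that] foldr.simps id_apply pv ..
      also have "\<dots> = scale ((c + lead L) * fact K) v"
        by (simp only: scale_scale scale_left_distrib distrib_right)
      finally show ?thesis by (simp only: a lead_simps True if_True simp_thms)
    qed
    then show ?thesis by blast
  next
    case False
    obtain n where n: "n > 0" "H (act \<rho> u v) = scale (m0 - of_nat n) (act \<rho> u v)"
      using word_weight[OF u(1) False] by blast
    have z: "proj K (act \<rho> u v) = 0" if "K \<ge> n" for K
      using proj_weight[OF m(1) n(2), of K] that n(1) by (auto simp: prod_zero_iff)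
    have "proj K (lincomb \<rho> (a # L) v) = scale (lead (a # L) * fact K) v" if "K \<ge> max n K0" for K
    proof -
      have "proj K (act \<rho> u v) = 0" "proj K (lincomb \<rho> L v) = scale (lead L * fact K) v"
        using z K0 that by simp_all
      then show ?thesis unfolding split using False by (simp add: a)
    qed
    then show ?thesis by blast
  qed
qed

lemma lead_unique:
  assumes "words negs L" "words negs L'" "lincomb \<rho> L v = lincomb \<rho> L' v"
  shows "lead L = lead L'"
proof -
  obtain K0 where K0: "\<And>K. K \<ge> K0 \<Longrightarrow> proj K (lincomb \<rho> L v) = scale (lead L * fact K) v" using proj_lincomb[OF assms(1)] by blast
  obtain K1 where K1: "\<And>K. K \<ge> K1 \<Longrightarrow> proj K (lincomb \<rho> L' v) = scale (lead L' * fact K) v" using proj_lincomb[OF assms(2)] by blast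
  have "scale (lead L * fact (max K0 K1)) v = scale (lead L' * fact (max K0 K1)) v"
    by (rule trans[OF K0[OF max.cobounded1, symmetric, unfolded assms(3)] K1[OF max.cobounded2]])
  then have "lead L * fact (max K0 K1) = lead L' * fact (max K0 K1)"
    using scale_cancel_right v_nz by blast
  then show ?thesis by (simp only: mult_cancel_right fact_nonzero simp_thms)
qed

end

context cvs
begin

lemma span_words:
  assumes "x \<in> span {act \<rho> w v | w. set w \<subseteq> so8}"
  shows "\<exists>L. words so8 L \<and> x = lincomb \<rho> L v"
  using assms
proof (induction rule: span_induct_alt)
  case base show ?case by (intro exI[of _ "[]"]) simp
next
  case (step c x y)
  then obtain w L where "x = act \<rho> w v" "set w \<subseteq> so8" "words so8 L" "y = lincomb \<rho> L v" by auto
  then show ?case by (intro exI[of _ "(c, w) # L"]) simp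
qed

end

lemma (in hw_module) span_words_invariant:
  assumes x: "x \<in> W" and "X \<in> so8" "y \<in> span {act \<rho> w x | w. set w \<subseteq> so8}"
  shows "\<rho> X y \<in> span {act \<rho> w x | w. set w \<subseteq> so8}" "y \<in> W"
proof -
  obtain L where L: "words so8 L" "y = lincomb \<rho> L x" using span_words[OF assms(3)] by blast
  show "y \<in> W" using L lincomb_mem x by blast
  have e: "\<rho> X y = lincomb \<rho> (map (\<lambda>(c, u). (c, [X] @ u)) L) x"
    using lincomb_prefix[of L "[X]" x] L assms by simp
  have w: "words so8 (map (\<lambda>(c, u). (c, [X] @ u)) L)" using words_prefix[of so8 L "[X]"] L assms by simp
  have s: "lincomb \<rho> L' x \<in> span {act \<rho> w x | w. set w \<subseteq> so8}" if "words so8 L'" for L'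
    using that
  proof (induction L')
    case Nil
    show ?case unfolding lincomb_simps(1) by (rule span_zero)
  next
    case (Cons a L')
    obtain c w where a: "a = (c, w)" by (cases a)
    have "act \<rho> w x \<in> span {act \<rho> w x | w. set w \<subseteq> so8}"
      using Cons.prems a by (intro span_base) auto
    then show ?case using Cons unfolding a lincomb_simps(2)
      by (intro span_add span_scale) auto
  qed
  show "\<rho> X y \<in> span {act \<rho> w x | w. set w \<subseteq> so8}" unfolding e by (rule s[OF w])
qed

text \<open>If \<open>L\<close> annihilates \<open>v\<close> but not \<open>v'\<close>, then irreducibility gives a combination \<open>N\<close> that leads from
  \<open>L v'\<close> back to \<open>v'\<close>. The composite \<open>N L\<close> has leading coefficient 1 in one module and 0 in the other,
  although both are the leading coefficient of the same reduced combination.\<close>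

lemma (in cvs) annihilator_subset:
  assumes M: "hw_module scale \<mu> W \<rho> v" and M': "hw_module scale \<mu> W' \<rho>' v'" and irr: "\<And>U. subspace U \<Longrightarrow> U \<subseteq> W' \<Longrightarrow> \<forall>X\<in>so8. \<forall>u\<in>U. \<rho>' X u \<in> U \<Longrightarrow> U = {0} \<or> U = W'"
    and L: "words so8 L" and zero: "lincomb \<rho> L v = 0"
  shows "lincomb \<rho>' L v' = 0"
proof (rule ccontr)
  interpret A: hw_module scale \<mu> W \<rho> v by (rule M)
  interpret B: hw_module scale \<mu> W' \<rho>' v' by (rule M')
  let ?x = "lincomb \<rho>' L v'"
  assume nz: "?x \<noteq> 0"
  have xW: "?x \<in> W'" using B.lincomb_mem L B.v_mem by blast
  let ?U = "span {act \<rho>' w ?x | w. set w \<subseteq> so8}"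
  have "?U \<subseteq> W'" using B.span_words_invariant(2)[OF xW so8_zero] by blast
  moreover have "\<forall>X\<in>so8. \<forall>u\<in>?U. \<rho>' X u \<in> ?U" using B.span_words_invariant(1)[OF xW] by blast
  moreover have "?x \<in> ?U" by (rule span_base) (rule CollectI, rule exI[of _ "[]"], simp)
  then have "?U \<noteq> {0}" using nz by blast
  ultimately have "?U = W'" using irr[OF subspace_span] by blast
  then have "v' \<in> ?U" using B.v_mem by simp
  then obtain N where N: "words so8 N" "v' = lincomb \<rho>' N ?x" using span_words by blast
  define P where "P = concat (map (\<lambda>(d, w). map (\<lambda>(c, u). (d * c, w @ u)) L) N)"
  have P: "lincomb \<sigma> P z = lincomb \<sigma> N (lincomb \<sigma> L z)" if h: "hw_module scale \<mu> V \<sigma> z" for V \<sigma> z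
  proof -
    interpret C: hw_module scale \<mu> V \<sigma> z by (rule h)
    have "lincomb \<sigma> (map (\<lambda>(c, u). (d * c, w @ u)) L) z = scale d (act \<sigma> w (lincomb \<sigma> L z))" if "set w \<subseteq> so8" for d w
    proof -
      have "map (\<lambda>(c, u). (d * c, w @ u)) L = map (\<lambda>(c, w). (d * c, w)) (map (\<lambda>(c, u). (c, w @ u)) L)" by auto
      then show ?thesis using C.lincomb_prefix[OF L that C.v_mem] by (simp only: lincomb_scaled)
    qed
    then show ?thesis using N(1) unfolding P_def by (induction N) auto
  qed
  have wP: "words so8 P" using N(1) L unfolding P_def words_def by fastforce
  obtain P' where P': "words negs P'" "\<And>V \<sigma> z. hw_module scale \<mu> V \<sigma> z \<Longrightarrow> lincomb \<sigma> P z = lincomb \<sigma> P' z"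
    using reduce[OF wP, of \<mu>] by blast
  have "lincomb \<rho>' P' v' = lincomb \<rho>' [(1, [])] v'" using P'(2)[OF M'] P[OF M'] N(2) by simp
  then have "lead P' = 1" using B.lead_unique[OF P'(1), of "[(1, [])]"] by simp
  moreover have "lincomb \<rho> N 0 = 0"
  proof -
    have "act \<rho> w 0 = 0" if "set w \<subseteq> so8" for w using A.act_scale[OF that A.zero_mem, of 0] by simp
    then show ?thesis using N(1) by (induction N) auto
  qed
  then have "lincomb \<rho> P' v = lincomb \<rho> [] v" using P'(2)[OF M] P[OF M] zero by simp
  then have "lead P' = 0" using A.lead_unique[OF P'(1), of "[]"] by simp
  ultimately show False by simp
qed

section \<open>Matrix representations\<close>

type_synonym matrep = "mat8 \<Rightarrow> nat \<Rightarrow> nat \<Rightarrow> complex"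

definition pact :: "nat set \<Rightarrow> matrep \<Rightarrow> mat8 \<Rightarrow> (nat \<Rightarrow> pol) \<Rightarrow> nat \<Rightarrow> pol" where
  "pact S \<pi> X G = (\<lambda>i. if i \<in> S then \<Sum>j\<in>S. pscale (\<pi> X i j) (G j) else 0)"

definition mact :: "nat set \<Rightarrow> matrep \<Rightarrow> mat8 \<Rightarrow> cseq \<Rightarrow> cseq" where
  "mact S \<pi> X f = (\<lambda>i. if i \<in> S then \<Sum>j\<in>S. \<pi> X i j * f j else 0)"

lemma lookup_pact: "Poly_Mapping.lookup (pact S \<pi> X G i) q = mact S \<pi> X (\<lambda>j. Poly_Mapping.lookup (G j) q) i"
  by (simp add: pact_def mact_def lookup_sum)

lemma lookup_pact_pow:
  "Poly_Mapping.lookup ((pact S \<pi> X ^^ n) G i) q = (mact S \<pi> X ^^ n) (\<lambda>j. Poly_Mapping.lookup (G j) q) i"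
  by (induction n arbitrary: i) (simp_all add: lookup_pact)

lemma pscale_mult: "pscale c (F * G) = F * pscale c G" "pscale c (F * G) = pscale c F * G"
  by (simp_all add: pscale_def ac_simps)

lemma pact_mult: "pact S \<pi> X (\<lambda>i. F * G i) i = F * pact S \<pi> X G i"
  by (simp add: pact_def sum_distrib_left pscale_mult(1))

lemma pact_sum: "pact S \<pi> X (\<lambda>i. \<Sum>a\<in>A. G a i) i = (\<Sum>a\<in>A. pact S \<pi> X (G a) i)"
proof (cases "i \<in> S")
  case True
  have "(\<Sum>j\<in>S. \<Sum>a\<in>A. pscale (\<pi> X i j) (G a j)) = (\<Sum>a\<in>A. \<Sum>j\<in>S. pscale (\<pi> X i j) (G a j))"
    by (rule sum.swap)
  then show ?thesis using True by (simp add: pact_def pol.scale_sum_right)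
qed (simp add: pact_def)

lemma pact_scale: "pact S \<pi> X (\<lambda>i. pscale c (G i)) i = pscale c (pact S \<pi> X G i)"
  by (simp add: pact_def pol.scale_sum_right mult.commute)

text \<open>The divided powers of \<open>X\<close> with the variable \<open>y\<close>; their sum is $\exp(y X)$.\<close>

definition dpow :: "nat set \<Rightarrow> matrep \<Rightarrow> mat8 \<Rightarrow> pol \<Rightarrow> nat \<Rightarrow> (nat \<Rightarrow> pol) \<Rightarrow> nat \<Rightarrow> pol" where
  "dpow S \<pi> X y n G = (\<lambda>i. pscale (1 / fact n) (y ^ n * (pact S \<pi> X ^^ n) G i))"

lemma dpow_0 [simp]: "dpow S \<pi> X y 0 G = G"
  by (simp add: dpow_def)

lemma dpow_Suc: "pscale (of_nat (Suc n)) (dpow S \<pi> X y (Suc n) G i) = y * pact S \<pi> X (dpow S \<pi> X y n G) i"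
proof -
  have "y * pact S \<pi> X (dpow S \<pi> X y n G) i = pscale (1 / fact n) (y ^ Suc n * (pact S \<pi> X ^^ Suc n) G i)"
    unfolding dpow_def pact_scale pact_mult by (simp add: pscale_mult(1) mult.assoc)
  then show ?thesis by (simp add: dpow_def del: of_nat_Suc)
qed

text \<open>The tensor product of spaces with bases \<open>S\<close> and \<open>S'\<close> has a basis indexed by pairs, encoded as
  numbers.\<close>

definition tset :: "nat set \<Rightarrow> nat set \<Rightarrow> nat set" where "tset S S' = prod_encode ` (S \<times> S')"
definition trep :: "matrep \<Rightarrow> matrep \<Rightarrow> matrep" where
  "trep \<pi> \<pi>' X m n = (case prod_decode m of (i, i') \<Rightarrow> case prod_decode n of (j, j') \<Rightarrow>
     (if i' = j' then \<pi> X i j else 0) + (if i = j then \<pi>' X i' j' else 0))"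
definition tens :: "(nat \<Rightarrow> 'a::times) \<Rightarrow> (nat \<Rightarrow> 'a) \<Rightarrow> nat \<Rightarrow> 'a" where
  "tens G G' m = G (fst (prod_decode m)) * G' (snd (prod_decode m))"

lemma tens_encode [simp]: "tens G G' (prod_encode (i, j)) = G i * G' j"
  by (simp add: tens_def)

lemma sum_tset: "(\<Sum>m\<in>tset S S'. f m) = (\<Sum>i\<in>S. \<Sum>j\<in>S'. f (prod_encode (i, j)))"
  unfolding tset_def by (subst sum.reindex) (auto simp: inj_on_def sum.cartesian_product)

lemma in_tset: "prod_encode (i, j) \<in> tset S S' \<longleftrightarrow> i \<in> S \<and> j \<in> S'"
  by (auto simp: tset_def)

lemma tset_cases: "m \<in> tset S S' \<Longrightarrow> (\<And>i j. i \<in> S \<Longrightarrow> j \<in> S' \<Longrightarrow> m = prod_encode (i, j) \<Longrightarrow> P) \<Longrightarrow> P"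
  by (auto simp: tset_def)

lemma pact_tens:
  assumes "finite S" "finite S'" "\<And>i. i \<notin> S \<Longrightarrow> G i = 0" "\<And>i. i \<notin> S' \<Longrightarrow> G' i = 0"
  shows "pact (tset S S') (trep \<pi> \<pi>') X (tens G G') = (\<lambda>m. tens (pact S \<pi> X G) G' m + tens G (pact S' \<pi>' X G') m)"
proof
  fix m
  obtain i i' where m: "m = prod_encode (i, i')" by (metis prod_decode_inverse surj_pair)
  show "pact (tset S S') (trep \<pi> \<pi>') X (tens G G') m = tens (pact S \<pi> X G) G' m + tens G (pact S' \<pi>' X G') m"
  proof (cases "i \<in> S \<and> i' \<in> S'")
    case True
    have "pact (tset S S') (trep \<pi> \<pi>') X (tens G G') m =
      (\<Sum>j\<in>S. \<Sum>j'\<in>S'. (if i' = j' then pscale (\<pi> X i j) (G j * G' j') else 0) + (if i = j then pscale (\<pi>' X i' j') (G j * G' j') else 0))"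
      using True by (simp add: pact_def m in_tset sum_tset trep_def pol.scale_left_distrib if_distrib[of "\<lambda>c. pscale c _"] cong: if_cong)
    also have "\<dots> = (\<Sum>j\<in>S. pscale (\<pi> X i j) (G j * G' i')) + (\<Sum>j'\<in>S'. pscale (\<pi>' X i' j') (G i * G' j'))"
      using True assms by (simp add: sum.distrib sum.swap[of _ S' S] sum.delta' sum.delta)
    also have "\<dots> = (\<Sum>j\<in>S. pscale (\<pi> X i j) (G j) * G' i') + (\<Sum>j'\<in>S'. G i * pscale (\<pi>' X i' j') (G' j'))"
      by (intro arg_cong2[where f = "(+)"] sum.cong refl) (rule pscale_mult(2), rule pscale_mult(1))
    also have "\<dots> = tens (pact S \<pi> X G) G' m + tens G (pact S' \<pi>' X G') m"
      using True by (simp add: m pact_def[of S] pact_def[of S'] sum_distrib_left sum_distrib_right)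
    finally show ?thesis .
  next
    case False
    then show ?thesis using assms(3,4) by (auto simp: pact_def m in_tset)
  qed
qed

lemma pact_supp: "i \<notin> S \<Longrightarrow> pact S \<pi> X G i = 0"
  by (simp add: pact_def)

lemma dpow_supp: "(\<And>i. i \<notin> S \<Longrightarrow> G i = 0) \<Longrightarrow> i \<notin> S \<Longrightarrow> dpow S \<pi> X y n G i = 0"
  by (cases n) (simp_all add: dpow_def pact_supp)

lemma leibniz_sum:
  fixes d d' :: "nat \<Rightarrow> pol"
  shows "(\<Sum>a\<le>n. pscale (of_nat (Suc a)) (d (Suc a)) * d' (n - a) + d a * pscale (of_nat (Suc (n - a))) (d' (Suc (n - a))))
    = pscale (of_nat (Suc n)) (\<Sum>a\<le>Suc n. d a * d' (Suc n - a))"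
proof -
  have 1: "(\<Sum>a\<le>n. pscale (of_nat (Suc a)) (d (Suc a)) * d' (n - a)) = (\<Sum>a\<le>Suc n. pscale (of_nat a) (d a * d' (Suc n - a)))"
    by (subst sum.atMost_Suc_shift) (simp add: pscale_mult(2))
  have 2: "(\<Sum>a\<le>n. d a * pscale (of_nat (Suc (n - a))) (d' (Suc (n - a)))) = (\<Sum>a\<le>Suc n. pscale (of_nat (Suc n - a)) (d a * d' (Suc n - a)))"
  proof -
    have "(\<Sum>a\<le>Suc n. pscale (of_nat (Suc n - a)) (d a * d' (Suc n - a))) = (\<Sum>a\<le>n. pscale (of_nat (Suc n - a)) (d a * d' (Suc n - a)))"
      by (simp del: of_nat_diff)
    also have "\<dots> = (\<Sum>a\<le>n. d a * pscale (of_nat (Suc (n - a))) (d' (Suc (n - a))))"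
      by (intro sum.cong refl) (simp add: pscale_mult(1) Suc_diff_le del: of_nat_Suc of_nat_diff)
    finally show ?thesis by (rule sym)
  qed
  have "pscale (of_nat a) F + pscale (of_nat (Suc n - a)) F = pscale (of_nat (Suc n)) F" if "a \<le> Suc n" for a F
    using that by (simp add: pol.scale_left_distrib[symmetric] of_nat_add[symmetric] del: of_nat_add of_nat_Suc)
  then show ?thesis
    unfolding sum.distrib 1 2 pol.scale_sum_right by (simp add: sum.distrib[symmetric] del: sum.atMost_Suc of_nat_Suc)
qed

lemma dpow_tens:
  assumes "finite S" "finite S'" "\<And>i. i \<notin> S \<Longrightarrow> G i = 0" "\<And>i. i \<notin> S' \<Longrightarrow> G' i = 0"
  shows "dpow (tset S S') (trep \<pi> \<pi>') X y n (tens G G') m =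
     (\<Sum>a\<le>n. tens (dpow S \<pi> X y a G) (dpow S' \<pi>' X y (n - a) G') m)"
proof (induction n arbitrary: m)
  case (Suc n)
  let ?T = "tset S S'" and ?p = "trep \<pi> \<pi>'" and ?D = "\<lambda>a. dpow S \<pi> X y a G" and ?D' = "\<lambda>a. dpow S' \<pi>' X y a G'"
  obtain i i' where m: "m = prod_encode (i, i')" by (metis prod_decode_inverse surj_pair)
  have "pscale (of_nat (Suc n)) (dpow ?T ?p X y (Suc n) (tens G G') m) = y * pact ?T ?p X (dpow ?T ?p X y n (tens G G')) m"
    by (rule dpow_Suc)
  also have "dpow ?T ?p X y n (tens G G') = (\<lambda>m. \<Sum>a\<le>n. tens (?D a) (?D' (n - a)) m)"
    using Suc.IH by blast
  also have "pact ?T ?p X (\<lambda>m. \<Sum>a\<le>n. tens (?D a) (?D' (n - a)) m) m = (\<Sum>a\<le>n. pact ?T ?p X (tens (?D a) (?D' (n - a))) m)"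
    by (rule pact_sum)
  also have "\<dots> = (\<Sum>a\<le>n. pact S \<pi> X (?D a) i * ?D' (n - a) i' + ?D a i * pact S' \<pi>' X (?D' (n - a)) i')"
    using assms by (intro sum.cong refl) (simp add: pact_tens dpow_supp m)
  also have "y * \<dots> = (\<Sum>a\<le>n. pscale (of_nat (Suc a)) (?D (Suc a) i) * ?D' (n - a) i' + ?D a i * pscale (of_nat (Suc (n - a))) (?D' (Suc (n - a)) i'))"
    unfolding dpow_Suc by (simp add: sum_distrib_left algebra_simps)
  also have "\<dots> = pscale (of_nat (Suc n)) (\<Sum>a\<le>Suc n. ?D a i * ?D' (Suc n - a) i')"
    by (rule leibniz_sum)
  finally show ?case unfolding m tens_encode
    by (simp only: pol.scale_cancel_left of_nat_eq_0_iff nat.distinct simp_thms)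
qed simp

definition nilrep :: "nat set \<Rightarrow> matrep \<Rightarrow> nat \<Rightarrow> bool" where
  "nilrep S \<pi> N \<longleftrightarrow> (\<forall>k\<in>{1..12}. \<forall>G i. (pact S \<pi> (neg k) ^^ N) G i = 0)"

lemma pact_zero: "pact S \<pi> X (\<lambda>i. 0) = (\<lambda>i. 0)"
  by (simp add: pact_def fun_eq_iff)

lemma nilrep_ge: "nilrep S \<pi> N \<Longrightarrow> k \<in> {1..12} \<Longrightarrow> n \<ge> N \<Longrightarrow> (pact S \<pi> (neg k) ^^ n) G i = 0"
proof -
  assume n: "nilrep S \<pi> N" "k \<in> {1..12}" "n \<ge> N"
  have z: "(pact S \<pi> (neg k) ^^ N) G = (\<lambda>i. 0)" using n by (simp add: nilrep_def fun_eq_iff)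
  have "(pact S \<pi> (neg k) ^^ n) G = (pact S \<pi> (neg k) ^^ (n - N)) ((pact S \<pi> (neg k) ^^ N) G)"
    using n(3) by (metis funpow_add le_add_diff_inverse2 comp_apply)
  also have "\<dots> = (\<lambda>i. 0)" 
  proof -
    have "(pact S \<pi> (neg k) ^^ m) (\<lambda>i. 0) = (\<lambda>i. 0)" for m
      by (induction m) (simp_all add: pact_zero)
    then show ?thesis unfolding z by blast
  qed
  finally show ?thesis by simp
qed

lemma dpow_nil: "nilrep S \<pi> N \<Longrightarrow> k \<in> {1..12} \<Longrightarrow> n \<ge> N \<Longrightarrow> dpow S \<pi> (neg k) y n G i = 0"
  by (simp add: dpow_def nilrep_ge)

text \<open>The exponential $\exp(x_k e_{-\alpha_k})$, applied to a vector with polynomial entries. The sum can be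
  cut off at \<open>N\<close> when the \<open>N\<close>-th powers of the root vectors vanish.\<close>

definition Phi :: "nat set \<Rightarrow> matrep \<Rightarrow> nat \<Rightarrow> nat \<Rightarrow> (nat \<Rightarrow> pol) \<Rightarrow> nat \<Rightarrow> pol" where
  "Phi S \<pi> N k G = (\<lambda>i. \<Sum>n<N. dpow S \<pi> (neg k) (var k) n G i)"

lemma Phi_supp: "(\<And>i. i \<notin> S \<Longrightarrow> G i = 0) \<Longrightarrow> i \<notin> S \<Longrightarrow> Phi S \<pi> N k G i = 0"
  by (simp add: Phi_def dpow_supp)

lemma Phi_tens:
  assumes f: "finite S" "finite S'" "\<And>i. i \<notin> S \<Longrightarrow> G i = 0" "\<And>i. i \<notin> S' \<Longrightarrow> G' i = 0"
    and nil: "nilrep S \<pi> N" "nilrep S' \<pi>' N'" and k: "k \<in> {1..12}"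
  shows "Phi (tset S S') (trep \<pi> \<pi>') (N + N') k (tens G G') = tens (Phi S \<pi> N k G) (Phi S' \<pi>' N' k G')"
proof
  fix m
  obtain i i' where m: "m = prod_encode (i, i')" by (metis prod_decode_inverse surj_pair)
  let ?d = "\<lambda>a. dpow S \<pi> (neg k) (var k) a G i" and ?d' = "\<lambda>a. dpow S' \<pi>' (neg k) (var k) a G' i'"
  have "Phi (tset S S') (trep \<pi> \<pi>') (N + N') k (tens G G') m = (\<Sum>n<N + N'. \<Sum>a\<le>n. ?d a * ?d' (n - a))"
  proof -
    have "dpow (tset S S') (trep \<pi> \<pi>') (neg k) (var k) n (tens G G') m = (\<Sum>a\<le>n. ?d a * ?d' (n - a))" for n
      using dpow_tens[OF f, where m = m and n = n] by (simp add: m)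
    then show ?thesis unfolding Phi_def by (rule sum.cong[OF refl])
  qed
  also have "\<dots> = (\<Sum>(a, b)\<in>{(a, b). a + b < N + N'}. ?d a * ?d' b)"
    by (rule sum.triangle_reindex[symmetric])
  also have "\<dots> = (\<Sum>(a, b)\<in>{..<N} \<times> {..<N'}. ?d a * ?d' b)"
  proof (rule sum.mono_neutral_right)
    show "finite {(a, b). a + b < N + N'}"
      by (rule finite_subset[of _ "{..<N + N'} \<times> {..<N + N'}"]) auto
    show "{..<N} \<times> {..<N'} \<subseteq> {(a, b). a + b < N + N'}" by auto
    have "a < N" if "?d a \<noteq> 0" for a using dpow_nil[OF nil(1) k, of a] that by (meson not_less)
    moreover have "b < N'" if "?d' b \<noteq> 0" for b using dpow_nil[OF nil(2) k, of b] that by (meson not_less)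
    ultimately show "\<forall>x\<in>{(a, b). a + b < N + N'} - {..<N} \<times> {..<N'}. (case x of (a, b) \<Rightarrow> ?d a * ?d' b) = 0"
      by auto
  qed
  also have "\<dots> = (\<Sum>a<N. ?d a) * (\<Sum>b<N'. ?d' b)"
    by (simp add: sum_product sum.cartesian_product)
  finally show "Phi (tset S S') (trep \<pi> \<pi>') (N + N') k (tens G G') m = tens (Phi S \<pi> N k G) (Phi S' \<pi>' N' k G') m"
    by (simp add: m Phi_def)
qed

text \<open>The coordinates of $\exp(x_1 e_{-\alpha_1}) \cdots \exp(x_{12} e_{-\alpha_{12}}) v$.\<close>

definition gen :: "nat set \<Rightarrow> matrep \<Rightarrow> nat \<Rightarrow> cseq \<Rightarrow> nat \<Rightarrow> pol" where
  "gen S \<pi> N v = foldr (Phi S \<pi> N) [1..<13] (\<lambda>i. Poly_Mapping.single 0 (v i))"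

text \<open>Root vectors act on a tensor product as derivations, so their exponentials act diagonally, and the
  coordinates of the tensor product are the products of the coordinates of the factors.\<close>

lemma gen_tens:
  assumes f: "finite S" "finite S'" "\<And>i. i \<notin> S \<Longrightarrow> v i = 0" "\<And>i. i \<notin> S' \<Longrightarrow> v' i = 0"
    and nil: "nilrep S \<pi> N" "nilrep S' \<pi>' N'"
  shows "gen (tset S S') (trep \<pi> \<pi>') (N + N') (tens v v') = tens (gen S \<pi> N v) (gen S' \<pi>' N' v')"
proof -
  have main: "foldr (Phi (tset S S') (trep \<pi> \<pi>') (N + N')) ks (tens G G') = tens (foldr (Phi S \<pi> N) ks G) (foldr (Phi S' \<pi>' N') ks G')
      \<and> (\<forall>i. i \<notin> S \<longrightarrow> foldr (Phi S \<pi> N) ks G i = 0) \<and> (\<forall>i. i \<notin> S' \<longrightarrow> foldr (Phi S' \<pi>' N') ks G' i = 0)"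
    if "set ks \<subseteq> {1..12}" "\<And>i. i \<notin> S \<Longrightarrow> G i = 0" "\<And>i. i \<notin> S' \<Longrightarrow> G' i = 0" for ks G G'
    using that
  proof (induction ks)
    case (Cons k ks)
    then show ?case using Phi_tens[OF f(1,2) _ _ nil, of "foldr (Phi S \<pi> N) ks G" "foldr (Phi S' \<pi>' N') ks G'" k]
      by (auto intro: Phi_supp)
  qed simp
  have "foldr (Phi (tset S S') (trep \<pi> \<pi>') (N + N')) [1..<13] (tens (\<lambda>i. Poly_Mapping.single 0 (v i)) (\<lambda>i. Poly_Mapping.single 0 (v' i)))
     = tens (gen S \<pi> N v) (gen S' \<pi>' N' v')"
    unfolding gen_def by (rule conjunct1[OF main]) (use f(3,4) in auto)
  moreover have "(\<lambda>m. Poly_Mapping.single 0 (tens v v' m)) = tens (\<lambda>i. Poly_Mapping.single 0 (v i) :: pol) (\<lambda>i. Poly_Mapping.single 0 (v' i))"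
    by (simp add: tens_def mult_single fun_eq_iff)
  ultimately show ?thesis unfolding gen_def by simp
qed

lemma nilrep_tens:
  assumes f: "finite S" "finite S'" and nil: "nilrep S \<pi> N" "nilrep S' \<pi>' N'"
  shows "nilrep (tset S S') (trep \<pi> \<pi>') (N + N')"
  unfolding nilrep_def
proof (intro ballI allI)
  fix k :: nat and G :: "nat \<Rightarrow> pol" and m assume k: "k \<in> {1..12}"
  let ?T = "tset S S'" and ?p = "trep \<pi> \<pi>'"
  let ?M = "pact ?T ?p (neg k) ^^ (N + N')"
  define e :: "nat \<Rightarrow> nat \<Rightarrow> pol" where "e i j = (if j = i then 1 else 0)" for i j
  define g where "g i j = (if j \<in> S' then G (prod_encode (i, j)) else 0)" for i j
  have z: "(pact ?T ?p (neg k) ^^ (N + N')) (tens (e i) (g i)) m = 0" if "i \<in> S" for i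
  proof -
    have "dpow ?T ?p (neg k) 1 (N + N') (tens (e i) (g i)) m
       = (\<Sum>a\<le>N + N'. tens (dpow S \<pi> (neg k) 1 a (e i)) (dpow S' \<pi>' (neg k) 1 (N + N' - a) (g i)) m)"
      by (rule dpow_tens[OF f]) (use that in \<open>auto simp: e_def g_def\<close>)
    also have "\<dots> = 0"
    proof (rule sum.neutral, rule ballI)
      fix a assume "a \<in> {..N + N'}"
      show "tens (dpow S \<pi> (neg k) 1 a (e i)) (dpow S' \<pi>' (neg k) 1 (N + N' - a) (g i)) m = 0"
        using dpow_nil[OF nil(1) k, of a] dpow_nil[OF nil(2) k, of "N + N' - a"]
        by (cases "N \<le> a") (auto simp: tens_def)
    qed
    finally show ?thesis by (simp add: dpow_def)
  qed
  have lin: "(pact ?T ?p (neg k) ^^ n) (\<lambda>m. \<Sum>i\<in>S. H i m) = (\<lambda>m. \<Sum>i\<in>S. (pact ?T ?p (neg k) ^^ n) (H i) m)" for n H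
  proof (induction n)
    case (Suc n)
    show ?case unfolding funpow.simps comp_apply Suc by (rule ext) (rule pact_sum)
  qed simp
  have agree: "pact ?T ?p (neg k) G = pact ?T ?p (neg k) G'" if "\<And>m. m \<in> ?T \<Longrightarrow> G m = G' m" for G G'
    using that by (auto simp: pact_def fun_eq_iff intro!: sum.cong)
  have dec: "G m = (\<Sum>i\<in>S. tens (e i) (g i) m)" if "m \<in> ?T" for m
    using that f(1) by (auto simp: tset_def e_def g_def if_distrib[of "\<lambda>x. x * _"] cong: if_cong)
  show "?M G m = 0"
  proof (cases "N + N'")
    case 0
    then have "N = 0" "N' = 0" by auto
    have "(pact S \<pi> (neg k) ^^ N) (\<lambda>_. 1) 0 = 0" using nil(1) k unfolding nilrep_def by blast
    then show ?thesis using \<open>N = 0\<close> by simp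
  next
    case (Suc n)
    have "?M G = ?M (\<lambda>m. \<Sum>i\<in>S. tens (e i) (g i) m)"
      unfolding Suc funpow_Suc_right comp_apply using agree[OF dec] by simp
    then show ?thesis unfolding lin using z by simp
  qed
qed

section \<open>Concrete models and their cyclic submodules\<close>

text \<open>The last condition says that the representation is unitary for the compact real form. It makes
  submodules have invariant complements.\<close>

definition matrix_rep :: "nat set \<Rightarrow> matrep \<Rightarrow> bool" where
  "matrix_rep S \<pi> \<longleftrightarrow> finite S \<and>
     (\<forall>X\<in>so8. \<forall>Y\<in>so8. \<forall>i\<in>S. \<forall>j\<in>S. \<pi> (X + Y) i j = \<pi> X i j + \<pi> Y i j) \<and>
     (\<forall>X\<in>so8. \<forall>c. \<forall>i\<in>S. \<forall>j\<in>S. \<pi> (cscale c X) i j = c * \<pi> X i j) \<and>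
     (\<forall>X\<in>so8. \<forall>Y\<in>so8. \<forall>i\<in>S. \<forall>j\<in>S. \<pi> (bracket X Y) i j = (\<Sum>k\<in>S. \<pi> X i k * \<pi> Y k j - \<pi> Y i k * \<pi> X k j)) \<and>
     (\<forall>X\<in>so8. \<forall>i\<in>S. \<forall>j\<in>S. \<pi> (herm X) i j = cnj (\<pi> X j i))"

definition hw_vec :: "nat set \<Rightarrow> matrep \<Rightarrow> rat ^ 4 \<Rightarrow> cseq \<Rightarrow> bool" where
  "hw_vec S \<pi> \<mu> v \<longleftrightarrow> (\<forall>i. i \<notin> S \<longrightarrow> v i = 0) \<and> (\<exists>i. v i \<noteq> 0) \<and>
     (\<forall>x i. mact S \<pi> (cartan x) v i = eval_weight \<mu> x * v i) \<and>
     (\<forall>k\<in>{1..12}. \<forall>i. mact S \<pi> (pos k) v i = 0)"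

lemma exists_other:
  assumes "z \<in> U" "U \<noteq> {z}" obtains u where "u \<in> U" "u \<noteq> z"
  using assms by auto

locale model =
  fixes S \<pi> N \<mu> v
  assumes rep: "matrix_rep S \<pi>" and nil: "nilrep S \<pi> N" and hwv: "hw_vec S \<pi> \<mu> v"
begin

abbreviation "\<rho> \<equiv> mact S \<pi>"
abbreviation "full \<equiv> {f :: cseq. \<forall>i. i \<notin> S \<longrightarrow> f i = 0}"

lemma fin: "finite S"
  using rep by (simp add: matrix_rep_def)

lemma mact_bracket:
  assumes "X \<in> so8" "Y \<in> so8"
  shows "\<rho> (bracket X Y) f i = \<rho> X (\<rho> Y f) i - \<rho> Y (\<rho> X f) i"
proof (cases "i \<in> S")
  case True
  have "\<rho> (bracket X Y) f i = (\<Sum>j\<in>S. (\<Sum>k\<in>S. \<pi> X i k * \<pi> Y k j - \<pi> Y i k * \<pi> X k j) * f j)"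
    using True assms rep by (simp add: mact_def matrix_rep_def)
  also have "\<dots> = (\<Sum>j\<in>S. \<Sum>k\<in>S. \<pi> X i k * (\<pi> Y k j * f j)) - (\<Sum>j\<in>S. \<Sum>k\<in>S. \<pi> Y i k * (\<pi> X k j * f j))"
    by (simp add: sum_distrib_right sum_subtractf left_diff_distrib mult.assoc)
  also have "(\<Sum>j\<in>S. \<Sum>k\<in>S. \<pi> X i k * (\<pi> Y k j * f j)) = (\<Sum>k\<in>S. \<Sum>j\<in>S. \<pi> X i k * (\<pi> Y k j * f j))"
    by (rule sum.swap)
  also have "(\<Sum>j\<in>S. \<Sum>k\<in>S. \<pi> Y i k * (\<pi> X k j * f j)) = (\<Sum>k\<in>S. \<Sum>j\<in>S. \<pi> Y i k * (\<pi> X k j * f j))"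
    by (rule sum.swap)
  finally show ?thesis using True by (simp add: mact_def sum_distrib_left)
qed (simp add: mact_def)

lemma full_module: "hw_module seq_scale \<mu> full \<rho> v"
proof
  show "cseq.subspace full" by (auto simp: cseq.subspace_def seq_scale_def)
  fix X Y :: mat8 and w w' :: cseq and c :: complex
  show "w \<in> full \<Longrightarrow> \<rho> X w \<in> full" by (simp add: mact_def)
  show "\<rho> X (w + w') = \<rho> X w + \<rho> X w'"
    by (rule ext) (simp add: mact_def sum.distrib distrib_left)
  show "\<rho> X (seq_scale c w) = seq_scale c (\<rho> X w)"
    by (rule ext) (simp add: mact_def seq_scale_def sum_distrib_left mult.left_commute)
  show "X \<in> so8 \<Longrightarrow> Y \<in> so8 \<Longrightarrow> \<rho> (X + Y) w = \<rho> X w + \<rho> Y w"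
    using rep by (intro ext) (simp add: mact_def matrix_rep_def sum.distrib distrib_right)
  show "X \<in> so8 \<Longrightarrow> \<rho> (cscale c X) w = seq_scale c (\<rho> X w)"
    using rep by (intro ext) (simp add: mact_def matrix_rep_def seq_scale_def sum_distrib_left mult.assoc)
  show "X \<in> so8 \<Longrightarrow> Y \<in> so8 \<Longrightarrow> \<rho> (bracket X Y) w = \<rho> X (\<rho> Y w) - \<rho> Y (\<rho> X w)"
    by (rule ext) (simp only: mact_bracket minus_apply)
  show "v \<in> full" using hwv by (simp add: hw_vec_def)
  show "v \<noteq> 0" using hwv by (auto simp: hw_vec_def)
  show "\<rho> (cartan x) v = seq_scale (eval_weight \<mu> x) v" for x
    using hwv by (intro ext) (simp add: hw_vec_def seq_scale_def)
  show "\<rho> (pos k) v = 0" if "k \<in> {1..12}" for k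
    using hwv that by (intro ext) (simp add: hw_vec_def)
qed

sublocale hw_module seq_scale \<mu> full \<rho> v by (rule full_module)

definition ip :: "cseq \<Rightarrow> cseq \<Rightarrow> complex" where "ip f g = (\<Sum>i\<in>S. f i * cnj (g i))"

lemma ip_adjoint:
  assumes "X \<in> so8" shows "ip (\<rho> X f) g = ip f (\<rho> (herm X) g)"
proof -
  have "ip (\<rho> X f) g = (\<Sum>i\<in>S. \<Sum>j\<in>S. \<pi> X i j * f j * cnj (g i))"
    by (simp add: ip_def mact_def sum_distrib_right)
  also have "\<dots> = (\<Sum>j\<in>S. \<Sum>i\<in>S. \<pi> X i j * f j * cnj (g i))"
    by (rule sum.swap)
  also have "\<dots> = ip f (\<rho> (herm X) g)"
    using assms rep by (simp add: ip_def mact_def matrix_rep_def sum_distrib_left ac_simps)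
  finally show ?thesis .
qed

lemma herm_herm [simp]: "herm (herm X) = X"
  by (simp add: herm_def vec_eq_iff)

lemma ip_act: "set w \<subseteq> so8 \<Longrightarrow> ip (act \<rho> w f) g = ip f (act \<rho> (rev (map herm w)) g)"
  by (induction w arbitrary: g) (simp_all add: ip_adjoint)

lemma ip_add: "ip (f + f') g = ip f g + ip f' g" "ip g (f + f') = ip g f + ip g f'"
  by (simp_all add: ip_def sum.distrib distrib_left distrib_right)

lemma ip_scale: "ip (seq_scale c f) g = c * ip f g" "ip g (seq_scale c f) = cnj c * ip g f"
  by (simp_all add: ip_def seq_scale_def sum_distrib_left ac_simps)

lemma ip_zero: "ip 0 g = 0" "ip g 0 = 0"
  by (simp_all add: ip_def)

lemma ip_self: assumes "f \<in> full" "f \<noteq> 0" shows "ip f f \<noteq> 0"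
proof -
  obtain i where i: "f i \<noteq> 0" using assms(2) by (metis ext zero_fun_apply)
  then have iS: "i \<in> S" using assms(1) by auto
  have "ip f f = of_real (\<Sum>i\<in>S. (cmod (f i))\<^sup>2)"
    unfolding ip_def of_real_sum by (rule sum.cong[OF refl]) (rule complex_norm_square[symmetric])
  moreover have "0 < (\<Sum>i\<in>S. (cmod (f i))\<^sup>2)"
    using i iS fin by (intro sum_pos2[of _ i]) auto
  ultimately show ?thesis by (simp only: of_real_eq_0_iff less_imp_neq[symmetric] not_False_eq_True)
qed

definition "cyc = cseq.span {act \<rho> w v | w. set w \<subseteq> so8}"

lemma cyc_full: "cyc \<subseteq> full"
  using span_words_invariant(2)[OF v_mem so8_zero] unfolding cyc_def by blast

lemma cyc_invariant: "X \<in> so8 \<Longrightarrow> y \<in> cyc \<Longrightarrow> \<rho> X y \<in> cyc"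
  using span_words_invariant(1)[OF v_mem] unfolding cyc_def by blast

lemma act_cyc: "set w \<subseteq> so8 \<Longrightarrow> act \<rho> w v \<in> cyc"
  unfolding cyc_def by (rule cseq.span_base) blast

lemma v_cyc: "v \<in> cyc"
  using act_cyc[of "[]"] by simp

lemma cyc_module: "is_module cyc \<rho>"
proof -
  have "\<exists>B. finite B \<and> cseq.span B = cyc"
  proof -
    obtain B where B: "B \<subseteq> cyc" "cseq.independent B" "cyc \<subseteq> cseq.span B"
      using cseq.maximal_independent_subset by blast
    let ?e = "\<lambda>i. (\<lambda>j. if j = i then 1 else 0) :: cseq"
    have "f \<in> cseq.span (?e ` S)" if "f \<in> full" for f
    proof -
      have "f = (\<Sum>i\<in>S. seq_scale (f i) (?e i))"
      proof
        fix j
        have "(\<Sum>i\<in>A. seq_scale (f i) (?e i)) j = (\<Sum>i\<in>A. seq_scale (f i) (?e i) j)" for A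
          by (induction A rule: infinite_finite_induct) simp_all
        then show "f j = (\<Sum>i\<in>S. seq_scale (f i) (?e i)) j"
          using that fin by (simp add: seq_scale_def if_distrib[of "\<lambda>x. _ * x"] cong: if_cong)
      qed
      also have "\<dots> \<in> cseq.span (?e ` S)"
        by (intro cseq.span_sum cseq.span_scale cseq.span_base) blast
      finally show ?thesis .
    qed
    then have "B \<subseteq> cseq.span (?e ` S)" using B(1) cyc_full by blast
    then have "finite B" using cseq.independent_span_bound[OF _ B(2)] fin by blast
    moreover have "cseq.span B = cyc"
      using B cseq.span_minimal[of B cyc] cseq.subspace_span unfolding cyc_def by blast
    ultimately show ?thesis by blast
  qed
  moreover have "cseq.subspace cyc" unfolding cyc_def by (rule cseq.subspace_span)
  moreover have "\<rho> X w \<in> cyc" if "X \<in> so8" "w \<in> cyc" for X w by (rule cyc_invariant[OF that])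
  moreover have "\<rho> X (w + w') = \<rho> X w + \<rho> X w'" if "X \<in> so8" "w \<in> cyc" "w' \<in> cyc" for X w w'
    by (rule rho_add[OF that(1) subsetD[OF cyc_full that(2)] subsetD[OF cyc_full that(3)]])
  moreover have "\<rho> X (seq_scale c w) = seq_scale c (\<rho> X w)" if "X \<in> so8" "w \<in> cyc" for X c w
    by (rule rho_scale[OF that(1) subsetD[OF cyc_full that(2)]])
  moreover have "\<rho> (X + Y) w = \<rho> X w + \<rho> Y w" if "X \<in> so8" "Y \<in> so8" "w \<in> cyc" for X Y w
    by (rule add_rho[OF that(1,2) subsetD[OF cyc_full that(3)]])
  moreover have "\<rho> (cscale c X) w = seq_scale c (\<rho> X w)" if "X \<in> so8" "w \<in> cyc" for X c w
    by (rule cscale_rho[OF that(1) subsetD[OF cyc_full that(2)]])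
  moreover have "\<rho> (bracket X Y) w = \<rho> X (\<rho> Y w) - \<rho> Y (\<rho> X w)" if "X \<in> so8" "Y \<in> so8" "w \<in> cyc" for X Y w
    by (rule bracket_rho[OF that(1,2) subsetD[OF cyc_full that(3)]])
  ultimately show ?thesis unfolding is_module_def by (intro conjI ballI allI) assumption+
qed

lemma hwv_root_space:
  assumes "k \<in> {1..12}" "X \<in> root_space (pos_root k)" shows "\<rho> X v = 0"
proof -
  obtain c where "X = cscale c (pos k)" using root_space_pos[OF assms] by blast
  then show ?thesis using cscale_rho[OF pos_so8 v_mem] v_pos[OF assms(1)] by simp
qed

lemma cyc_hw: "highest_weight_vector \<mu> cyc \<rho> v"
  unfolding highest_weight_vector_def using v_cyc v_nz v_cartan hwv_root_space by blast

lemma proj_invariant: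
  assumes "cseq.subspace U" "\<forall>X\<in>so8. \<forall>u\<in>U. \<rho> X u \<in> U" "u \<in> U"
  shows "proj K u \<in> U"
proof (induction K)
  case (Suc K)
  then show ?case unfolding proj.simps
    using assms cartan_so8 by (intro cseq.subspace_diff cseq.subspace_scale) blast+
qed (use assms in simp)

lemma ip_negs_word: "set u \<subseteq> negs \<Longrightarrow> u \<noteq> [] \<Longrightarrow> ip (act \<rho> u v) v = 0"
proof (cases u)
  case (Cons E u')
  assume "set u \<subseteq> negs"
  then obtain k where k: "k \<in> {1..12}" "E = neg k" using Cons by auto
  have "ip (act \<rho> u v) v = ip (act \<rho> u' v) (\<rho> (pos k) v)"
    unfolding Cons using ip_adjoint[OF neg_so8, of k] k(2) by (simp add: herm_neg)
  then show ?thesis using v_pos[OF k(1)] by (simp add: ip_zero)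
qed simp

lemma ip_lincomb_lead: "words negs L \<Longrightarrow> ip (lincomb \<rho> L v) v = lead L * ip v v"
proof (induction L)
  case (Cons a L)
  obtain c w where a: "a = (c, w)" by (cases a)
  then have IH: "ip (lincomb \<rho> L v) v = lead L * ip v v" and w: "set w \<subseteq> negs" using Cons by auto
  show ?case
    using ip_negs_word[OF w] unfolding a lincomb_simps lead_simps ip_add ip_scale IH
    by (cases "w = []") (simp_all add: distrib_right)
qed (simp add: ip_zero)

text \<open>A nonzero submodule \<open>U\<close> contains some \<open>u\<close> that is not orthogonal to some vector \<open>w v\<close>. Moving the word \<open>w\<close>
  to the other side of the hermitian form gives an element of \<open>U\<close> that is not orthogonal to \<open>v\<close>. Its
  component of highest weight is a nonzero multiple of \<open>v\<close> and lies in \<open>U\<close>.\<close>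

lemma cyc_irreducible: "is_irreducible cyc \<rho>"
  unfolding is_irreducible_def
proof (intro conjI allI impI)
  show "is_module cyc \<rho>" by (rule cyc_module)
  show "cyc \<noteq> {0}" using v_cyc v_nz by blast
  fix U assume "cseq.subspace U \<and> U \<subseteq> cyc \<and> (\<forall>X\<in>so8. \<forall>u\<in>U. \<rho> X u \<in> U)"
  then have U: "cseq.subspace U" "U \<subseteq> cyc" "\<forall>X\<in>so8. \<forall>u\<in>U. \<rho> X u \<in> U" by auto
  have actU: "set w \<subseteq> so8 \<Longrightarrow> u \<in> U \<Longrightarrow> act \<rho> w u \<in> U" for w u
  proof (induction w)
    case (Cons X w)
    then have "X \<in> so8" "act \<rho> w u \<in> U" by auto
    then show ?case using U(3) unfolding foldr.simps comp_apply by blast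
  qed simp
  have "v \<in> U" if nz0: "U \<noteq> {0}"
  proof -
    obtain u where u: "u \<in> U" "u \<noteq> 0" by (rule exists_other[OF cseq.subspace_0[OF U(1)] nz0])
    have ucyc: "u \<in> cyc" by (rule subsetD[OF U(2) u(1)])
    obtain L where L: "words so8 L" "u = lincomb \<rho> L v" using span_words[OF ucyc[unfolded cyc_def]] by blast
    have "\<exists>w. set w \<subseteq> so8 \<and> ip u (act \<rho> w v) \<noteq> 0"
    proof (rule ccontr)
      assume none: "\<not> ?thesis"
      have z: "ip u (lincomb \<rho> L' v) = 0" if "words so8 L'" for L'
        using that
      proof (induction L')
        case Nil
        show ?case unfolding lincomb_simps(1) by (rule ip_zero)
      next
        case (Cons a L')
        obtain c w where a: "a = (c, w)" by (cases a)
        then have "set w \<subseteq> so8" "words so8 L'" using Cons.prems by auto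
        then show ?case using none Cons.IH unfolding a lincomb_simps ip_add ip_scale by simp
      qed
      have "ip u u = 0" using z[OF L(1)] unfolding L(2)[symmetric] .
      with ip_self[OF subsetD[OF cyc_full ucyc] u(2)] show False by (rule notE)
    qed
    then obtain w where w: "set w \<subseteq> so8" "ip u (act \<rho> w v) \<noteq> 0" by blast
    let ?w = "rev (map herm w)"
    have w': "set ?w \<subseteq> so8" using w(1) herm_so8 by auto
    have "rev (map herm ?w) = w" by (simp add: rev_map[symmetric] comp_def)
    then have nz: "ip (act \<rho> ?w u) v \<noteq> 0" using w(2) ip_act[OF w', of u v] by simp
    have u'U: "act \<rho> ?w u \<in> U" by (rule actU[OF w' u(1)])
    then obtain L1 where L1: "words so8 L1" "act \<rho> ?w u = lincomb \<rho> L1 v"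
      using span_words[OF subsetD[OF U(2) u'U, unfolded cyc_def]] by blast
    obtain L2 where L2: "words negs L2" "lincomb \<rho> L1 v = lincomb \<rho> L2 v"
      using reduce[OF L1(1), of \<mu>] full_module by fast
    have ld: "lead L2 \<noteq> 0" using nz ip_lincomb_lead[OF L2(1)] unfolding L1(2) L2(2) by auto
    obtain K where K: "proj K (lincomb \<rho> L2 v) = seq_scale (lead L2 * fact K) v"
      using proj_lincomb[OF L2(1)] by blast
    have "seq_scale (lead L2 * fact K) v \<in> U"
      using proj_invariant[OF U(1,3) u'U, of K] unfolding L1(2) L2(2) K .
    then have "seq_scale (inverse (lead L2 * fact K)) (seq_scale (lead L2 * fact K) v) \<in> U"
      by (rule cseq.subspace_scale[OF U(1)])
    moreover have "inverse (lead L2 * fact K) * (lead L2 * fact K) = 1"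
      using ld by (intro left_inverse) simp
    ultimately show ?thesis by (simp only: cseq.scale_scale cseq.scale_one)
  qed
  then have "cyc \<subseteq> U" if "U \<noteq> {0}"
    unfolding cyc_def using that actU by (intro cseq.span_minimal[OF _ U(1)]) fast
  with U(2) show "U = {0} \<or> U = cyc" by (meson subset_antisym)
qed


lemma mact_pow_nil:
  assumes "k \<in> {1..12}" "n \<ge> N" shows "(\<rho> (neg k) ^^ n) f i = 0"
proof -
  have "Poly_Mapping.lookup ((pact S \<pi> (neg k) ^^ n) (\<lambda>j. Poly_Mapping.single 0 (f j)) i) 0 = 0"
    using nilrep_ge[OF nil assms] by simp
  then show ?thesis unfolding lookup_pact_pow by simp
qed

lemma mact_pow_scale: "(\<rho> X ^^ n) (\<lambda>j. c * f j) i = c * (\<rho> X ^^ n) f i"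
proof (induction n arbitrary: i)
  case (Suc n)
  have IH: "(\<rho> X ^^ n) (\<lambda>j. c * f j) = (\<lambda>i. c * (\<rho> X ^^ n) f i)" using Suc by blast
  have lin: "\<rho> X (\<lambda>j. c * g j) i = c * \<rho> X g i" for g
    by (simp add: mact_def sum_distrib_left mult.left_commute)
  show ?case unfolding funpow.simps comp_apply IH by (rule lin)
qed simp

end

lemma lookup_single_times: "Poly_Mapping.lookup (Poly_Mapping.single m 1 * F) (m + q) = Poly_Mapping.lookup (F :: pol) q"
proof -
  have "Poly_Mapping.lookup (Poly_Mapping.single m 1 * F) (m + q) =
      (\<Sum>l. (1 when m = l) * (\<Sum>a. Poly_Mapping.lookup F a when m + q = l + a))"
    by (simp add: lookup_mult lookup_single)
  also have "\<dots> = (\<Sum>l. (\<Sum>a. Poly_Mapping.lookup F a when m + q = l + a) when m = l)"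
    by (rule Sum_any.cong) (simp add: when_def)
  also have "\<dots> = Poly_Mapping.lookup F q" by (simp add: Sum_any_when_equal)
  finally show ?thesis .
qed

lemma lookup_single_times_0:
  assumes "\<And>q. p \<noteq> m + q" shows "Poly_Mapping.lookup (Poly_Mapping.single m 1 * F) p = (0 :: complex)"
proof -
  have "Poly_Mapping.lookup (Poly_Mapping.single m 1 * F) p =
      (\<Sum>l. (1 when m = l) * (\<Sum>a. Poly_Mapping.lookup F a when p = l + a))"
    by (simp add: lookup_mult lookup_single)
  also have "\<dots> = (\<Sum>l. (\<Sum>a. Poly_Mapping.lookup F a when p = l + a) when m = l)"
    by (rule Sum_any.cong) (simp add: when_def)
  also have "\<dots> = 0" using assms by (simp add: Sum_any_when_equal)
  finally show ?thesis .
qed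

lemma var_pow: "var k ^ n = Poly_Mapping.single (Mono (axis (of_nat k) n)) 1"
proof (induction n)
  case 0
  have "Mono (axis (of_nat k) 0) = 0" by (simp add: zero_mono_def axis_def vec_eq_iff)
  then show ?case by simp
next
  case (Suc n)
  have "Mono (axis (of_nat k) 1) + Mono (axis (of_nat k) n) = Mono (axis (of_nat k) (Suc n))"
    by (simp add: plus_mono_def axis_def vec_eq_iff)
  then show ?case using Suc by (simp add: var_def[of k] mult_single)
qed

lemma prod_nonzero: "(\<And>x. f x \<noteq> (0 :: complex)) \<Longrightarrow> prod f A \<noteq> 0"
  by (induction A rule: infinite_finite_induct) auto

context model
begin

lemma lookup_foldr_Phi:
  assumes "k \<in> {1..13}"
  shows "Poly_Mapping.lookup (foldr (Phi S \<pi> N) [k..<13] (\<lambda>i. Poly_Mapping.single 0 (v i)) i) (Mono p) =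
    (if \<forall>j\<in>{1..<k}. p $ of_nat j = 0
     then (1 / (\<Prod>j\<in>{k..<13}. fact (p $ of_nat j))) * foldr (\<lambda>j w. (\<rho> (neg j) ^^ (p $ of_nat j)) w) [k..<13] v i else 0)"
proof -
  have "k \<le> 13" using assms by simp
  then have "1 \<le> k \<longrightarrow> (\<forall>p i. Poly_Mapping.lookup (foldr (Phi S \<pi> N) [k..<13] (\<lambda>i. Poly_Mapping.single 0 (v i)) i) (Mono p) =
    (if \<forall>j\<in>{1..<k}. p $ of_nat j = 0
     then (1 / (\<Prod>j\<in>{k..<13}. fact (p $ of_nat j))) * foldr (\<lambda>j w. (\<rho> (neg j) ^^ (p $ of_nat j)) w) [k..<13] v i else 0))"
  proof (induction k rule: inc_induct)
    case base
    have e: "(0 = Mono p) \<longleftrightarrow> (\<forall>j\<in>{1..<13}. p $ of_nat j = 0)" for p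
    proof
      assume "\<forall>j\<in>{1..<13}. p $ of_nat j = 0"
      then have "p = 0" by (intro vec12_eqI) auto
      then show "0 = Mono p" by (simp add: zero_mono_def)
    qed (simp add: zero_mono_def)
    show ?case
      by (simp only: upt_conv_Nil order_refl foldr.simps id_apply lookup_single e when_def
        atLeastLessThan_empty prod.empty div_by_1 mult_1_left simp_thms)
  next
    case (step k)
    show ?case
    proof (intro impI allI)
      fix p :: "nat ^ 12" and i assume k1: "1 \<le> k"
      have k: "k \<in> {1..12}" using k1 step.hyps by auto
      let ?G = "foldr (Phi S \<pi> N) [Suc k..<13] (\<lambda>i. Poly_Mapping.single 0 (v i))"
      let ?sv = "\<lambda>p. foldr (\<lambda>j w. (\<rho> (neg j) ^^ (p $ of_nat j)) w) [Suc k..<13] v"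
      have IH: "Poly_Mapping.lookup (?G j) (Mono q) = (if \<forall>j\<in>{1..<Suc k}. q $ of_nat j = 0
         then (1 / (\<Prod>j\<in>{Suc k..<13}. fact (q $ of_nat j))) * ?sv q j else 0)" for q j
        using step.IH by simp
      define p0 where "p0 = (\<chi> x. if x = of_nat k then 0 else p $ x)"
      have p0: "p0 $ of_nat j = (if j = k then 0 else p $ of_nat j)" if "j \<in> {1..12}" for j
        by (simp only: p0_def vec_lambda_beta of_nat12_inj[OF that k])
      let ?c = "\<lambda>j. Poly_Mapping.lookup (?G j) (Mono p0)"
      have split: "[k..<13] = k # [Suc k..<13]" using k by (simp add: upt_rec)
      have trm: "Poly_Mapping.lookup (dpow S \<pi> (neg k) (var k) n ?G i) (Mono p) =
         (if n = p $ of_nat k then (1 / fact n) * (\<rho> (neg k) ^^ n) ?c i else 0)" for n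
      proof (cases "n \<le> p $ of_nat k")
        case True
        define q where "q = (\<chi> x. if x = of_nat k then p $ x - n else p $ x)"
        have "Mono p = Mono (axis (of_nat k) n) + Mono q"
          using True by (simp add: plus_mono_def q_def vec_eq_iff axis_def)
        then have l: "Poly_Mapping.lookup (dpow S \<pi> (neg k) (var k) n ?G i) (Mono p) = (1 / fact n) * (\<rho> (neg k) ^^ n) (\<lambda>j. Poly_Mapping.lookup (?G j) (Mono q)) i"
          unfolding dpow_def lookup_pscale var_pow by (simp only: lookup_single_times lookup_pact_pow)
        show ?thesis
        proof (cases "n = p $ of_nat k")
          case True
          then have "q = p0" by (auto simp: q_def p0_def vec_eq_iff)
          then show ?thesis using l True by simp
        next
          case False
          then have "q $ of_nat k \<noteq> 0" using \<open>n \<le> p $ of_nat k\<close> by (simp add: q_def)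
          moreover have kk: "k \<in> {1..<Suc k}" using k1 by simp
          ultimately have nq: "\<not> (\<forall>j\<in>{1..<Suc k}. q $ of_nat j = 0)" using bspec[OF _ kk, of "\<lambda>j. q $ of_nat j = 0"] by argo
          have zq: "(\<lambda>j. Poly_Mapping.lookup (?G j) (Mono q)) = (\<lambda>j. 0 * 0)"
            unfolding IH if_not_P[OF nq] mult_zero_left ..
          show ?thesis unfolding l zq mact_pow_scale[where X = "neg k" and n = n and c = 0 and f = "\<lambda>j. 0"] using False by simp
        qed
      next
        case False
        have "Mono p \<noteq> Mono (axis (of_nat k) n) + q" for q
        proof
          assume "Mono p = Mono (axis (of_nat k) n) + q"
          then have "p $ of_nat k = n + exps q $ of_nat k" by (simp add: plus_mono_def)
          then show False using False by simp
        qed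
        then show ?thesis using False unfolding dpow_def lookup_pscale var_pow by (simp add: lookup_single_times_0)
      qed
      have "Poly_Mapping.lookup (Phi S \<pi> N k ?G i) (Mono p) = (\<Sum>n<N. if n = p $ of_nat k then (1 / fact n) * (\<rho> (neg k) ^^ n) ?c i else 0)"
        unfolding Phi_def lookup_sum trm ..
      also have "\<dots> = (1 / fact (p $ of_nat k)) * (\<rho> (neg k) ^^ (p $ of_nat k)) ?c i"
        using mact_pow_nil[OF k, of "p $ of_nat k"] by (simp add: not_less)
      finally have L: "Poly_Mapping.lookup (Phi S \<pi> N k ?G i) (Mono p) = (1 / fact (p $ of_nat k)) * (\<rho> (neg k) ^^ (p $ of_nat k)) ?c i" .
      have cond: "(\<forall>j\<in>{1..<Suc k}. p0 $ of_nat j = 0) \<longleftrightarrow> (\<forall>j\<in>{1..<k}. p $ of_nat j = 0)"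
      proof
        assume a: "\<forall>j\<in>{1..<Suc k}. p0 $ of_nat j = 0"
        show "\<forall>j\<in>{1..<k}. p $ of_nat j = 0"
        proof
          fix j assume "j \<in> {1..<k}"
          then have j: "j \<in> {1..<Suc k}" "j \<in> {1..12}" "j \<noteq> k" using k by auto
          show "p $ of_nat j = 0" using bspec[OF a j(1)] unfolding p0[OF j(2)] if_not_P[OF j(3)] .
        qed
      next
        assume a: "\<forall>j\<in>{1..<k}. p $ of_nat j = 0"
        show "\<forall>j\<in>{1..<Suc k}. p0 $ of_nat j = 0"
        proof
          fix j assume "j \<in> {1..<Suc k}"
          then have j: "j \<in> {1..12}" "j \<noteq> k \<Longrightarrow> j \<in> {1..<k}" using k by auto
          show "p0 $ of_nat j = 0" unfolding p0[OF j(1)] using bspec[OF a j(2)] by (cases "j = k") simp_all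
        qed
      qed
      have prod: "(\<Prod>j\<in>{Suc k..<13}. fact (p0 $ of_nat j)) = (\<Prod>j\<in>{Suc k..<13}. fact (p $ of_nat j) :: complex)"
        by (rule prod.cong) (use p0 k in auto)
      have "foldr (\<lambda>j w. (\<rho> (neg j) ^^ (p0 $ of_nat j)) w) ks v = foldr (\<lambda>j w. (\<rho> (neg j) ^^ (p $ of_nat j)) w) ks v"
        if "set ks \<subseteq> {Suc k..<13}" for ks using that
      proof (induction ks)
        case (Cons j ks)
        then have "p0 $ of_nat j = p $ of_nat j" using p0[of j] k by auto
        then show ?case using Cons by simp
      qed simp
      then have sv: "?sv p0 = ?sv p" by simp
      have c: "?c = (if \<forall>j\<in>{1..<k}. p $ of_nat j = 0 then (\<lambda>j. (1 / (\<Prod>j\<in>{Suc k..<13}. fact (p $ of_nat j))) * ?sv p j) else (\<lambda>j. 0 * 0))"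
      proof (cases "\<forall>j\<in>{1..<k}. p $ of_nat j = 0")
        case True
        show ?thesis unfolding IH cond prod sv if_P[OF True] ..
      next
        case False
        show ?thesis unfolding IH cond prod sv if_not_P[OF False] mult_zero_left ..
      qed
      have frac: "(1 / a) * ((1 / b) * x) = 1 / (a * b) * x" for a b x :: complex by simp
      have pk: "(\<Prod>j\<in>{k..<13}. fact (p $ of_nat j)) = fact (p $ of_nat k) * (\<Prod>j\<in>{Suc k..<13}. fact (p $ of_nat j) :: complex)"
        using k by (subst prod.atLeast_Suc_lessThan) auto
      show "Poly_Mapping.lookup (foldr (Phi S \<pi> N) [k..<13] (\<lambda>i. Poly_Mapping.single 0 (v i)) i) (Mono p) =
        (if \<forall>j\<in>{1..<k}. p $ of_nat j = 0
         then (1 / (\<Prod>j\<in>{k..<13}. fact (p $ of_nat j))) * foldr (\<lambda>j w. (\<rho> (neg j) ^^ (p $ of_nat j)) w) [k..<13] v i else 0)"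
      proof (cases "\<forall>j\<in>{1..<k}. p $ of_nat j = 0")
        case True
        show ?thesis unfolding if_P[OF True] split foldr.simps comp_apply L c pk mact_pow_scale by (rule frac)
      next
        case False
        show ?thesis unfolding if_not_P[OF False] split foldr.simps comp_apply L c
          mact_pow_scale[where X = "neg k" and n = "p $ of_nat k" and c = 0 and f = "\<lambda>j. 0"]
          by (simp only: mult_zero_left mult_zero_right)
      qed
    qed
  qed
  then show ?thesis using assms by auto
qed

text \<open>The coefficient of $x^p$ is the vector of signature \<open>p\<close>, divided by factorials.\<close>

lemma lookup_gen:
  "Poly_Mapping.lookup (gen S \<pi> N v i) (Mono p) * (\<Prod>j\<in>{1..<13}. fact (p $ of_nat j)) = sig_vector neg \<rho> v p i"
proof -
  define P :: complex where "P = (\<Prod>j\<in>{1..<13}. fact (p $ of_nat j))"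
  have nz: "P \<noteq> 0" unfolding P_def by (rule prod_nonzero) (rule fact_nonzero)
  have eq: "x * P = y" if "x = 1 / P * y" for x y using nz that by simp
  have t: "\<forall>j\<in>{1..<1::nat}. p $ of_nat j = 0" by (rule ballI) (simp only: atLeastLessThan_iff not_less[symmetric] simp_thms)
  have "(1 :: nat) \<in> {1..13}" by simp
  from lookup_foldr_Phi[OF this, of i p, unfolded if_P[OF t], folded P_def gen_def sig_vector_def]
  show ?thesis unfolding P_def[symmetric] by (rule eq)
qed

end

section \<open>Essential signatures and lowest monomials\<close>

definition sigword :: "(nat \<Rightarrow> mat8) \<Rightarrow> nat ^ 12 \<Rightarrow> mat8 list" where
  "sigword e p = concat (map (\<lambda>k. replicate (p $ of_nat k) (e k)) [1..<13])"

lemma sig_vector_act: "sig_vector e \<rho> v p = act \<rho> (sigword e p) v"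
proof -
  have "foldr (\<lambda>k w. (\<rho> (e k) ^^ (p $ of_nat k)) w) ks v = act \<rho> (concat (map (\<lambda>k. replicate (p $ of_nat k) (e k)) ks)) v" for ks
    by (induction ks) (simp_all only: foldr.simps comp_apply id_apply list.map concat.simps foldr_append foldr_replicate)
  then show ?thesis unfolding sig_vector_def sigword_def .
qed

lemma set_concat_replicate: "set ks \<subseteq> A \<Longrightarrow> set (concat (map (\<lambda>k. replicate (n k) (e k)) ks)) \<subseteq> e ` A"
  by (induction ks) auto

lemma sigword_set: "set (sigword e p) \<subseteq> e ` {1..12}"
  unfolding sigword_def by (rule set_concat_replicate) auto

context hw_module
begin

lemma pow_mem: "X \<in> so8 \<Longrightarrow> x \<in> W \<Longrightarrow> (\<rho> X ^^ n) x \<in> W"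
  by (induction n) (auto intro: rho_mem)

lemma pow_cscale:
  assumes "X \<in> so8" "x \<in> W"
  shows "(\<rho> (cscale c X) ^^ n) (scale d x) = scale (c ^ n * d) ((\<rho> X ^^ n) x)"
proof (induction n)
  case (Suc n)
  have m: "(\<rho> X ^^ n) x \<in> W" by (rule pow_mem[OF assms])
  show ?case unfolding funpow.simps comp_apply Suc rho_scale[OF so8_cscale[OF assms(1)] m] cscale_rho[OF assms(1) m]
    by (simp only: scale_scale power_Suc ac_simps)
qed simp

lemma foldr_pow_cscale:
  assumes "\<And>k. k \<in> set ks \<Longrightarrow> e k = cscale (c k) (g k) \<and> g k \<in> so8"
  shows "foldr (\<lambda>k w. (\<rho> (e k) ^^ n k) w) ks v = scale (prod_list (map (\<lambda>k. c k ^ n k) ks)) (foldr (\<lambda>k w. (\<rho> (g k) ^^ n k) w) ks v)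
    \<and> foldr (\<lambda>k w. (\<rho> (g k) ^^ n k) w) ks v \<in> W"
  using assms
proof (induction ks)
  case Nil
  show ?case using v_mem by (simp only: foldr.simps id_apply list.map prod_list.Nil scale_one simp_thms)
next
  case (Cons k ks)
  have k: "e k = cscale (c k) (g k)" "g k \<in> so8" using Cons.prems[of k] by auto
  have IH: "foldr (\<lambda>k w. (\<rho> (e k) ^^ n k) w) ks v = scale (prod_list (map (\<lambda>k. c k ^ n k) ks)) (foldr (\<lambda>k w. (\<rho> (g k) ^^ n k) w) ks v)"
    "foldr (\<lambda>k w. (\<rho> (g k) ^^ n k) w) ks v \<in> W" using Cons by auto
  show ?case unfolding foldr.simps comp_apply IH(1) k(1) pow_cscale[OF k(2) IH(2)]
    using pow_mem[OF k(2) IH(2)] by (simp only: list.map prod_list.Cons simp_thms)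
qed

end

context cvs
begin

lemma span_relation:
  assumes "x \<in> span {act \<rho> (f q) v | q. P q}"
  shows "\<exists>L. (\<forall>(c, w)\<in>set L. \<exists>q. w = f q \<and> P q) \<and> x = lincomb \<rho> L v"
  using assms
proof (induction rule: span_induct_alt)
  case base show ?case by (intro exI[of _ "[]"]) simp
next
  case (step c x y)
  then obtain q L where "x = act \<rho> (f q) v" "P q" "\<forall>(c, w)\<in>set L. \<exists>q. w = f q \<and> P q" "y = lincomb \<rho> L v" by auto
  then show ?case by (intro exI[of _ "(c, f q) # L"]) auto
qed

lemma relation_span:
  "(\<forall>(c, w)\<in>set L. \<exists>q. w = f q \<and> P q) \<Longrightarrow> lincomb \<rho> L v \<in> span {act \<rho> (f q) v | q. P q}"
proof (induction L)
  case Nil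
  show ?case unfolding lincomb_simps(1) by (rule span_zero)
next
  case (Cons a L)
  obtain c w where a: "a = (c, w)" by (cases a)
  then obtain q where "w = f q" "P q" using Cons.prems by auto
  then have "act \<rho> w v \<in> span {act \<rho> (f q) v | q. P q}" by (intro span_base) blast
  then show ?case using Cons unfolding a lincomb_simps(2) by (intro span_add span_scale) auto
qed

text \<open>Linear dependences between vectors obtained from the highest weight vector depend on the
  weight only, as the annihilator of the highest weight vector of an irreducible module is as
  large as possible.\<close>

lemma dependence_transfer:
  assumes M: "hw_module scale \<mu> W \<rho> v" and M': "hw_module scale \<mu> W' \<rho>' v'"
    and irr: "\<And>U. subspace U \<Longrightarrow> U \<subseteq> W' \<Longrightarrow> \<forall>X\<in>so8. \<forall>u\<in>U. \<rho>' X u \<in> U \<Longrightarrow> U = {0} \<or> U = W'"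
    and f: "\<And>q. set (f q) \<subseteq> so8"
    and dep: "act \<rho> (f p) v \<in> span {act \<rho> (f q) v | q. P q}"
  shows "act \<rho>' (f p) v' \<in> span {act \<rho>' (f q) v' | q. P q}"
proof -
  obtain L where L: "\<forall>(c, w)\<in>set L. \<exists>q. w = f q \<and> P q" "act \<rho> (f p) v = lincomb \<rho> L v"
    using span_relation[OF dep] by blast
  have wL: "words so8 L" unfolding words_def
  proof (rule ballI)
    fix a assume a: "a \<in> set L"
    obtain c w where cw: "a = (c, w)" by (cases a)
    have "\<exists>q. w = f q \<and> P q" using bspec[OF L(1) a] unfolding cw prod.case .
    then obtain q where "w = f q" by (elim exE conjE) (rule that)
    then show "case a of (c, w) \<Rightarrow> set w \<subseteq> so8" using f[of q] unfolding cw prod.case by simp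
  qed
  have w: "words so8 ((- 1, f p) # L)" unfolding words_simps using wL f[of p] by (rule conjI[rotated])
  have m: "scale (- 1) x + y = 0 \<longleftrightarrow> x = y" for x y
    by (simp only: scale_minus_left scale_one neg_eq_iff_add_eq_0[symmetric] minus_minus)
  have "lincomb \<rho> ((- 1, f p) # L) v = 0" unfolding lincomb_simps(2) m by (rule L(2))
  from annihilator_subset[OF M M' irr w this, unfolded lincomb_simps(2) m]
  have "act \<rho>' (f p) v' = lincomb \<rho>' L v'" .
  then show ?thesis using relation_span[OF L(1)] by simp
qed

lemma span_scaled:
  assumes "\<And>q. \<kappa> q \<noteq> 0" shows "span {scale (\<kappa> q) (h q) | q. P q} = span {h q | q. P q}"
proof (rule span_eq[THEN iffD2], rule conjI)
  show "{scale (\<kappa> q) (h q) | q. P q} \<subseteq> span {h q | q. P q}"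
  proof clarify
    fix q assume "P q"
    then have "h q \<in> {h q | q. P q}" by blast
    then show "scale (\<kappa> q) (h q) \<in> span {h q | q. P q}" by (rule span_scale[OF span_base])
  qed
  show "{h q | q. P q} \<subseteq> span {scale (\<kappa> q) (h q) | q. P q}"
  proof clarify
    fix q assume "P q"
    then have "scale (inverse (\<kappa> q)) (scale (\<kappa> q) (h q)) \<in> span {scale (\<kappa> q) (h q) | q. P q}"
      by (intro span_scale span_base) blast
    then show "h q \<in> span {scale (\<kappa> q) (h q) | q. P q}" using assms by simp
  qed
qed

lemma span_scale_iff: "c \<noteq> 0 \<Longrightarrow> scale c x \<in> span V \<longleftrightarrow> x \<in> span V"
  using span_scale[of "scale c x" V "inverse c"] span_scale[of x V c] by auto

end

interpretation seqs: cvs seq_scale ..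

lemma dependence_normalize:
  assumes M: "hw_module seq_scale \<mu> W \<rho> v" and e: "\<And>k. k \<in> {1..12} \<Longrightarrow> e k = cscale (c k) (neg k) \<and> c k \<noteq> 0"
  shows "sig_vector e \<rho> v p \<in> cseq.span {sig_vector e \<rho> v q | q. P q} \<longleftrightarrow>
    sig_vector neg \<rho> v p \<in> cseq.span {sig_vector neg \<rho> v q | q. P q}"
proof -
  define \<kappa> where "\<kappa> q = prod_list (map (\<lambda>k. c k ^ (q $ of_nat k)) [1..<13])" for q :: "nat ^ 12"
  have s: "set [1..<13] \<subseteq> {1..12::nat}" by auto
  have sv: "sig_vector e \<rho> v q = seq_scale (\<kappa> q) (sig_vector neg \<rho> v q)" for q
    unfolding sig_vector_def \<kappa>_def
    by (rule conjunct1[OF hw_module.foldr_pow_cscale[OF M]]) (use e s neg_so8 in blast)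
  have "prod_list (map (\<lambda>k. c k ^ (q $ of_nat k)) ks) \<noteq> 0" if "set ks \<subseteq> {1..12}" for q ks
    using that e by (induction ks) auto
  from this[OF s] have nz: "\<kappa> q \<noteq> 0" for q unfolding \<kappa>_def .
  show ?thesis unfolding sv seqs.span_scaled[OF nz] seqs.span_scale_iff[OF nz] ..
qed

text \<open>Membership in a span is tested by linear functionals that vanish on it.\<close>

lemma separating_functional:
  assumes "x \<notin> cseq.span V"
  obtains \<phi> :: "cseq \<Rightarrow> complex" where "\<And>f g. \<phi> (f + g) = \<phi> f + \<phi> g" "\<And>c f. \<phi> (seq_scale c f) = c * \<phi> f"
    "\<And>f. f \<in> V \<Longrightarrow> \<phi> f = 0" "\<phi> x = 1"
proof -
  interpret P: vector_space_pair seq_scale "(*) :: complex \<Rightarrow> complex \<Rightarrow> complex"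
    by unfold_locales (simp_all add: algebra_simps)
  obtain B where B: "B \<subseteq> V" "cseq.independent B" "V \<subseteq> cseq.span B"
    using cseq.maximal_independent_subset by blast
  have "cseq.span B \<subseteq> cseq.span V" by (rule cseq.span_mono[OF B(1)])
  then have xB: "x \<notin> cseq.span B" using assms by blast
  then have xB': "x \<notin> B" using cseq.span_base by blast
  obtain \<phi> where \<phi>: "Vector_Spaces.linear seq_scale (*) \<phi>" "\<forall>y\<in>insert x B. \<phi> y = (if y = x then 1 else 0)"
    using P.linear_independent_extend[OF cseq.independent_insertI[OF xB B(2)], of "\<lambda>y. if y = x then 1 else 0"] by blast
  have add: "\<phi> (f + g) = \<phi> f + \<phi> g" for f g by (rule P.linear_add[OF \<phi>(1)])
  have scl: "\<phi> (seq_scale c f) = c * \<phi> f" for c f by (rule P.linear_scale[OF \<phi>(1)])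
  have "\<phi> f = 0" if "f \<in> V" for f
  proof -
    have "f \<in> cseq.span B" using that B(3) by blast
    then show ?thesis
    proof (induction rule: cseq.span_induct_alt)
      case base
      show ?case using scl[of 0 0] unfolding cseq.scale_zero_left mult_zero_left .
    next
      case (step c y z)
      then have "\<phi> y = 0" using \<phi>(2) xB' by auto
      then show ?case using step by (simp only: add scl mult_zero_right add_0)
    qed
  qed
  note z = this
  have o: "\<phi> x = 1" using \<phi>(2) by simp
  show thesis by (rule that[of \<phi>]) (erule z | rule add scl o)+
qed

lemma irreducible_hw_module:
  assumes "is_irreducible W \<rho>" "highest_weight_vector \<mu> W \<rho> v"
  shows "hw_module seq_scale \<mu> W \<rho> v"
proof
  have m: "is_module W \<rho>" using assms(1) unfolding is_irreducible_def by (elim conjE)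
  show "cseq.subspace W" using m unfolding is_module_def by (elim conjE)
  have m2: "\<forall>X\<in>so8. \<forall>w\<in>W. \<rho> X w \<in> W" using m unfolding is_module_def by (elim conjE)
  have m3: "\<forall>X\<in>so8. \<forall>w\<in>W. \<forall>w'\<in>W. \<rho> X (w + w') = \<rho> X w + \<rho> X w'" using m unfolding is_module_def by (elim conjE)
  have m4: "\<forall>X\<in>so8. \<forall>c. \<forall>w\<in>W. \<rho> X (seq_scale c w) = seq_scale c (\<rho> X w)" using m unfolding is_module_def by (elim conjE)
  have m5: "\<forall>X\<in>so8. \<forall>Y\<in>so8. \<forall>w\<in>W. \<rho> (X + Y) w = \<rho> X w + \<rho> Y w" using m unfolding is_module_def by (elim conjE)
  have m6: "\<forall>X\<in>so8. \<forall>c. \<forall>w\<in>W. \<rho> (cscale c X) w = seq_scale c (\<rho> X w)" using m unfolding is_module_def by (elim conjE)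
  have m7: "\<forall>X\<in>so8. \<forall>Y\<in>so8. \<forall>w\<in>W. \<rho> (bracket X Y) w = \<rho> X (\<rho> Y w) - \<rho> Y (\<rho> X w)" using m unfolding is_module_def by (elim conjE)
  show "\<rho> X w \<in> W" if "X \<in> so8" "w \<in> W" for X w by (rule m2[rule_format, OF that])
  show "\<rho> X (w + w') = \<rho> X w + \<rho> X w'" if "X \<in> so8" "w \<in> W" "w' \<in> W" for X w w' by (rule m3[rule_format, OF that])
  show "\<rho> X (seq_scale c w) = seq_scale c (\<rho> X w)" if "X \<in> so8" "w \<in> W" for X w c by (rule m4[rule_format, OF that])
  show "\<rho> (X + Y) w = \<rho> X w + \<rho> Y w" if "X \<in> so8" "Y \<in> so8" "w \<in> W" for X Y w by (rule m5[rule_format, OF that])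
  show "\<rho> (cscale c X) w = seq_scale c (\<rho> X w)" if "X \<in> so8" "w \<in> W" for X w c by (rule m6[rule_format, OF that])
  show "\<rho> (bracket X Y) w = \<rho> X (\<rho> Y w) - \<rho> Y (\<rho> X w)" if "X \<in> so8" "Y \<in> so8" "w \<in> W" for X Y w by (rule m7[rule_format, OF that])
  show "v \<in> W" using assms(2) unfolding highest_weight_vector_def by (elim conjE)
  show "v \<noteq> 0" using assms(2) unfolding highest_weight_vector_def by (elim conjE)
  have h3: "\<forall>x. \<rho> (cartan x) v = seq_scale (eval_weight \<mu> x) v" using assms(2) unfolding highest_weight_vector_def by (elim conjE)
  have h4: "\<forall>k\<in>{1..12}. \<forall>X\<in>root_space (pos_root k). \<rho> X v = 0" using assms(2) unfolding highest_weight_vector_def by (elim conjE)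
  show "\<rho> (cartan x) v = seq_scale (eval_weight \<mu> x) v" for x by (rule h3[rule_format])
  show "\<rho> (pos k) v = 0" if "k \<in> {1..12}" for k by (rule h4[rule_format, OF that pos_root_vec[OF that]])
qed

context model
begin

lemma span_gen_functional:
  assumes "F \<in> pol.span (range (gen S \<pi> N v))"
  shows "\<exists>\<phi>. (\<forall>f g. \<phi> (f + g) = \<phi> f + \<phi> g) \<and> (\<forall>c f. \<phi> (seq_scale c f) = c * \<phi> f) \<and>
    (\<forall>q. Poly_Mapping.lookup F (Mono q) * (\<Prod>j\<in>{1..<13}. fact (q $ of_nat j)) = \<phi> (sig_vector neg \<rho> v q))"
  using assms
proof (induction rule: pol.span_induct_alt)
  case base
  show ?case by (rule exI[of _ "\<lambda>f. 0"]) simp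
next
  case (step c G F)
  obtain \<phi> where p: "(\<forall>f g. \<phi> (f + g) = \<phi> f + \<phi> g) \<and> (\<forall>c f. \<phi> (seq_scale c f) = c * \<phi> f) \<and>
    (\<forall>q. Poly_Mapping.lookup F (Mono q) * (\<Prod>j\<in>{1..<13}. fact (q $ of_nat j)) = \<phi> (sig_vector neg \<rho> v q))"
    using step(2) by (rule exE) (rule that)
  note \<phi> = p[THEN conjunct1, rule_format] p[THEN conjunct2, THEN conjunct1, rule_format] p[THEN conjunct2, THEN conjunct2, rule_format]
  obtain i where G: "G = gen S \<pi> N v i" using step(1) by (rule rangeE) (rule that)
  show ?case
  proof (rule exI[of _ "\<lambda>f. c * f i + \<phi> f"], intro conjI allI)
    show "c * (f + g) i + \<phi> (f + g) = c * f i + \<phi> f + (c * g i + \<phi> g)" for f g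
      unfolding \<phi>(1) by (simp add: distrib_left)
    show "c * seq_scale d f i + \<phi> (seq_scale d f) = d * (c * f i + \<phi> f)" for d f
      unfolding \<phi>(2) by (simp add: seq_scale_def distrib_left)
    show "Poly_Mapping.lookup (pscale c G + F) (Mono q) * (\<Prod>j\<in>{1..<13}. fact (q $ of_nat j)) =
        c * sig_vector neg \<rho> v q i + \<phi> (sig_vector neg \<rho> v q)" for q
      unfolding lookup_add lookup_pscale distrib_right \<phi>(3) G mult.assoc lookup_gen ..
  qed
qed

lemma fact_nz: "(\<Prod>j\<in>{1..<13}. fact (q $ of_nat j)) \<noteq> (0 :: complex)"
  by (rule prod_nonzero) (rule fact_nonzero)

lemma sig_vector_full: "sig_vector neg \<rho> v q \<in> full"
  unfolding sig_vector_act using sigword_set[of neg q] neg_so8 by (intro act_mem v_mem) blast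

lemma functional_coords:
  assumes add: "\<And>f g. \<phi> (f + g) = \<phi> f + \<phi> g" and scl: "\<And>c f. \<phi> (seq_scale c f) = (c * \<phi> f :: complex)" and f: "f \<in> full"
  shows "\<phi> f = (\<Sum>i\<in>S. f i * \<phi> (\<lambda>j. if j = i then 1 else 0))"
proof -
  let ?e = "\<lambda>i. (\<lambda>j. if j = i then 1 else 0) :: cseq"
  have fin': "\<phi> (\<lambda>j. if j \<in> A then f j else 0) = (\<Sum>i\<in>A. f i * \<phi> (?e i))" if "finite A" for A
    using that
  proof (induction A)
    case empty
    have "(\<lambda>j. if j \<in> {} then f j else 0) = seq_scale 0 f" by (rule ext) (simp add: seq_scale_def)
    then show ?case using scl[of 0 f] by simp
  next
    case (insert i A)
    have e: "(\<lambda>j. if j \<in> insert i A then f j else 0) = seq_scale (f i) (?e i) + (\<lambda>j. if j \<in> A then f j else 0)"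
      using insert(2) by (intro ext) (auto simp: seq_scale_def)
    show ?case unfolding e add scl insert(3) sum.insert[OF insert(1,2)] ..
  qed
  have "(\<lambda>j. if j \<in> S then f j else 0) = f" using f by (intro ext) auto
  then show ?thesis using fin'[OF fin] by simp
qed

text \<open>A linear functional on the module corresponds to the combination of the coordinate polynomials with
  its values as coefficients, and the coefficient of this polynomial at \<open>p\<close> is, up to a factorial, the
  value on the vector of signature \<open>p\<close>. So \<open>p\<close> is the lowest exponent of a combination iff some functional
  vanishes on all earlier vectors but not on this one.\<close>

lemma lowest_iff_independent:
  "sig_vector neg \<rho> v p \<notin> cseq.span {sig_vector neg \<rho> v q | q. sig_less q p} \<longleftrightarrow>
    (\<exists>F\<in>pol.span (range (gen S \<pi> N v)). lowest F (Mono p))"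
proof
  assume "sig_vector neg \<rho> v p \<notin> cseq.span {sig_vector neg \<rho> v q | q. sig_less q p}"
  then obtain \<phi> where \<phi>: "\<And>f g. \<phi> (f + g) = \<phi> f + \<phi> g" "\<And>c f. \<phi> (seq_scale c f) = c * \<phi> f"
    "\<And>f. f \<in> {sig_vector neg \<rho> v q | q. sig_less q p} \<Longrightarrow> \<phi> f = 0" "\<phi> (sig_vector neg \<rho> v p) = (1 :: complex)"
    by (rule separating_functional) (rule that)
  define F where "F = (\<Sum>i\<in>S. pscale (\<phi> (\<lambda>j. if j = i then 1 else 0)) (gen S \<pi> N v i))"
  have "F \<in> pol.span (range (gen S \<pi> N v))"
    unfolding F_def by (intro pol.span_sum pol.span_scale pol.span_base) blast
  moreover have l: "Poly_Mapping.lookup F (Mono q) * (\<Prod>j\<in>{1..<13}. fact (q $ of_nat j)) = \<phi> (sig_vector neg \<rho> v q)" for q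
    unfolding F_def lookup_sum lookup_pscale sum_distrib_right mult.assoc lookup_gen functional_coords[OF \<phi>(1,2) sig_vector_full]
    by (simp only: mult.commute)
  have "lowest F (Mono p)" unfolding lowest_def
  proof (intro conjI allI impI)
    show "Poly_Mapping.lookup F (Mono p) \<noteq> 0" using l[of p] \<phi>(4) by auto
    fix q assume "q < Mono p"
    then have "sig_less (exps q) p" by (simp add: less_mono_def)
    then have "\<phi> (sig_vector neg \<rho> v (exps q)) = 0" using \<phi>(3) by blast
    then show "Poly_Mapping.lookup F q = 0" using l[of "exps q"] fact_nz[of "exps q"] by (simp only: mult_eq_0_iff simp_thms mono.collapse)
  qed
  ultimately show "\<exists>F\<in>pol.span (range (gen S \<pi> N v)). lowest F (Mono p)" by blast
next
  assume "\<exists>F\<in>pol.span (range (gen S \<pi> N v)). lowest F (Mono p)"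
  then obtain F where F: "F \<in> pol.span (range (gen S \<pi> N v))" "lowest F (Mono p)" by blast
  obtain \<phi> where p: "(\<forall>f g. \<phi> (f + g) = \<phi> f + \<phi> g) \<and> (\<forall>c f. \<phi> (seq_scale c f) = c * \<phi> f) \<and>
    (\<forall>q. Poly_Mapping.lookup F (Mono q) * (\<Prod>j\<in>{1..<13}. fact (q $ of_nat j)) = \<phi> (sig_vector neg \<rho> v q))"
    using span_gen_functional[OF F(1)] by (rule exE) (rule that)
  note \<phi> = p[THEN conjunct1, rule_format] p[THEN conjunct2, THEN conjunct1, rule_format] p[THEN conjunct2, THEN conjunct2, rule_format]
  show "sig_vector neg \<rho> v p \<notin> cseq.span {sig_vector neg \<rho> v q | q. sig_less q p}"
  proof
    assume "sig_vector neg \<rho> v p \<in> cseq.span {sig_vector neg \<rho> v q | q. sig_less q p}"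
    then have "\<phi> (sig_vector neg \<rho> v p) = 0"
    proof (induction rule: cseq.span_induct_alt)
      case base
      show ?case using \<phi>(2)[of 0 0] unfolding cseq.scale_zero_left mult_zero_left .
    next
      case (step c x y)
      then obtain q where q: "x = sig_vector neg \<rho> v q" "sig_less q p" by blast
      have "Poly_Mapping.lookup F (Mono q) = 0" using F(2) q(2) unfolding lowest_def by (simp add: less_mono_def)
      then have "\<phi> x = 0" using \<phi>(3)[of q] q(1) by simp
      then show ?case using step by (simp only: \<phi>(1,2) mult_zero_right add_0)
    qed
    then have "Poly_Mapping.lookup F (Mono p) = 0" using \<phi>(3)[of p] fact_nz[of p] by (simp only: mult_eq_0_iff simp_thms)
    then show False using F(2) unfolding lowest_def by blast
  qed
qed

theorem essential_iff_lowest: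
  assumes e: "\<And>k. k \<in> {1..12} \<Longrightarrow> e k = cscale (c k) (neg k) \<and> c k \<noteq> 0" and dom: "dominant \<mu>"
  shows "essential e \<mu> p \<longleftrightarrow> (\<exists>F\<in>pol.span (range (gen S \<pi> N v)). lowest F (Mono p))"
proof
  assume "essential e \<mu> p"
  then obtain W \<rho>' v' where W: "is_irreducible W \<rho>'" "highest_weight_vector \<mu> W \<rho>' v'"
    "sig_vector e \<rho>' v' p \<notin> cseq.span {sig_vector e \<rho>' v' q | q. sig_less q p}"
    unfolding essential_def by blast
  have M: "hw_module seq_scale \<mu> W \<rho>' v'" by (rule irreducible_hw_module[OF W(1,2)])
  have irr: "U = {0} \<or> U = W" if "cseq.subspace U" "U \<subseteq> W" "\<forall>X\<in>so8. \<forall>u\<in>U. \<rho>' X u \<in> U" for U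
    using W(1) that unfolding is_irreducible_def by blast
  have sw: "set (sigword neg q) \<subseteq> so8" for q using sigword_set[of neg q] neg_so8 by blast
  have "sig_vector neg \<rho> v p \<notin> cseq.span {sig_vector neg \<rho> v q | q. sig_less q p}"
  proof
    assume "sig_vector neg \<rho> v p \<in> cseq.span {sig_vector neg \<rho> v q | q. sig_less q p}"
    then have d: "act \<rho> (sigword neg p) v \<in> cseq.span {act \<rho> (sigword neg q) v | q. sig_less q p}"
      unfolding sig_vector_act .
    have "act \<rho>' (sigword neg p) v' \<in> cseq.span {act \<rho>' (sigword neg q) v' | q. sig_less q p}"
      by (rule seqs.dependence_transfer[OF full_module M _ sw d]) (rule irr)
    then have "sig_vector neg \<rho>' v' p \<in> cseq.span {sig_vector neg \<rho>' v' q | q. sig_less q p}"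
      unfolding sig_vector_act .
    moreover have "sig_vector e \<rho>' v' p \<in> cseq.span {sig_vector e \<rho>' v' q | q. sig_less q p} \<longleftrightarrow>
      sig_vector neg \<rho>' v' p \<in> cseq.span {sig_vector neg \<rho>' v' q | q. sig_less q p}"
      by (rule dependence_normalize[OF M e])
    ultimately show False using W(3) by blast
  qed
  then show "\<exists>F\<in>pol.span (range (gen S \<pi> N v)). lowest F (Mono p)" unfolding lowest_iff_independent .
next
  assume "\<exists>F\<in>pol.span (range (gen S \<pi> N v)). lowest F (Mono p)"
  then have n1: "sig_vector neg \<rho> v p \<notin> cseq.span {sig_vector neg \<rho> v q | q. sig_less q p}"
    unfolding lowest_iff_independent .
  have n2: "sig_vector e \<rho> v p \<in> cseq.span {sig_vector e \<rho> v q | q. sig_less q p} \<longleftrightarrow>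
      sig_vector neg \<rho> v p \<in> cseq.span {sig_vector neg \<rho> v q | q. sig_less q p}"
    by (rule dependence_normalize[OF full_module e])
  have "sig_vector e \<rho> v p \<notin> cseq.span {sig_vector e \<rho> v q | q. sig_less q p}" by (simp only: n1 n2 not_False_eq_True)
  then show "essential e \<mu> p" unfolding essential_def by (intro conjI exI[of _ cyc] exI[of _ \<rho>] exI[of _ v] dom cyc_irreducible cyc_hw)
qed

end

section \<open>Tensor products of models\<close>

lemma pact_const: "pact S \<pi> X (\<lambda>j. Poly_Mapping.single 0 (f j)) = (\<lambda>i. Poly_Mapping.single 0 (mact S \<pi> X f i))"
proof
  fix i
  have "Poly_Mapping.lookup (pact S \<pi> X (\<lambda>j. Poly_Mapping.single 0 (f j)) i) q = Poly_Mapping.lookup (Poly_Mapping.single 0 (mact S \<pi> X f i)) q" for q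
    unfolding lookup_pact by (cases "q = 0") (simp_all add: lookup_single when_def mact_def)
  then show "pact S \<pi> X (\<lambda>j. Poly_Mapping.single 0 (f j)) i = Poly_Mapping.single 0 (mact S \<pi> X f i)"
    by (rule poly_mapping_eqI)
qed

lemma tens_const: "tens (\<lambda>i. Poly_Mapping.single 0 (v i) :: pol) (\<lambda>i. Poly_Mapping.single 0 (v' i)) = (\<lambda>m. Poly_Mapping.single 0 (tens v v' m))"
  by (rule ext) (simp add: tens_def mult_single)

lemma mact_tens:
  assumes "finite S" "finite S'" "\<And>i. i \<notin> S \<Longrightarrow> f i = 0" "\<And>i. i \<notin> S' \<Longrightarrow> f' i = 0"
  shows "mact (tset S S') (trep \<pi> \<pi>') X (tens f f') m = tens (mact S \<pi> X f) f' m + tens f (mact S' \<pi>' X f') m"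
proof -
  have "pact (tset S S') (trep \<pi> \<pi>') X (tens (\<lambda>i. Poly_Mapping.single 0 (f i)) (\<lambda>i. Poly_Mapping.single 0 (f' i)))
    = (\<lambda>m. tens (pact S \<pi> X (\<lambda>i. Poly_Mapping.single 0 (f i))) (\<lambda>i. Poly_Mapping.single 0 (f' i)) m
         + tens (\<lambda>i. Poly_Mapping.single 0 (f i)) (pact S' \<pi>' X (\<lambda>i. Poly_Mapping.single 0 (f' i))) m)"
    by (rule pact_tens) (use assms in auto)
  then have "Poly_Mapping.single 0 (mact (tset S S') (trep \<pi> \<pi>') X (tens f f') m) =
    (Poly_Mapping.single 0 (tens (mact S \<pi> X f) f' m) + Poly_Mapping.single 0 (tens f (mact S' \<pi>' X f') m) :: pol)"
    unfolding pact_const tens_const by (rule fun_cong)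
  then have "Poly_Mapping.lookup (Poly_Mapping.single 0 (mact (tset S S') (trep \<pi> \<pi>') X (tens f f') m)) (0 :: mono) =
    Poly_Mapping.lookup (Poly_Mapping.single 0 (tens (mact S \<pi> X f) f' m) + Poly_Mapping.single 0 (tens f (mact S' \<pi>' X f') m) :: pol) 0"
    by (rule arg_cong[where f = "\<lambda>F. Poly_Mapping.lookup F 0"])
  then show ?thesis unfolding lookup_add lookup_single by (simp only: when_def refl if_True simp_thms)
qed

lemma sum_if_const: "(\<Sum>b\<in>B. if P then h b else 0) = (if P then \<Sum>b\<in>B. h b else (0 :: complex))"
  by simp

lemma trep_encode: "trep \<pi> \<pi>' X (prod_encode (i, i')) (prod_encode (j, j')) =
   (if i' = j' then \<pi> X i j else 0) + (if i = j then \<pi>' X i' j' else 0)"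
  by (simp add: trep_def)

lemma trep_prod:
  assumes "finite S" "finite S'" "i \<in> S" "i' \<in> S'" "j \<in> S" "j' \<in> S'"
  shows "(\<Sum>a\<in>S. \<Sum>b\<in>S'. trep \<pi> \<pi>' X (prod_encode (i, i')) (prod_encode (a, b)) * trep \<pi> \<pi>' Y (prod_encode (a, b)) (prod_encode (j, j')))
    = (if i' = j' then \<Sum>a\<in>S. \<pi> X i a * \<pi> Y a j else 0) + \<pi> X i j * \<pi>' Y i' j' + \<pi>' X i' j' * \<pi> Y i j
      + (if i = j then \<Sum>b\<in>S'. \<pi>' X i' b * \<pi>' Y b j' else 0)"
proof -
  have "(\<Sum>a\<in>S. \<Sum>b\<in>S'. trep \<pi> \<pi>' X (prod_encode (i, i')) (prod_encode (a, b)) * trep \<pi> \<pi>' Y (prod_encode (a, b)) (prod_encode (j, j')))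
    = (\<Sum>a\<in>S. \<Sum>b\<in>S'. (if b = i' then if b = j' then \<pi> X i a * \<pi> Y a j else 0 else 0)
        + (if b = i' then if a = j then \<pi> X i a * \<pi>' Y b j' else 0 else 0)
        + (if a = i then if b = j' then \<pi>' X i' b * \<pi> Y a j else 0 else 0)
        + (if a = i then if a = j then \<pi>' X i' b * \<pi>' Y b j' else 0 else 0))"
    unfolding trep_encode by (intro sum.cong refl) (simp add: distrib_left distrib_right)
  also have "\<dots> = (if i' = j' then \<Sum>a\<in>S. \<pi> X i a * \<pi> Y a j else 0) + \<pi> X i j * \<pi>' Y i' j' + \<pi>' X i' j' * \<pi> Y i j
      + (if i = j then \<Sum>b\<in>S'. \<pi>' X i' b * \<pi>' Y b j' else 0)"
    by (simp only: sum.distrib sum_if_const sum.delta assms if_True)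
  finally show ?thesis .
qed

lemma matrix_rep_tens:
  assumes "matrix_rep S \<pi>" "matrix_rep S' \<pi>'"
  shows "matrix_rep (tset S S') (trep \<pi> \<pi>')"
proof -
  have f: "finite S" "finite S'" using assms by (simp_all add: matrix_rep_def)
  have "trep \<pi> \<pi>' (X + Y) m n = trep \<pi> \<pi>' X m n + trep \<pi> \<pi>' Y m n"
    if "X \<in> so8" "Y \<in> so8" "m \<in> tset S S'" "n \<in> tset S S'" for X Y m n
    using that assms by (auto simp: matrix_rep_def trep_encode elim!: tset_cases)
  moreover have "trep \<pi> \<pi>' (cscale c X) m n = c * trep \<pi> \<pi>' X m n"
    if "X \<in> so8" "m \<in> tset S S'" "n \<in> tset S S'" for c X m n
    using that assms by (auto simp: matrix_rep_def trep_encode distrib_left elim!: tset_cases)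
  moreover have "trep \<pi> \<pi>' (herm X) m n = cnj (trep \<pi> \<pi>' X n m)"
    if "X \<in> so8" "m \<in> tset S S'" "n \<in> tset S S'" for X m n
    using that assms by (auto simp: matrix_rep_def trep_encode elim!: tset_cases)
  moreover have "trep \<pi> \<pi>' (bracket X Y) m n = (\<Sum>k\<in>tset S S'. trep \<pi> \<pi>' X m k * trep \<pi> \<pi>' Y k n - trep \<pi> \<pi>' Y m k * trep \<pi> \<pi>' X k n)"
    if XY: "X \<in> so8" "Y \<in> so8" and mn: "m \<in> tset S S'" "n \<in> tset S S'" for X Y m n
  proof -
    obtain i i' where i: "i \<in> S" "i' \<in> S'" "m = prod_encode (i, i')" using mn(1) by (rule tset_cases)
    obtain j j' where j: "j \<in> S" "j' \<in> S'" "n = prod_encode (j, j')" using mn(2) by (rule tset_cases)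
    have b: "\<pi> (bracket X Y) i j = (\<Sum>k\<in>S. \<pi> X i k * \<pi> Y k j) - (\<Sum>k\<in>S. \<pi> Y i k * \<pi> X k j)"
      "\<pi>' (bracket X Y) i' j' = (\<Sum>k\<in>S'. \<pi>' X i' k * \<pi>' Y k j') - (\<Sum>k\<in>S'. \<pi>' Y i' k * \<pi>' X k j')"
      using assms XY i j by (simp_all add: matrix_rep_def sum_subtractf)
    show ?thesis unfolding i(3) j(3) sum_tset sum_subtractf trep_prod[OF f i(1,2) j(1,2)]
      unfolding trep_encode b
      by (cases "i = j"; cases "i' = j'") (simp_all only: if_True if_False simp_thms, simp_all add: algebra_simps)
  qed
  ultimately show ?thesis using f unfolding matrix_rep_def by (auto simp: tset_def)
qed

lemma eval_weight_add: "eval_weight (\<mu> + \<mu>') x = eval_weight \<mu> x + eval_weight \<mu>' x"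
  by (simp add: eval_weight_def of_rat_add distrib_right sum.distrib)

lemma hw_vec_tens:
  assumes f: "finite S" "finite S'" and h: "hw_vec S \<pi> \<mu> v" "hw_vec S' \<pi>' \<mu>' v'"
  shows "hw_vec (tset S S') (trep \<pi> \<pi>') (\<mu> + \<mu>') (tens v v')"
proof -
  have s: "\<And>i. i \<notin> S \<Longrightarrow> v i = 0" "\<And>i. i \<notin> S' \<Longrightarrow> v' i = 0" using h by (simp_all add: hw_vec_def)
  have "tens v v' m = 0" if "m \<notin> tset S S'" for m
  proof -
    obtain i i' where m: "m = prod_encode (i, i')" by (metis prod_decode_inverse surj_pair)
    then show ?thesis using that s by (auto simp: in_tset)
  qed
  moreover obtain i i' where "v i \<noteq> 0" "v' i' \<noteq> 0" using h by (auto simp: hw_vec_def)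
  then have "tens v v' (prod_encode (i, i')) \<noteq> 0" by simp
  then have "\<exists>m. tens v v' m \<noteq> 0" by blast
  moreover have mt: "mact (tset S S') (trep \<pi> \<pi>') X (tens v v') m = tens (mact S \<pi> X v) v' m + tens v (mact S' \<pi>' X v') m" for X m
    by (rule mact_tens[OF f]) (use s in auto)
  have c: "mact S \<pi> (cartan x) v = (\<lambda>i. eval_weight \<mu> x * v i)" "mact S' \<pi>' (cartan x) v' = (\<lambda>i. eval_weight \<mu>' x * v' i)" for x
    using h by (simp_all add: hw_vec_def fun_eq_iff)
  have "mact (tset S S') (trep \<pi> \<pi>') (cartan x) (tens v v') m = eval_weight (\<mu> + \<mu>') x * tens v v' m" for x m
    unfolding mt c by (simp add: tens_def eval_weight_add distrib_right)
  moreover have "mact (tset S S') (trep \<pi> \<pi>') (pos k) (tens v v') m = 0" if "k \<in> {1..12}" for k m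
  proof -
    have "mact S \<pi> (pos k) v i = 0" "mact S' \<pi>' (pos k) v' i = 0" for i using h that unfolding hw_vec_def by blast+
    then show ?thesis unfolding mt tens_def by simp
  qed
  ultimately show ?thesis unfolding hw_vec_def by blast
qed

lemma model_tens:
  assumes "model S \<pi> N \<mu> v" "model S' \<pi>' N' \<mu>' v'"
  shows "model (tset S S') (trep \<pi> \<pi>') (N + N') (\<mu> + \<mu>') (tens v v')"
proof -
  interpret A: model S \<pi> N \<mu> v by (rule assms)
  interpret B: model S' \<pi>' N' \<mu>' v' by (rule assms)
  show ?thesis
    by unfold_locales (rule matrix_rep_tens[OF A.rep B.rep] nilrep_tens[OF A.fin B.fin A.nil B.nil] hw_vec_tens[OF A.fin B.fin A.hwv B.hwv])+
qed

lemma span_products: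
  assumes "A \<subseteq> pol.span A'" "B \<subseteq> pol.span B'"
  shows "{a * b | a b. a \<in> A \<and> b \<in> B} \<subseteq> pol.span {a * b | a b. a \<in> A' \<and> b \<in> B'}"
proof clarify
  fix a b assume ab: "a \<in> A" "b \<in> B"
  let ?P = "{a * b | a b. a \<in> A' \<and> b \<in> B'}"
  have 1: "a' * b \<in> pol.span ?P" if "a' \<in> A'" for a'
  proof -
    have "b \<in> pol.span B'" using ab assms by blast
    then show ?thesis
    proof (induction rule: pol.span_induct_alt)
      case base show ?case using pol.span_zero by simp
    next
      case (step c x y)
      have m: "a' * x \<in> ?P" using step that by blast
      show ?case unfolding distrib_left pscale_mult(1)[symmetric]
        by (rule pol.span_add[OF pol.span_scale[OF pol.span_base[OF m]] step(2)])
    qed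
  qed
  have "a \<in> pol.span A'" using ab assms by blast
  then show "a * b \<in> pol.span ?P"
  proof (induction rule: pol.span_induct_alt)
    case base show ?case using pol.span_zero by simp
  next
    case (step c x y)
    show ?case unfolding distrib_right pscale_mult(2)[symmetric]
      by (rule pol.span_add[OF pol.span_scale[OF 1[OF step(1)]] step(2)])
  qed
qed

lemma span_products_eq:
  assumes "pol.span A = pol.span A'" "pol.span B = pol.span B'"
  shows "pol.span {a * b | a b. a \<in> A \<and> b \<in> B} = pol.span {a * b | a b. a \<in> A' \<and> b \<in> B'}"
proof -
  have "A \<subseteq> pol.span A'" "B \<subseteq> pol.span B'" "A' \<subseteq> pol.span A" "B' \<subseteq> pol.span B"
    using assms pol.span_superset by auto
  then show ?thesis unfolding pol.span_eq using span_products by simp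
qed

text \<open>Spans are compared instead of generating families, since the coordinates depend on the choice of a
  basis.\<close>

definition has_model :: "rat ^ 4 \<Rightarrow> pol set \<Rightarrow> bool" where
  "has_model \<mu> A \<longleftrightarrow> (\<exists>S \<pi> N v. model S \<pi> N \<mu> v \<and> pol.span (range (gen S \<pi> N v)) = pol.span A)"

lemma has_model_mult:
  assumes "has_model \<mu> A" "has_model \<mu>' B"
  shows "has_model (\<mu> + \<mu>') {a * b | a b. a \<in> A \<and> b \<in> B}"
proof -
  obtain S \<pi> N v where A: "model S \<pi> N \<mu> v" "pol.span (range (gen S \<pi> N v)) = pol.span A"
    using assms(1) unfolding has_model_def by blast
  obtain S' \<pi>' N' v' where B: "model S' \<pi>' N' \<mu>' v'" "pol.span (range (gen S' \<pi>' N' v')) = pol.span B"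
    using assms(2) unfolding has_model_def by blast
  interpret A: model S \<pi> N \<mu> v by (rule A)
  interpret B: model S' \<pi>' N' \<mu>' v' by (rule B)
  have g: "gen (tset S S') (trep \<pi> \<pi>') (N + N') (tens v v') = tens (gen S \<pi> N v) (gen S' \<pi>' N' v')"
    by (rule gen_tens[OF A.fin B.fin _ _ A.nil B.nil]) (use A.hwv B.hwv in \<open>simp_all add: hw_vec_def\<close>)
  have "range (tens G G') = {a * b | a b. a \<in> range G \<and> b \<in> range G'}" for G G' :: "nat \<Rightarrow> pol"
  proof (intro set_eqI iffI)
    fix F assume "F \<in> {a * b | a b. a \<in> range G \<and> b \<in> range G'}"
    then obtain i j where "F = tens G G' (prod_encode (i, j))" by auto
    then show "F \<in> range (tens G G')" by blast
  qed (auto simp: tens_def)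
  then have "pol.span (range (gen (tset S S') (trep \<pi> \<pi>') (N + N') (tens v v'))) = pol.span {a * b | a b. a \<in> A \<and> b \<in> B}"
    unfolding g by (simp only: span_products_eq[OF A(2) B(2)])
  then show ?thesis using model_tens[OF A(1) B(1)] unfolding has_model_def by blast
qed

lemma mact_null: "mact S (\<lambda>X i j. 0) X f i = 0"
  by (simp add: mact_def)

lemma has_model_trivial: "has_model 0 {1}"
proof -
  let ?v = "(\<lambda>i. if i = 0 then 1 else 0) :: cseq"
  have p: "pact {0} (\<lambda>X i j. 0) X G i = 0" for X G i by (simp add: pact_def)
  have m: "model {0} (\<lambda>X i j. 0) 1 0 ?v"
    by unfold_locales (simp_all add: matrix_rep_def nilrep_def p hw_vec_def mact_null eval_weight_def)
  have "Phi {0} (\<lambda>X i j. 0) 1 k G = G" for k G by (rule ext) (simp add: Phi_def)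
  then have "foldr (Phi {0} (\<lambda>X i j. 0) 1) ks G = G" for ks G by (induction ks) simp_all
  then have "gen {0} (\<lambda>X i j. 0) 1 ?v = (\<lambda>i. Poly_Mapping.single 0 (?v i))" unfolding gen_def .
  then have g: "gen {0} (\<lambda>X i j. 0) 1 ?v = (\<lambda>i. if i = 0 then 1 else 0)" by (auto simp: fun_eq_iff)
  have "pol.span (range (\<lambda>i :: nat. if i = 0 then 1 else 0)) = pol.span {1}"
    unfolding pol.span_eq by (auto intro: pol.span_base pol.span_zero rev_image_eqI[of 0])
  then show ?thesis using m g unfolding has_model_def by metis
qed

fun omega :: "nat \<Rightarrow> rat ^ 4" where
  "omega t = (if t = 1 then eps 1 else if t = 2 then eps 1 + eps 2
     else if t = 3 then (1/2) *s (eps 1 + eps 2 + eps 3 - eps 4) else (1/2) *s (eps 1 + eps 2 + eps 3 + eps 4))"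
declare omega.simps [simp del]

lemma has_model_types:
  assumes base: "\<And>t. t \<in> {1..4} \<Longrightarrow> has_model (omega t) {gpoly var g | g. g < 52 \<and> gtype g = t}"
    and T: "set_mset T \<subseteq> {1..4}"
  shows "has_model (\<Sum>t\<in>#T. omega t) {gprod S | S. valid S \<and> gtypes S = T}"
  using T
proof (induction T)
  case empty
  have "{gprod S | S. valid S \<and> gtypes S = {#}} = {1}" by (auto simp: gtypes_def intro!: exI[of _ "{#}"])
  then show ?case using has_model_trivial by simp
next
  case (add t T)
  have "{gprod S | S. valid S \<and> gtypes S = add_mset t T} =
     {a * b | a b. a \<in> {gpoly var g | g. g < 52 \<and> gtype g = t} \<and> b \<in> {gprod S | S. valid S \<and> gtypes S = T}}" (is "?l = ?r")
  proof (intro set_eqI iffI)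
    fix F assume "F \<in> ?l"
    then obtain S where S: "F = gprod S" "valid S" "gtypes S = add_mset t T" by blast
    from S(3) obtain g S' where "S = add_mset g S'" "gtype g = t" "gtypes S' = T"
      unfolding gtypes_def by (elim msed_map_invR[elim_format]) blast
    then show "F \<in> ?r" using S by auto
  next
    fix F assume "F \<in> ?r"
    then obtain g S where "F = gpoly var g * gprod S" "g < 52" "gtype g = t" "valid S" "gtypes S = T" by blast
    then have "F = gprod (add_mset g S)" "valid (add_mset g S)" "gtypes (add_mset g S) = add_mset t T" by simp_all
    then show "F \<in> ?l" by blast
  qed
  then show ?case using has_model_mult[OF base[of t] add.IH] add.prems by simp
qed

section \<open>The fundamental modules\<close>

definition unit8 :: "nat \<Rightarrow> 'a::comm_ring_1 list" where "unit8 a = map (\<lambda>i. if i = a then 1 else 0) [0..<8]"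
definition delta :: "nat \<Rightarrow> cseq" where "delta a = (\<lambda>i. if i = a then 1 else 0)"

lemma sum8: "(\<Sum>k\<in>{..<8::nat}. f k) = f 0 + f 1 + f 2 + f 3 + f 4 + f 5 + f 6 + f 7"
  by (simp add: eval_nat_numeral lessThan_Suc ac_simps)

lemma all8: "(\<forall>i<8::nat. P i) \<longleftrightarrow> P 0 \<and> P 1 \<and> P 2 \<and> P 3 \<and> P 4 \<and> P 5 \<and> P 6 \<and> P 7"
  by (simp add: eval_nat_numeral All_less_Suc conj_ac)

lemma all12: "(\<forall>k\<in>{1..12::nat}. P k) \<longleftrightarrow> P 1 \<and> P 2 \<and> P 3 \<and> P 4 \<and> P 5 \<and> P 6 \<and> P 7 \<and> P 8 \<and> P 9 \<and> P 10 \<and> P 11 \<and> P 12"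
  unfolding set_eqI[OF index12] by (simp only: list.set ball_simps simp_thms)

text \<open>In the eight-dimensional modules below each negative root vector has exactly two nonzero entries.
  Its exponential changes two coordinates, so the coordinate polynomials can be computed on lists.\<close>

fun step8 :: "nat \<times> nat \<times> int \<times> nat \<times> nat \<times> int \<Rightarrow> 'a::comm_ring_1 \<Rightarrow> 'a list \<Rightarrow> 'a list" where
  "step8 (r1, s1, c1, r2, s2, c2) y L = L[r1 := L ! r1 + of_int c1 * (y * L ! s1), r2 := L ! r2 + of_int c2 * (y * L ! s2)]"

definition run8 :: "(nat \<times> nat \<times> int \<times> nat \<times> nat \<times> int) list \<Rightarrow> (nat \<Rightarrow> 'a::comm_ring_1) \<Rightarrow> nat \<Rightarrow> 'a list" where
  "run8 sp X a = foldr (\<lambda>k L. step8 (sp ! (k - 1)) (X k) L) [1,2,3,4,5,6,7,8,9,10,11,12] (unit8 a)"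

fun sparse :: "nat \<times> nat \<times> int \<times> nat \<times> nat \<times> int \<Rightarrow> (nat \<Rightarrow> nat \<Rightarrow> complex) \<Rightarrow> bool" where
  "sparse (r1, s1, c1, r2, s2, c2) P \<longleftrightarrow> r1 < 8 \<and> s1 < 8 \<and> r2 < 8 \<and> s2 < 8 \<and> r1 \<noteq> r2 \<and> s1 \<noteq> r1 \<and> s1 \<noteq> r2 \<and> s2 \<noteq> r1 \<and> s2 \<noteq> r2 \<and>
     (\<forall>i<8. \<forall>j<8. P i j = (if i = r1 \<and> j = s1 then of_int c1 else if i = r2 \<and> j = s2 then of_int c2 else 0))"

lemma sparse_pact:
  assumes "sparse (r1, s1, c1, r2, s2, c2) (\<pi> X)"
  shows "pact {..<8} \<pi> X G i = (if i = r1 then pscale (of_int c1) (G s1) else if i = r2 then pscale (of_int c2) (G s2) else 0)"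
proof (cases "i < 8")
  case True
  have "pact {..<8} \<pi> X G i = (\<Sum>j\<in>{..<8}. if i = r1 then if j = s1 then pscale (of_int c1) (G j) else 0 else if i = r2 then if j = s2 then pscale (of_int c2) (G j) else 0 else 0)"
    using True assms unfolding pact_def by (auto intro!: sum.cong)
  also have "\<dots> = (if i = r1 then pscale (of_int c1) (G s1) else if i = r2 then pscale (of_int c2) (G s2) else 0)"
    using assms by (cases "i = r1"; cases "i = r2") simp_all
  finally show ?thesis .
next
  case False
  then show ?thesis using assms by (auto simp: pact_def)
qed

lemma sparse_nilrep:
  assumes "\<forall>k\<in>{1..12}. sparse (sp ! (k - 1)) (\<pi> (neg k))" shows "nilrep {..<8} \<pi> 2"
  unfolding nilrep_def
proof (intro ballI allI)
  fix k :: nat and G :: "nat \<Rightarrow> pol" and i assume k: "k \<in> {1..12}"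
  obtain r1 s1 c1 r2 s2 c2 where e: "sp ! (k - 1) = (r1, s1, c1, r2, s2, c2)" by (metis surj_pair)
  have s: "sparse (r1, s1, c1, r2, s2, c2) (\<pi> (neg k))" using bspec[OF assms k] unfolding e .
  show "(pact {..<8} \<pi> (neg k) ^^ 2) G i = 0"
    unfolding numeral_2_eq_2 funpow.simps comp_apply id_apply sparse_pact[where \<pi> = \<pi> and X = "neg k", OF s] using s by simp
qed

lemma sparse_Phi:
  assumes s: "\<forall>k\<in>{1..12}. sparse (sp ! (k - 1)) (\<pi> (neg k))" and k: "k \<in> {1..12}" and L: "length L = 8"
  shows "Phi {..<8} \<pi> 2 k (\<lambda>i. if i < 8 then L ! i else 0) = (\<lambda>i. if i < 8 then step8 (sp ! (k - 1)) (var k) L ! i else 0)"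
proof
  fix i
  obtain r1 s1 c1 r2 s2 c2 where e: "sp ! (k - 1) = (r1, s1, c1, r2, s2, c2)" by (metis surj_pair)
  have s: "sparse (r1, s1, c1, r2, s2, c2) (\<pi> (neg k))" using bspec[OF s k] unfolding e .
  let ?G = "\<lambda>i. if i < 8 then L ! i else 0"
  have "Phi {..<8} \<pi> 2 k ?G i = ?G i + var k * pact {..<8} \<pi> (neg k) ?G i"
    unfolding Phi_def numeral_2_eq_2 by (simp add: dpow_def del: One_nat_def)
  also have "\<dots> = (if i < 8 then step8 (sp ! (k - 1)) (var k) L ! i else 0)"
    unfolding sparse_pact[where \<pi> = \<pi> and X = "neg k", OF s] e using s L
    by (auto simp: nth_list_update of_int_pscale pscale_mult(1)[symmetric])
  finally show "Phi {..<8} \<pi> 2 k ?G i = (if i < 8 then step8 (sp ! (k - 1)) (var k) L ! i else 0)" .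
qed

lemma zero8: "(0::nat) < 8" by simp

lemma length_step8: "length (step8 t y L) = length L" by (cases t) simp

lemma sparse_gen:
  assumes s: "\<forall>k\<in>{1..12}. sparse (sp ! (k - 1)) (\<pi> (neg k))"
    and a: "a < 8"
  shows "gen {..<8} \<pi> 2 (delta a) = (\<lambda>i. if i < 8 then run8 sp var a ! i else 0)"
proof -
  have main: "foldr (Phi {..<8} \<pi> 2) ks (\<lambda>i. if i < 8 then L ! i else 0) = (\<lambda>i. if i < 8 then foldr (\<lambda>k L. step8 (sp ! (k - 1)) (var k) L) ks L ! i else 0)
      \<and> length (foldr (\<lambda>k L. step8 (sp ! (k - 1)) (var k) L) ks L) = 8" if "set ks \<subseteq> {1..12}" "length L = 8" for ks L
    using that
  proof (induction ks)
    case Nil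
    then show ?case by (simp only: foldr.simps id_apply simp_thms)
  next
    case (Cons k ks)
    then have IH: "foldr (Phi {..<8} \<pi> 2) ks (\<lambda>i. if i < 8 then L ! i else 0) = (\<lambda>i. if i < 8 then foldr (\<lambda>k L. step8 (sp ! (k - 1)) (var k) L) ks L ! i else 0)"
      "length (foldr (\<lambda>k L. step8 (sp ! (k - 1)) (var k) L) ks L) = 8" and k: "k \<in> {1..12}" by auto
    show ?case unfolding foldr.simps comp_apply IH(1)
      by (rule conjI) (rule sparse_Phi[OF s k IH(2)], simp only: length_step8 IH(2))
  qed
  have u: "[1..<13] = [1,2,3,4,5,6,7,8,9,10,11,12::nat]" by (simp add: upt_rec)
  have i: "(\<lambda>i. Poly_Mapping.single 0 (delta a i)) = (\<lambda>i. if i < 8 then unit8 a ! i else 0 :: pol)"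
    using a by (auto simp: fun_eq_iff delta_def unit8_def)
  show ?thesis unfolding gen_def i run8_def u by (rule conjunct1[OF main]) (auto simp: unit8_def)
qed

lemma mact_delta: "a < 8 \<Longrightarrow> mact {..<8} \<pi> X (delta a) = (\<lambda>i. if i < 8 then \<pi> X i a else 0)"
  by (rule ext) (simp add: mact_def delta_def if_distrib[of "\<lambda>x. _ * x"] cong: if_cong)

lemma base_model:
  assumes "matrix_rep {..<8} \<pi>" "\<forall>k\<in>{1..12}. sparse (sp ! (k - 1)) (\<pi> (neg k))"
    "\<And>x. \<forall>i<8. \<pi> (cartan x) i 0 = (if i = 0 then eval_weight \<mu> x else 0)" "\<forall>k\<in>{1..12}. \<forall>i<8. \<pi> (pos k) i 0 = 0"
  shows "model {..<8} \<pi> 2 \<mu> (delta 0)"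
proof
  show "matrix_rep {..<8} \<pi>" by (rule assms)
  show "nilrep {..<8} \<pi> 2" by (rule sparse_nilrep[OF assms(2)])
  have "(0::nat) < 8" by simp
  note md = mact_delta[OF this]
  show "hw_vec {..<8} \<pi> \<mu> (delta 0)" unfolding hw_vec_def md
  proof (intro conjI allI ballI impI)
    show "\<exists>i. delta 0 i \<noteq> 0" by (rule exI[of _ 0]) (simp add: delta_def)
    show "delta 0 i = 0" if "i \<notin> {..<8}" for i using that by (auto simp: delta_def)
    show "(if i < 8 then \<pi> (cartan x) i 0 else 0) = eval_weight \<mu> x * delta 0 i" for x i
      using assms(3)[of x] by (auto simp: delta_def)
    show "(if i < 8 then \<pi> (pos k) i 0 else 0) = 0" if "k \<in> {1..12}" for k i
      using assms(4) that by auto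
  qed
qed

definition comb :: "(int \<times> nat) list \<Rightarrow> (nat \<Rightarrow> 'a::comm_ring_1) \<Rightarrow> 'a" where
  "comb L X = (\<Sum>(c, g)\<leftarrow>L. of_int c * gpoly X g)"

lemma comb_span:
  assumes "list_all (\<lambda>(c, g). gpoly var g \<in> A) L" shows "comb L var \<in> pol.span A"
  using assms
proof (induction L)
  case Nil
  show ?case by (simp add: comb_def pol.span_zero)
next
  case (Cons a L)
  obtain c g where a: "a = (c, g)" by (cases a)
  have e: "comb (a # L) var = pscale (of_int c) (gpoly var g) + comb L var" by (simp add: comb_def a of_int_pscale)
  have "gpoly var g \<in> A" "comb L var \<in> pol.span A" using Cons a by simp_all
  then show ?case unfolding e by (intro pol.span_add[OF pol.span_scale[OF pol.span_base]])
qed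

definition typed :: "nat \<Rightarrow> nat \<Rightarrow> bool" where "typed t g \<longleftrightarrow> g < 52 \<and> gtype g = t"

lemma span_table:
  assumes run: "\<And>i. i < 8 \<Longrightarrow> run8 sp var 0 ! i = of_int (fst (tb ! i)) * gpoly var (snd (tb ! i))"
    and tb: "length tb = 8" "list_all (\<lambda>(c, g). (c = 1 \<or> c = -1) \<and> typed t g) tb" "list_all (\<lambda>g. gtype g = t \<longrightarrow> g \<in> set (map snd tb)) ids"
    and s: "\<forall>k\<in>{1..12}. sparse (sp ! (k - 1)) (\<pi> (neg k))"
  shows "pol.span (range (gen {..<8} \<pi> 2 (delta 0))) = pol.span {gpoly var g | g. typed t g}"
  unfolding pol.span_eq sparse_gen[OF s zero8]
proof (intro conjI subsetI)
  fix F :: pol assume "F \<in> range (\<lambda>i. if i < 8 then run8 sp var 0 ! i else 0)"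
  then obtain i where F: "F = (if i < 8 then run8 sp var 0 ! i else 0)" by blast
  show "F \<in> pol.span {gpoly var g | g. typed t g}"
  proof (cases "i < 8")
    case True
    then have "tb ! i \<in> set tb" using tb(1) by simp
    then have "case tb ! i of (c, g) \<Rightarrow> (c = 1 \<or> c = -1) \<and> typed t g" using tb(2) unfolding list_all_iff by (rule bspec[rotated])
    then have "typed t (snd (tb ! i))" unfolding case_prod_beta by (rule conjunct2)
    then show ?thesis unfolding F if_P[OF True] run[OF True] of_int_pscale by (intro pol.span_scale pol.span_base) blast
  next
    case False
    then show ?thesis unfolding F if_not_P[OF False] by (simp add: pol.span_zero)
  qed
next
  fix F assume "F \<in> {gpoly var g | g. typed t g}"
  then obtain g where g: "F = gpoly var g" "g < 52" "gtype g = t" unfolding typed_def by blast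
  then have "g \<in> set (map snd tb)" using tb(3) by (simp add: list_all_iff ids)
  then obtain i where i: "i < 8" "snd (tb ! i) = g" using tb(1) by (auto simp: in_set_conv_nth)
  let ?R = "range (\<lambda>i. if i < 8 then run8 sp var 0 ! i else 0) :: pol set"
  have "(\<lambda>i. if i < 8 then run8 sp var 0 ! i else 0) i \<in> ?R" by (rule rangeI)
  then have m: "run8 sp var 0 ! i \<in> ?R" using i(1) by simp
  have "tb ! i \<in> set tb" using i tb(1) by simp
  then have "case tb ! i of (c, g) \<Rightarrow> (c = 1 \<or> c = -1) \<and> typed t g" using tb(2) unfolding list_all_iff by (rule bspec[rotated])
  then have c: "fst (tb ! i) = 1 \<or> fst (tb ! i) = - 1" unfolding case_prod_beta by (rule conjunct1)
  have "F = of_int (fst (tb ! i)) * run8 sp var 0 ! i" unfolding run[OF i(1)] i(2) g(1) using c by auto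
  then show "F \<in> pol.span ?R" unfolding of_int_pscale by (simp only:) (rule pol.span_scale[OF pol.span_base[OF m]])
qed

definition sp1 :: "(nat \<times> nat \<times> int \<times> nat \<times> nat \<times> int) list" where
  "sp1 = [(4,1,- 1,5,0,1), (5,2,- 1,6,1,1), (4,2,- 1,6,0,1), (6,3,- 1,7,2,1), (5,3,- 1,7,1,1), (4,3,- 1,7,0,1), (2,0,1,4,6,- 1), (3,0,1,4,7,- 1), (3,2,1,6,7,- 1), (3,1,1,5,7,- 1), (2,1,1,5,6,- 1), (1,0,1,4,5,- 1)]"

definition tb1 :: "(int \<times> nat) list" where
  "tb1 = [(1,30), (1,12), (1,2), (1,49), (- 1,32), (1,37), (1,10), (1,4)]"

definition sp3 :: "(nat \<times> nat \<times> int \<times> nat \<times> nat \<times> int) list" where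
  "sp3 = [(6,0,- 1,7,1,- 1), (3,0,- 1,7,4,- 1), (5,0,1,7,2,- 1), (3,2,- 1,5,4,- 1), (3,1,- 1,6,4,1), (5,1,1,6,2,1), (4,1,- 1,6,3,1), (4,0,1,7,3,1), (1,0,1,7,6,1), (2,0,- 1,7,5,1), (2,1,1,6,5,1), (4,2,1,5,3,1)]"

definition tb3 :: "(int \<times> nat) list" where
  "tb3 = [(1,43), (1,13), (- 1,5), (- 1,17), (1,18), (1,51), (- 1,19), (1,0)]"

definition sp4 :: "(nat \<times> nat \<times> int \<times> nat \<times> nat \<times> int) list" where
  "sp4 = [(6,0,- 1,7,1,- 1), (3,0,- 1,7,4,- 1), (5,0,1,7,2,- 1), (1,0,- 1,7,6,- 1), (2,0,1,7,5,- 1), (4,0,- 1,7,3,- 1), (4,1,- 1,6,3,1), (5,1,- 1,6,2,- 1), (3,2,1,5,4,1), (3,1,1,6,4,- 1), (2,1,1,6,5,1), (4,2,1,5,3,1)]"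

definition tb4 :: "(int \<times> nat) list" where
  "tb4 = [(1,50), (- 1,39), (1,16), (- 1,6), (- 1,11), (1,48), (- 1,27), (1,1)]"

definition natA :: "(nat \<Rightarrow> 'a::comm_ring_1) \<Rightarrow> 'a list" where
  "natA X = [1, X 12, X 7 + X 11 * X 12, X 8 + X 9 * X 11 * X 12 + X 10 * X 12, (- 1) * X 1 * X 12 + (- 1) * X 3 * X 7 + (- 1) * X 3 * X 11 * X 12 + (- 1) * X 6 * X 8 + (- 1) * X 6 * X 9 * X 11 * X 12 + (- 1) * X 6 * X 10 * X 12, X 1 + (- 1) * X 2 * X 7 + (- 1) * X 2 * X 11 * X 12 + (- 1) * X 5 * X 8 + (- 1) * X 5 * X 9 * X 11 * X 12 + (- 1) * X 5 * X 10 * X 12, X 2 * X 12 + X 3 + (- 1) * X 4 * X 8 + (- 1) * X 4 * X 9 * X 11 * X 12 + (- 1) * X 4 * X 10 * X 12, X 4 * X 7 + X 4 * X 11 * X 12 + X 5 * X 12 + X 6]"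

definition natB :: "(nat \<Rightarrow> 'a::comm_ring_1) \<Rightarrow> 'a list" where
  "natB X = [0, 1, X 11, X 9 * X 11 + X 10, (- 1) * X 1 + (- 1) * X 3 * X 11 + (- 1) * X 6 * X 9 * X 11 + (- 1) * X 6 * X 10, (- 1) * X 2 * X 11 + (- 1) * X 5 * X 9 * X 11 + (- 1) * X 5 * X 10, X 2 + (- 1) * X 4 * X 9 * X 11 + (- 1) * X 4 * X 10, X 4 * X 11 + X 5]"

text \<open>The entry \<open>(i, j)\<close> expresses a 2 by 2 minor of the coordinates of the two first vectors of the natural
  module through the generators of type 2; conversely \<open>utab\<close> expresses twice each of these generators
  through minors.\<close>

definition wtab :: "(int \<times> nat) list list list" where
  "wtab = [[[], [(1,38)], [(1,20)], [(1,24)], [(- 1,29)], [(- 1,44)], [(1,14)], [(1,46)]],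
    [[(- 1,38)], [], [(- 1,47)], [(- 1,28)], [(1,41)], [(1,8), (- 1,29)], [(- 1,34)], [(- 1,35)]],
    [[(- 1,20)], [(1,47)], [], [(- 1,26)], [(- 1,23)], [(- 1,22)], [(- 1,8), (1,36)], [(- 1,7)]],
    [[(- 1,24)], [(1,28)], [(1,26)], [], [(- 1,21)], [(- 1,15)], [(- 1,3)], [(- 1,36), (2,40)]],
    [[(1,29)], [(- 1,41)], [(1,23)], [(1,21)], [], [(1,31)], [(1,42)], [(1,25)]],
    [[(1,44)], [(- 1,8), (1,29)], [(1,22)], [(1,15)], [(- 1,31)], [], [(1,9)], [(1,45)]],
    [[(- 1,14)], [(1,34)], [(1,8), (- 1,36)], [(1,3)], [(- 1,42)], [(- 1,9)], [], [(- 1,33)]],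
    [[(- 1,46)], [(1,35)], [(1,7)], [(1,36), (- 2,40)], [(- 1,25)], [(- 1,45)], [(1,33)], []]]"

definition utab :: "(nat \<times> (int \<times> nat \<times> nat) list) list" where
  "utab = [(3, [(- 2,3,6)]),
    (7, [(- 2,2,7)]),
    (8, [(- 2,0,4), (2,1,5)]),
    (9, [(2,5,6)]),
    (14, [(2,0,6)]),
    (15, [(- 2,3,5)]),
    (20, [(2,0,2)]),
    (21, [(- 2,3,4)]),
    (22, [(- 2,2,5)]),
    (23, [(- 2,2,4)]),
    (24, [(2,0,3)]),
    (25, [(2,4,7)]),
    (26, [(- 2,2,3)]),
    (28, [(- 2,1,3)]),
    (29, [(- 2,0,4)]),
    (31, [(2,4,5)]),
    (33, [(- 2,6,7)]),
    (34, [(- 2,1,6)]),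
    (35, [(- 2,1,7)]),
    (36, [(- 2,0,4), (2,1,5), (2,2,6)]),
    (38, [(2,0,1)]),
    (40, [(- 1,0,4), (1,1,5), (1,2,6), (1,3,7)]),
    (41, [(2,1,4)]),
    (42, [(2,4,6)]),
    (44, [(- 2,0,5)]),
    (45, [(2,5,7)]),
    (46, [(2,0,7)]),
    (47, [(- 2,1,2)])]"

text \<open>The two half-spin representations, on the parts of odd and of even degree of the exterior algebra
  of the span of the first four basis vectors. The order of the basis puts the highest weight vector
  first.\<close>

definition spin3 :: "mat8 \<Rightarrow> complex list list" where
  "spin3 X = [[(X $ Inl 1 $ Inl 1 + X $ Inl 2 $ Inl 2 + X $ Inl 3 $ Inl 3 - X $ Inl 4 $ Inl 4) / 2, X $ Inl 3 $ Inl 4, - X $ Inl 2 $ Inl 4, - X $ Inl 2 $ Inr 3, X $ Inl 1 $ Inl 4, X $ Inl 1 $ Inr 3, - X $ Inl 1 $ Inr 2, 0],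
    [X $ Inl 4 $ Inl 3, (X $ Inl 1 $ Inl 1 + X $ Inl 2 $ Inl 2 - X $ Inl 3 $ Inl 3 + X $ Inl 4 $ Inl 4) / 2, X $ Inl 2 $ Inl 3, - X $ Inl 2 $ Inr 4, - X $ Inl 1 $ Inl 3, X $ Inl 1 $ Inr 4, 0, - X $ Inl 1 $ Inr 2],
    [- X $ Inl 4 $ Inl 2, X $ Inl 3 $ Inl 2, (X $ Inl 1 $ Inl 1 - X $ Inl 2 $ Inl 2 + X $ Inl 3 $ Inl 3 + X $ Inl 4 $ Inl 4) / 2, - X $ Inl 3 $ Inr 4, X $ Inl 1 $ Inl 2, 0, X $ Inl 1 $ Inr 4, - X $ Inl 1 $ Inr 3],
    [X $ Inr 2 $ Inl 3, X $ Inr 2 $ Inl 4, X $ Inr 3 $ Inl 4, (X $ Inl 1 $ Inl 1 - X $ Inl 2 $ Inl 2 - X $ Inl 3 $ Inl 3 - X $ Inl 4 $ Inl 4) / 2, 0, X $ Inl 1 $ Inl 2, X $ Inl 1 $ Inl 3, X $ Inl 1 $ Inl 4],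
    [X $ Inl 4 $ Inl 1, - X $ Inl 3 $ Inl 1, X $ Inl 2 $ Inl 1, 0, (- X $ Inl 1 $ Inl 1 + X $ Inl 2 $ Inl 2 + X $ Inl 3 $ Inl 3 + X $ Inl 4 $ Inl 4) / 2, - X $ Inl 3 $ Inr 4, X $ Inl 2 $ Inr 4, - X $ Inl 2 $ Inr 3],
    [- X $ Inr 1 $ Inl 3, - X $ Inr 1 $ Inl 4, 0, X $ Inl 2 $ Inl 1, X $ Inr 3 $ Inl 4, (- X $ Inl 1 $ Inl 1 + X $ Inl 2 $ Inl 2 - X $ Inl 3 $ Inl 3 - X $ Inl 4 $ Inl 4) / 2, X $ Inl 2 $ Inl 3, X $ Inl 2 $ Inl 4],
    [X $ Inr 1 $ Inl 2, 0, - X $ Inr 1 $ Inl 4, X $ Inl 3 $ Inl 1, - X $ Inr 2 $ Inl 4, X $ Inl 3 $ Inl 2, (- X $ Inl 1 $ Inl 1 - X $ Inl 2 $ Inl 2 + X $ Inl 3 $ Inl 3 - X $ Inl 4 $ Inl 4) / 2, X $ Inl 3 $ Inl 4],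
    [0, X $ Inr 1 $ Inl 2, X $ Inr 1 $ Inl 3, X $ Inl 4 $ Inl 1, X $ Inr 2 $ Inl 3, X $ Inl 4 $ Inl 2, X $ Inl 4 $ Inl 3, (- X $ Inl 1 $ Inl 1 - X $ Inl 2 $ Inl 2 - X $ Inl 3 $ Inl 3 + X $ Inl 4 $ Inl 4) / 2]]"

definition spin4 :: "mat8 \<Rightarrow> complex list list" where
  "spin4 X = [[(X $ Inl 1 $ Inl 1 + X $ Inl 2 $ Inl 2 + X $ Inl 3 $ Inl 3 + X $ Inl 4 $ Inl 4) / 2, - X $ Inl 3 $ Inr 4, X $ Inl 2 $ Inr 4, - X $ Inl 2 $ Inr 3, - X $ Inl 1 $ Inr 4, X $ Inl 1 $ Inr 3, - X $ Inl 1 $ Inr 2, 0],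
    [X $ Inr 3 $ Inl 4, (X $ Inl 1 $ Inl 1 + X $ Inl 2 $ Inl 2 - X $ Inl 3 $ Inl 3 - X $ Inl 4 $ Inl 4) / 2, X $ Inl 2 $ Inl 3, X $ Inl 2 $ Inl 4, - X $ Inl 1 $ Inl 3, - X $ Inl 1 $ Inl 4, 0, - X $ Inl 1 $ Inr 2],
    [- X $ Inr 2 $ Inl 4, X $ Inl 3 $ Inl 2, (X $ Inl 1 $ Inl 1 - X $ Inl 2 $ Inl 2 + X $ Inl 3 $ Inl 3 - X $ Inl 4 $ Inl 4) / 2, X $ Inl 3 $ Inl 4, X $ Inl 1 $ Inl 2, 0, - X $ Inl 1 $ Inl 4, - X $ Inl 1 $ Inr 3],
    [X $ Inr 2 $ Inl 3, X $ Inl 4 $ Inl 2, X $ Inl 4 $ Inl 3, (X $ Inl 1 $ Inl 1 - X $ Inl 2 $ Inl 2 - X $ Inl 3 $ Inl 3 + X $ Inl 4 $ Inl 4) / 2, 0, X $ Inl 1 $ Inl 2, X $ Inl 1 $ Inl 3, - X $ Inl 1 $ Inr 4],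
    [X $ Inr 1 $ Inl 4, - X $ Inl 3 $ Inl 1, X $ Inl 2 $ Inl 1, 0, (- X $ Inl 1 $ Inl 1 + X $ Inl 2 $ Inl 2 + X $ Inl 3 $ Inl 3 - X $ Inl 4 $ Inl 4) / 2, X $ Inl 3 $ Inl 4, - X $ Inl 2 $ Inl 4, - X $ Inl 2 $ Inr 3],
    [- X $ Inr 1 $ Inl 3, - X $ Inl 4 $ Inl 1, 0, X $ Inl 2 $ Inl 1, X $ Inl 4 $ Inl 3, (- X $ Inl 1 $ Inl 1 + X $ Inl 2 $ Inl 2 - X $ Inl 3 $ Inl 3 + X $ Inl 4 $ Inl 4) / 2, X $ Inl 2 $ Inl 3, - X $ Inl 2 $ Inr 4],
    [X $ Inr 1 $ Inl 2, 0, - X $ Inl 4 $ Inl 1, X $ Inl 3 $ Inl 1, - X $ Inl 4 $ Inl 2, X $ Inl 3 $ Inl 2, (- X $ Inl 1 $ Inl 1 - X $ Inl 2 $ Inl 2 + X $ Inl 3 $ Inl 3 + X $ Inl 4 $ Inl 4) / 2, - X $ Inl 3 $ Inr 4],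
    [0, X $ Inr 1 $ Inl 2, X $ Inr 1 $ Inl 3, X $ Inr 1 $ Inl 4, X $ Inr 2 $ Inl 3, X $ Inr 2 $ Inl 4, X $ Inr 3 $ Inl 4, (- X $ Inl 1 $ Inl 1 - X $ Inl 2 $ Inl 2 - X $ Inl 3 $ Inl 3 - X $ Inl 4 $ Inl 4) / 2]]"


definition ix :: "nat \<Rightarrow> 4 + 4" where "ix i = [Inl 1, Inl 2, Inl 3, Inl 4, Inr 1, Inr 2, Inr 3, Inr 4] ! i"
definition vec8 :: matrep where "vec8 X i j = X $ ix i $ ix j"

lemma ix_simps: "ix 0 = Inl 1" "ix (Suc 0) = Inl 2" "ix 2 = Inl 3" "ix 3 = Inl 4" "ix 4 = Inr 1" "ix 5 = Inr 2" "ix 6 = Inr 3" "ix 7 = Inr 4"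
  by (simp_all add: ix_def)

lemma vec8_rep: "matrix_rep {..<8} vec8"
  unfolding matrix_rep_def vec8_def
  by (simp add: sum8 ix_simps bracket_nth sum_44 herm_def)

lemma vec8_sparse: "\<forall>k\<in>{1..12}. sparse (sp1 ! (k - 1)) (vec8 (neg k))"
  unfolding all12 by (intro conjI; simp add: sp1_def all8 vec8_def ix_simps neg_def rootmat_nth root_entries)

lemma vec8_model: "model {..<8} vec8 2 (eps 1) (delta 0)"
proof (rule base_model[OF vec8_rep vec8_sparse])
  show "\<forall>i<8. vec8 (cartan x) i 0 = (if i = 0 then eval_weight (eps 1) x else 0)" for x
    unfolding all8 by (simp add: vec8_def ix_simps cartan_nth eval_weight_def sum_4)
  show "\<forall>k\<in>{1..12}. \<forall>i<8. vec8 (pos k) i 0 = 0"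
    unfolding all12 all8 by (simp add: vec8_def ix_simps pos_def rootmat_nth root_entries)
qed

lemma run1: "i < 8 \<Longrightarrow> run8 sp1 (X :: nat \<Rightarrow> 'a::comm_ring_1) 0 ! i = of_int (fst (tb1 ! i)) * gpoly X (snd (tb1 ! i))"
proof -
  have "\<forall>i<8. run8 sp1 X 0 ! i = of_int (fst (tb1 ! i)) * gpoly X (snd (tb1 ! i))"
    unfolding all8 by (simp add: run8_def sp1_def tb1_def unit8_def upt_rec gpoly_table) (simp add: algebra_simps)?
  then show "i < 8 \<Longrightarrow> run8 sp1 X 0 ! i = of_int (fst (tb1 ! i)) * gpoly X (snd (tb1 ! i))" by blast
qed

lemma span1: "pol.span (range (gen {..<8} vec8 2 (delta 0))) = pol.span {gpoly var g | g. typed 1 g}"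
  by (rule span_table[OF run1 _ _ _ vec8_sparse]) (simp_all add: tb1_def typed_def gtype_def gtv_nth ids_def)

lemma spin3_nth:
  shows "spin3 X ! 0 ! 0 = (X $ Inl 1 $ Inl 1 + X $ Inl 2 $ Inl 2 + X $ Inl 3 $ Inl 3 - X $ Inl 4 $ Inl 4) / 2"
  "spin3 X ! 0 ! Suc 0 = X $ Inl 3 $ Inl 4"
  "spin3 X ! 0 ! 2 = - X $ Inl 2 $ Inl 4"
  "spin3 X ! 0 ! 3 = - X $ Inl 2 $ Inr 3"
  "spin3 X ! 0 ! 4 = X $ Inl 1 $ Inl 4"
  "spin3 X ! 0 ! 5 = X $ Inl 1 $ Inr 3"
  "spin3 X ! 0 ! 6 = - X $ Inl 1 $ Inr 2"
  "spin3 X ! 0 ! 7 = 0"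
  "spin3 X ! Suc 0 ! 0 = X $ Inl 4 $ Inl 3"
  "spin3 X ! Suc 0 ! Suc 0 = (X $ Inl 1 $ Inl 1 + X $ Inl 2 $ Inl 2 - X $ Inl 3 $ Inl 3 + X $ Inl 4 $ Inl 4) / 2"
  "spin3 X ! Suc 0 ! 2 = X $ Inl 2 $ Inl 3"
  "spin3 X ! Suc 0 ! 3 = - X $ Inl 2 $ Inr 4"
  "spin3 X ! Suc 0 ! 4 = - X $ Inl 1 $ Inl 3"
  "spin3 X ! Suc 0 ! 5 = X $ Inl 1 $ Inr 4"
  "spin3 X ! Suc 0 ! 6 = 0"
  "spin3 X ! Suc 0 ! 7 = - X $ Inl 1 $ Inr 2"
  "spin3 X ! 2 ! 0 = - X $ Inl 4 $ Inl 2"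
  "spin3 X ! 2 ! Suc 0 = X $ Inl 3 $ Inl 2"
  "spin3 X ! 2 ! 2 = (X $ Inl 1 $ Inl 1 - X $ Inl 2 $ Inl 2 + X $ Inl 3 $ Inl 3 + X $ Inl 4 $ Inl 4) / 2"
  "spin3 X ! 2 ! 3 = - X $ Inl 3 $ Inr 4"
  "spin3 X ! 2 ! 4 = X $ Inl 1 $ Inl 2"
  "spin3 X ! 2 ! 5 = 0"
  "spin3 X ! 2 ! 6 = X $ Inl 1 $ Inr 4"
  "spin3 X ! 2 ! 7 = - X $ Inl 1 $ Inr 3"
  "spin3 X ! 3 ! 0 = X $ Inr 2 $ Inl 3"
  "spin3 X ! 3 ! Suc 0 = X $ Inr 2 $ Inl 4"
  "spin3 X ! 3 ! 2 = X $ Inr 3 $ Inl 4"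
  "spin3 X ! 3 ! 3 = (X $ Inl 1 $ Inl 1 - X $ Inl 2 $ Inl 2 - X $ Inl 3 $ Inl 3 - X $ Inl 4 $ Inl 4) / 2"
  "spin3 X ! 3 ! 4 = 0"
  "spin3 X ! 3 ! 5 = X $ Inl 1 $ Inl 2"
  "spin3 X ! 3 ! 6 = X $ Inl 1 $ Inl 3"
  "spin3 X ! 3 ! 7 = X $ Inl 1 $ Inl 4"
  "spin3 X ! 4 ! 0 = X $ Inl 4 $ Inl 1"
  "spin3 X ! 4 ! Suc 0 = - X $ Inl 3 $ Inl 1"
  "spin3 X ! 4 ! 2 = X $ Inl 2 $ Inl 1"
  "spin3 X ! 4 ! 3 = 0"
  "spin3 X ! 4 ! 4 = (- X $ Inl 1 $ Inl 1 + X $ Inl 2 $ Inl 2 + X $ Inl 3 $ Inl 3 + X $ Inl 4 $ Inl 4) / 2"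
  "spin3 X ! 4 ! 5 = - X $ Inl 3 $ Inr 4"
  "spin3 X ! 4 ! 6 = X $ Inl 2 $ Inr 4"
  "spin3 X ! 4 ! 7 = - X $ Inl 2 $ Inr 3"
  "spin3 X ! 5 ! 0 = - X $ Inr 1 $ Inl 3"
  "spin3 X ! 5 ! Suc 0 = - X $ Inr 1 $ Inl 4"
  "spin3 X ! 5 ! 2 = 0"
  "spin3 X ! 5 ! 3 = X $ Inl 2 $ Inl 1"
  "spin3 X ! 5 ! 4 = X $ Inr 3 $ Inl 4"
  "spin3 X ! 5 ! 5 = (- X $ Inl 1 $ Inl 1 + X $ Inl 2 $ Inl 2 - X $ Inl 3 $ Inl 3 - X $ Inl 4 $ Inl 4) / 2"
  "spin3 X ! 5 ! 6 = X $ Inl 2 $ Inl 3"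
  "spin3 X ! 5 ! 7 = X $ Inl 2 $ Inl 4"
  "spin3 X ! 6 ! 0 = X $ Inr 1 $ Inl 2"
  "spin3 X ! 6 ! Suc 0 = 0"
  "spin3 X ! 6 ! 2 = - X $ Inr 1 $ Inl 4"
  "spin3 X ! 6 ! 3 = X $ Inl 3 $ Inl 1"
  "spin3 X ! 6 ! 4 = - X $ Inr 2 $ Inl 4"
  "spin3 X ! 6 ! 5 = X $ Inl 3 $ Inl 2"
  "spin3 X ! 6 ! 6 = (- X $ Inl 1 $ Inl 1 - X $ Inl 2 $ Inl 2 + X $ Inl 3 $ Inl 3 - X $ Inl 4 $ Inl 4) / 2"
  "spin3 X ! 6 ! 7 = X $ Inl 3 $ Inl 4"
  "spin3 X ! 7 ! 0 = 0"
  "spin3 X ! 7 ! Suc 0 = X $ Inr 1 $ Inl 2"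
  "spin3 X ! 7 ! 2 = X $ Inr 1 $ Inl 3"
  "spin3 X ! 7 ! 3 = X $ Inl 4 $ Inl 1"
  "spin3 X ! 7 ! 4 = X $ Inr 2 $ Inl 3"
  "spin3 X ! 7 ! 5 = X $ Inl 4 $ Inl 2"
  "spin3 X ! 7 ! 6 = X $ Inl 4 $ Inl 3"
  "spin3 X ! 7 ! 7 = (- X $ Inl 1 $ Inl 1 - X $ Inl 2 $ Inl 2 - X $ Inl 3 $ Inl 3 + X $ Inl 4 $ Inl 4) / 2"
  by (simp_all add: spin3_def del: minus_add_distrib)

lemma spin3_rep: "matrix_rep {..<8} (\<lambda>X i j. spin3 X ! i ! j)"
proof -
  have "\<forall>i<8. \<forall>j<8. spin3 (X + Y) ! i ! j = spin3 X ! i ! j + spin3 Y ! i ! j" for X Y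
    unfolding all8 by (intro conjI; simp add: spin3_nth field_simps)
  moreover have "\<forall>i<8. \<forall>j<8. spin3 (cscale c X) ! i ! j = c * spin3 X ! i ! j" for c X
    unfolding all8 by (intro conjI; simp add: spin3_nth field_simps)
  moreover have "\<forall>i<8. \<forall>j<8. spin3 (herm X) ! i ! j = cnj (spin3 X ! j ! i)" if "X \<in> so8" for X
    unfolding all8 by (intro conjI; simp add: spin3_nth herm_def so8_rules[OF that])
  moreover have "\<forall>i<8. \<forall>j<8. spin3 (bracket X Y) ! i ! j = (\<Sum>k\<in>{..<8}. spin3 X ! i ! k * spin3 Y ! k ! j - spin3 Y ! i ! k * spin3 X ! k ! j)"
    if "X \<in> so8" "Y \<in> so8" for X Y
    unfolding all8 sum8 by (intro conjI; simp add: spin3_nth bracket_nth sum_44 so8_rules[OF that(1)] so8_rules[OF that(2)] field_simps)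
  ultimately show ?thesis unfolding matrix_rep_def by simp
qed

lemma spin4_nth:
  shows "spin4 X ! 0 ! 0 = (X $ Inl 1 $ Inl 1 + X $ Inl 2 $ Inl 2 + X $ Inl 3 $ Inl 3 + X $ Inl 4 $ Inl 4) / 2"
  "spin4 X ! 0 ! Suc 0 = - X $ Inl 3 $ Inr 4"
  "spin4 X ! 0 ! 2 = X $ Inl 2 $ Inr 4"
  "spin4 X ! 0 ! 3 = - X $ Inl 2 $ Inr 3"
  "spin4 X ! 0 ! 4 = - X $ Inl 1 $ Inr 4"
  "spin4 X ! 0 ! 5 = X $ Inl 1 $ Inr 3"
  "spin4 X ! 0 ! 6 = - X $ Inl 1 $ Inr 2"
  "spin4 X ! 0 ! 7 = 0"
  "spin4 X ! Suc 0 ! 0 = X $ Inr 3 $ Inl 4"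
  "spin4 X ! Suc 0 ! Suc 0 = (X $ Inl 1 $ Inl 1 + X $ Inl 2 $ Inl 2 - X $ Inl 3 $ Inl 3 - X $ Inl 4 $ Inl 4) / 2"
  "spin4 X ! Suc 0 ! 2 = X $ Inl 2 $ Inl 3"
  "spin4 X ! Suc 0 ! 3 = X $ Inl 2 $ Inl 4"
  "spin4 X ! Suc 0 ! 4 = - X $ Inl 1 $ Inl 3"
  "spin4 X ! Suc 0 ! 5 = - X $ Inl 1 $ Inl 4"
  "spin4 X ! Suc 0 ! 6 = 0"
  "spin4 X ! Suc 0 ! 7 = - X $ Inl 1 $ Inr 2"
  "spin4 X ! 2 ! 0 = - X $ Inr 2 $ Inl 4"
  "spin4 X ! 2 ! Suc 0 = X $ Inl 3 $ Inl 2"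
  "spin4 X ! 2 ! 2 = (X $ Inl 1 $ Inl 1 - X $ Inl 2 $ Inl 2 + X $ Inl 3 $ Inl 3 - X $ Inl 4 $ Inl 4) / 2"
  "spin4 X ! 2 ! 3 = X $ Inl 3 $ Inl 4"
  "spin4 X ! 2 ! 4 = X $ Inl 1 $ Inl 2"
  "spin4 X ! 2 ! 5 = 0"
  "spin4 X ! 2 ! 6 = - X $ Inl 1 $ Inl 4"
  "spin4 X ! 2 ! 7 = - X $ Inl 1 $ Inr 3"
  "spin4 X ! 3 ! 0 = X $ Inr 2 $ Inl 3"
  "spin4 X ! 3 ! Suc 0 = X $ Inl 4 $ Inl 2"
  "spin4 X ! 3 ! 2 = X $ Inl 4 $ Inl 3"
  "spin4 X ! 3 ! 3 = (X $ Inl 1 $ Inl 1 - X $ Inl 2 $ Inl 2 - X $ Inl 3 $ Inl 3 + X $ Inl 4 $ Inl 4) / 2"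
  "spin4 X ! 3 ! 4 = 0"
  "spin4 X ! 3 ! 5 = X $ Inl 1 $ Inl 2"
  "spin4 X ! 3 ! 6 = X $ Inl 1 $ Inl 3"
  "spin4 X ! 3 ! 7 = - X $ Inl 1 $ Inr 4"
  "spin4 X ! 4 ! 0 = X $ Inr 1 $ Inl 4"
  "spin4 X ! 4 ! Suc 0 = - X $ Inl 3 $ Inl 1"
  "spin4 X ! 4 ! 2 = X $ Inl 2 $ Inl 1"
  "spin4 X ! 4 ! 3 = 0"
  "spin4 X ! 4 ! 4 = (- X $ Inl 1 $ Inl 1 + X $ Inl 2 $ Inl 2 + X $ Inl 3 $ Inl 3 - X $ Inl 4 $ Inl 4) / 2"
  "spin4 X ! 4 ! 5 = X $ Inl 3 $ Inl 4"
  "spin4 X ! 4 ! 6 = - X $ Inl 2 $ Inl 4"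
  "spin4 X ! 4 ! 7 = - X $ Inl 2 $ Inr 3"
  "spin4 X ! 5 ! 0 = - X $ Inr 1 $ Inl 3"
  "spin4 X ! 5 ! Suc 0 = - X $ Inl 4 $ Inl 1"
  "spin4 X ! 5 ! 2 = 0"
  "spin4 X ! 5 ! 3 = X $ Inl 2 $ Inl 1"
  "spin4 X ! 5 ! 4 = X $ Inl 4 $ Inl 3"
  "spin4 X ! 5 ! 5 = (- X $ Inl 1 $ Inl 1 + X $ Inl 2 $ Inl 2 - X $ Inl 3 $ Inl 3 + X $ Inl 4 $ Inl 4) / 2"
  "spin4 X ! 5 ! 6 = X $ Inl 2 $ Inl 3"
  "spin4 X ! 5 ! 7 = - X $ Inl 2 $ Inr 4"
  "spin4 X ! 6 ! 0 = X $ Inr 1 $ Inl 2"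
  "spin4 X ! 6 ! Suc 0 = 0"
  "spin4 X ! 6 ! 2 = - X $ Inl 4 $ Inl 1"
  "spin4 X ! 6 ! 3 = X $ Inl 3 $ Inl 1"
  "spin4 X ! 6 ! 4 = - X $ Inl 4 $ Inl 2"
  "spin4 X ! 6 ! 5 = X $ Inl 3 $ Inl 2"
  "spin4 X ! 6 ! 6 = (- X $ Inl 1 $ Inl 1 - X $ Inl 2 $ Inl 2 + X $ Inl 3 $ Inl 3 + X $ Inl 4 $ Inl 4) / 2"
  "spin4 X ! 6 ! 7 = - X $ Inl 3 $ Inr 4"
  "spin4 X ! 7 ! 0 = 0"
  "spin4 X ! 7 ! Suc 0 = X $ Inr 1 $ Inl 2"
  "spin4 X ! 7 ! 2 = X $ Inr 1 $ Inl 3"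
  "spin4 X ! 7 ! 3 = X $ Inr 1 $ Inl 4"
  "spin4 X ! 7 ! 4 = X $ Inr 2 $ Inl 3"
  "spin4 X ! 7 ! 5 = X $ Inr 2 $ Inl 4"
  "spin4 X ! 7 ! 6 = X $ Inr 3 $ Inl 4"
  "spin4 X ! 7 ! 7 = (- X $ Inl 1 $ Inl 1 - X $ Inl 2 $ Inl 2 - X $ Inl 3 $ Inl 3 - X $ Inl 4 $ Inl 4) / 2"
  by (simp_all add: spin4_def del: minus_add_distrib)

lemma spin4_rep: "matrix_rep {..<8} (\<lambda>X i j. spin4 X ! i ! j)"
proof -
  have "\<forall>i<8. \<forall>j<8. spin4 (X + Y) ! i ! j = spin4 X ! i ! j + spin4 Y ! i ! j" for X Y
    unfolding all8 by (intro conjI; simp add: spin4_nth field_simps)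
  moreover have "\<forall>i<8. \<forall>j<8. spin4 (cscale c X) ! i ! j = c * spin4 X ! i ! j" for c X
    unfolding all8 by (intro conjI; simp add: spin4_nth field_simps)
  moreover have "\<forall>i<8. \<forall>j<8. spin4 (herm X) ! i ! j = cnj (spin4 X ! j ! i)" if "X \<in> so8" for X
    unfolding all8 by (intro conjI; simp add: spin4_nth herm_def so8_rules[OF that])
  moreover have "\<forall>i<8. \<forall>j<8. spin4 (bracket X Y) ! i ! j = (\<Sum>k\<in>{..<8}. spin4 X ! i ! k * spin4 Y ! k ! j - spin4 Y ! i ! k * spin4 X ! k ! j)"
    if "X \<in> so8" "Y \<in> so8" for X Y
    unfolding all8 sum8 by (intro conjI; simp add: spin4_nth bracket_nth sum_44 so8_rules[OF that(1)] so8_rules[OF that(2)] field_simps)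
  ultimately show ?thesis unfolding matrix_rep_def by simp
qed


lemma spin3_sparse: "\<forall>k\<in>{1..12}. sparse (sp3 ! (k - 1)) (\<lambda>i j. spin3 (neg k) ! i ! j)"
  unfolding all12 by (intro conjI; simp add: sp3_def all8 spin3_nth neg_def rootmat_nth root_entries)

lemma spin3_model: "model {..<8} (\<lambda>X i j. spin3 X ! i ! j) 2 ((1/2) *s (eps 1 + eps 2 + eps 3 - eps 4)) (delta 0)"
proof (rule base_model[OF spin3_rep spin3_sparse])
  show "\<forall>i<8. spin3 (cartan x) ! i ! 0 = (if i = 0 then eval_weight ((1/2) *s (eps 1 + eps 2 + eps 3 - eps 4)) x else 0)" for x
    unfolding all8 by (simp add: spin3_nth cartan_nth eval_weight_def sum_4 of_rat_divide of_rat_minus add_divide_distrib diff_divide_distrib)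
  show "\<forall>k\<in>{1..12}. \<forall>i<8. spin3 (pos k) ! i ! 0 = 0"
    unfolding all12 all8 by (simp add: spin3_nth pos_def rootmat_nth root_entries)
qed

lemma run3: "i < 8 \<Longrightarrow> run8 sp3 (X :: nat \<Rightarrow> 'a::comm_ring_1) 0 ! i = of_int (fst (tb3 ! i)) * gpoly X (snd (tb3 ! i))"
proof -
  have "\<forall>i<8. run8 sp3 X 0 ! i = of_int (fst (tb3 ! i)) * gpoly X (snd (tb3 ! i))"
    unfolding all8 by (simp add: run8_def sp3_def tb3_def unit8_def upt_rec gpoly_table) (simp add: algebra_simps)?
  then show "i < 8 \<Longrightarrow> run8 sp3 X 0 ! i = of_int (fst (tb3 ! i)) * gpoly X (snd (tb3 ! i))" by blast
qed

lemma span3: "pol.span (range (gen {..<8} (\<lambda>X i j. spin3 X ! i ! j) 2 (delta 0))) = pol.span {gpoly var g | g. typed 3 g}"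
  by (rule span_table[OF run3 _ _ _ spin3_sparse]) (simp_all add: tb3_def typed_def gtype_def gtv_nth ids_def)

lemma spin4_sparse: "\<forall>k\<in>{1..12}. sparse (sp4 ! (k - 1)) (\<lambda>i j. spin4 (neg k) ! i ! j)"
  unfolding all12 by (intro conjI; simp add: sp4_def all8 spin4_nth neg_def rootmat_nth root_entries)

lemma spin4_model: "model {..<8} (\<lambda>X i j. spin4 X ! i ! j) 2 ((1/2) *s (eps 1 + eps 2 + eps 3 + eps 4)) (delta 0)"
proof (rule base_model[OF spin4_rep spin4_sparse])
  show "\<forall>i<8. spin4 (cartan x) ! i ! 0 = (if i = 0 then eval_weight ((1/2) *s (eps 1 + eps 2 + eps 3 + eps 4)) x else 0)" for x
    unfolding all8 by (simp add: spin4_nth cartan_nth eval_weight_def sum_4 of_rat_divide of_rat_minus add_divide_distrib diff_divide_distrib)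
  show "\<forall>k\<in>{1..12}. \<forall>i<8. spin4 (pos k) ! i ! 0 = 0"
    unfolding all12 all8 by (simp add: spin4_nth pos_def rootmat_nth root_entries)
qed

lemma run4: "i < 8 \<Longrightarrow> run8 sp4 (X :: nat \<Rightarrow> 'a::comm_ring_1) 0 ! i = of_int (fst (tb4 ! i)) * gpoly X (snd (tb4 ! i))"
proof -
  have "\<forall>i<8. run8 sp4 X 0 ! i = of_int (fst (tb4 ! i)) * gpoly X (snd (tb4 ! i))"
    unfolding all8 by (simp add: run8_def sp4_def tb4_def unit8_def upt_rec gpoly_table) (simp add: algebra_simps)?
  then show "i < 8 \<Longrightarrow> run8 sp4 X 0 ! i = of_int (fst (tb4 ! i)) * gpoly X (snd (tb4 ! i))" by blast
qed

lemma span4: "pol.span (range (gen {..<8} (\<lambda>X i j. spin4 X ! i ! j) 2 (delta 0))) = pol.span {gpoly var g | g. typed 4 g}"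
  by (rule span_table[OF run4 _ _ _ spin4_sparse]) (simp_all add: tb4_def typed_def gtype_def gtv_nth ids_def)


lemma runA: "run8 sp1 X 0 = natA X" and runB: "run8 sp1 X 1 = natB X"
  by (simp add: run8_def sp1_def unit8_def upt_rec natA_def natB_def; simp add: algebra_simps)+

lemma wedge: "i < 8 \<Longrightarrow> j < 8 \<Longrightarrow> natA X ! i * natB X ! j - natB X ! i * natA X ! j = comb (wtab ! i ! j) (X :: nat \<Rightarrow> 'a::comm_ring_1)"
proof -
  have "\<forall>i<8. \<forall>j<8. natA X ! i * natB X ! j - natB X ! i * natA X ! j = comb (wtab ! i ! j) X"
    unfolding all8 by (intro conjI; simp add: natA_def natB_def wtab_def comb_def gpoly_table; simp add: algebra_simps)
  then show "i < 8 \<Longrightarrow> j < 8 \<Longrightarrow> ?thesis" by blast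
qed

lemma unwedge: "list_all (\<lambda>(g, L). of_int 2 * gpoly X g = (\<Sum>(c, i, j)\<leftarrow>L. of_int c * (natA X ! i * natB X ! j - natB X ! i * natA X ! j))) utab"
  unfolding utab_def list.pred_inject prod.case by (intro conjI TrueI; simp add: natA_def natB_def gpoly_table; simp add: algebra_simps)


lemma pact_diff: "pact S \<pi> X (\<lambda>i. G i - G' i) = (\<lambda>i. pact S \<pi> X G i - pact S \<pi> X G' i)"
  by (rule ext) (simp add: pact_def pol.scale_right_diff_distrib sum_subtractf)

lemma pact_pow_diff: "(pact S \<pi> X ^^ n) (\<lambda>i. G i - G' i) = (\<lambda>i. (pact S \<pi> X ^^ n) G i - (pact S \<pi> X ^^ n) G' i)"
proof (induction n)
  case (Suc n)
  show ?case unfolding funpow.simps comp_apply Suc by (rule pact_diff)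
qed simp

lemma Phi_diff: "Phi S \<pi> N k (\<lambda>i. G i - G' i) = (\<lambda>i. Phi S \<pi> N k G i - Phi S \<pi> N k G' i)"
  unfolding Phi_def dpow_def pact_pow_diff
  by (rule ext) (simp only: right_diff_distrib pol.scale_right_diff_distrib sum_subtractf)

lemma gen_diff: "gen S \<pi> N (\<lambda>i. v i - v' i) = (\<lambda>i. gen S \<pi> N v i - gen S \<pi> N v' i)"
proof -
  have "foldr (Phi S \<pi> N) ks (\<lambda>i. G i - G' i) = (\<lambda>i. foldr (Phi S \<pi> N) ks G i - foldr (Phi S \<pi> N) ks G' i)" for ks G G'
  proof (induction ks)
    case (Cons k ks)
    show ?case unfolding foldr.simps comp_apply Cons by (rule Phi_diff)
  qed simp
  moreover have "(\<lambda>i. Poly_Mapping.single 0 (v i - v' i)) = (\<lambda>i. Poly_Mapping.single 0 (v i) - Poly_Mapping.single 0 (v' i) :: pol)"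
    by (simp add: fun_eq_iff single_diff)
  ultimately show ?thesis unfolding gen_def by simp
qed

text \<open>The vector $e_1 \wedge e_2$, of weight $\omega_2 = \varepsilon_1 + \varepsilon_2$.\<close>

definition wedge_vec :: cseq where
  "wedge_vec = (\<lambda>m. tens (delta 0) (delta 1) m - tens (delta 1) (delta 0) m)"

abbreviation "square8 \<equiv> tset {..<8} {..<8}"
abbreviation "vec8_sq \<equiv> trep vec8 vec8"

lemma delta_supp: "a < 8 \<Longrightarrow> i \<notin> {..<8} \<Longrightarrow> delta a i = 0"
  by (auto simp: delta_def)

lemma mact_wedge:
  "mact square8 vec8_sq X wedge_vec m =
     (tens (mact {..<8} vec8 X (delta 0)) (delta 1) m + tens (delta 0) (mact {..<8} vec8 X (delta 1)) m)
     - (tens (mact {..<8} vec8 X (delta 1)) (delta 0) m + tens (delta 1) (mact {..<8} vec8 X (delta 0)) m)"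
proof -
  have d: "mact S \<pi> X (\<lambda>i. f i - g i) m = mact S \<pi> X f m - mact S \<pi> X g m" for S \<pi> f g
    by (simp add: mact_def right_diff_distrib sum_subtractf)
  have t: "mact square8 vec8_sq X (tens (delta a) (delta b)) m = tens (mact {..<8} vec8 X (delta a)) (delta b) m + tens (delta a) (mact {..<8} vec8 X (delta b)) m"
    if "a < 8" "b < 8" for a b
    by (rule mact_tens) (use that delta_supp in auto)
  have "(0::nat) < 8" "(1::nat) < 8" by simp_all
  then show ?thesis unfolding wedge_vec_def d by (simp only: t)
qed

lemma vec8_delta:
  "mact {..<8} vec8 (cartan x) (delta 0) = (\<lambda>i. x $ 1 * delta 0 i)"
  "mact {..<8} vec8 (cartan x) (delta 1) = (\<lambda>i. x $ 2 * delta 1 i)"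
  "k \<in> {1..12} \<Longrightarrow> mact {..<8} vec8 (pos k) (delta 0) = (\<lambda>i. 0)"
  "k \<in> {1..12} \<Longrightarrow> mact {..<8} vec8 (pos k) (delta 1) = (\<lambda>i. (if k = 12 then 1 else 0) * delta 0 i)"
proof -
  have lt: "(0::nat) < 8" "(1::nat) < 8" by simp_all
  have c0: "\<forall>i<8. vec8 (cartan x) i 0 = x $ 1 * delta 0 i" and c1: "\<forall>i<8. vec8 (cartan x) i 1 = x $ 2 * delta 1 i"
    unfolding all8 by (simp_all add: vec8_def ix_simps cartan_nth delta_def)
  have p0: "\<forall>k\<in>{1..12}. \<forall>i<8. vec8 (pos k) i 0 = 0"
    and p1: "\<forall>k\<in>{1..12}. \<forall>i<8. vec8 (pos k) i 1 = (if k = 12 then 1 else 0) * delta 0 i"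
    unfolding all12 all8 by (simp_all add: vec8_def ix_simps pos_def rootmat_nth root_entries delta_def)
  show "mact {..<8} vec8 (cartan x) (delta 0) = (\<lambda>i. x $ 1 * delta 0 i)"
    unfolding mact_delta[OF lt(1)] using c0 by (intro ext) (auto simp: delta_def)
  show "mact {..<8} vec8 (cartan x) (delta 1) = (\<lambda>i. x $ 2 * delta 1 i)"
    unfolding mact_delta[OF lt(2)] using c1 by (intro ext) (auto simp: delta_def)
  show "mact {..<8} vec8 (pos k) (delta 0) = (\<lambda>i. 0)" if "k \<in> {1..12}"
    unfolding mact_delta[OF lt(1)] using bspec[OF p0 that] by (intro ext) auto
  show "mact {..<8} vec8 (pos k) (delta 1) = (\<lambda>i. (if k = 12 then 1 else 0) * delta 0 i)" if "k \<in> {1..12}"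
    unfolding mact_delta[OF lt(2)] using bspec[OF p1 that] by (intro ext) (auto simp: delta_def)
qed

lemma wedge_model: "model square8 vec8_sq (2 + 2) (eps 1 + eps 2) wedge_vec"
proof
  interpret model "{..<8}" vec8 2 "eps 1" "delta 0" by (rule vec8_model)
  show "matrix_rep square8 vec8_sq" by (rule matrix_rep_tens[OF vec8_rep vec8_rep])
  show "nilrep square8 vec8_sq (2 + 2)" by (rule nilrep_tens[OF fin fin nil nil])
  show "hw_vec square8 vec8_sq (eps 1 + eps 2) wedge_vec" unfolding hw_vec_def
  proof (intro conjI allI impI ballI)
    show "wedge_vec m = 0" if "m \<notin> square8" for m
    proof -
      obtain i j where m: "m = prod_encode (i, j)" by (metis prod_decode_inverse surj_pair)
      then show ?thesis using that by (auto simp: in_tset wedge_vec_def delta_def)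
    qed
    show "\<exists>m. wedge_vec m \<noteq> 0" by (rule exI[of _ "prod_encode (0, 1)"]) (simp add: wedge_vec_def delta_def)
    show "mact square8 vec8_sq (cartan x) wedge_vec m = eval_weight (eps 1 + eps 2) x * wedge_vec m" for x m
      unfolding mact_wedge vec8_delta by (simp add: wedge_vec_def tens_def eval_weight_def sum_4 algebra_simps)
    show "mact square8 vec8_sq (pos k) wedge_vec m = 0" if "k \<in> {1..12}" for k m
      unfolding mact_wedge vec8_delta(3)[OF that] vec8_delta(4)[OF that] by (simp add: tens_def)
  qed
qed

lemma gen_wedge:
  "gen square8 vec8_sq (2 + 2) wedge_vec m = (let i = fst (prod_decode m); j = snd (prod_decode m) in
     if i < 8 \<and> j < 8 then natA var ! i * natB var ! j - natB var ! i * natA var ! j else 0)"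
proof -
  interpret model "{..<8}" vec8 2 "eps 1" "delta 0" by (rule vec8_model)
  have lt: "(0::nat) < 8" "(1::nat) < 8" by simp_all
  have t: "gen square8 vec8_sq (2 + 2) (tens (delta a) (delta b)) = tens (gen {..<8} vec8 2 (delta a)) (gen {..<8} vec8 2 (delta b))"
    if "a < 8" "b < 8" for a b
    by (rule gen_tens[OF fin fin _ _ nil nil]) (use that delta_supp in auto)
  have "gen square8 vec8_sq (2 + 2) wedge_vec m = tens (gen {..<8} vec8 2 (delta 0)) (gen {..<8} vec8 2 (delta 1)) m
     - tens (gen {..<8} vec8 2 (delta 1)) (gen {..<8} vec8 2 (delta 0)) m"
    unfolding wedge_vec_def gen_diff t[OF lt] t[OF lt(2) lt(1)] ..
  then show ?thesis
    unfolding sparse_gen[OF vec8_sparse lt(1)] sparse_gen[OF vec8_sparse lt(2)] runA runB tens_def Let_def by simp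
qed

lemma wtab_typed: "\<forall>i<8. \<forall>j<8. list_all (\<lambda>(c, g). typed 2 g) (wtab ! i ! j)"
  unfolding all8 by (simp add: wtab_def typed_def gtype_def gtv_nth)

lemma utab_range: "list_all (\<lambda>(g, L). list_all (\<lambda>(c, i, j). i < 8 \<and> j < 8) L) utab"
  by (simp add: utab_def)

lemma utab_typed: "list_all (\<lambda>g. gtype g = 2 \<longrightarrow> g \<in> set (map fst utab)) ids"
  by (simp add: utab_def gtype_def gtv_nth ids_def)

lemma wedge_span: "pol.span (range (gen square8 vec8_sq (2 + 2) wedge_vec)) = pol.span {gpoly var g | g. typed 2 g}"
  unfolding pol.span_eq
proof (intro conjI subsetI)
  fix F assume "F \<in> range (gen square8 vec8_sq (2 + 2) wedge_vec)"
  then obtain m where F: "F = gen square8 vec8_sq (2 + 2) wedge_vec m" by blast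
  show "F \<in> pol.span {gpoly var g | g. typed 2 g}"
  proof (cases "fst (prod_decode m) < 8 \<and> snd (prod_decode m) < 8")
    case True
    then have "F = comb (wtab ! fst (prod_decode m) ! snd (prod_decode m)) var"
      unfolding F gen_wedge Let_def by (simp only: if_True wedge simp_thms)
    moreover have "list_all (\<lambda>(c, g). typed 2 g) (wtab ! fst (prod_decode m) ! snd (prod_decode m))"
      using wtab_typed True by blast
    then have "list_all (\<lambda>(c, g). gpoly var g \<in> {gpoly var g | g. typed 2 g}) (wtab ! fst (prod_decode m) ! snd (prod_decode m))"
      by (rule list.pred_mono_strong) auto
    ultimately show ?thesis using comb_span by blast
  next
    case False
    then show ?thesis unfolding F gen_wedge Let_def by (simp only: if_False pol.span_zero)
  qed
next
  let ?R = "pol.span (range (gen square8 vec8_sq (2 + 2) wedge_vec))"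
  fix F assume "F \<in> {gpoly var g | g. typed 2 g}"
  then obtain g where g: "F = gpoly var g" "g < 52" "gtype g = 2" unfolding typed_def by blast
  then have "g \<in> set (map fst utab)" using utab_typed by (simp add: list_all_iff ids)
  then obtain L where L: "(g, L) \<in> set utab" by auto
  have minor: "natA var ! i * natB var ! j - natB var ! i * natA var ! j \<in> ?R" if "i < 8" "j < 8" for i j
  proof -
    have "gen square8 vec8_sq (2 + 2) wedge_vec (prod_encode (i, j)) = natA var ! i * natB var ! j - natB var ! i * natA var ! j"
      unfolding gen_wedge Let_def prod_encode_inverse using that by simp
    then show ?thesis using pol.span_base[OF rangeI] by metis
  qed
  have "case (g, L) of (g, L) \<Rightarrow> list_all (\<lambda>(c, i, j). i < 8 \<and> j < 8) L" using utab_range L unfolding list_all_iff by (rule bspec)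
  then have rng: "list_all (\<lambda>(c, i, j). i < 8 \<and> j < 8) L" by simp
  have "(\<Sum>(c, i, j)\<leftarrow>L. of_int c * (natA var ! i * natB var ! j - natB var ! i * natA var ! j)) \<in> ?R"
    using rng
  proof (induction L)
    case Nil
    show ?case by (simp add: pol.span_zero)
  next
    case (Cons a L)
    obtain c i j where a: "a = (c, i, j)" by (cases a) auto
    then have ij: "i < 8" "j < 8" and L: "list_all (\<lambda>(c, i, j). i < 8 \<and> j < 8) L" using Cons.prems by auto
    show ?case unfolding a list.map sum_list.Cons prod.case of_int_pscale
      using pol.span_add[OF pol.span_scale[OF minor[OF ij]] Cons.IH[OF L]] unfolding of_int_pscale .
  qed
  moreover have "case (g, L) of (g, L) \<Rightarrow> of_int 2 * gpoly var g = (\<Sum>(c, i, j)\<leftarrow>L. of_int c * (natA var ! i * natB var ! j - natB var ! i * natA var ! j))"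
    using unwedge L unfolding list_all_iff by (rule bspec)
  ultimately have "pscale 2 F \<in> ?R" unfolding g(1) using of_int_pscale[of 2 "gpoly var g"] by simp
  then have "pscale (1/2) (pscale 2 F) \<in> ?R" by (rule pol.span_scale)
  then show "F \<in> ?R" by simp
qed

text \<open>The fundamental modules are the natural module, its exterior square, realised inside the
  tensor square by the vector \<open>wedge_vec\<close>, and the two half-spin modules.\<close>

lemma has_model_fundamental: "t \<in> {1..4} \<Longrightarrow> has_model (omega t) {gpoly var g | g. g < 52 \<and> gtype g = t}"
proof -
  assume "t \<in> {1..4}"
  then have t: "t = 1 \<or> t = 2 \<or> t = 3 \<or> t = 4" by auto
  have "has_model (eps 1) {gpoly var g | g. typed 1 g}"
    unfolding has_model_def using vec8_model span1 by blast
  moreover have "has_model (eps 1 + eps 2) {gpoly var g | g. typed 2 g}"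
    unfolding has_model_def using wedge_model wedge_span by blast
  moreover have "has_model ((1/2) *s (eps 1 + eps 2 + eps 3 - eps 4)) {gpoly var g | g. typed 3 g}"
    unfolding has_model_def using spin3_model span3 by blast
  moreover have "has_model ((1/2) *s (eps 1 + eps 2 + eps 3 + eps 4)) {gpoly var g | g. typed 4 g}"
    unfolding has_model_def using spin4_model span4 by blast
  ultimately have "has_model (omega t) {gpoly var g | g. typed t g}"
    using t by (elim disjE) (simp_all add: omega.simps)
  then show "has_model (omega t) {gpoly var g | g. g < 52 \<and> gtype g = t}" unfolding typed_def .
qed


section \<open>Dominant weights and the polyhedral cone\<close>

definition simple_coroot :: "nat \<Rightarrow> rat ^ 4" where "simple_coroot k = coroot (simple_root k)"

lemma index4: "k \<in> {1..4} \<longleftrightarrow> k = 1 \<or> k = 2 \<or> k = 3 \<or> k = (4::nat)"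
  by (simp, presburger)

lemma coroot_pos_root: assumes "k \<in> {1..12}" shows "coroot (pos_root k) = pos_root k"
proof -
  have "pairing (pos_root k) (pos_root k) = 2"
    using assms unfolding index12 by (auto simp: pairing_def sum_4 pos_root_def)
  then show ?thesis by (simp add: coroot_def)
qed

lemma simple_coroot_pos: "simple_coroot 1 = coroot (pos_root 12)" "simple_coroot 2 = coroot (pos_root 11)"
  "simple_coroot 3 = coroot (pos_root 9)" "simple_coroot 4 = coroot (pos_root 4)"
  by (simp_all add: simple_coroot_def simple_root_def pos_root_def)

lemma simple_coroot_eqs: "simple_coroot 1 = eps 1 - eps 2" "simple_coroot 2 = eps 2 - eps 3"
  "simple_coroot 3 = eps 3 - eps 4" "simple_coroot 4 = eps 3 + eps 4"
  unfolding simple_coroot_pos by (simp_all only: coroot_pos_root atLeastAtMost_iff one_le_numeral le_numeral_extra numeral_le_iff semiring_norm simp_thms)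
    (simp_all add: pos_root_def)

lemma pairing_add_right: "pairing \<mu> (x + y) = pairing \<mu> x + pairing \<mu> y"
  by (simp add: pairing_def distrib_left sum.distrib)

lemma pairing_add_left: "pairing (\<mu> + \<nu>) x = pairing \<mu> x + pairing \<nu> x"
  by (simp add: pairing_def distrib_right sum.distrib)

lemma pairing_scale_right: "pairing \<mu> (c *s x) = c * pairing \<mu> x"
  by (simp add: pairing_def sum_distrib_left ac_simps)

lemma pairing_scale_left: "pairing (c *s \<mu>) x = c * pairing \<mu> x"
  by (simp add: pairing_def sum_distrib_left ac_simps)

lemma pairing_zero: "pairing \<mu> 0 = 0" "pairing 0 x = 0"
  by (simp_all add: pairing_def)

lemma pairing_sum_right: "pairing \<mu> (\<Sum>i\<in>A. f i) = (\<Sum>i\<in>A. pairing \<mu> (f i))"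
  by (induction A rule: infinite_finite_induct) (simp_all add: pairing_add_right pairing_zero)

lemma pairing_sum_left: "pairing (\<Sum>i\<in>A. f i) x = (\<Sum>i\<in>A. pairing (f i) x)"
  by (induction A rule: infinite_finite_induct) (simp_all add: pairing_add_left pairing_zero)

lemma coroot_comb_in_lattice:
  "of_int a *s simple_coroot 1 + of_int b *s simple_coroot 2 + of_int c *s simple_coroot 3 + of_int d *s simple_coroot 4 \<in> coroot_lattice"
proof -
  let ?c = "\<lambda>k::nat. if k = 12 then a else if k = 11 then b else if k = 9 then c else if k = 4 then d else 0"
  have i: "{1..12::nat} = set [1,2,3,4,5,6,7,8,9,10,11,12]" by (rule set_eqI) (rule index12)
  have "(\<Sum>k=1..12. of_int (?c k) *s coroot (pos_root k)) = of_int d *s coroot (pos_root 4) + (of_int c *s coroot (pos_root 9) + (of_int b *s coroot (pos_root 11) + of_int a *s coroot (pos_root 12)))"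
    unfolding i by simp
  then have eq: "of_int a *s simple_coroot 1 + of_int b *s simple_coroot 2 + of_int c *s simple_coroot 3 + of_int d *s simple_coroot 4 = (\<Sum>k=1..12. of_int (?c k) *s coroot (pos_root k))"
    unfolding simple_coroot_pos by (simp only: ac_simps)
  show ?thesis unfolding coroot_lattice_def by (rule CollectI, rule exI[of _ ?c], rule conjI[OF eq TrueI])
qed

lemma simple_coroot_lattice: assumes "k \<in> {1..4}" shows "simple_coroot k \<in> coroot_lattice"
  using assms coroot_comb_in_lattice[of 1 0 0 0] coroot_comb_in_lattice[of 0 1 0 0] coroot_comb_in_lattice[of 0 0 1 0] coroot_comb_in_lattice[of 0 0 0 1]
  unfolding index4 by (elim disjE) simp_all

lemma weight_latticeI:
  assumes "\<And>k. k \<in> {1..12} \<Longrightarrow> pairing \<mu> (coroot (pos_root k)) \<in> \<int>" shows "\<mu> \<in> weight_lattice"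
proof -
  have "pairing \<mu> (\<Sum>k=1..12. of_int (c k) *s coroot (pos_root k)) \<in> \<int>" for c :: "nat \<Rightarrow> int"
    unfolding pairing_sum_right pairing_scale_right
  proof -
    have "(\<Sum>k\<in>A. of_int (c k) * pairing \<mu> (coroot (pos_root k))) \<in> \<int>" if "finite A" "A \<subseteq> {1..12}" for A
      using that by (induction A) (simp_all add: assms Ints_mult)
    from this[of "{1..12}"] show "(\<Sum>k=1..12. of_int (c k) * pairing \<mu> (coroot (pos_root k))) \<in> \<int>" by blast
  qed
  then show ?thesis unfolding weight_lattice_def coroot_lattice_def by blast
qed

lemma pairing_omega: assumes "t \<in> {1..4}" "k \<in> {1..4}"
  shows "pairing (omega t) (simple_coroot k) = (if t = k then 1 else 0)"
  using assms unfolding index4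
  by (elim disjE) (simp_all add: pairing_def sum_4 omega.simps simple_coroot_eqs[unfolded One_nat_def])

lemma omega_dominant: assumes "t \<in> {1..4}" shows "dominant (omega t)"
proof -
  have "\<forall>k\<in>set [1,2,3,4,5,6,7,8,9,10,11,12]. pairing (omega t) (pos_root k) \<in> \<int>"
    using assms unfolding index4
    by (elim disjE) (simp_all add: pairing_def sum_4 omega.simps pos_root_def)
  then have "\<omega> \<in> weight_lattice" if "\<omega> = omega t" for \<omega>
    unfolding that by (intro weight_latticeI) (simp only: coroot_pos_root index12)
  then have "omega t \<in> weight_lattice" by blast
  then show ?thesis unfolding dominant_def simple_coroot_def[symmetric] using pairing_omega[OF assms] by simp
qed

lemma omega_fundamental: "t \<in> {1..4} \<Longrightarrow> omega t \<in> fundamental_weights"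
  unfolding fundamental_weights_def simple_coroot_def[symmetric] using pairing_omega[of t] by (auto intro!: bexI[of _ t])

lemma dominant_add: "dominant \<mu> \<Longrightarrow> dominant \<nu> \<Longrightarrow> dominant (\<mu> + \<nu>)"
  unfolding dominant_def weight_lattice_def by (auto simp: pairing_add_left)

lemma dominant_zero: "dominant 0"
  unfolding dominant_def weight_lattice_def by (auto simp: pairing_zero)

lemma dominant_types: "set_mset T \<subseteq> {1..4} \<Longrightarrow> dominant (\<Sum>t\<in>#T. omega t)"
proof (induction T)
  case empty
  show ?case using dominant_zero by simp
next
  case (add t T)
  then have "t \<in> {1..4}" "dominant (\<Sum>t\<in>#T. omega t)" by auto
  then show ?case unfolding image_mset_add_mset sum_mset.add_mset by (intro dominant_add omega_dominant)
qed

lemma pairing_types: "set_mset T \<subseteq> {1..4} \<Longrightarrow> k \<in> {1..4} \<Longrightarrow> pairing (\<Sum>t\<in>#T. omega t) (simple_coroot k) = of_nat (count T k)"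
proof (induction T)
  case (add t T)
  then show ?case using pairing_omega[of t k] by (simp add: pairing_add_left)
qed (simp add: pairing_zero)

lemma weight_determined:
  assumes "\<And>k. k \<in> {1..4} \<Longrightarrow> pairing \<mu> (simple_coroot k) = pairing \<nu> (simple_coroot k)" shows "\<mu> = \<nu>"
proof -
  have e: "\<mu> $ 1 - \<mu> $ 2 = \<nu> $ 1 - \<nu> $ 2" "\<mu> $ 2 - \<mu> $ 3 = \<nu> $ 2 - \<nu> $ 3" "\<mu> $ 3 - \<mu> $ 4 = \<nu> $ 3 - \<nu> $ 4" "\<mu> $ 3 + \<mu> $ 4 = \<nu> $ 3 + \<nu> $ 4"
    using assms[of 1] assms[of 2] assms[of 3] assms[of 4]
    by (simp_all add: simple_coroot_eqs[unfolded One_nat_def] pairing_def sum_4)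
  have "\<mu> $ 1 = \<nu> $ 1 \<and> \<mu> $ 2 = \<nu> $ 2 \<and> \<mu> $ 3 = \<nu> $ 3 \<and> \<mu> $ 4 = \<nu> $ 4" using e by linarith
  then show ?thesis unfolding vec_eq_iff forall_4 .
qed

lemma Ints_nonneg_nat: assumes "x \<in> \<int>" "(x :: rat) \<ge> 0" obtains n :: nat where "x = of_nat n"
proof -
  obtain z where z: "x = of_int z" using assms(1) by (rule Ints_cases)
  then have "x = of_nat (nat z)" using assms(2) by simp
  then show thesis by (rule that)
qed

lemma dominant_types_exist:
  assumes "dominant \<mu>" shows "\<exists>T. set_mset T \<subseteq> {1..4} \<and> \<mu> = (\<Sum>t\<in>#T. omega t)"
proof -
  have "\<exists>n::nat. pairing \<mu> (simple_coroot k) = of_nat n" if "k \<in> {1..4}" for k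
  proof (rule Ints_nonneg_nat)
    show "pairing \<mu> (simple_coroot k) \<in> \<int>" using assms simple_coroot_lattice[OF that] unfolding dominant_def weight_lattice_def by blast
    show "0 \<le> pairing \<mu> (simple_coroot k)" using assms that unfolding dominant_def simple_coroot_def by blast
  qed blast
  then obtain n :: "nat \<Rightarrow> nat" where n: "\<And>k. k \<in> {1..4} \<Longrightarrow> pairing \<mu> (simple_coroot k) = of_nat (n k)" by metis
  define T where "T = replicate_mset (n 1) (1::nat) + replicate_mset (n 2) 2 + replicate_mset (n 3) 3 + replicate_mset (n 4) 4"
  have T: "set_mset T \<subseteq> {1..4}" unfolding T_def by (auto split: if_splits)
  have "count T k = n k" if "k \<in> {1..4}" for k using that unfolding index4 T_def by (elim disjE) simp_all
  then have "\<mu> = (\<Sum>t\<in>#T. omega t)" by (intro weight_determined) (simp add: n pairing_types[OF T])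
  then show ?thesis using T by blast
qed

definition ineq :: "nat \<Rightarrow> sig_space \<Rightarrow> rat" where
  "ineq l s = (\<Sum>k\<in>{1..4}. of_int (fst (facets ! l) ! (k - 1)) * pairing (fst s) (simple_coroot k))
     - (\<Sum>j\<in>{1..12}. of_int (snd (facets ! l) ! (j - 1)) * snd s $ of_nat j)"

definition sig_of :: "nat multiset \<Rightarrow> sig_space" where
  "sig_of S = (\<Sum>t\<in>#gtypes S. omega t, \<chi> j. of_nat (exps (monm (gsum S)) $ j))"

lemma monm_union: "monm (A + B) = monm A + monm B"
  by (simp add: monm_def)

lemma sig_of_add: "sig_of (S + S') = sig_of S + sig_of S'"
  by (simp add: sig_of_def gtypes_def gsum_def monm_union vec_eq_iff prod_eq_iff)

lemma sig_of_empty: "sig_of {#} = 0"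
  by (simp add: sig_of_def gtypes_def gsum_def vec_eq_iff prod_eq_iff)

lemma gtype_range: "g < 52 \<Longrightarrow> gtype g \<in> {1..4}"
  by (rule gtv_mem(1))

lemma gtypes_range: "valid S \<Longrightarrow> set_mset (gtypes S) \<subseteq> {1..4}"
  using gtype_range by (fastforce simp: gtypes_def valid_def)

lemma sum_mset_count:
  fixes f :: "nat \<Rightarrow> int"
  assumes "set_mset T \<subseteq> A" "finite A" shows "(\<Sum>t\<in>#T. f t) = (\<Sum>t\<in>A. f t * of_nat (count T t))"
  using assms
proof (induction T)
  case (add x T)
  have "(\<Sum>t\<in>A. f t * of_nat (count (add_mset x T) t)) = (\<Sum>t\<in>A. (if t = x then f t else 0) + f t * of_nat (count T t))"
    by (rule sum.cong) (auto simp: distrib_left)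
  also have "\<dots> = f x + (\<Sum>t\<in>A. f t * of_nat (count T t))" using add.prems by (simp add: sum.distrib)
  finally show ?case using add by simp
qed simp

lemma ineq_FV:
  assumes T: "set_mset T \<subseteq> {1..4}" and M: "set_mset M \<subseteq> {1..12}"
  shows "ineq l (\<Sum>t\<in>#T. omega t, \<chi> j. of_nat (exps (monm M) $ j)) = of_int (FV (facets ! l) T M)"
proof -
  have "(\<Sum>k\<in>{1..4}. of_int (fst (facets ! l) ! (k - 1)) * pairing (\<Sum>t\<in>#T. omega t) (simple_coroot k)) = of_int (\<Sum>t\<in>#T. fst (facets ! l) ! (t - 1))"
    unfolding sum_mset_count[OF T finite_atLeastAtMost] of_int_sum
    by (rule sum.cong) (simp_all add: pairing_types[OF T])
  moreover have "(\<Sum>j\<in>{1..12}. of_int (snd (facets ! l) ! (j - 1)) * of_nat (exps (monm M) $ of_nat j)) = (of_int (\<Sum>v\<in>#M. snd (facets ! l) ! (v - 1)) :: rat)"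
    unfolding sum_mset_count[OF M finite_atLeastAtMost] of_int_sum
    by (rule sum.cong) (use M in \<open>simp_all add: exps_monm\<close>)
  ultimately show ?thesis unfolding ineq_def FV_def by simp
qed

lemma ineq_sig_of: assumes "valid S" "l < 70" shows "0 \<le> ineq l (sig_of S)"
proof -
  have "0 \<le> FV (all_facets ! l) (gtypes S) (gsum S)" using FV_nonneg[OF assms(1)] assms(2) by simp
  moreover have "all_facets ! l = facets ! l" using assms(2) by (simp add: all_facets_def nth_append length_facets)
  ultimately show ?thesis unfolding sig_of_def ineq_FV[OF gtypes_range[OF assms(1)] gsum_vars[OF assms(1)]] by simp
qed

text \<open>The converse is \<open>ineq_sig_of\<close>: the signatures of multisets of generators are exactly the lattice points
  satisfying the inequalities.\<close>

lemma polyhedral_point: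
  assumes "dominant \<mu>" "\<And>l. l < 70 \<Longrightarrow> 0 \<le> ineq l (\<mu>, \<chi> j. of_nat (p $ j))"
  shows "\<exists>S. valid S \<and> sig_of S = (\<mu>, \<chi> j. of_nat (p $ j))"
proof -
  obtain T where T: "set_mset T \<subseteq> {1..4}" "\<mu> = (\<Sum>t\<in>#T. omega t)" using dominant_types_exist[OF assms(1)] by blast
  obtain M where M: "set_mset M \<subseteq> {1..12}" "monm M = Mono p" using monm_surj by blast
  have "0 \<le> FV (facets ! l) T M" if "l < 70" for l
    using assms(2)[OF that] ineq_FV[OF T(1) M(1), of l] unfolding T(2) M(2) by simp
  then obtain S where "valid S" "gtypes S = T" "gsum S = M" using decompose[OF T(1) M(1)] by blast
  then show ?thesis unfolding sig_of_def using T(2) M(2) by (intro exI[of _ S]) simp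
qed

lemma ineq_sum: "ineq l (\<Sum>s\<in>F. sig_scale (c s) s) = (\<Sum>s\<in>F. c s * ineq l s)"
proof -
  have add: "ineq l (s + t) = ineq l s + ineq l t" for s t
    by (simp add: ineq_def pairing_add_left distrib_left sum.distrib)
  have scl: "ineq l (sig_scale c s) = c * ineq l s" for c s
    by (simp add: ineq_def sig_scale_def pairing_scale_left sum_distrib_left right_diff_distrib mult.left_commute)
  have "ineq l 0 = 0" by (simp add: ineq_def pairing_zero)
  then show ?thesis by (induction F rule: infinite_finite_induct) (simp_all add: add scl)
qed

section \<open>The theorem\<close>

lemma negative_root_vectors_scaled:
  assumes "negative_root_vectors e" shows "\<exists>c. \<forall>k\<in>{1..12}. e k = cscale (c k) (neg k) \<and> c k \<noteq> 0"
proof (rule bchoice, rule ballI)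
  fix k :: nat assume k: "k \<in> {1..12}"
  then have e: "e k \<in> root_space (- pos_root k)" "e k \<noteq> 0" using assms unfolding negative_root_vectors_def by blast+
  obtain c where c: "e k = cscale c (neg k)" using root_space_neg[OF k e(1)] by blast
  have "cscale 0 X = 0" for X by (simp add: vec_eq_iff)
  then have "c \<noteq> 0" using c e(2) by auto
  then show "\<exists>c. e k = cscale c (neg k) \<and> c \<noteq> 0" using c by blast
qed

context
  fixes e :: "nat \<Rightarrow> mat8"
  assumes e: "negative_root_vectors e"
begin

lemma essential_types:
  assumes T: "set_mset T \<subseteq> {1..4}"
  shows "essential e (\<Sum>t\<in>#T. omega t) p \<longleftrightarrow> (\<exists>S. valid S \<and> gtypes S = T \<and> monm (gsum S) = Mono p)"
proof -
  obtain c where "\<forall>k\<in>{1..12}. e k = cscale (c k) (neg k) \<and> c k \<noteq> 0" using negative_root_vectors_scaled[OF e] by blast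
  then have c: "e k = cscale (c k) (neg k) \<and> c k \<noteq> 0" if "k \<in> {1..12}" for k using that by blast
  have "has_model (\<Sum>t\<in>#T. omega t) {gprod S | S. valid S \<and> gtypes S = T}"
    by (rule has_model_types[OF has_model_fundamental T])
  then obtain S \<pi> N v where m: "model S \<pi> N (\<Sum>t\<in>#T. omega t) v"
    and sp: "pol.span (range (gen S \<pi> N v)) = pol.span {gprod S | S. valid S \<and> gtypes S = T}"
    unfolding has_model_def by blast
  have "essential e (\<Sum>t\<in>#T. omega t) p \<longleftrightarrow> (\<exists>F\<in>pol.span (range (gen S \<pi> N v)). lowest F (Mono p))"
    by (rule model.essential_iff_lowest[OF m c dominant_types[OF T]])
  also have "\<dots> \<longleftrightarrow> (\<exists>S. valid S \<and> gtypes S = T \<and> monm (gsum S) = Mono p)"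
    unfolding sp
  proof
    assume "\<exists>F\<in>pol.span {gprod S | S. valid S \<and> gtypes S = T}. lowest F (Mono p)"
    then obtain F where F: "F \<in> pol.span {gprod S | S. valid S \<and> gtypes S = T}" "lowest F (Mono p)" by blast
    from lowest_span[OF F] obtain S where "valid S \<and> gtypes S = T \<and> Mono p = monm (gsum S)" by (rule exE)
    then show "\<exists>S. valid S \<and> gtypes S = T \<and> monm (gsum S) = Mono p" by (intro exI[of _ S]) simp
  next
    assume "\<exists>S. valid S \<and> gtypes S = T \<and> monm (gsum S) = Mono p"
    then obtain S where S: "valid S" "gtypes S = T" "monm (gsum S) = Mono p" by blast
    have "gprod S \<in> pol.span {gprod S | S. valid S \<and> gtypes S = T}" by (rule pol.span_base) (use S in blast)
    then show "\<exists>F\<in>pol.span {gprod S | S. valid S \<and> gtypes S = T}. lowest F (Mono p)"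
      using lowest_gprod[OF S(1)] unfolding S(3) by blast
  qed
  finally show ?thesis .
qed

lemma essential_iff_sig_of:
  "essential e \<mu> p \<longleftrightarrow> (\<exists>S. valid S \<and> sig_of S = (\<mu>, \<chi> j. of_nat (p $ j)))"
proof
  assume ess: "essential e \<mu> p"
  then have "dominant \<mu>" unfolding essential_def by blast
  then obtain T where T: "set_mset T \<subseteq> {1..4}" "\<mu> = (\<Sum>t\<in>#T. omega t)" using dominant_types_exist by blast
  obtain S where "valid S" "gtypes S = T" "monm (gsum S) = Mono p" using ess unfolding T(2) essential_types[OF T(1)] by blast
  then show "\<exists>S. valid S \<and> sig_of S = (\<mu>, \<chi> j. of_nat (p $ j))" unfolding sig_of_def T(2) by (intro exI[of _ S]) simp
next
  assume "\<exists>S. valid S \<and> sig_of S = (\<mu>, \<chi> j. of_nat (p $ j))"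
  then obtain S where S: "valid S" "sig_of S = (\<mu>, \<chi> j. of_nat (p $ j))" by blast
  then have m: "\<mu> = (\<Sum>t\<in>#gtypes S. omega t)" and "\<forall>j. (of_nat (exps (monm (gsum S)) $ j) :: rat) = of_nat (p $ j)"
    unfolding sig_of_def by (simp_all add: vec_eq_iff)
  then have "exps (monm (gsum S)) = p" by (simp add: vec_eq_iff)
  then have "monm (gsum S) = Mono p" by (metis mono.collapse)
  then show "essential e \<mu> p" unfolding m essential_types[OF gtypes_range[OF S(1)]] using S(1) by blast
qed

lemma essential_signatures_sig_of: "essential_signatures e = sig_of ` {S. valid S}"
proof (intro set_eqI iffI)
  fix s assume "s \<in> essential_signatures e"
  then obtain \<mu> p where s: "s = (\<mu>, \<chi> j. of_nat (p $ j))" and ess: "essential e \<mu> p" unfolding essential_signatures_def by blast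
  from ess[unfolded essential_iff_sig_of] obtain S where S: "valid S" "sig_of S = (\<mu>, \<chi> j. of_nat (p $ j))" by blast
  show "s \<in> sig_of ` {S. valid S}" unfolding s S(2)[symmetric] using S(1) by blast
next
  fix s assume "s \<in> sig_of ` {S. valid S}"
  then obtain S where S: "valid S" "s = sig_of S" by blast
  then have "essential e (\<Sum>t\<in>#gtypes S. omega t) (exps (monm (gsum S)))"
    unfolding essential_iff_sig_of sig_of_def by blast
  then show "s \<in> essential_signatures e" unfolding essential_signatures_def S(2) sig_of_def by blast
qed

lemma essential_dominant: "valid S \<Longrightarrow> dominant (fst (sig_of S))"
  unfolding sig_of_def fst_conv by (rule dominant_types) (rule gtypes_range)

lemma essential_generated: "essential_signatures e = fundamental_semigroup e"
proof (intro set_eqI iffI)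
  fix s assume "s \<in> essential_signatures e"
  then obtain S where S: "valid S" "s = sig_of S" unfolding essential_signatures_sig_of by blast
  have "valid S \<Longrightarrow> sig_of S \<in> fundamental_semigroup e"
  proof (induction S)
    case empty
    show ?case unfolding sig_of_empty fundamental_semigroup_def by (rule semigroup_generated.zero)
  next
    case (add g S)
    have g: "valid {#g#}" using add.prems by simp
    have "sig_of {#g#} \<in> essential_signatures e" unfolding essential_signatures_sig_of using g by blast
    moreover have "fst (sig_of {#g#}) = omega (gtype g)" by (simp add: sig_of_def)
    moreover have "omega (gtype g) \<in> fundamental_weights" using g by (intro omega_fundamental gtype_range) simp
    ultimately have "sig_of {#g#} \<in> fundamental_semigroup e"
      unfolding fundamental_semigroup_def by (intro semigroup_generated.gen) simp
    moreover have "sig_of S \<in> fundamental_semigroup e" using add by simp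
    ultimately have "sig_of {#g#} + sig_of S \<in> fundamental_semigroup e"
      unfolding fundamental_semigroup_def by (rule semigroup_generated.add)
    then show ?case unfolding sig_of_add[symmetric] by simp
  qed
  then show "s \<in> fundamental_semigroup e" using S by simp
next
  fix s assume "s \<in> fundamental_semigroup e"
  then show "s \<in> essential_signatures e" unfolding fundamental_semigroup_def
  proof (induction rule: semigroup_generated.induct)
    case zero
    have "valid {#}" by simp
    then show ?case unfolding essential_signatures_sig_of sig_of_empty[symmetric] by blast
  next
    case (gen s)
    then show ?case by blast
  next
    case (add s t)
    then obtain S S' where "valid S" "s = sig_of S" "valid S'" "t = sig_of S'" unfolding essential_signatures_sig_of by blast
    then have "s + t = sig_of (S + S')" "valid (S + S')" by (auto simp: sig_of_add valid_def)
    then show ?case unfolding essential_signatures_sig_of by blast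
  qed
qed

text \<open>The inequalities are linear and homogeneous, so they pass to the rational cone; a lattice point of the
  cone satisfies them and is therefore essential.\<close>

lemma essential_saturated: "essential_signatures e = rational_cone (essential_signatures e) \<inter> sig_lattice"
proof (intro set_eqI iffI)
  fix s assume s: "s \<in> essential_signatures e"
  then obtain S where S: "valid S" "s = sig_of S" unfolding essential_signatures_sig_of by blast
  have "s = (\<Sum>t\<in>{s}. sig_scale 1 t)" by (simp add: sig_scale_def)
  then have "s \<in> rational_cone (essential_signatures e)"
    unfolding rational_cone_def using s by (intro CollectI exI[of _ "{s}"] exI[of _ "\<lambda>_. 1"]) simp
  moreover have "s \<in> sig_lattice" using essential_dominant[OF S(1)] unfolding S(2) sig_lattice_def dominant_def sig_of_def by simp
  ultimately show "s \<in> rational_cone (essential_signatures e) \<inter> sig_lattice" by blast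
next
  fix s assume s: "s \<in> rational_cone (essential_signatures e) \<inter> sig_lattice"
  then obtain F c where F: "s = (\<Sum>t\<in>F. sig_scale (c t) t)" "F \<subseteq> essential_signatures e" "\<forall>t\<in>F. 0 \<le> c t"
    unfolding rational_cone_def by blast
  obtain \<mu> q where mq: "s = (\<mu>, q)" by (cases s)
  have lat: "\<mu> \<in> weight_lattice" "\<And>j. q $ j \<in> \<int>" using s unfolding mq sig_lattice_def by auto
  have gen: "\<exists>S. valid S \<and> t = sig_of S" if "t \<in> F" for t using F(2) that unfolding essential_signatures_sig_of by blast
  have mu: "\<mu> = (\<Sum>t\<in>F. c t *s fst t)" and q: "q = (\<Sum>t\<in>F. c t *s snd t)"
    using F(1) unfolding mq by (simp_all add: prod_eq_iff fst_sum snd_sum sig_scale_def)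
  have "0 \<le> pairing \<mu> (simple_coroot k)" if k: "k \<in> {1..4}" for k
    unfolding mu pairing_sum_left pairing_scale_left
  proof (rule sum_nonneg)
    fix t assume t: "t \<in> F"
    then obtain S where "valid S" "t = sig_of S" using gen by blast
    then have "0 \<le> pairing (fst t) (simple_coroot k)"
      using essential_dominant k unfolding dominant_def simple_coroot_def by blast
    then show "0 \<le> c t * pairing (fst t) (simple_coroot k)" using F(3) t by simp
  qed
  then have dom: "dominant \<mu>" using lat(1) unfolding dominant_def simple_coroot_def by blast
  have "0 \<le> q $ j" for j unfolding q sum_component
  proof (rule sum_nonneg)
    fix t assume t: "t \<in> F"
    then obtain S where "t = sig_of S" using gen by blast
    then have "0 \<le> snd t $ j" by (simp add: sig_of_def)
    then show "0 \<le> (c t *s snd t) $ j" using F(3) t by simp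
  qed
  then have "\<exists>n::nat. q $ j = of_nat n" for j using Ints_nonneg_nat[OF lat(2)] by blast
  then obtain f :: "12 \<Rightarrow> nat" where f: "\<And>j. q $ j = of_nat (f j)" by metis
  have qf: "q = (\<chi> j. of_nat ((\<chi> j. f j) $ j))" by (simp add: vec_eq_iff f)
  have "0 \<le> ineq l s" if l: "l < 70" for l
    unfolding F(1) ineq_sum
  proof (rule sum_nonneg)
    fix t assume t: "t \<in> F"
    then obtain S where "valid S" "t = sig_of S" using gen by blast
    then show "0 \<le> c t * ineq l t" using F(3) t ineq_sig_of[OF _ l] by simp
  qed
  then have "\<exists>S. valid S \<and> sig_of S = s" unfolding mq qf by (intro polyhedral_point[OF dom])
  then show "s \<in> essential_signatures e" unfolding essential_signatures_sig_of by blast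
qed

lemma essential_iff_ineq:
  assumes "dominant \<mu>"
  shows "essential e \<mu> p \<longleftrightarrow> (\<forall>l<70. 0 \<le> ineq l (\<mu>, \<chi> j. of_nat (p $ j)))"
proof
  assume "essential e \<mu> p"
  then obtain S where "valid S" "sig_of S = (\<mu>, \<chi> j. of_nat (p $ j))" unfolding essential_iff_sig_of by blast
  then show "\<forall>l<70. 0 \<le> ineq l (\<mu>, \<chi> j. of_nat (p $ j))" using ineq_sig_of by metis
next
  assume "\<forall>l<70. 0 \<le> ineq l (\<mu>, \<chi> j. of_nat (p $ j))"
  then show "essential e \<mu> p" unfolding essential_iff_sig_of using polyhedral_point[OF assms] by blast
qed

end

definition facet_coroot :: "nat \<Rightarrow> rat ^ 4" where
  "facet_coroot l = of_int (fst (facets ! l) ! 0) *s simple_coroot 1 + of_int (fst (facets ! l) ! 1) *s simple_coroot 2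
     + of_int (fst (facets ! l) ! 2) *s simple_coroot 3 + of_int (fst (facets ! l) ! 3) *s simple_coroot 4"

definition facet_vars :: "nat \<Rightarrow> nat set" where
  "facet_vars l = {j \<in> {1..12}. snd (facets ! l) ! (j - 1) \<noteq> 0}"

lemma ineq_facet:
  assumes "l < 70"
  shows "0 \<le> ineq l (\<mu>, \<chi> j. of_nat (p $ j)) \<longleftrightarrow>
    of_nat (\<Sum>j\<in>facet_vars l. nat (snd (facets ! l) ! (j - 1)) * p $ of_nat j) \<le> pairing \<mu> (facet_coroot l)"
proof -
  have nn: "snd (facets ! l) ! (j - 1) \<ge> 0" if "j \<in> {1..12}" for j using facet_coeff[OF assms that] by auto
  have "(\<Sum>j\<in>{1..12}. of_int (snd (facets ! l) ! (j - 1)) * (\<chi> j. of_nat (p $ j)) $ of_nat j)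
      = (\<Sum>j\<in>facet_vars l. (of_int (snd (facets ! l) ! (j - 1)) * of_nat (p $ of_nat j) :: rat))"
    by (rule sum.mono_neutral_cong_right) (auto simp: facet_vars_def)
  also have "\<dots> = of_nat (\<Sum>j\<in>facet_vars l. nat (snd (facets ! l) ! (j - 1)) * p $ of_nat j)"
    unfolding of_nat_sum of_nat_mult by (rule sum.cong) (use nn in \<open>auto simp: facet_vars_def of_nat_nat\<close>)
  finally have 1: "(\<Sum>j\<in>{1..12}. of_int (snd (facets ! l) ! (j - 1)) * (\<chi> j. of_nat (p $ j)) $ of_nat j)
      = (of_nat (\<Sum>j\<in>facet_vars l. nat (snd (facets ! l) ! (j - 1)) * p $ of_nat j) :: rat)" .
  have i: "{1..4::nat} = {1,2,3,4}" by (auto simp: index4[simplified])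
  have 2: "(\<Sum>k\<in>{1..4}. of_int (fst (facets ! l) ! (k - 1)) * pairing \<mu> (simple_coroot k)) = pairing \<mu> (facet_coroot l)"
    unfolding i facet_coroot_def pairing_add_right pairing_scale_right by simp
  show ?thesis unfolding ineq_def fst_conv snd_conv 1 2 by simp
qed

theorem mainTheorem1:
  fixes e :: "nat \<Rightarrow> mat8"
  assumes "negative_root_vectors e"
  shows "essential_signatures e = fundamental_semigroup e \<and>
    essential_signatures e = rational_cone (essential_signatures e) \<inter> sig_lattice \<and>
    (\<exists>(I :: nat set) (M :: nat \<Rightarrow> nat set) (l :: nat \<Rightarrow> rat ^ 4) (a :: nat \<Rightarrow> nat \<Rightarrow> nat).
       finite I \<and>
       (\<forall>i\<in>I. M i \<subseteq> {1..12} \<and> l i \<in> coroot_lattice \<and> (\<forall>j\<in>M i. a i j \<in> {1, 2, 3})) \<and>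
       (\<forall>\<mu> (p :: nat ^ 12). dominant \<mu> \<longrightarrow>
          (essential e \<mu> p \<longleftrightarrow>
             (\<forall>i\<in>I. of_nat (\<Sum>j\<in>M i. a i j * p $ of_nat j) \<le> pairing \<mu> (l i)))))"
proof (intro conjI)
  show "essential_signatures e = fundamental_semigroup e" by (rule essential_generated[OF assms])
  show "essential_signatures e = rational_cone (essential_signatures e) \<inter> sig_lattice" by (rule essential_saturated[OF assms])
  let ?a = "\<lambda>i j. nat (snd (facets ! i) ! (j - 1))"
  have c: "?a i j \<in> {1, 2, 3}" if "i < 70" "j \<in> facet_vars i" for i j
    using facet_coeff[OF that(1), of j] that(2) by (auto simp: facet_vars_def)
  have l: "facet_coroot i \<in> coroot_lattice" for i
    unfolding facet_coroot_def by (rule coroot_comb_in_lattice)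
  have ess: "essential e \<mu> p \<longleftrightarrow> (\<forall>i\<in>{..<70}. of_nat (\<Sum>j\<in>facet_vars i. ?a i j * p $ of_nat j) \<le> pairing \<mu> (facet_coroot i))"
    if "dominant \<mu>" for \<mu> p
    unfolding essential_iff_ineq[OF assms that] using ineq_facet by auto
  show "\<exists>(I :: nat set) (M :: nat \<Rightarrow> nat set) (l :: nat \<Rightarrow> rat ^ 4) (a :: nat \<Rightarrow> nat \<Rightarrow> nat).
       finite I \<and>
       (\<forall>i\<in>I. M i \<subseteq> {1..12} \<and> l i \<in> coroot_lattice \<and> (\<forall>j\<in>M i. a i j \<in> {1, 2, 3})) \<and>
       (\<forall>\<mu> (p :: nat ^ 12). dominant \<mu> \<longrightarrow>
          (essential e \<mu> p \<longleftrightarrow>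
             (\<forall>i\<in>I. of_nat (\<Sum>j\<in>M i. a i j * p $ of_nat j) \<le> pairing \<mu> (l i))))"
  proof (rule exI[of _ "{..<70}"], rule exI[of _ facet_vars], rule exI[of _ facet_coroot], rule exI[of _ ?a], intro conjI)
    show "finite {..<70::nat}" by simp
    show "\<forall>i\<in>{..<70}. facet_vars i \<subseteq> {1..12} \<and> facet_coroot i \<in> coroot_lattice \<and> (\<forall>j\<in>facet_vars i. ?a i j \<in> {1, 2, 3})"
      using c l by (auto simp: facet_vars_def)
    show "\<forall>\<mu> (p :: nat ^ 12). dominant \<mu> \<longrightarrow>
          (essential e \<mu> p \<longleftrightarrow> (\<forall>i\<in>{..<70}. of_nat (\<Sum>j\<in>facet_vars i. ?a i j * p $ of_nat j) \<le> pairing \<mu> (facet_coroot i)))"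
      using ess by blast
  qed
qed

end
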